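(* Let $\Omega\Subset\Omega'$ be open subsets of $\mathbb{R}^n$ and let $g\in C(\Omega')\cap L^{p-1}_{sp}(\mathbb{R}^n)$. Assume that $h\in C(\overline\Omega)$ is a weak solution in $\Omega$ such that $$\lim_{\Omega\ni y\to x}h(y)=g(x)\ \text{ for every }x\in\partial\Omega\qquad\text{and}\qquad h=g\ \text{ a.e. in }\mathbb{R}^n\setminus\Omega.$$ Then $\overline H_g=h=\underline H_g$ in $\Omega$, where $\overline H_g$ and $\underline H_g$ are the upper and lower Perron solutions with boundary datum $g$ in $\Omega$.
   Context: Standing assumptions: $n\ge1$ is an integer, $s\in(0,1)$, $p\in(1,\infty)$, $\Lambda\ge1$, and $K:\mathbb{R}^n\times\mathbb{R}^n\to[0,\infty)$ is a measurable symmetric kernel ($K(x,y)=K(y,x)$) with $\Lambda^{-1}\le K(x,y)|x-y|^{n+sp}\le\Lambda$ for a.e. $x,y\in\mathbb{R}^n$. Functions are measurable; $D\Subset\Omega$ means that $\overline D$ is a compact subset of $\Omega$; $u_\pm:=\max\{\pm u,0\}$. $W^{s,p}(U)$ consists of $v\in L^p(U)$ with $\int_U\int_U\frac{|v(x)-v(y)|^p}{|x-y|^{n+sp}}\,dx\,dy<\infty$; $v\in W^{s,p}_{\rm loc}(\Omega)$ means $v\in W^{s,p}(D)$ for every open $D\Subset\Omega$. The tail space is $L^{p-1}_{sp}(\mathbb{R}^n):=\{f\in L^{p-1}_{\rm loc}(\mathbb{R}^n):\int_{\mathbb{R}^n}|f(x)|^{p-1}(1+|x|)^{-n-sp}\,dx<\infty\}$.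 A weak supersolution in an open set $\Omega$ is a function $u$ on $\mathbb{R}^n$ with $u\in W^{s,p}_{\rm loc}(\Omega)$, $u_-\in L^{p-1}_{sp}(\mathbb{R}^n)$, and $$\int_{\mathbb{R}^n}\int_{\mathbb{R}^n}|u(x)-u(y)|^{p-2}(u(x)-u(y))(\eta(x)-\eta(y))K(x,y)\,dx\,dy\ge0$$ for every nonnegative $\eta\in C_0^\infty(\Omega)$. $u$ is a weak subsolution if $-u$ is a weak supersolution, and a weak solution if it is both. "$v\in C(\overline D)$ is a weak solution in $D$" means that $v$, defined on $\mathbb{R}^n$, is a weak solution in $D$ whose restriction to $\overline D$ is continuous (and finite). A function $u:\mathbb{R}^n\to[-\infty,\infty]$ is $(s,p)$-superharmonic in an open set $\Omega$ if: (a) $u<+\infty$ almost everywhere in $\Omega$ and $u>-\infty$ everywhere in $\Omega$; (b) $u$ is lower semicontinuous in $\Omega$; (c) if $D\Subset\Omega$ is open and $v\in C(\overline D)$ is a weak solution in $D$ such that $v_+\in L^\infty(\mathbb{R}^n)$ and $u\ge v$ on $\partial D$ and almost everywhere on $\mathbb{R}^n\setminus D$, then $u\ge v$ in $D$; (d) $u_-\in L^{p-1}_{sp}(\mathbb{R}^n)$. Perron solutions (for $g$ continuous in a neighborhood of $\partial\Omega$): the upper class $\mathcal U_g$ consists of all functions $u$ such that (i) $u$ is $(s,p)$-superharmonic in $\Omega$; (ii) $u$ is bounded from below in $\Omega$; (iii) $\liminf_{\Omega\ni y\to x}u(y)\ge g(x)$ for all $x\in\partial\Omega$; (iv) $u=g$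 almost everywhere in $\mathbb{R}^n\setminus\Omega$. The lower class is $\mathcal L_g:=\{u:-u\in\mathcal U_{-g}\}$. In $\Omega$, pointwise, $\overline H_g:=\inf\{u:u\in\mathcal U_g\}$ and $\underline H_g:=\sup\{u:u\in\mathcal L_g\}$. *)

theory Defs
  imports "HOL-Analysis.Analysis"
begin

definition compactly_contained :: "'a::topological_space set \<Rightarrow> 'a set \<Rightarrow> bool"  (infix "\<Subset>" 50)
  where "D \<Subset> \<Omega> \<longleftrightarrow> compact (closure D) \<and> closure D \<subseteq> \<Omega>"

(* Functions take values in [-oo,oo].  real_of_ereal maps both infinities to 0, so it is only
   applied below to functions that are required to be finite almost everywhere. *)

definition pos_part :: "('a \<Rightarrow> ereal) \<Rightarrow> 'a \<Rightarrow> ereal"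
  where "pos_part u x = max (u x) 0"

definition neg_part :: "('a \<Rightarrow> ereal) \<Rightarrow> 'a \<Rightarrow> ereal"
  where "neg_part u x = max (- u x) 0"

definition finite_continuous_on :: "'a::topological_space set \<Rightarrow> ('a \<Rightarrow> ereal) \<Rightarrow> bool"
  where "finite_continuous_on S f \<longleftrightarrow> continuous_on S f \<and> (\<forall>x\<in>S. \<bar>f x\<bar> \<noteq> \<infinity>)"

definition in_Lq :: "real \<Rightarrow> (real ^ 'n) set \<Rightarrow> (real ^ 'n \<Rightarrow> ereal) \<Rightarrow> bool"
  where "in_Lq q U f \<longleftrightarrow>
    f \<in> borel_measurable (lebesgue_on U) \<and>
    (AE x in lebesgue_on U. \<bar>f x\<bar> \<noteq> \<infinity>) \<and>
    integrable (lebesgue_on U) (\<lambda>x. \<bar>real_of_ereal (f x)\<bar> powr q)"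

definition in_Linf :: "(real ^ 'n \<Rightarrow> ereal) \<Rightarrow> bool"
  where "in_Linf f \<longleftrightarrow>
    f \<in> borel_measurable lebesgue \<and> (\<exists>M::real. AE x in lebesgue. \<bar>f x\<bar> \<le> ereal M)"

definition in_Wsp :: "real \<Rightarrow> real \<Rightarrow> (real ^ 'n) set \<Rightarrow> (real ^ 'n \<Rightarrow> ereal) \<Rightarrow> bool"
  where "in_Wsp s p U v \<longleftrightarrow>
    in_Lq p U v \<and>
    integrable (lebesgue_on (U \<times> U))
      (\<lambda>(x, y). \<bar>real_of_ereal (v x) - real_of_ereal (v y)\<bar> powr p
                 / norm (x - y) powr (real CARD('n) + s * p))"

definition in_Wsp_loc :: "real \<Rightarrow> real \<Rightarrow> (real ^ 'n) set \<Rightarrow> (real ^ 'n \<Rightarrow> ereal) \<Rightarrow> bool"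
  where "in_Wsp_loc s p \<Omega> v \<longleftrightarrow> (\<forall>D. open D \<and> D \<Subset> \<Omega> \<longrightarrow> in_Wsp s p D v)"

definition tail_space :: "real \<Rightarrow> real \<Rightarrow> (real ^ 'n \<Rightarrow> ereal) \<Rightarrow> bool"
  where "tail_space s p f \<longleftrightarrow>
    f \<in> borel_measurable lebesgue \<and>
    (\<forall>C. compact C \<longrightarrow> in_Lq (p - 1) C f) \<and>
    integrable lebesgue
      (\<lambda>x. \<bar>real_of_ereal (f x)\<bar> powr (p - 1)
            * (1 + norm x) powr (- real CARD('n) - s * p))"

definition admissible_kernel ::
  "real \<Rightarrow> real \<Rightarrow> real \<Rightarrow> (real ^ 'n \<Rightarrow> real ^ 'n \<Rightarrow> real) \<Rightarrow> bool"
  where "admissible_kernel s p \<Lambda> K \<longleftrightarrow>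
    (\<lambda>(x, y). K x y) \<in> borel_measurable lebesgue \<and>
    (\<forall>x y. 0 \<le> K x y) \<and>
    (\<forall>x y. K x y = K y x) \<and>
    (AE (x, y) in lebesgue.
       inverse \<Lambda> \<le> K x y * norm (x - y) powr (real CARD('n) + s * p) \<and>
       K x y * norm (x - y) powr (real CARD('n) + s * p) \<le> \<Lambda>)"

(* C^k on the whole space: f is differentiable and all its directional derivatives are C^(k-1). *)

primrec Ck :: "nat \<Rightarrow> (real ^ 'n \<Rightarrow> real) \<Rightarrow> bool"
  where
    "Ck 0 f \<longleftrightarrow> continuous_on UNIV f"
  | "Ck (Suc k) f \<longleftrightarrow>
      (\<forall>x. f differentiable (at x)) \<and> (\<forall>v. Ck k (\<lambda>x. frechet_derivative f (at x) v))"

definition test_function :: "(real ^ 'n) set \<Rightarrow> (real ^ 'n \<Rightarrow> real) \<Rightarrow> bool"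
  where "test_function \<Omega> \<eta> \<longleftrightarrow> (\<forall>k. Ck k \<eta>) \<and> {x. \<eta> x \<noteq> 0} \<Subset> \<Omega>"

definition weak_integrand ::
  "real \<Rightarrow> (real ^ 'n \<Rightarrow> real ^ 'n \<Rightarrow> real) \<Rightarrow> (real ^ 'n \<Rightarrow> ereal) \<Rightarrow> (real ^ 'n \<Rightarrow> real) \<Rightarrow>
   (real ^ 'n) \<times> (real ^ 'n) \<Rightarrow> real"
  where "weak_integrand p K u \<eta> = (\<lambda>(x, y).
    \<bar>real_of_ereal (u x) - real_of_ereal (u y)\<bar> powr (p - 2)
      * (real_of_ereal (u x) - real_of_ereal (u y)) * (\<eta> x - \<eta> y) * K x y)"

(* The W^{s,p}_loc and tail conditions imply that the positive part of the integrand has finite integral.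
   So the double integral always exists in [-oo,oo), and it is nonnegative iff the integrand is
   integrable with nonnegative Bochner integral (which alone would be 0 by convention in the
   non-integrable case).  If u = oo on a set of positive measure, the integral is -oo for every
   nonnegative test function that is not identically zero; hence almost everywhere finiteness is
   part of the inequality, too. *)

definition weak_supersolution ::
  "real \<Rightarrow> real \<Rightarrow> (real ^ 'n \<Rightarrow> real ^ 'n \<Rightarrow> real) \<Rightarrow> (real ^ 'n) set \<Rightarrow> (real ^ 'n \<Rightarrow> ereal) \<Rightarrow> bool"
  where "weak_supersolution s p K \<Omega> u \<longleftrightarrow>
    u \<in> borel_measurable lebesgue \<and>
    in_Wsp_loc s p \<Omega> u \<and>
    tail_space s p (neg_part u) \<and>
    (AE x in lebesgue. \<bar>u x\<bar> \<noteq> \<infinity>) \<and>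
    (\<forall>\<eta>. test_function \<Omega> \<eta> \<and> (\<forall>x. 0 \<le> \<eta> x) \<longrightarrow>
       integrable lebesgue (weak_integrand p K u \<eta>) \<and>
       0 \<le> (LINT z|lebesgue. weak_integrand p K u \<eta> z))"

definition weak_subsolution ::
  "real \<Rightarrow> real \<Rightarrow> (real ^ 'n \<Rightarrow> real ^ 'n \<Rightarrow> real) \<Rightarrow> (real ^ 'n) set \<Rightarrow> (real ^ 'n \<Rightarrow> ereal) \<Rightarrow> bool"
  where "weak_subsolution s p K \<Omega> u \<longleftrightarrow> weak_supersolution s p K \<Omega> (\<lambda>x. - u x)"

definition weak_solution ::
  "real \<Rightarrow> real \<Rightarrow> (real ^ 'n \<Rightarrow> real ^ 'n \<Rightarrow> real) \<Rightarrow> (real ^ 'n) set \<Rightarrow> (real ^ 'n \<Rightarrow> ereal) \<Rightarrow> bool"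
  where "weak_solution s p K \<Omega> u \<longleftrightarrow>
    weak_supersolution s p K \<Omega> u \<and> weak_subsolution s p K \<Omega> u"

definition superharmonic ::
  "real \<Rightarrow> real \<Rightarrow> (real ^ 'n \<Rightarrow> real ^ 'n \<Rightarrow> real) \<Rightarrow> (real ^ 'n) set \<Rightarrow> (real ^ 'n \<Rightarrow> ereal) \<Rightarrow> bool"
  where "superharmonic s p K \<Omega> u \<longleftrightarrow>
    u \<in> borel_measurable lebesgue \<and>
    (AE x in lebesgue. x \<in> \<Omega> \<longrightarrow> u x < \<infinity>) \<and>
    (\<forall>x\<in>\<Omega>. - \<infinity> < u x) \<and>
    (\<forall>x\<in>\<Omega>. u x \<le> Liminf (at x within \<Omega>) u) \<and>
    (\<forall>D v. open D \<and> D \<Subset> \<Omega> \<and>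
           finite_continuous_on (closure D) v \<and> weak_solution s p K D v \<and>
           in_Linf (pos_part v) \<and>
           (\<forall>x\<in>frontier D. v x \<le> u x) \<and>
           (AE x in lebesgue. x \<notin> D \<longrightarrow> v x \<le> u x)
       \<longrightarrow> (\<forall>x\<in>D. v x \<le> u x)) \<and>
    tail_space s p (neg_part u)"

definition upper_class ::
  "real \<Rightarrow> real \<Rightarrow> (real ^ 'n \<Rightarrow> real ^ 'n \<Rightarrow> real) \<Rightarrow> (real ^ 'n) set \<Rightarrow> (real ^ 'n \<Rightarrow> ereal) \<Rightarrow>
   (real ^ 'n \<Rightarrow> ereal) set"
  where "upper_class s p K \<Omega> g = {u.
    superharmonic s p K \<Omega> u \<and>
    (\<exists>m::real. \<forall>x\<in>\<Omega>. ereal m \<le> u x) \<and>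
    (\<forall>x\<in>frontier \<Omega>. g x \<le> Liminf (at x within \<Omega>) u) \<and>
    (AE x in lebesgue. x \<notin> \<Omega> \<longrightarrow> u x = g x)}"

definition lower_class ::
  "real \<Rightarrow> real \<Rightarrow> (real ^ 'n \<Rightarrow> real ^ 'n \<Rightarrow> real) \<Rightarrow> (real ^ 'n) set \<Rightarrow> (real ^ 'n \<Rightarrow> ereal) \<Rightarrow>
   (real ^ 'n \<Rightarrow> ereal) set"
  where "lower_class s p K \<Omega> g = {u. (\<lambda>x. - u x) \<in> upper_class s p K \<Omega> (\<lambda>x. - g x)}"

(* The Perron solutions are meant on \<Omega> only; their values elsewhere carry no information. *)

definition upper_Perron ::
  "real \<Rightarrow> real \<Rightarrow> (real ^ 'n \<Rightarrow> real ^ 'n \<Rightarrow> real) \<Rightarrow> (real ^ 'n) set \<Rightarrow> (real ^ 'n \<Rightarrow> ereal) \<Rightarrow>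
   real ^ 'n \<Rightarrow> ereal"
  where "upper_Perron s p K \<Omega> g x = (INF u\<in>upper_class s p K \<Omega> g. u x)"

definition lower_Perron ::
  "real \<Rightarrow> real \<Rightarrow> (real ^ 'n \<Rightarrow> real ^ 'n \<Rightarrow> real) \<Rightarrow> (real ^ 'n) set \<Rightarrow> (real ^ 'n \<Rightarrow> ereal) \<Rightarrow>
   real ^ 'n \<Rightarrow> ereal"
  where "lower_Perron s p K \<Omega> g x = (SUP u\<in>lower_class s p K \<Omega> g. u x)"

end

theory Submission
  imports Defs
begin

text \<open>
  The solution \<open>h\<close> lies in both classes, by the comparison principle for weak solutions; the point is that
  every \<open>u\<close> in the upper class dominates \<open>h\<close>. Property (c) of superharmonic functions cannot be applied to \<open>h\<close>
  because the positive part of \<open>h\<close> may be unbounded outside \<open>\<Omega>\<close>. Given \<open>e > 0\<close>, lower \<open>h\<close> by \<open>2 e\<close> inside \<open>\<Omega>\<close>,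
  and outside replace it by \<open>min h K - e\<close>. For large \<open>K\<close> this is a subsolution below the solution \<open>h - e\<close>, and
  minimising the energy between the two over an open \<open>D\<close> compactly contained in \<open>\<Omega>\<close> yields a solution \<open>v\<close> in
  \<open>D\<close> that is bounded above and satisfies \<open>h - 2 e \<le> v \<le> h - e\<close> in \<open>\<Omega>\<close>. It is continuous by De Giorgi's method.
  By the boundary condition on \<open>u\<close>, the inequality \<open>u \<ge> h - e\<close> holds in \<open>\<Omega>\<close> outside a compact set; choose \<open>D\<close>
  around that set and apply (c) to \<open>v\<close> on a slightly smaller open set. This gives \<open>u \<ge> v \<ge> h - 2 e\<close>, and \<open>e \<rightarrow> 0\<close>.
\<close>

section \<open>Power inequalities\<close>

text \<open>Three obstacles shape the details. Property (c) asks for continuity up to the boundary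
  of the set on which it is applied, while interior estimates give continuity only inside the set
  \<open>D\<close> of the minimisation; two nested sets avoid any question about regularity at the
  boundary of \<open>D\<close>. The minimisation is confined to a strip between two obstacles.
  Because the lower one is a subsolution and the upper one a supersolution, cutting an arbitrary
  competitor down to the strip does not raise the energy, so the constrained minimiser solves the
  equation. Finally, the equation for \<open>h\<close> is given for smooth test functions, whereas
  comparison and the cutting of competitors test with positive parts of differences; mollification
  extends it to bounded functions of finite energy with compact support. Positive margins recur
  because the part of a continuous difference that exceeds e lives on a compact subset of the open
  set as soon as the difference is at most 0 on the boundary.\<close>

definition phi :: "real \<Rightarrow> real \<Rightarrow> real"
  where "phi p t = \<bar>t\<bar> powr (p - 1) * sgn t"

text \<open>Links the integrand of \<open>weak_integrand\<close> to \<open>phi\<close>. At 0 both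
  sides vanish even for p < 2, since a power with base 0 is 0.\<close>

lemma abs_powr_minus_two: "\<bar>t\<bar> powr (p - 2) * t = phi p t"
proof (cases "t = 0")
  case False
  have "\<bar>t\<bar> powr (p - 1) = \<bar>t\<bar> powr (p - 2) * \<bar>t\<bar>"
    using False powr_add[of "\<bar>t\<bar>" "p - 2" 1] by simp
  then show ?thesis by (simp add: phi_def mult_sgn_abs abs_sgn mult.assoc)
qed (simp add: phi_def)

lemma phi_minus [simp]: "phi p (- t) = - phi p t"
  by (simp add: phi_def sgn_minus)

lemma phi_zero [simp]: "phi p 0 = 0"
  by (simp add: phi_def)

lemma abs_phi: "\<bar>phi p t\<bar> = \<bar>t\<bar> powr (p - 1)"
  by (auto simp: phi_def abs_mult abs_sgn_eq)

lemma phi_eq_max: "phi p t = max t 0 powr (p - 1) - max (- t) 0 powr (p - 1)"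
  by (auto simp: phi_def sgn_if max_def)

lemma borel_measurable_phi [measurable]: "phi p \<in> borel_measurable borel"
  unfolding phi_def[abs_def] by measurable

lemma continuous_on_phi: "1 < p \<Longrightarrow> continuous_on A (phi p)"
  unfolding phi_eq_max[abs_def]
  by (intro continuous_intros continuous_on_powr') auto

lemma phi_mono: assumes "1 < p" "a \<le> b" shows "phi p a \<le> phi p b"
  unfolding phi_eq_max using assms by (intro diff_mono powr_mono2) auto

lemma phi_strict_mono: assumes "1 < p" "a < b" shows "phi p a < phi p b"
proof (cases "0 < b")
  case True
  have "max a 0 powr (p - 1) < max b 0 powr (p - 1)" using assms True
    by (intro powr_less_mono2) auto
  moreover have "max (- b) 0 powr (p - 1) \<le> max (- a) 0 powr (p - 1)" using assms by (intro powr_mono2) auto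
  ultimately show ?thesis unfolding phi_eq_max by linarith
next
  case False
  have "max (- b) 0 powr (p - 1) < max (- a) 0 powr (p - 1)" using assms False
    by (intro powr_less_mono2) auto
  moreover have "max a 0 powr (p - 1) \<le> max b 0 powr (p - 1)" using assms by (intro powr_mono2) auto
  ultimately show ?thesis unfolding phi_eq_max by linarith
qed

text \<open>The gap \<open>phi p a - phi p (a - e)\<close> is continuous and positive, hence has a
  positive minimum on a compact interval. For p < 2 it tends to 0 as a grows, which is why a is
  bounded. The gain in \<open>cutdown_subsolution\<close> rests on this \<kappa>.\<close>

lemma phi_gap:
  assumes "1 < p" "0 < e"
  obtains \<kappa> where "0 < \<kappa>" "\<And>a. \<bar>a\<bar> \<le> m \<Longrightarrow> phi p (a - e) \<le> phi p a - \<kappa>"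
proof -
  let ?I = "{- \<bar>m\<bar>..\<bar>m\<bar>}"
  have "continuous_on ?I (\<lambda>a. phi p a - phi p (a - e))"
    by (intro continuous_intros continuous_on_compose2[OF continuous_on_phi[OF assms(1), of UNIV]]) auto
  then obtain a0 where a0: "a0 \<in> ?I" "\<And>a. a \<in> ?I \<Longrightarrow> phi p a0 - phi p (a0 - e) \<le> phi p a - phi p (a - e)"
    using continuous_attains_inf[of ?I "\<lambda>a. phi p a - phi p (a - e)"] by auto
  show ?thesis
  proof (rule that[of "phi p a0 - phi p (a0 - e)"])
    show "0 < phi p a0 - phi p (a0 - e)" using phi_strict_mono[OF assms(1), of "a0 - e" a0] assms(2) by simp
  next
    fix a assume "\<bar>a\<bar> \<le> m"
    then have "a \<in> ?I" by auto
    then show "phi p (a - e) \<le> phi p a - (phi p a0 - phi p (a0 - e))" using a0(2)[of a] by auto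
  qed
qed

lemma DERIV_abs_powr:
  assumes "1 < p"
  shows "((\<lambda>t. \<bar>t\<bar> powr p) has_real_derivative p * phi p t) (at t)"
proof -
  consider "t > 0" | "t < 0" | "t = 0" by linarith
  then show ?thesis
  proof cases
    case 1
    have "((\<lambda>t. t powr p) has_real_derivative p * phi p t) (at t)"
      using 1 by (auto intro!: derivative_eq_intros simp: phi_def)
    moreover have "eventually (\<lambda>x. \<bar>x\<bar> powr p = x powr p) (nhds t)"
      using eventually_nhds_in_open[of "{0<..}" t] 1 by (auto elim: eventually_mono)
    ultimately show ?thesis by (subst DERIV_cong_ev[OF refl _ refl]) auto
  next
    case 2
    have "((\<lambda>t. (- t) powr p) has_real_derivative p * phi p t) (at t)"
      using 2 by (auto intro!: derivative_eq_intros simp: phi_def)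
    moreover have "eventually (\<lambda>x. \<bar>x\<bar> powr p = (- x) powr p) (nhds t)"
      using eventually_nhds_in_open[of "{..<0}" t] 2 by (auto elim: eventually_mono)
    ultimately show ?thesis by (subst DERIV_cong_ev[OF refl _ refl]) auto
  next
    case 3
    \<comment> \<open>At 0 the difference quotient is \<open>phi p h\<close> itself, so continuity
      of \<open>phi p\<close> at 0 gives the derivative.\<close>
    have "((\<lambda>h. \<bar>h\<bar> powr (p - 1) * sgn h) \<longlongrightarrow> 0) (at 0)"
    proof (rule tendsto_rabs_zero_cancel, rule tendsto_eq_rhs)
      show "((\<lambda>h. \<bar>\<bar>h\<bar> powr (p - 1) * sgn h\<bar>) \<longlongrightarrow> \<bar>phi p 0\<bar>) (at 0)"
        unfolding phi_def[symmetric]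
        using continuous_on_phi[OF assms, of UNIV]
        by (intro tendsto_rabs) (metis UNIV_I continuous_on_eq_continuous_at isCont_def open_UNIV)
    qed simp
    moreover have "\<bar>h\<bar> powr p / h = \<bar>h\<bar> powr (p - 1) * sgn h" if "h \<noteq> 0" for h :: real
      using that by (auto simp: powr_diff sgn_if)
    ultimately have "((\<lambda>h. \<bar>h\<bar> powr p / h) \<longlongrightarrow> 0) (at 0)"
      by (subst tendsto_cong[where g="\<lambda>h. \<bar>h\<bar> powr (p - 1) * sgn h"])
         (auto simp: eventually_at_filter)
    then show ?thesis using 3 assms by (simp add: has_field_derivative_iff)
  qed
qed

lemma abs_powr_MVT:
  assumes "1 < p"
  obtains c where "min a b \<le> c" "c \<le> max a b" "\<bar>b\<bar> powr p - \<bar>a\<bar> powr p = p * phi p c * (b - a)"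
proof -
  consider "a < b" | "b < a" | "a = b" by linarith
  then show ?thesis
  proof cases
    case 1
    from MVT2[OF 1, of "\<lambda>t. \<bar>t\<bar> powr p" "\<lambda>t. p * phi p t"] DERIV_abs_powr[OF assms]
    obtain c where "a < c" "c < b" "\<bar>b\<bar> powr p - \<bar>a\<bar> powr p = (b - a) * (p * phi p c)" by blast
    then show ?thesis by (intro that[of c]) (auto simp: algebra_simps)
  next
    case 2
    from MVT2[OF 2, of "\<lambda>t. \<bar>t\<bar> powr p" "\<lambda>t. p * phi p t"] DERIV_abs_powr[OF assms]
    obtain c where "b < c" "c < a" "\<bar>a\<bar> powr p - \<bar>b\<bar> powr p = (a - b) * (p * phi p c)" by blast
    then show ?thesis by (intro that[of c]) (auto simp: algebra_simps)
  qed (auto intro: that)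
qed

text \<open>Convexity with explicit slope: the mean value theorem puts the slope of the chord at
  some c between a and b, and monotonicity of \<open>phi\<close> compares it with the slope at a on
  either side.\<close>

lemma abs_powr_above_tangent:
  assumes "1 < p"
  shows "p * phi p a * (b - a) \<le> \<bar>b\<bar> powr p - \<bar>a\<bar> powr p"
proof -
  obtain c where c: "min a b \<le> c" "c \<le> max a b" "\<bar>b\<bar> powr p - \<bar>a\<bar> powr p = p * phi p c * (b - a)"
    by (rule abs_powr_MVT[OF assms])
  have "phi p a * (b - a) \<le> phi p c * (b - a)"
  proof (cases "a \<le> b")
    case True then show ?thesis using c phi_mono[OF assms, of a c] by (intro mult_right_mono) auto
  next
    case False then show ?thesis using c phi_mono[OF assms, of c a] by (intro mult_right_mono_neg) auto
  qed
  then show ?thesis using c(3) assms by (simp add: mult.assoc)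
qed

lemma abs_powr_diff_bound:
  fixes a b p :: real
  assumes "1 < p"
  shows "\<bar>\<bar>a + b\<bar> powr p - \<bar>a\<bar> powr p\<bar> \<le> p * \<bar>b\<bar> * (\<bar>a\<bar> + \<bar>b\<bar>) powr (p - 1)"
proof -
  obtain c where c: "min a (a + b) \<le> c" "c \<le> max a (a + b)"
    "\<bar>a + b\<bar> powr p - \<bar>a\<bar> powr p = p * phi p c * ((a + b) - a)"
    by (rule abs_powr_MVT[OF assms])
  have "\<bar>c\<bar> \<le> \<bar>a\<bar> + \<bar>b\<bar>" using c(1,2) by (auto simp: min_def max_def split: if_splits)
  then have "\<bar>c\<bar> powr (p - 1) \<le> (\<bar>a\<bar> + \<bar>b\<bar>) powr (p - 1)" using assms by (intro powr_mono2) auto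
  then have "\<bar>b\<bar> * \<bar>c\<bar> powr (p - 1) \<le> \<bar>b\<bar> * (\<bar>a\<bar> + \<bar>b\<bar>) powr (p - 1)" by (intro mult_left_mono) auto
  then have "p * (\<bar>b\<bar> * \<bar>c\<bar> powr (p - 1)) \<le> p * (\<bar>b\<bar> * (\<bar>a\<bar> + \<bar>b\<bar>) powr (p - 1))" by (rule mult_left_mono) (use assms in auto)
  moreover have "\<bar>\<bar>a + b\<bar> powr p - \<bar>a\<bar> powr p\<bar> = p * (\<bar>b\<bar> * \<bar>c\<bar> powr (p - 1))"
    unfolding c(3) using assms by (simp add: abs_mult abs_phi)
  ultimately show ?thesis by (simp add: mult.assoc)
qed

lemma abs_powr_increment_mono:
  fixes s t e p :: real
  assumes "1 < p" "0 \<le> e" "s \<le> t"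
  shows "\<bar>s + e\<bar> powr p - \<bar>s\<bar> powr p \<le> \<bar>t + e\<bar> powr p - \<bar>t\<bar> powr p"
proof (rule DERIV_nonneg_imp_nondecreasing[where f = "\<lambda>t. \<bar>t + e\<bar> powr p - \<bar>t\<bar> powr p", OF assms(3)])
  fix x
  have "((\<lambda>t. \<bar>t + e\<bar> powr p) has_real_derivative p * phi p (x + e)) (at x)"
    using DERIV_shift[of "\<lambda>t. \<bar>t\<bar> powr p" "p * phi p (x + e)" x e] DERIV_abs_powr[OF assms(1), of "x + e"] by (simp add: add.commute)
  then have "((\<lambda>t. \<bar>t + e\<bar> powr p - \<bar>t\<bar> powr p) has_real_derivative p * phi p (x + e) - p * phi p x) (at x)"
    by (intro derivative_intros DERIV_abs_powr[OF assms(1)])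
  moreover have "0 \<le> p * phi p (x + e) - p * phi p x"
    using phi_mono[OF assms(1), of x "x + e"] assms by (simp add: mult_left_mono)
  ultimately show "\<exists>y. ((\<lambda>t. \<bar>t + e\<bar> powr p - \<bar>t\<bar> powr p) has_real_derivative y) (at x) \<and> 0 \<le> y" by blast
qed

text \<open>If the same function is the larger one at both points, this is an identity. In the
  crossed case the differences \<open>f1 - g2\<close> and \<open>g1 - f2\<close> have the same sum
  as \<open>f1 - f2\<close> and \<open>g1 - g2\<close> and lie between them, so convexity, in the
  form of increasing increments, decides.\<close>

lemma abs_powr_submodular:
  fixes f1 f2 g1 g2 p :: real
  assumes "1 < p"
  shows "\<bar>max f1 g1 - max f2 g2\<bar> powr p + \<bar>min f1 g1 - min f2 g2\<bar> powr p
       \<le> \<bar>f1 - f2\<bar> powr p + \<bar>g1 - g2\<bar> powr p"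
proof -
  have *: "\<bar>f1 - g2\<bar> powr p + \<bar>g1 - f2\<bar> powr p \<le> \<bar>f1 - f2\<bar> powr p + \<bar>g1 - g2\<bar> powr p"
    if "g1 \<le> f1" "f2 \<le> g2" for f1 g1 f2 g2 :: real
    using abs_powr_increment_mono[OF assms, of "f1 - g1" "g1 - g2" "g1 - f2"] that by simp
  show ?thesis
    using *[of g1 f1 f2 g2] *[of f1 g1 g2 f2]
    by (cases "f1 \<le> g1"; cases "f2 \<le> g2") (auto simp: max_def min_def)
qed

text \<open>Cutting \<open>f\<close> down to an obstacle \<open>g\<close> changes the energy by at most the first variation at \<open>g\<close>.\<close>

lemma abs_powr_min_obstacle:
  fixes f1 f2 g1 g2 p :: real
  assumes "1 < p"
  shows "\<bar>min f1 g1 - min f2 g2\<bar> powr p - \<bar>f1 - f2\<bar> powr p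
       \<le> - p * phi p (g1 - g2) * (max (f1 - g1) 0 - max (f2 - g2) 0)"
proof -
  \<comment> \<open>Only the first point exceeds the obstacle. The tangent is taken at
    \<open>g1 - f2\<close>; since \<open>f2 \<le> g2\<close>, its slope is at least the one at
    \<open>g1 - g2\<close>.\<close>
  have half: "\<bar>g1 - f2\<bar> powr p - \<bar>f1 - f2\<bar> powr p \<le> - p * phi p (g1 - g2) * (f1 - g1)"
    if "g1 \<le> f1" "f2 \<le> g2" for f1 g1 f2 g2 :: real
  proof -
    have "p * phi p (g1 - f2) * (f1 - g1) \<le> \<bar>f1 - f2\<bar> powr p - \<bar>g1 - f2\<bar> powr p"
      using abs_powr_above_tangent[OF assms, of "g1 - f2" "f1 - f2"] by simp
    moreover have "p * phi p (g1 - g2) * (f1 - g1) \<le> p * phi p (g1 - f2) * (f1 - g1)"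
      using that assms by (intro mult_right_mono mult_left_mono phi_mono) auto
    ultimately show ?thesis by simp
  qed
  have sw: "\<bar>f1 - g2\<bar> powr p - \<bar>f1 - f2\<bar> powr p \<le> p * phi p (g1 - g2) * (f2 - g2)"
    if "f1 \<le> g1" "g2 \<le> f2"
    using half[OF that(2,1)] phi_minus[of p "g1 - g2"] by (simp add: abs_minus_commute)
  show ?thesis
  proof (cases "f1 \<le> g1"; cases "f2 \<le> g2")
    assume "\<not> f1 \<le> g1" "\<not> f2 \<le> g2"
    then show ?thesis using abs_powr_above_tangent[OF assms, of "g1 - g2" "f1 - f2"]
      by (simp add: max_def min_def algebra_simps)
  qed (use half[of g1 f1 f2 g2] sw in \<open>auto simp: max_def min_def algebra_simps\<close>)
qed

lemma abs_powr_max_obstacle: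
  fixes f1 f2 g1 g2 p :: real
  assumes "1 < p"
  shows "\<bar>max f1 g1 - max f2 g2\<bar> powr p - \<bar>f1 - f2\<bar> powr p
       \<le> p * phi p (g1 - g2) * (max (g1 - f1) 0 - max (g2 - f2) 0)"
proof -
  have "max f1 g1 = - min (- f1) (- g1)" "max f2 g2 = - min (- f2) (- g2)" by (auto simp: max_def min_def)
  moreover have "\<bar>- min (- f1) (- g1) - - min (- f2) (- g2)\<bar> = \<bar>min (- f1) (- g1) - min (- f2) (- g2)\<bar>"
    "\<bar>f1 - f2\<bar> = \<bar>- f1 - - f2\<bar>" by linarith+
  moreover have "phi p (- g1 - - g2) = - phi p (g1 - g2)" using phi_minus[of p "g1 - g2"] by simp
  ultimately show ?thesis using abs_powr_min_obstacle[OF assms, of "- f1" "- g1" "- f2" "- g2"] by simp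
qed

text \<open>A Young inequality: if \<beta> is at most half of \<alpha>, then
  \<open>\<alpha> + \<beta>\<close> keeps the sign of \<alpha> and half of its size; otherwise
  \<beta> controls everything. In the Caccioppoli inequality \<alpha> is the increment of the test
  function and \<beta> that of the barrier.\<close>

lemma phi_add_mult_lower:
  assumes "1 < p"
  shows "2 powr (1 - p) * \<bar>\<alpha>\<bar> powr p - (2 * 3 powr (p - 1) + 2) * \<bar>\<beta>\<bar> powr p \<le> phi p (\<alpha> + \<beta>) * \<alpha>"
proof (cases "\<bar>\<beta>\<bar> \<le> \<bar>\<alpha>\<bar> / 2")
  case True
  have pp: "\<bar>\<alpha>\<bar> powr (p - 1) * \<bar>\<alpha>\<bar> = \<bar>\<alpha>\<bar> powr p" using powr_add[of "\<bar>\<alpha>\<bar>" "p - 1" 1] by (cases "\<alpha> = 0") auto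
  have "phi p (\<alpha> + \<beta>) * \<alpha> = \<bar>\<alpha> + \<beta>\<bar> powr (p - 1) * \<bar>\<alpha>\<bar>"
  proof -
    have "sgn (\<alpha> + \<beta>) * \<alpha> = \<bar>\<alpha>\<bar>" using True by (auto simp: sgn_if abs_if split: if_splits)
    then show ?thesis by (simp add: phi_def mult.assoc)
  qed
  moreover have "\<bar>\<alpha>\<bar> / 2 \<le> \<bar>\<alpha> + \<beta>\<bar>" using True by linarith
  then have "(\<bar>\<alpha>\<bar> / 2) powr (p - 1) \<le> \<bar>\<alpha> + \<beta>\<bar> powr (p - 1)" using assms by (intro powr_mono2) auto
  then have "(\<bar>\<alpha>\<bar> / 2) powr (p - 1) * \<bar>\<alpha>\<bar> \<le> \<bar>\<alpha> + \<beta>\<bar> powr (p - 1) * \<bar>\<alpha>\<bar>" by (intro mult_right_mono) auto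
  moreover have "(\<bar>\<alpha>\<bar> / 2) powr (p - 1) * \<bar>\<alpha>\<bar> = 2 powr (1 - p) * \<bar>\<alpha>\<bar> powr p"
    using powr_minus_divide[of 2 "p - 1"] by (simp add: powr_divide pp[symmetric] field_simps)
  moreover have "0 \<le> (2 * 3 powr (p - 1) + 2) * \<bar>\<beta>\<bar> powr p" by simp
  ultimately show ?thesis by linarith
next
  case False
  then have lt: "\<bar>\<alpha>\<bar> \<le> 2 * \<bar>\<beta>\<bar>" and b: "0 < \<bar>\<beta>\<bar>" by auto
  have pp: "\<bar>\<beta>\<bar> powr (p - 1) * \<bar>\<beta>\<bar> = \<bar>\<beta>\<bar> powr p" using b powr_add[of "\<bar>\<beta>\<bar>" "p - 1" 1] by auto
  have "\<bar>phi p (\<alpha> + \<beta>) * \<alpha>\<bar> = \<bar>\<alpha> + \<beta>\<bar> powr (p - 1) * \<bar>\<alpha>\<bar>" by (simp add: abs_mult abs_phi)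
  also have "\<dots> \<le> (3 * \<bar>\<beta>\<bar>) powr (p - 1) * (2 * \<bar>\<beta>\<bar>)" using lt assms by (intro mult_mono powr_mono2) auto
  also have "\<dots> = 2 * 3 powr (p - 1) * \<bar>\<beta>\<bar> powr p" by (simp add: powr_mult pp[symmetric])
  finally have 1: "- (2 * 3 powr (p - 1) * \<bar>\<beta>\<bar> powr p) \<le> phi p (\<alpha> + \<beta>) * \<alpha>" by linarith
  have "2 powr (1 - p) * \<bar>\<alpha>\<bar> powr p \<le> 2 powr (1 - p) * (2 * \<bar>\<beta>\<bar>) powr p"
    using lt assms by (intro mult_left_mono powr_mono2) auto
  also have "\<dots> = 2 powr (1 - p) * 2 powr p * \<bar>\<beta>\<bar> powr p" by (simp add: powr_mult)
  also have "\<dots> = 2 * \<bar>\<beta>\<bar> powr p" unfolding powr_add[symmetric] by simp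
  finally show ?thesis using 1 by (simp add: algebra_simps)
qed

lemma powr_add3_le:
  fixes a b c q :: real
  assumes "0 \<le> q" "0 \<le> a" "0 \<le> b" "0 \<le> c"
  shows "(a + b + c) powr q \<le> 3 powr q * (a powr q + b powr q + c powr q)"
proof -
  define m where "m = max a (max b c)"
  have "(a + b + c) powr q \<le> (3 * m) powr q" using assms by (intro powr_mono2) (auto simp: m_def)
  also have "\<dots> = 3 powr q * m powr q" using assms by (simp add: powr_mult m_def)
  also have "m powr q \<le> a powr q + b powr q + c powr q"
    unfolding m_def max_def by (simp add: add_nonneg_nonneg)
  finally show ?thesis by (simp add: mult_left_mono)
qed

lemma powr_add2_le:
  fixes a b q :: real
  assumes "0 \<le> q" "0 \<le> a" "0 \<le> b"
  shows "(a + b) powr q \<le> 2 powr q * (a powr q + b powr q)"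
proof -
  define m where "m = max a b"
  have "(a + b) powr q \<le> (2 * m) powr q" using assms by (intro powr_mono2) (auto simp: m_def)
  also have "\<dots> = 2 powr q * m powr q" using assms by (simp add: powr_mult m_def)
  also have "m powr q \<le> a powr q + b powr q"
    unfolding m_def max_def by (simp add: add_nonneg_nonneg)
  finally show ?thesis by (simp add: mult_left_mono)
qed

lemma powr_minus_one_mult: "0 \<le> a \<Longrightarrow> a powr (p - 1) * a = (a::real) powr p"
  using powr_add[of a "p - 1" 1] by (cases "a = 0") auto

lemma abs_phi_mult_le:
  assumes "1 < p" shows "\<bar>phi p a * b\<bar> \<le> \<bar>a\<bar> powr p + \<bar>b\<bar> powr p"
proof -
  define m where "m = max \<bar>a\<bar> \<bar>b\<bar>"
  have "\<bar>phi p a * b\<bar> = \<bar>a\<bar> powr (p - 1) * \<bar>b\<bar>" by (simp add: abs_mult abs_phi)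
  also have "\<dots> \<le> m powr (p - 1) * m" using assms by (intro mult_mono powr_mono2) (auto simp: m_def)
  also have "\<dots> = m powr p" by (rule powr_minus_one_mult) (auto simp: m_def)
  also have "\<dots> \<le> \<bar>a\<bar> powr p + \<bar>b\<bar> powr p" by (auto simp: m_def max_def)
  finally show ?thesis .
qed

lemma phi_mult_diff_nonneg:
  assumes "1 < p" "0 \<le> (a - b) * c" shows "0 \<le> (phi p a - phi p b) * c"
proof (cases "a = b")
  case False
  then consider "a < b" "c \<le> 0" | "b < a" "0 \<le> c"
    using assms(2) by (smt (verit) mult_neg_pos mult_pos_neg)
  then show ?thesis
    by cases (auto intro!: mult_nonneg_nonneg mult_nonpos_nonpos simp: phi_mono assms)
qed simp

lemma phi_mult_diff_pos:
  assumes "1 < p" "0 < (a - b) * c" shows "0 < (phi p a - phi p b) * c"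
proof -
  consider "a < b" "c < 0" | "b < a" "0 < c"
    using assms(2) by (auto simp: zero_less_mult_iff)
  then show ?thesis
    by cases (auto intro!: mult_pos_pos mult_neg_neg simp: phi_strict_mono assms)
qed

section \<open>Integrals of powers of the distance\<close>

lemma ennreal_le_suminf: "f i \<le> suminf (f :: nat \<Rightarrow> ennreal)"
  using sum_le_suminf[OF summableI, of "{i}" f] by simp

lemma cball_sets_borel [measurable]: "cball x r \<in> sets borel"
  by (rule borel_closed[OF closed_cball])

lemma ball_sets_borel [measurable]: "ball x r \<in> sets borel"
  by (rule borel_open[OF open_ball])

lemma shell_sum_bound:
  fixes x :: "'a::euclidean_space"
  assumes \<rho>: "\<And>i. 0 < \<rho> i" and c: "\<And>i. 0 \<le> c i" "(\<Sum>i. ennreal (c i)) \<le> ennreal B" "0 \<le> B"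
    and S: "\<And>y. y \<in> S \<Longrightarrow> y = x \<or> (\<exists>i. \<rho> i \<le> norm (x - y) \<and> norm (x - y) \<le> 2 * \<rho> i \<and> norm (x - y) powr \<beta> \<le> c i)"
  shows "(\<integral>\<^sup>+y. ennreal (norm (x - y) powr (\<beta> - real DIM('a))) * indicator S y \<partial>lborel)
      \<le> ennreal (unit_ball_vol (real DIM('a)) * 2 ^ DIM('a) * B)"
proof -
  let ?N = "DIM('a)"
  let ?t = "\<lambda>i y. ennreal (c i * \<rho> i powr (- real ?N)) * indicator (cball x (2 * \<rho> i)) y"
  have t_measurable: "?t i \<in> borel_measurable lborel" for i
    by measurable
  have "(\<integral>\<^sup>+y. ennreal (norm (x - y) powr (\<beta> - real ?N)) * indicator S y \<partial>lborel)
      \<le> (\<integral>\<^sup>+y. (\<Sum>i. ?t i y) \<partial>lborel)"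
  proof (rule nn_integral_mono)
    fix y
    show "ennreal (norm (x - y) powr (\<beta> - real ?N)) * indicator S y \<le> (\<Sum>i. ?t i y)"
    proof (cases "y \<in> S \<and> y \<noteq> x")
      case True
      then obtain i where i: "\<rho> i \<le> norm (x - y)" "norm (x - y) \<le> 2 * \<rho> i" "norm (x - y) powr \<beta> \<le> c i"
        using S by blast
      have "norm (x - y) powr (\<beta> - real ?N) = norm (x - y) powr \<beta> * norm (x - y) powr (- real ?N)"
        by (simp add: powr_add[symmetric])
      also have "\<dots> \<le> c i * \<rho> i powr (- real ?N)"
        using i \<rho>[of i] c by (intro mult_mono powr_mono2') auto
      finally have "ennreal (norm (x - y) powr (\<beta> - real ?N)) * indicator S y \<le> ?t i y"
        using i True by (simp add: dist_norm ennreal_leI)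
      also have "\<dots> \<le> (\<Sum>i. ?t i y)"
        by (rule ennreal_le_suminf)
      finally show ?thesis .
    next
      case False
      then have "ennreal (norm (x - y) powr (\<beta> - real ?N)) * indicator S y = 0" by (auto simp: indicator_def)
      then show ?thesis by (simp only: zero_le)
    qed
  qed
  also have "\<dots> = (\<Sum>i. \<integral>\<^sup>+y. ?t i y \<partial>lborel)"
    by (rule nn_integral_suminf[OF t_measurable])
  also have "\<dots> = (\<Sum>i. ennreal (unit_ball_vol (real ?N) * 2 ^ ?N) * ennreal (c i))"
  proof (rule suminf_cong)
    fix i
    have "(\<integral>\<^sup>+y. ?t i y \<partial>lborel) = ennreal (c i * \<rho> i powr (- real ?N)) * emeasure lborel (cball x (2 * \<rho> i))"
      by (rule nn_integral_cmult_indicator) simp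
    also have "\<dots> = ennreal (c i * \<rho> i powr (- real ?N)) * ennreal (unit_ball_vol (real ?N) * (2 * \<rho> i) ^ ?N)"
      using \<rho>[of i] by (simp add: emeasure_cball)
    also have "\<dots> = ennreal (c i * \<rho> i powr (- real ?N) * (unit_ball_vol (real ?N) * (2 * \<rho> i) ^ ?N))"
      using c \<rho>[of i] by (intro ennreal_mult[symmetric]) (auto intro!: mult_nonneg_nonneg simp: less_imp_le)
    also have "c i * \<rho> i powr (- real ?N) * (unit_ball_vol (real ?N) * (2 * \<rho> i) ^ ?N) = unit_ball_vol (real ?N) * 2 ^ ?N * c i"
      using \<rho>[of i] by (simp add: powr_minus powr_realpow power_mult_distrib field_simps)
    finally show "(\<integral>\<^sup>+y. ?t i y \<partial>lborel) = ennreal (unit_ball_vol (real ?N) * 2 ^ ?N) * ennreal (c i)"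
      using c by (simp add: ennreal_mult)
  qed
  also have "\<dots> = ennreal (unit_ball_vol (real ?N) * 2 ^ ?N) * (\<Sum>i. ennreal (c i))"
    by simp
  also have "\<dots> \<le> ennreal (unit_ball_vol (real ?N) * 2 ^ ?N) * ennreal B"
    by (intro mult_left_mono c) auto
  also have "\<dots> = ennreal (unit_ball_vol (real ?N) * 2 ^ ?N * B)"
    using c by (intro ennreal_mult[symmetric]) auto
  finally show ?thesis .
qed

lemma geometric_powr_sum:
  assumes "0 < \<gamma>" "0 \<le> a"
  shows "(\<Sum>i::nat. ennreal (a * (2 powr (- \<gamma>)) ^ i)) = ennreal (a / (1 - 2 powr (- \<gamma>)))"
proof -
  have "2 powr (- \<gamma>) < (1::real)" using assms powr_less_one[of 2 "- \<gamma>"] by simp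
  then have "(\<lambda>i. a * (2 powr (- \<gamma>)) ^ i) sums (a * (1 / (1 - 2 powr (- \<gamma>))))"
    by (intro sums_mult geometric_sums) auto
  then show ?thesis using assms
    by (subst suminf_ennreal_eq) auto
qed

lemma nn_integral_powr_outside:
  fixes x :: "'a::euclidean_space"
  assumes \<gamma>: "0 < \<gamma>" and r: "0 < r"
  shows "(\<integral>\<^sup>+y. ennreal (norm (x - y) powr (- \<gamma> - real DIM('a))) * indicator {y. r \<le> norm (x - y)} y \<partial>lborel)
      \<le> ennreal (unit_ball_vol (real DIM('a)) * 2 ^ DIM('a) * (r powr (- \<gamma>) / (1 - 2 powr (- \<gamma>))))"
proof (rule shell_sum_bound[where \<rho> = "\<lambda>i. 2 ^ i * r" and c = "\<lambda>i. r powr (- \<gamma>) * (2 powr (- \<gamma>)) ^ i"])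
  have l1: "2 powr (- \<gamma>) < (1::real)" using \<gamma> powr_less_one[of 2 "- \<gamma>"] by simp
  show "0 \<le> r powr - \<gamma> / (1 - 2 powr - \<gamma>)" using l1 by simp
  show "(\<Sum>i. ennreal (r powr - \<gamma> * (2 powr - \<gamma>) ^ i)) \<le> ennreal (r powr - \<gamma> / (1 - 2 powr - \<gamma>))"
    using \<gamma> by (subst geometric_powr_sum) auto
  fix y assume "y \<in> {y. r \<le> norm (x - y)}"
  then have y: "r \<le> norm (x - y)" by simp
  \<comment> \<open>The index of the dyadic shell that contains y; the logarithm is nonnegative
    since \<open>r \<le> norm (x - y)\<close>.\<close>
  define i where "i = nat \<lfloor>log 2 (norm (x - y) / r)\<rfloor>"
  have "1 \<le> norm (x - y) / r" using y r by simp
  then have nn: "0 \<le> log 2 (norm (x - y) / r)" by (subst zero_le_log_cancel_iff) auto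
  have n0: "0 < norm (x - y)" using y r by linarith
  have "real i \<le> log 2 (norm (x - y) / r)" "log 2 (norm (x - y) / r) \<le> real i + 1"
    using nn unfolding i_def by linarith+
  then have "2 powr real i \<le> norm (x - y) / r" "norm (x - y) / r \<le> 2 powr (real i + 1)"
    using n0 r by (auto simp: le_log_iff log_le_iff)
  then have i: "2 ^ i * r \<le> norm (x - y)" "norm (x - y) \<le> 2 * (2 ^ i * r)"
    using r by (auto simp: powr_add powr_realpow field_simps)
  have "norm (x - y) powr (- \<gamma>) \<le> (2 ^ i * r) powr (- \<gamma>)"
    using i r \<gamma> by (intro powr_mono2') auto
  also have "\<dots> = r powr (- \<gamma>) * (2 powr (- \<gamma>)) ^ i"
    using r by (simp add: powr_mult powr_realpow[symmetric] powr_powr mult.commute)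
  finally show "y = x \<or> (\<exists>i. 2 ^ i * r \<le> norm (x - y) \<and> norm (x - y) \<le> 2 * (2 ^ i * r) \<and> norm (x - y) powr - \<gamma> \<le> r powr - \<gamma> * (2 powr - \<gamma>) ^ i)"
    using i by blast
qed (use r in auto)

lemma nn_integral_powr_inside:
  fixes x :: "'a::euclidean_space"
  assumes \<gamma>: "0 < \<gamma>" and r: "0 < r"
  shows "(\<integral>\<^sup>+y. ennreal (norm (x - y) powr (\<gamma> - real DIM('a))) * indicator {y. norm (x - y) \<le> r} y \<partial>lborel)
      \<le> ennreal (unit_ball_vol (real DIM('a)) * 2 ^ DIM('a) * (r powr \<gamma> / (1 - 2 powr (- \<gamma>))))"
\<comment> \<open>Shells now shrink towards x. The exponent \<open>Suc i\<close> makes the outer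
  radius of the first shell, twice \<rho>, equal to r.\<close>
proof (rule shell_sum_bound[where \<rho> = "\<lambda>i. r / 2 ^ Suc i" and c = "\<lambda>i. r powr \<gamma> * (2 powr (- \<gamma>)) ^ i"])
  have l1: "2 powr (- \<gamma>) < (1::real)" using \<gamma> powr_less_one[of 2 "- \<gamma>"] by simp
  show "0 \<le> r powr \<gamma> / (1 - 2 powr - \<gamma>)" using l1 by simp
  show "(\<Sum>i. ennreal (r powr \<gamma> * (2 powr - \<gamma>) ^ i)) \<le> ennreal (r powr \<gamma> / (1 - 2 powr - \<gamma>))"
    using \<gamma> by (subst geometric_powr_sum) auto
  fix y assume "y \<in> {y. norm (x - y) \<le> r}"
  then have y: "norm (x - y) \<le> r" by simp
  show "y = x \<or> (\<exists>i. r / 2 ^ Suc i \<le> norm (x - y) \<and> norm (x - y) \<le> 2 * (r / 2 ^ Suc i) \<and> norm (x - y) powr \<gamma> \<le> r powr \<gamma> * (2 powr - \<gamma>) ^ i)"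
  proof (cases "y = x")
    case False
    then have n0: "0 < norm (x - y)" by simp
    define i where "i = nat \<lfloor>log 2 (r / norm (x - y))\<rfloor>"
    have "1 \<le> r / norm (x - y)" using y n0 by simp
    then have nn: "0 \<le> log 2 (r / norm (x - y))" by (subst zero_le_log_cancel_iff) auto
    have "real i \<le> log 2 (r / norm (x - y))" "log 2 (r / norm (x - y)) \<le> real i + 1"
      using nn unfolding i_def by linarith+
    then have "2 powr real i \<le> r / norm (x - y)" "r / norm (x - y) \<le> 2 powr (real i + 1)"
      using n0 r by (auto simp: le_log_iff log_le_iff)
    then have i: "r / 2 ^ Suc i \<le> norm (x - y)" "norm (x - y) \<le> r / 2 ^ i"
      using r n0 by (auto simp: powr_add powr_realpow field_simps)
    have "norm (x - y) powr \<gamma> \<le> (r / 2 ^ i) powr \<gamma>"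
      using i r \<gamma> by (intro powr_mono2) auto
    also have "\<dots> = r powr \<gamma> * (2 powr (- \<gamma>)) ^ i"
      using r by (simp add: powr_divide powr_realpow[symmetric] powr_powr powr_minus field_simps)
    finally show ?thesis using i by auto
  qed simp
qed (use r in auto)

section \<open>The nonlocal form\<close>

lemma borel_measurable_fst_snd [measurable]:
  "fst \<in> borel_measurable (borel :: ('a::second_countable_topology \<times> 'b::second_countable_topology) measure)"
  "snd \<in> borel_measurable (borel :: ('a \<times> 'b) measure)"
  by (auto intro!: borel_measurable_continuous_onI continuous_on_fst continuous_on_snd continuous_on_id)

lemma lborel_fst_snd_measurable [measurable]:
  "fst \<in> borel_measurable (lborel :: ('a::euclidean_space \<times> 'b::euclidean_space) measure)"
  "snd \<in> borel_measurable (lborel :: ('a \<times> 'b) measure)"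
  by (simp_all add: borel_measurable_fst_snd)

definition dif :: "('a \<Rightarrow> real) \<Rightarrow> 'a \<times> 'a \<Rightarrow> real"
  where "dif u z = u (fst z) - u (snd z)"

lemma dif_Pair [simp]: "dif u (x, y) = u x - u y"
  by (simp add: dif_def)

lemma borel_measurable_dif [measurable]:
  fixes u :: "'a::second_countable_topology \<Rightarrow> real"
  assumes [measurable]: "u \<in> borel_measurable borel"
  shows "dif u \<in> borel_measurable borel"
  unfolding dif_def[abs_def] by measurable

text \<open>The interactions of a function supported in C with the far region. For C inside U every
  pair lies in \<open>U \<times> U\<close>, or in \<open>outs C U\<close>, or has both points
  outside C; this trichotomy organises all integrability proofs.\<close>

definition outs :: "'a set \<Rightarrow> 'a set \<Rightarrow> ('a \<times> 'a) set"
  where "outs C U = C \<times> (- U) \<union> (- U) \<times> C"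

lemma sets_borel_Times [measurable]:
  fixes A :: "'a::second_countable_topology set" and B :: "'b::second_countable_topology set"
  shows "A \<in> sets borel \<Longrightarrow> B \<in> sets borel \<Longrightarrow> A \<times> B \<in> sets borel"
  unfolding borel_prod[symmetric] by (rule pair_measureI)

lemma sets_outs [measurable]:
  fixes C U :: "'a::second_countable_topology set"
  shows "C \<in> sets borel \<Longrightarrow> U \<in> sets borel \<Longrightarrow> outs C U \<in> sets borel"
  unfolding outs_def by (intro sets.Un sets_borel_Times) auto

text \<open>A Borel kernel with bounds valid everywhere, so that exceptional sets do not have to be
  carried along; \<open>admissible_kernel_borel\<close> provides it. On the diagonal both bounds
  read 0, hence \<open>k x x = 0\<close>.\<close>

locale frac_kernel =
  fixes s p \<Lambda> :: real and k :: "'a::euclidean_space \<Rightarrow> 'a \<Rightarrow> real"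
  assumes s_pos: "0 < s" and s_less: "s < 1" and p_gt: "1 < p" and \<Lambda>_ge: "1 \<le> \<Lambda>"
    and k_measurable: "(\<lambda>z. k (fst z) (snd z)) \<in> borel_measurable borel"
    and k_sym: "k x y = k y x"
    and k_upper: "k x y \<le> \<Lambda> * norm (x - y) powr (- (s * p) - real DIM('a))"
    and k_lower: "norm (x - y) powr (- (s * p) - real DIM('a)) / \<Lambda> \<le> k x y"
begin

lemma k_nonneg: "0 \<le> k x y"
  using k_lower[of x y] \<Lambda>_ge by (meson divide_nonneg_nonneg order_trans powr_ge_zero zero_le_one)

lemma sp_pos: "0 < s * p" using s_pos p_gt by simp

lemma k_measurable' [measurable]:
  "f \<in> borel_measurable M \<Longrightarrow> g \<in> borel_measurable M \<Longrightarrow> (\<lambda>z. k (f z) (g z)) \<in> borel_measurable M"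
  using measurable_compose[OF borel_measurable_Pair k_measurable, of f M g] by simp

text \<open>Absorbing the kernel into the measure turns the double integrals of the weak form and of
  the energy into integrals over one measure space, open to monotone and dominated
  convergence.\<close>

definition mu :: "('a \<times> 'a) measure"
  where "mu = density lborel (\<lambda>z. ennreal (k (fst z) (snd z)))"

lemma sets_mu [measurable_cong, simp]: "sets mu = sets borel"
  by (simp add: mu_def)

lemma space_mu [simp]: "space mu = UNIV"
  by (simp add: mu_def)

lemma nn_integral_mu_lborel:
  assumes [measurable]: "F \<in> borel_measurable borel"
  shows "(\<integral>\<^sup>+z. F z \<partial>mu) = (\<integral>\<^sup>+z. ennreal (k (fst z) (snd z)) * F z \<partial>lborel)"
  unfolding mu_def by (subst nn_integral_density) auto

lemma nn_integral_mu:
  assumes [measurable]: "F \<in> borel_measurable borel"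
  shows "(\<integral>\<^sup>+z. F z \<partial>mu) = (\<integral>\<^sup>+x. \<integral>\<^sup>+y. ennreal (k x y) * F (x, y) \<partial>lborel \<partial>lborel)"
proof -
  have "(\<lambda>z. ennreal (k (fst z) (snd z)) * F z) \<in> borel_measurable (lborel \<Otimes>\<^sub>M lborel)"
    unfolding lborel_prod by measurable
  then have "(\<integral>\<^sup>+x. \<integral>\<^sup>+y. ennreal (k x y) * F (x, y) \<partial>lborel \<partial>lborel) = (\<integral>\<^sup>+z. ennreal (k (fst z) (snd z)) * F z \<partial>(lborel \<Otimes>\<^sub>M lborel))"
    by (subst lborel.nn_integral_fst[symmetric]) auto
  then show ?thesis by (simp add: nn_integral_mu_lborel lborel_prod)
qed

lemma nn_integral_mu_swap:
  assumes [measurable]: "F \<in> borel_measurable borel"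
  shows "(\<integral>\<^sup>+z. F (snd z, fst z) \<partial>mu) = (\<integral>\<^sup>+z. F z \<partial>mu)"
proof -
  have m: "(\<lambda>z. ennreal (k (fst z) (snd z)) * F z) \<in> borel_measurable (lborel \<Otimes>\<^sub>M lborel)"
    unfolding lborel_prod by measurable
  have "(\<integral>\<^sup>+z. F z \<partial>mu) = (\<integral>\<^sup>+z. ennreal (k (fst z) (snd z)) * F z \<partial>(lborel \<Otimes>\<^sub>M lborel))"
    by (simp add: nn_integral_mu_lborel lborel_prod)
  also have "\<dots> = (\<integral>\<^sup>+y. \<integral>\<^sup>+x. ennreal (k x y) * F (x, y) \<partial>lborel \<partial>lborel)"
    using lborel_pair.nn_integral_snd[OF m] by (simp add: case_prod_unfold)
  also have "\<dots> = (\<integral>\<^sup>+z. F (snd z, fst z) \<partial>mu)"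
    by (subst nn_integral_mu) (auto simp: k_sym intro!: nn_integral_cong)
  finally show ?thesis ..
qed

section \<open>Tails and far interactions\<close>

definition tailw :: "'a \<Rightarrow> real"
  where "tailw x = (1 + norm x) powr (- (s * p) - real DIM('a))"

lemma tailw_pos: "0 < tailw x"
proof -
  have "0 < 1 + norm x" by (smt (verit) norm_ge_zero)
  then show ?thesis by (simp add: tailw_def)
qed

lemma tailw_measurable [measurable]: "tailw \<in> borel_measurable borel"
  unfolding tailw_def[abs_def] by measurable

lemma tailw_finite: "(\<integral>\<^sup>+x. ennreal (tailw x) \<partial>lborel) < \<infinity>"
proof -
  have "(\<integral>\<^sup>+x. ennreal (tailw x) \<partial>lborel) \<le>
    (\<integral>\<^sup>+x. ennreal (norm (0 - x) powr (- (s * p) - real DIM('a))) * indicator {y. 1 \<le> norm (0 - y)} x + indicator (cball 0 1) x \<partial>(lborel::'a measure))"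
  proof (rule nn_integral_mono)
    fix x :: 'a
    show "ennreal (tailw x) \<le> ennreal (norm (0 - x) powr (- (s * p) - real DIM('a))) * indicator {y. 1 \<le> norm (0 - y)} x + indicator (cball 0 1) x"
    proof (cases "1 \<le> norm x")
      case True
      then have "tailw x \<le> norm x powr (- (s * p) - real DIM('a))"
        unfolding tailw_def using sp_pos by (intro powr_mono2') auto
      then show ?thesis using True by (auto intro!: add_increasing2 ennreal_leI)
    next
      case False
      have "tailw x \<le> 1 powr (- (s * p) - real DIM('a))"
        unfolding tailw_def using sp_pos by (intro powr_mono2') auto
      then show ?thesis using False by (auto simp flip: ennreal_1 intro!: ennreal_leI)
    qed
  qed
  also have "\<dots> = (\<integral>\<^sup>+x. ennreal (norm (0 - x) powr (- (s * p) - real DIM('a))) * indicator {y. 1 \<le> norm (0 - y)} x \<partial>(lborel::'a measure)) + emeasure lborel (cball (0::'a) 1)"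
    by (subst nn_integral_add) (auto intro!: borel_measurable_indicator)
  also have "\<dots> < \<infinity>"
    using nn_integral_powr_outside[OF sp_pos, of 1 "0::'a"]
    by (auto simp: emeasure_cball ennreal_add_less_top intro: le_less_trans simp del: diff_0)
  finally show ?thesis .
qed

text \<open>Membership in the tail space for Borel functions. The local integrability that the tail
  space also demands follows in \<open>tail_local\<close>, because \<open>tailw\<close> is bounded
  below on compact sets.\<close>

definition tailf :: "('a \<Rightarrow> real) \<Rightarrow> bool"
  where "tailf u \<longleftrightarrow> (\<integral>\<^sup>+x. ennreal (\<bar>u x\<bar> powr (p - 1) * tailw x) \<partial>lborel) < \<infinity>"

text \<open>With d the distance from C to the complement of U and m a bound for C,
  \<open>1 + norm y\<close> is at most \<open>(1 + m) + norm (x - y)\<close>, and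
  \<open>1 + m\<close> is at most \<open>(1 + m) / d * norm (x - y)\<close>. This explains
  \<open>A = (1 + m) / d + 1\<close>; raising to the negative kernel exponent yields
  \<open>tailw\<close>.\<close>

lemma sep_kernel_bound:
  assumes C: "compact C" and U: "open U" "C \<subseteq> U"
  obtains c where "0 < c" "\<And>x y. x \<in> C \<Longrightarrow> y \<notin> U \<Longrightarrow> k x y \<le> c * tailw y"
proof -
  obtain d where d: "0 < d" "\<And>x y. x \<in> C \<Longrightarrow> y \<in> - U \<Longrightarrow> d \<le> dist x y"
    using separate_compact_closed[of C "- U"] C U by (auto simp: open_closed disjoint_eq_subset_Compl)
  obtain m where m: "0 < m" "\<And>x. x \<in> C \<Longrightarrow> norm x \<le> m"
    using compact_imp_bounded[OF C] by (auto simp: bounded_pos)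
  define A where "A = (1 + m) / d + 1"
  have A: "0 < A" using d m by (auto simp: A_def intro!: add_pos_pos divide_pos_pos)
  let ?e = "- (s * p) - real DIM('a)"
  show ?thesis
  proof (rule that[of "\<Lambda> * A powr (- ?e)"])
    show "0 < \<Lambda> * A powr (- ?e)" using A \<Lambda>_ge by simp
    fix x y assume xy: "x \<in> C" "y \<notin> U"
    have dxy: "d \<le> norm (x - y)" using d(2)[of x y] xy by (simp add: dist_norm)
    have "1 + norm y \<le> (1 + m) + norm (x - y)"
      using m(2)[OF xy(1)] norm_triangle_ineq4[of x "x - y"] by simp
    also have "\<dots> \<le> (1 + m) / d * norm (x - y) + norm (x - y)"
    proof -
      have "d * (1 + m) \<le> norm (x - y) * (1 + m)" using dxy m by (intro mult_right_mono) auto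
      then show ?thesis using d by (simp add: field_simps)
    qed
    finally have le: "1 + norm y \<le> A * norm (x - y)" by (simp add: A_def algebra_simps)
    have "norm (x - y) powr ?e = A powr (- ?e) * (A * norm (x - y)) powr ?e"
      using A by (simp add: powr_mult powr_add[symmetric] mult.assoc[symmetric])
    also have "(A * norm (x - y)) powr ?e \<le> (1 + norm y) powr ?e"
      using le sp_pos by (intro powr_mono2') (auto intro: add_pos_nonneg)
    finally have "norm (x - y) powr ?e \<le> A powr (- ?e) * tailw y"
      by (simp add: tailw_def mult_left_mono)
    then have "\<Lambda> * norm (x - y) powr ?e \<le> \<Lambda> * (A powr (- ?e) * tailw y)"
      using \<Lambda>_ge by (intro mult_left_mono) auto
    then show "k x y \<le> \<Lambda> * A powr (- ?e) * tailw y"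
      using k_upper[of x y] by (simp add: mult.assoc)
  qed
qed

lemma tail_local:
  assumes C: "compact C" and u [measurable]: "u \<in> borel_measurable borel" and t: "tailf u"
  shows "(\<integral>\<^sup>+x. ennreal (\<bar>u x\<bar> powr (p - 1)) * indicator C x \<partial>lborel) < \<infinity>"
proof -
  obtain m where m: "0 < m" "\<And>x. x \<in> C \<Longrightarrow> norm x \<le> m"
    using compact_imp_bounded[OF C] by (auto simp: bounded_pos)
  define c where "c = (1 + m) powr (- (s * p) - real DIM('a))"
  have c: "0 < c" using m by (simp add: c_def)
  have "(\<integral>\<^sup>+x. ennreal (\<bar>u x\<bar> powr (p - 1)) * indicator C x \<partial>lborel)
    \<le> (\<integral>\<^sup>+x. ennreal (1 / c) * ennreal (\<bar>u x\<bar> powr (p - 1) * tailw x) \<partial>lborel)"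
  proof (rule nn_integral_mono)
    fix x
    show "ennreal (\<bar>u x\<bar> powr (p - 1)) * indicator C x \<le> ennreal (1 / c) * ennreal (\<bar>u x\<bar> powr (p - 1) * tailw x)"
    proof (cases "x \<in> C")
      case True
      have "c \<le> tailw x" unfolding c_def tailw_def using m True sp_pos
        by (intro powr_mono2') (auto intro: add_pos_nonneg)
      then have "\<bar>u x\<bar> powr (p - 1) * c \<le> \<bar>u x\<bar> powr (p - 1) * tailw x" by (intro mult_left_mono) auto
      then have "\<bar>u x\<bar> powr (p - 1) \<le> 1 / c * (\<bar>u x\<bar> powr (p - 1) * tailw x)" using c by (simp add: field_simps)
      then show ?thesis using True c tailw_pos[of x] by (subst ennreal_mult[symmetric]) (auto simp: ennreal_leI less_imp_le)
    qed auto
  qed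
  also have "\<dots> = ennreal (1 / c) * (\<integral>\<^sup>+x. ennreal (\<bar>u x\<bar> powr (p - 1) * tailw x) \<partial>lborel)"
    by (rule nn_integral_cmult) measurable
  also have "\<dots> < \<infinity>" using t by (simp add: tailf_def ennreal_mult_less_top)
  finally show ?thesis .
qed

text \<open>Once the kernel is replaced by a multiple of \<open>tailw y\<close>, the integral over x
  in C and y outside U splits into products of a local integral of u and a tail integral. The other
  half of \<open>outs\<close> is its mirror image under the symmetry of \<open>mu\<close>.\<close>

lemma outs_finite:
  assumes C: "compact C" and U: "open U" "C \<subseteq> U"
    and u [measurable]: "u \<in> borel_measurable borel" and t: "tailf u" and M: "0 \<le> M"
  shows "(\<integral>\<^sup>+z. ennreal ((\<bar>u (fst z)\<bar> + \<bar>u (snd z)\<bar> + M) powr (p - 1)) * indicator (outs C U) z \<partial>mu) < \<infinity>"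
proof -
  obtain c where c: "0 < c" "\<And>x y. x \<in> C \<Longrightarrow> y \<notin> U \<Longrightarrow> k x y \<le> c * tailw y"
    using sep_kernel_bound[OF C U] by blast
  have [measurable]: "C \<in> sets borel" "U \<in> sets borel" using C U by (auto simp: borel_compact)
  define F where "F z = ennreal ((\<bar>u (fst z)\<bar> + \<bar>u (snd z)\<bar> + M) powr (p - 1)) * indicator (C \<times> (- U)) z" for z
  have [measurable]: "F \<in> borel_measurable borel" unfolding F_def[abs_def] by measurable
  let ?g = "\<lambda>x. ennreal (\<bar>u x\<bar> powr (p - 1))"
  define T where "T = (\<integral>\<^sup>+y. ennreal (tailw y) \<partial>lborel)"
  define Tu where "Tu = (\<integral>\<^sup>+y. ennreal (\<bar>u y\<bar> powr (p - 1) * tailw y) \<partial>lborel)"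
  have T: "T < \<infinity>" "Tu < \<infinity>" using tailw_finite t by (auto simp: T_def Tu_def tailf_def)
  have Fle: "(\<integral>\<^sup>+z. F z \<partial>mu) \<le> (\<integral>\<^sup>+x. ennreal (c * 3 powr (p - 1)) * (?g x * T + ennreal (M powr (p - 1)) * T + Tu) * indicator C x \<partial>lborel)"
  proof (subst nn_integral_mu, measurable, rule nn_integral_mono)
    fix x
    show "(\<integral>\<^sup>+y. ennreal (k x y) * F (x, y) \<partial>lborel) \<le> ennreal (c * 3 powr (p - 1)) * (?g x * T + ennreal (M powr (p - 1)) * T + Tu) * indicator C x"
    proof (cases "x \<in> C")
      case True
      have "(\<integral>\<^sup>+y. ennreal (k x y) * F (x, y) \<partial>lborel) \<le>
        (\<integral>\<^sup>+y. ennreal (c * 3 powr (p - 1)) * (?g x * ennreal (tailw y) + ennreal (M powr (p - 1)) * ennreal (tailw y) + ennreal (\<bar>u y\<bar> powr (p - 1) * tailw y)) \<partial>lborel)"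
      proof (rule nn_integral_mono)
        fix y
        show "ennreal (k x y) * F (x, y) \<le> ennreal (c * 3 powr (p - 1)) * (?g x * ennreal (tailw y) + ennreal (M powr (p - 1)) * ennreal (tailw y) + ennreal (\<bar>u y\<bar> powr (p - 1) * tailw y))"
        proof (cases "y \<in> U")
          case False
          have "k x y * (\<bar>u x\<bar> + \<bar>u y\<bar> + M) powr (p - 1) \<le> (c * tailw y) * (3 powr (p - 1) * (\<bar>u x\<bar> powr (p - 1) + \<bar>u y\<bar> powr (p - 1) + M powr (p - 1)))"
            using c(2)[OF True False] powr_add3_le[of "p - 1" "\<bar>u x\<bar>" "\<bar>u y\<bar>" M] p_gt M c(1) tailw_pos[of y]
            by (intro mult_mono) auto
          also have "\<dots> = c * 3 powr (p - 1) * (\<bar>u x\<bar> powr (p - 1) * tailw y + M powr (p - 1) * tailw y + \<bar>u y\<bar> powr (p - 1) * tailw y)"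
            by (simp add: algebra_simps)
          finally show ?thesis using c(1) k_nonneg[of x y] tailw_pos[of y] True False
            by (simp add: F_def ennreal_mult[symmetric] ennreal_plus[symmetric] less_imp_le ennreal_leI del: ennreal_plus)
        qed (auto simp: F_def)
      qed
      also have "\<dots> = ennreal (c * 3 powr (p - 1)) * (?g x * T + ennreal (M powr (p - 1)) * T + Tu)"
        by (simp add: nn_integral_cmult nn_integral_add T_def Tu_def)
      finally show ?thesis using True by simp
    qed (auto simp: F_def)
  qed
  also have "\<dots> = (\<integral>\<^sup>+x. ennreal (c * 3 powr (p - 1)) * T * (?g x * indicator C x) + ennreal (c * 3 powr (p - 1)) * (ennreal (M powr (p - 1)) * T + Tu) * indicator C x \<partial>lborel)"
    by (intro nn_integral_cong) (auto simp: algebra_simps split: split_indicator)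
  also have "\<dots> = ennreal (c * 3 powr (p - 1)) * T * (\<integral>\<^sup>+x. ?g x * indicator C x \<partial>lborel) + ennreal (c * 3 powr (p - 1)) * (ennreal (M powr (p - 1)) * T + Tu) * emeasure lborel C"
    by (subst nn_integral_add) (auto simp: nn_integral_cmult)
  also have "\<dots> < \<infinity>"
    using tail_local[OF C u t] T emeasure_bounded_finite[OF compact_imp_bounded[OF C]] by (simp add: ennreal_mult_less_top)
  finally have FF: "(\<integral>\<^sup>+z. F z \<partial>mu) < \<infinity>" .
  have "(\<integral>\<^sup>+z. ennreal ((\<bar>u (fst z)\<bar> + \<bar>u (snd z)\<bar> + M) powr (p - 1)) * indicator (outs C U) z \<partial>mu)
    \<le> (\<integral>\<^sup>+z. F z + F (snd z, fst z) \<partial>mu)"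
    by (intro nn_integral_mono) (auto simp: F_def outs_def add.commute split: split_indicator)
  also have "\<dots> = (\<integral>\<^sup>+z. F z \<partial>mu) + (\<integral>\<^sup>+z. F (snd z, fst z) \<partial>mu)"
    by (rule nn_integral_add) measurable
  also have "\<dots> < \<infinity>" using FF by (simp add: nn_integral_mu_swap)
  finally show ?thesis .
qed

section \<open>Energies, test functions and the weak form\<close>

definition energy :: "('a \<Rightarrow> real) \<Rightarrow> ('a \<times> 'a) set \<Rightarrow> ennreal"
  where "energy u A = (\<integral>\<^sup>+z. ennreal (\<bar>dif u z\<bar> powr p) * indicator A z \<partial>mu)"

text \<open>Wider than the smooth test functions so that positive parts and truncations stay
  admissible. \<open>wsuper_of_smooth\<close> shows that testing with smooth functions already
  implies testing with these.\<close>

definition tests :: "'a set \<Rightarrow> ('a \<Rightarrow> real) set"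
  where "tests D = {\<eta>. \<eta> \<in> borel_measurable borel \<and> (\<exists>M. \<forall>x. \<bar>\<eta> x\<bar> \<le> M) \<and>
    (\<exists>C. compact C \<and> C \<subseteq> D \<and> (\<forall>x. x \<notin> C \<longrightarrow> \<eta> x = 0)) \<and> energy \<eta> UNIV < \<infinity>}"

text \<open>What makes the weak form integrable against \<open>tests\<close>: the energy handles
  pairs near the support of the test function, the tail handles the rest.\<close>

definition loc_energy :: "('a \<Rightarrow> real) \<Rightarrow> 'a set \<Rightarrow> bool"
  where "loc_energy u D \<longleftrightarrow> u \<in> borel_measurable borel \<and> tailf u \<and>
    (\<forall>C. compact C \<and> C \<subseteq> D \<longrightarrow> (\<exists>U. open U \<and> C \<subseteq> U \<and> U \<subseteq> D \<and> energy u (U \<times> U) < \<infinity>))"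

definition wform :: "('a \<Rightarrow> real) \<Rightarrow> ('a \<Rightarrow> real) \<Rightarrow> 'a \<times> 'a \<Rightarrow> real"
  where "wform u \<eta> z = phi p (dif u z) * dif \<eta> z"

lemma wform_measurable [measurable]:
  assumes [measurable]: "u \<in> borel_measurable borel" "\<eta> \<in> borel_measurable borel"
  shows "wform u \<eta> \<in> borel_measurable borel"
  unfolding wform_def[abs_def] by measurable

text \<open>Near the support Young's inequality separates u from \<eta>. On far pairs one value of
  \<eta> is 0, so the increment of \<eta> is at most M and only the power p - 1 of u remains. The
  last summand has the shape treated by \<open>outs_finite\<close>, hence the
  \<open>+ 0\<close>.\<close>

lemma wform_bound:
  assumes M: "\<And>x. \<bar>\<eta> x\<bar> \<le> M" and C: "\<And>x. x \<notin> C \<Longrightarrow> \<eta> x = 0" and CU: "C \<subseteq> U"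
  shows "\<bar>wform u \<eta> z\<bar> \<le> (\<bar>dif u z\<bar> powr p) * indicator (U \<times> U) z + \<bar>dif \<eta> z\<bar> powr p
    + M * ((\<bar>u (fst z)\<bar> + \<bar>u (snd z)\<bar> + 0) powr (p - 1) * indicator (outs C U) z)"
proof -
  obtain x y where z: "z = (x, y)" by (cases z)
  have M0: "0 \<le> M" using M[of x] by linarith
  consider "x \<in> U" "y \<in> U" | "x \<notin> C" "y \<notin> C" | "(x, y) \<in> outs C U"
    using CU unfolding outs_def by blast
  then show ?thesis
  proof cases
    case 1
    then show ?thesis using abs_phi_mult_le[OF p_gt, of "u x - u y" "\<eta> x - \<eta> y"] M0
      by (simp add: z wform_def add_increasing2)
  next
    case 2
    then show ?thesis using C M0 by (simp add: z wform_def)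
  next
    case 3
    have "\<eta> x = 0 \<or> \<eta> y = 0 \<or> z \<in> U \<times> U"
      using 3 C CU unfolding outs_def z by blast
    then have "\<bar>dif \<eta> z\<bar> \<le> M \<or> z \<in> U \<times> U"
      using M[of x] M[of y] by (auto simp: z)
    then show ?thesis
    proof
      assume "z \<in> U \<times> U" then show ?thesis using abs_phi_mult_le[OF p_gt, of "u x - u y" "\<eta> x - \<eta> y"] M0
        by (simp add: z wform_def add_increasing2)
    next
      assume dM: "\<bar>dif \<eta> z\<bar> \<le> M"
      have "\<bar>wform u \<eta> z\<bar> = \<bar>u x - u y\<bar> powr (p - 1) * \<bar>dif \<eta> z\<bar>" by (simp add: wform_def z abs_mult abs_phi)
      also have "\<dots> \<le> (\<bar>u x\<bar> + \<bar>u y\<bar>) powr (p - 1) * M"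
        using p_gt dM by (intro mult_mono powr_mono2) auto
      finally show ?thesis using 3 by (simp add: z add_increasing mult.commute)
    qed
  qed
qed

lemma energy_mono: "A \<subseteq> B \<Longrightarrow> energy u A \<le> energy u B"
  unfolding energy_def by (intro nn_integral_mono) (auto split: split_indicator)

lemma wform_integrable:
  assumes u: "loc_energy u D" and \<eta>: "\<eta> \<in> tests D"
  shows "integrable mu (wform u \<eta>)"
proof -
  have [measurable]: "u \<in> borel_measurable borel" "\<eta> \<in> borel_measurable borel"
    using u \<eta> by (auto simp: loc_energy_def tests_def)
  obtain M C where M: "\<And>x. \<bar>\<eta> x\<bar> \<le> M" and C: "compact C" "C \<subseteq> D" "\<And>x. x \<notin> C \<Longrightarrow> \<eta> x = 0"
    using \<eta> by (auto simp: tests_def)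
  obtain U where U: "open U" "C \<subseteq> U" "energy u (U \<times> U) < \<infinity>"
    using u C unfolding loc_energy_def by blast
  have [measurable]: "C \<in> sets borel" "U \<in> sets borel" using C U by (auto simp: borel_compact)
  have M0: "0 \<le> M" using M[of 0] by linarith
  have "(\<integral>\<^sup>+z. ennreal (norm (wform u \<eta> z)) \<partial>mu) \<le>
    (\<integral>\<^sup>+z. (ennreal (\<bar>dif u z\<bar> powr p) * indicator (U \<times> U) z + ennreal (\<bar>dif \<eta> z\<bar> powr p) * indicator UNIV z)
      + ennreal M * (ennreal ((\<bar>u (fst z)\<bar> + \<bar>u (snd z)\<bar> + 0) powr (p - 1)) * indicator (outs C U) z) \<partial>mu)"
  proof (rule nn_integral_mono)
    fix z
    have "ennreal (norm (wform u \<eta> z)) \<le> ennreal ((\<bar>dif u z\<bar> powr p) * indicator (U \<times> U) z + \<bar>dif \<eta> z\<bar> powr p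
      + M * ((\<bar>u (fst z)\<bar> + \<bar>u (snd z)\<bar> + 0) powr (p - 1) * indicator (outs C U) z))"
      using wform_bound[OF M C(3) U(2), where u = u and z = z] by (simp add: ennreal_leI)
    also have "\<dots> = (ennreal (\<bar>dif u z\<bar> powr p) * indicator (U \<times> U) z + ennreal (\<bar>dif \<eta> z\<bar> powr p) * indicator UNIV z)
      + ennreal M * (ennreal ((\<bar>u (fst z)\<bar> + \<bar>u (snd z)\<bar> + 0) powr (p - 1)) * indicator (outs C U) z)"
      using M0 by (auto simp: ennreal_plus[symmetric] ennreal_mult[symmetric] simp del: ennreal_plus split: split_indicator)
    finally show "ennreal (norm (wform u \<eta> z)) \<le> \<dots>" .
  qed
  also have "\<dots> = (energy u (U \<times> U) + energy \<eta> UNIV) + ennreal M * (\<integral>\<^sup>+z. ennreal ((\<bar>u (fst z)\<bar> + \<bar>u (snd z)\<bar> + 0) powr (p - 1)) * indicator (outs C U) z \<partial>mu)"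
    unfolding energy_def by (simp add: nn_integral_add nn_integral_cmult del: add_0_right)
  also have "\<dots> < \<infinity>"
    using U(3) \<eta> outs_finite[OF C(1) U(1,2), where u = u and M = 0] u
    by (auto simp: loc_energy_def tests_def ennreal_mult_less_top)
  finally show ?thesis by (intro integrableI_bounded) auto
qed

lemma tailf_zero: "tailf (\<lambda>x. 0)"
  by (simp add: tailf_def)

lemma outs_emeasure_finite:
  assumes C: "compact C" and U: "open U" "C \<subseteq> U"
  shows "emeasure mu (outs C U) < \<infinity>"
proof -
  have [measurable]: "C \<in> sets borel" "U \<in> sets borel" using C U by (auto simp: borel_compact)
  have "outs C U \<in> sets mu" by simp
  then show ?thesis using outs_finite[OF C U, where u = "\<lambda>x. 0" and M = 1] tailf_zero by simp
qed

text \<open>Reduces finite energy to finite energy near the support: beyond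
  \<open>U \<times> U\<close> only pairs in \<open>outs C U\<close> contribute, there the increment
  is at most M, and \<open>outs C U\<close> has finite mass.\<close>

lemma bounded_support_energy:
  assumes [measurable]: "\<eta> \<in> borel_measurable borel" and M: "\<And>x. \<bar>\<eta> x\<bar> \<le> M"
    and C: "compact C" "\<And>x. x \<notin> C \<Longrightarrow> \<eta> x = 0" and U: "open U" "C \<subseteq> U" "energy \<eta> (U \<times> U) < \<infinity>"
  shows "energy \<eta> UNIV < \<infinity>"
proof -
  have [measurable]: "C \<in> sets borel" "U \<in> sets borel" using C U by (auto simp: borel_compact)
  have "energy \<eta> UNIV \<le> (\<integral>\<^sup>+z. ennreal (\<bar>dif \<eta> z\<bar> powr p) * indicator (U \<times> U) z + ennreal (M powr p) * indicator (outs C U) z \<partial>mu)"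
    unfolding energy_def
  proof (rule nn_integral_mono)
    fix z :: "'a \<times> 'a"
    obtain x y where z: "z = (x, y)" by (cases z)
    consider "x \<in> U" "y \<in> U" | "x \<notin> C" "y \<notin> C" | "(x, y) \<in> outs C U" "\<not> (x \<in> U \<and> y \<in> U)"
      using U(2) unfolding outs_def by blast
    then show "ennreal (\<bar>dif \<eta> z\<bar> powr p) * indicator UNIV z \<le> ennreal (\<bar>dif \<eta> z\<bar> powr p) * indicator (U \<times> U) z + ennreal (M powr p) * indicator (outs C U) z"
    proof cases
      case 3
      then have "\<eta> x = 0 \<or> \<eta> y = 0" using U(2) C(2) by blast
      then have "\<bar>dif \<eta> z\<bar> \<le> M" using M[of x] M[of y] by (auto simp: z)
      then have "\<bar>dif \<eta> z\<bar> powr p \<le> M powr p" using p_gt by (intro powr_mono2) auto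
      then show ?thesis using 3 by (auto simp: z ennreal_leI)
    qed (auto simp: z C(2))
  qed
  also have "\<dots> = energy \<eta> (U \<times> U) + ennreal (M powr p) * emeasure mu (outs C U)"
    unfolding energy_def by (subst nn_integral_add) (auto simp: nn_integral_cmult)
  also have "\<dots> < \<infinity>" using U(3) outs_emeasure_finite[OF C(1) U(1,2)] by (simp add: ennreal_mult_less_top)
  finally show ?thesis .
qed

definition wsuper :: "('a \<Rightarrow> real) \<Rightarrow> 'a set \<Rightarrow> bool"
  where "wsuper u D \<longleftrightarrow> (\<forall>\<eta>\<in>tests D. (\<forall>x. 0 \<le> \<eta> x) \<longrightarrow> 0 \<le> (\<integral>z. wform u \<eta> z \<partial>mu))"

lemma wform_uminus: "wform (\<lambda>x. - u x) \<eta> z = - wform u \<eta> z"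
proof -
  have "dif (\<lambda>x. - u x) z = - dif u z" by (simp add: dif_def)
  then show ?thesis by (simp add: wform_def)
qed

lemma wform_uminus_right: "wform u (\<lambda>x. - \<eta> x) z = - wform u \<eta> z"
  by (simp add: wform_def dif_def algebra_simps)

lemma wsuper_uminusD:
  "wsuper (\<lambda>x. - u x) D \<Longrightarrow> \<eta> \<in> tests D \<Longrightarrow> (\<And>x. 0 \<le> \<eta> x) \<Longrightarrow> (\<integral>z. wform u \<eta> z \<partial>mu) \<le> 0"
  unfolding wsuper_def by (auto simp: wform_uminus[abs_def])

lemma energy_add_le:
  assumes [measurable]: "u \<in> borel_measurable borel" "v \<in> borel_measurable borel" "A \<in> sets borel"
  assumes w: "\<And>z. z \<in> A \<Longrightarrow> \<bar>dif w z\<bar> \<le> \<bar>dif u z\<bar> + \<bar>dif v z\<bar>"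
  shows "energy w A \<le> ennreal (2 powr p) * (energy u A + energy v A)"
proof -
  have "energy w A \<le> (\<integral>\<^sup>+z. ennreal (2 powr p) * (ennreal (\<bar>dif u z\<bar> powr p) * indicator A z + ennreal (\<bar>dif v z\<bar> powr p) * indicator A z) \<partial>mu)"
    unfolding energy_def
  proof (rule nn_integral_mono)
    fix z
    show "ennreal (\<bar>dif w z\<bar> powr p) * indicator A z \<le> ennreal (2 powr p) * (ennreal (\<bar>dif u z\<bar> powr p) * indicator A z + ennreal (\<bar>dif v z\<bar> powr p) * indicator A z)"
    proof (cases "z \<in> A")
      case True
      have "\<bar>dif w z\<bar> powr p \<le> (\<bar>dif u z\<bar> + \<bar>dif v z\<bar>) powr p" using w[OF True] p_gt by (intro powr_mono2) auto
      also have "\<dots> \<le> 2 powr p * (\<bar>dif u z\<bar> powr p + \<bar>dif v z\<bar> powr p)" using p_gt by (intro powr_add2_le) auto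
      finally show ?thesis using True by (simp add: ennreal_plus[symmetric] ennreal_mult[symmetric] ennreal_leI del: ennreal_plus)
    qed auto
  qed
  also have "\<dots> = ennreal (2 powr p) * (energy u A + energy v A)"
    unfolding energy_def by (simp add: nn_integral_add nn_integral_cmult)
  finally show ?thesis .
qed

lemma energy_finite_add:
  assumes "u \<in> borel_measurable borel" "v \<in> borel_measurable borel" "A \<in> sets borel"
  assumes "\<And>z. z \<in> A \<Longrightarrow> \<bar>dif w z\<bar> \<le> \<bar>dif u z\<bar> + \<bar>dif v z\<bar>"
    and "energy u A < \<infinity>" "energy v A < \<infinity>"
  shows "energy w A < \<infinity>"
  using energy_add_le[OF assms(1-4)] assms(5,6) by (auto simp: ennreal_mult_less_top intro: le_less_trans)

end

section \<open>Mollification\<close>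

text \<open>\<open>flat 0\<close> is the classical function exp(-1/t) continued by 0. The powers of
  1/t are included so that derivatives are linear combinations of members of the family.\<close>

definition flat :: "nat \<Rightarrow> real \<Rightarrow> real"
  where "flat m t = (if 0 < t then (1 / t) ^ m * exp (- (1 / t)) else 0)"

lemma flat_div_tendsto: "((\<lambda>h. flat m h / h) \<longlongrightarrow> 0) (at 0)"
proof -
  have "((\<lambda>x::real. x ^ Suc m / exp x) \<longlongrightarrow> 0) at_top" by (rule tendsto_power_div_exp_0)
  moreover have "filterlim (\<lambda>h::real. 1 / h) at_top (at_right 0)"
    using filterlim_inverse_at_top_right by (simp add: inverse_eq_divide)
  ultimately have "((\<lambda>h::real. (1 / h) ^ Suc m / exp (1 / h)) \<longlongrightarrow> 0) (at_right 0)"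
    by (rule filterlim_compose)
  moreover have "eventually (\<lambda>h. (1 / h) ^ Suc m / exp (1 / h) = flat m h / h) (at_right (0::real))"
    unfolding eventually_at_filter by (auto simp: flat_def exp_minus field_simps)
  ultimately have 1: "((\<lambda>h. flat m h / h) \<longlongrightarrow> 0) (at_right 0)"
    by (rule Lim_transform_eventually)
  have "eventually (\<lambda>h. 0 = flat m h / h) (at_left (0::real))"
    unfolding eventually_at_filter by (auto simp: flat_def)
  then have 2: "((\<lambda>h. flat m h / h) \<longlongrightarrow> 0) (at_left 0)"
    by (rule Lim_transform_eventually[OF tendsto_const])
  show ?thesis using 1 2 by (simp add: filterlim_split_at)
qed

lemma DERIV_flat:
  "(flat m has_real_derivative - real m * flat (Suc m) t + flat (Suc (Suc m)) t) (at t)"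
proof -
  consider "0 < t" | "t < 0" | "t = 0" by linarith
  then show ?thesis
  proof cases
    case 1
    have e: "eventually (\<lambda>x. flat m x = (1 / x) ^ m * exp (- (1 / x))) (nhds t)"
      using eventually_nhds_in_open[of "{0<..}" t] 1 by (auto elim!: eventually_mono simp: flat_def)
    have "((\<lambda>x. (1 / x) ^ m * exp (- (1 / x))) has_real_derivative
        (1 / t) ^ m * (exp (- (1 / t)) * (1 / t ^ 2)) + real m * (1 / t) ^ (m - 1) * (- (1 / t ^ 2)) * exp (- (1 / t))) (at t)"
      using 1 by (auto intro!: derivative_eq_intros simp: power2_eq_square)
    moreover have "(1 / t) ^ m * (exp (- (1 / t)) * (1 / t ^ 2)) + real m * (1 / t) ^ (m - 1) * (- (1 / t ^ 2)) * exp (- (1 / t))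
      = - real m * flat (Suc m) t + flat (Suc (Suc m)) t"
      using 1 by (cases m) (auto simp: flat_def power2_eq_square field_simps)
    ultimately show ?thesis by (subst DERIV_cong_ev[OF refl e refl]) simp
  next
    case 2
    have e: "eventually (\<lambda>x. flat m x = 0) (nhds t)"
      using eventually_nhds_in_open[of "{..<0}" t] 2 by (auto elim!: eventually_mono simp: flat_def)
    show ?thesis using 2 by (subst DERIV_cong_ev[OF refl e refl]) (simp add: flat_def)
  next
    case 3
    then show ?thesis using flat_div_tendsto[of m] by (simp add: has_field_derivative_iff flat_def)
  qed
qed

text \<open>The algebra generated by the flat functions of \<open>1 - a * (x \<bullet> x)\<close>,
  constants and linear forms. It is closed under directional derivatives, so smoothness of every
  order follows by induction without formulas for higher derivatives.\<close>

inductive bumpy :: "real \<Rightarrow> ('a::euclidean_space \<Rightarrow> real) \<Rightarrow> bool" for a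
  where
    base: "bumpy a (\<lambda>x. flat m (1 - a * (x \<bullet> x)))"
  | const: "bumpy a (\<lambda>x. c)"
  | lin: "bumpy a (\<lambda>x. x \<bullet> v)"
  | add: "bumpy a f \<Longrightarrow> bumpy a g \<Longrightarrow> bumpy a (\<lambda>x. f x + g x)"
  | mult: "bumpy a f \<Longrightarrow> bumpy a g \<Longrightarrow> bumpy a (\<lambda>x. f x * g x)"

lemma bumpy_derivative:
  assumes "bumpy a f"
  shows "\<exists>f'. (\<forall>x. (f has_derivative f' x) (at x)) \<and> (\<forall>v. bumpy a (\<lambda>x. f' x v))"
  using assms
proof induction
  case (base m)
  let ?d = "\<lambda>x::'a. - real m * flat (Suc m) (1 - a * (x \<bullet> x)) + flat (Suc (Suc m)) (1 - a * (x \<bullet> x))"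
  let ?f' = "\<lambda>x v. ?d x * (- (2 * a) * (x \<bullet> v))"
  have "((\<lambda>x. flat m (1 - a * (x \<bullet> x))) has_derivative ?f' x) (at x)" for x :: 'a
  proof -
    have i: "((\<lambda>x. 1 - a * (x \<bullet> x)) has_derivative (\<lambda>v. - (2 * a) * (x \<bullet> v))) (at x)"
      by (auto intro!: derivative_eq_intros simp: inner_commute)
    have o: "(flat m has_derivative (\<lambda>y. ?d x * y)) (at (1 - a * (x \<bullet> x)))"
      using DERIV_flat[of m "1 - a * (x \<bullet> x)"] by (simp add: has_field_derivative_def)
    show ?thesis using has_derivative_compose[OF i o] by simp
  qed
  moreover have "bumpy a (\<lambda>x::'a. ?f' x v)" for v
    by (intro bumpy.mult bumpy.add bumpy.base bumpy.const bumpy.lin)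
  ultimately show ?case by (intro exI[of _ ?f'] conjI allI)
next
  case (const c)
  have "\<forall>x::'a. ((\<lambda>x. c) has_derivative (\<lambda>v. 0)) (at x)" by (auto intro!: derivative_eq_intros)
  then show ?case using bumpy.const[of a 0] by (intro exI[of _ "\<lambda>x v. 0"]) blast
next
  case (lin v)
  have "\<forall>x::'a. ((\<lambda>x. x \<bullet> v) has_derivative (\<lambda>w. w \<bullet> v)) (at x)" by (auto intro!: derivative_eq_intros)
  then show ?case using bumpy.const by (intro exI[of _ "\<lambda>x w. w \<bullet> v"]) blast
next
  case (add f g)
  then obtain f' g' where "\<forall>x. (f has_derivative f' x) (at x)" "\<forall>v. bumpy a (\<lambda>x. f' x v)"
    "\<forall>x. (g has_derivative g' x) (at x)" "\<forall>v. bumpy a (\<lambda>x. g' x v)" by blast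
  then show ?case by (intro exI[of _ "\<lambda>x v. f' x v + g' x v"]) (auto intro: has_derivative_add bumpy.add)
next
  case (mult f g)
  then obtain f' g' where *: "\<forall>x. (f has_derivative f' x) (at x)" "\<forall>v. bumpy a (\<lambda>x. f' x v)"
    "\<forall>x. (g has_derivative g' x) (at x)" "\<forall>v. bumpy a (\<lambda>x. g' x v)" by blast
  show ?case using *
    by (intro exI[of _ "\<lambda>x v. f x * g' x v + f' x v * g x"])
       (auto intro!: has_derivative_mult bumpy.add bumpy.mult mult.hyps)
qed

lemma bumpy_continuous: "bumpy a f \<Longrightarrow> continuous_on UNIV f"
  using bumpy_derivative[of a f] has_derivative_continuous
  by (metis continuous_at_imp_continuous_on)

definition bump :: "real \<Rightarrow> ('a::euclidean_space \<Rightarrow> real) \<Rightarrow> bool"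
  where "bump a r \<longleftrightarrow> bumpy a r \<and> (\<forall>x. 1 < a * (x \<bullet> x) \<longrightarrow> r x = 0)"

lemma bump_derivative:
  assumes "bump a r"
  shows "\<exists>r'. (\<forall>x. (r has_derivative r' x) (at x)) \<and> (\<forall>v. bump a (\<lambda>x. r' x v))"
proof -
  obtain r' where r': "\<And>x. (r has_derivative r' x) (at x)" "\<And>v. bumpy a (\<lambda>x. r' x v)"
    using bumpy_derivative[of a r] assms by (auto simp: bump_def)
  \<comment> \<open>The support condition passes to the derivative because the set where r is known
    to vanish is open.\<close>
  have "r' x v = 0" if "1 < a * (x \<bullet> x)" for x v
  proof -
    have "open {x::'a. 1 < a * (x \<bullet> x)}" by (intro open_Collect_less continuous_intros)
    then have "((\<lambda>x. 0) has_derivative r' x) (at x)"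
      by (rule has_derivative_transform_within_open[OF r'(1)]) (use that assms in \<open>auto simp: bump_def\<close>)
    then have "r' x = (\<lambda>v. 0)" by (rule has_derivative_unique) (auto intro!: derivative_eq_intros)
    then show ?thesis by simp
  qed
  then show ?thesis using r' by (intro exI[of _ r']) (auto simp: bump_def)
qed

lemma bump_bounded:
  assumes "bump a r" "0 < a"
  obtains B where "0 \<le> B" "\<And>x. \<bar>r x\<bar> \<le> B"
proof -
  let ?C = "cball 0 (1 / sqrt a) :: 'a set"
  have cont: "continuous_on ?C r"
    using bumpy_continuous[of a r] assms(1) continuous_on_subset by (auto simp: bump_def)
  have "bounded (r ` ?C)" using compact_continuous_image[OF cont] compact_cball compact_imp_bounded by blast
  then obtain B where B: "\<And>x. x \<in> ?C \<Longrightarrow> \<bar>r x\<bar> \<le> B"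
    unfolding bounded_iff by (metis imageI real_norm_def)
  have "\<bar>r x\<bar> \<le> max B 0" for x
  proof (cases "x \<in> ?C")
    case False
    then have "1 / sqrt a < norm x" by simp
    then have "(1 / sqrt a)\<^sup>2 < (norm x)\<^sup>2" using assms(2) by (intro power_strict_mono) auto
    then have "1 < a * (x \<bullet> x)" using assms(2) by (simp add: power2_norm_eq_inner power_divide field_simps)
    then show ?thesis using assms(1) by (simp add: bump_def)
  next
    case True
    then show ?thesis using B[OF True] by linarith
  qed
  then show ?thesis using that[of "max B 0"] by auto
qed

lemma bump_measurable: "bump a r \<Longrightarrow> r \<in> borel_measurable borel"
  by (intro borel_measurable_continuous_onI bumpy_continuous[of a]) (auto simp: bump_def)

lemma convolution_integrable:
  fixes \<xi> :: "'a::euclidean_space \<Rightarrow> real"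
  assumes \<xi>: "integrable lborel \<xi>" and r [measurable]: "r \<in> borel_measurable borel" and B: "\<And>x. \<bar>r x\<bar> \<le> B"
  shows "integrable lborel (\<lambda>y. \<xi> y * r (x - y))"
proof -
  have [measurable]: "\<xi> \<in> borel_measurable borel" using borel_measurable_integrable[OF \<xi>] by simp
  have B0: "0 \<le> B" using B[of 0] by linarith
  show ?thesis
  proof (rule Bochner_Integration.integrable_bound[where f = "\<lambda>y. B * \<xi> y"])
    show "AE y in lborel. norm (\<xi> y * r (x - y)) \<le> norm (B * \<xi> y)"
      using B B0 by (auto simp: abs_mult mult.commute[of B] intro!: mult_left_mono AE_I2)
  qed (use \<xi> in auto)
qed

text \<open>Differentiation under the integral: the error quotient \<open>q\<close> tends to 0
  pointwise and is bounded by \<open>2 * B\<close>, by the Lipschitz bound for r and the bound for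
  its derivative. Dominated convergence along sequences with the weight |\<xi>| finishes.\<close>

lemma convolution_has_derivative:
  fixes \<xi> :: "'a::euclidean_space \<Rightarrow> real"
  assumes \<xi>: "integrable lborel \<xi>" and r: "bump a r" and a: "0 < a"
    and r': "\<And>x. (r has_derivative r' x) (at x)" "\<And>v. bump a (\<lambda>x. r' x v)"
  shows "((\<lambda>x. \<integral>y. \<xi> y * r (x - y) \<partial>lborel) has_derivative (\<lambda>v. \<integral>y. \<xi> y * r' (x - y) v \<partial>lborel)) (at x)"
proof -
  have [measurable]: "\<xi> \<in> borel_measurable borel" using borel_measurable_integrable[OF \<xi>] by simp
  have [measurable]: "r \<in> borel_measurable borel" using bump_measurable[OF r] .
  have [measurable]: "(\<lambda>x. r' x v) \<in> borel_measurable borel" for v using bump_measurable[OF r'(2)] .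
  have lin: "bounded_linear (r' x)" for x using r'(1) has_derivative_bounded_linear by blast
  obtain b where b: "\<And>i x. 0 \<le> b i \<and> \<bar>r' x i\<bar> \<le> b i"
  proof -
    have "\<exists>c. \<forall>x. 0 \<le> c \<and> \<bar>r' x i\<bar> \<le> c" for i using bump_bounded[OF r'(2) a, of i] by metis
    then show ?thesis using that by metis
  qed
  \<comment> \<open>Each partial derivative is a bump, hence bounded; summing over the basis bounds
    the full derivative.\<close>
  define B where "B = (\<Sum>i\<in>(Basis::'a set). b i)"
  have B0: "0 \<le> B" unfolding B_def using b by (intro sum_nonneg) auto
  have rB: "\<bar>r' x v\<bar> \<le> B * norm v" for x v
  proof -
    have "r' x v = r' x (\<Sum>i\<in>Basis. (v \<bullet> i) *\<^sub>R i)" by (simp add: euclidean_representation)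
    also have "\<dots> = (\<Sum>i\<in>Basis. (v \<bullet> i) * r' x i)"
      using lin[of x] by (simp add: linear_sum linear_scale bounded_linear.linear)
    also have "\<bar>\<dots>\<bar> \<le> (\<Sum>i\<in>Basis. norm v * b i)"
      using b by (intro order_trans[OF sum_abs] sum_mono) (auto simp: abs_mult intro!: mult_mono Basis_le_norm)
    finally show ?thesis by (simp add: B_def sum_distrib_left mult.commute)
  qed
  have lip: "\<bar>r x - r y\<bar> \<le> B * norm (x - y)" for x y
    using differentiable_bound[of UNIV r r' B x y] r'(1) onorm_le[of "r' _" B] rB by (simp add: has_derivative_at_withinI)
  have int_r: "integrable lborel (\<lambda>y. \<xi> y * r (x - y))" for x
  proof -
    obtain c where "\<And>x. \<bar>r x\<bar> \<le> c" using bump_bounded[OF r a] by blast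
    then show ?thesis by (intro convolution_integrable[OF \<xi>]) auto
  qed
  have int_r': "integrable lborel (\<lambda>y. \<xi> y * r' (x - y) v)" for x v
    using rB by (intro convolution_integrable[OF \<xi>, of "\<lambda>x. r' x v"]) auto
  let ?L = "\<lambda>v. \<integral>y. \<xi> y * r' (x - y) v \<partial>lborel"
  have blin: "bounded_linear ?L"
  proof (rule bounded_linear_intro[where K = "B * (\<integral>y. \<bar>\<xi> y\<bar> \<partial>lborel)"])
    fix v w c
    show "?L (v + w) = ?L v + ?L w"
      using int_r' by (simp add: linear_add[OF bounded_linear.linear[OF lin]] distrib_left)
    show "?L (c *\<^sub>R v) = c *\<^sub>R ?L v"
      by (simp add: linear_scale[OF bounded_linear.linear[OF lin]] mult.left_commute)
    have "norm (?L v) \<le> (\<integral>y. \<bar>\<xi> y\<bar> * (B * norm v) \<partial>lborel)"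
    proof (rule Bochner_Integration.integral_norm_bound_integral[OF int_r'])
      show "integrable lborel (\<lambda>y. \<bar>\<xi> y\<bar> * (B * norm v))" using \<xi> by auto
      show "norm (\<xi> y * r' (x - y) v) \<le> \<bar>\<xi> y\<bar> * (B * norm v)" for y
        using rB by (simp add: abs_mult mult_left_mono)
    qed
    then show "norm (?L v) \<le> norm v * (B * (\<integral>y. \<bar>\<xi> y\<bar> \<partial>lborel))" by (simp add: mult_ac)
  qed
  define q where "q h z = \<bar>r (z + h) - r z - r' z h\<bar> / norm h" for h z
  have qB: "\<bar>q h z\<bar> \<le> 2 * B" for h z
  proof (cases "h = 0")
    case False
    have "\<bar>r (z + h) - r z - r' z h\<bar> \<le> 2 * B * norm h"
      using lip[of "z + h" z] rB[of z h] by simp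
    then show ?thesis using False by (simp add: q_def field_simps)
  qed (use B0 in \<open>simp add: q_def\<close>)
  have q0: "(\<lambda>i. q (X i) z) \<longlonglongrightarrow> 0" if "\<And>i. X i \<noteq> 0" "X \<longlonglongrightarrow> 0" for X z
  proof -
    have "((\<lambda>h. norm (r (z + h) - r z - r' z h) / norm h) \<longlongrightarrow> 0) (at 0)"
      using r'(1)[of z] by (simp add: has_derivative_at)
    then show ?thesis using that unfolding tendsto_at_iff_sequentially by (auto simp: q_def o_def)
  qed
  have [measurable]: "(\<lambda>z. q h z) \<in> borel_measurable borel" for h unfolding q_def by measurable
  have "((\<lambda>h. norm ((\<integral>y. \<xi> y * r (x + h - y) \<partial>lborel) - (\<integral>y. \<xi> y * r (x - y) \<partial>lborel) - ?L h) / norm h) \<longlongrightarrow> 0) (at 0)"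
    unfolding tendsto_at_iff_sequentially
  proof (intro allI impI, unfold o_def)
    fix X :: "nat \<Rightarrow> 'a" assume X: "\<forall>i. X i \<in> UNIV - {0}" "X \<longlonglongrightarrow> 0"
    have lim: "(\<lambda>i. \<integral>y. \<bar>\<xi> y\<bar> * q (X i) (x - y) \<partial>lborel) \<longlonglongrightarrow> (\<integral>y. 0 \<partial>(lborel::'a measure))"
    proof (rule integral_dominated_convergence[where w = "\<lambda>y. \<bar>\<xi> y\<bar> * (2 * B)"])
      show "integrable lborel (\<lambda>y. \<bar>\<xi> y\<bar> * (2 * B))" using \<xi> by auto
      show "AE y in lborel. (\<lambda>i. \<bar>\<xi> y\<bar> * q (X i) (x - y)) \<longlonglongrightarrow> 0"
        using q0[of X] X by (intro AE_I2 tendsto_mult_right_zero) auto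
      show "AE y in lborel. norm (\<bar>\<xi> y\<bar> * q (X i) (x - y)) \<le> \<bar>\<xi> y\<bar> * (2 * B)" for i
        using qB by (auto simp: abs_mult intro!: mult_left_mono AE_I2)
    qed auto
    have bound: "norm ((\<integral>y. \<xi> y * r (x + X i - y) \<partial>lborel) - (\<integral>y. \<xi> y * r (x - y) \<partial>lborel) - ?L (X i)) / norm (X i)
      \<le> (\<integral>y. \<bar>\<xi> y\<bar> * q (X i) (x - y) \<partial>lborel)" for i
    proof -
      have Xi: "0 < norm (X i)" using X by auto
      have "(\<integral>y. \<xi> y * r (x + X i - y) \<partial>lborel) - (\<integral>y. \<xi> y * r (x - y) \<partial>lborel) - ?L (X i)
        = (\<integral>y. \<xi> y * r (x + X i - y) - \<xi> y * r (x - y) - \<xi> y * r' (x - y) (X i) \<partial>lborel)"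
        using int_r int_r' by simp
      also have "norm \<dots> \<le> (\<integral>y. (\<bar>\<xi> y\<bar> * q (X i) (x - y)) * norm (X i) \<partial>lborel)"
      proof (rule Bochner_Integration.integral_norm_bound_integral)
        show "integrable lborel (\<lambda>y. \<xi> y * r (x + X i - y) - \<xi> y * r (x - y) - \<xi> y * r' (x - y) (X i))"
          using int_r int_r' by simp
        have "integrable lborel (\<lambda>y. \<bar>\<xi> y\<bar> * q (X i) (x - y))"
          using qB \<xi> by (intro convolution_integrable[of "\<lambda>y. \<bar>\<xi> y\<bar>" "q (X i)"]) auto
        then show "integrable lborel (\<lambda>y. (\<bar>\<xi> y\<bar> * q (X i) (x - y)) * norm (X i))" by simp
        fix y
        have "\<xi> y * r (x + X i - y) - \<xi> y * r (x - y) - \<xi> y * r' (x - y) (X i)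
           = \<xi> y * (r (x - y + X i) - r (x - y) - r' (x - y) (X i))"
          by (simp add: algebra_simps)
        then show "norm (\<xi> y * r (x + X i - y) - \<xi> y * r (x - y) - \<xi> y * r' (x - y) (X i)) \<le> (\<bar>\<xi> y\<bar> * q (X i) (x - y)) * norm (X i)"
          using Xi by (simp add: q_def abs_mult)
      qed
      also have "\<dots> = (\<integral>y. \<bar>\<xi> y\<bar> * q (X i) (x - y) \<partial>lborel) * norm (X i)" by simp
      finally show ?thesis using Xi by (simp add: pos_divide_le_eq)
    qed
    show "(\<lambda>i. norm ((\<integral>y. \<xi> y * r (x + X i - y) \<partial>lborel) - (\<integral>y. \<xi> y * r (x - y) \<partial>lborel) - ?L (X i)) / norm (X i)) \<longlonglongrightarrow> 0"
    proof (rule tendsto_sandwich[of "\<lambda>i. 0"])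
      show "(\<lambda>i. \<integral>y. \<bar>\<xi> y\<bar> * q (X i) (x - y) \<partial>lborel) \<longlonglongrightarrow> 0" using lim by simp
    qed (use bound in \<open>auto intro!: always_eventually\<close>)
  qed
  then show ?thesis using blin by (simp add: has_derivative_at)
qed

text \<open>Induction over the order for all bumps r at once: a directional derivative of the
  convolution is the convolution with a directional derivative of r, again a bump.\<close>

lemma convolution_Ck:
  fixes \<xi> :: "real ^ 'n \<Rightarrow> real"
  assumes \<xi>: "integrable lborel \<xi>" and a: "0 < a"
  shows "bump a r \<Longrightarrow> Ck k (\<lambda>x. \<integral>y. \<xi> y * r (x - y) \<partial>lborel)"
proof (induction k arbitrary: r)
  case 0
  obtain r' where "\<And>x. (r has_derivative r' x) (at x)" "\<And>v. bump a (\<lambda>x. r' x v)"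
    using bump_derivative[OF 0] by blast
  then have "isCont (\<lambda>x. \<integral>y. \<xi> y * r (x - y) \<partial>lborel) x" for x
    using convolution_has_derivative[OF \<xi> 0 a] has_derivative_continuous by blast
  then show ?case by (simp add: continuous_at_imp_continuous_on)
next
  case (Suc k)
  obtain r' where r': "\<And>x. (r has_derivative r' x) (at x)" "\<And>v. bump a (\<lambda>x. r' x v)"
    using bump_derivative[OF Suc.prems] by blast
  let ?G = "\<lambda>x. \<integral>y. \<xi> y * r (x - y) \<partial>lborel"
  have d: "(?G has_derivative (\<lambda>v. \<integral>y. \<xi> y * r' (x - y) v \<partial>lborel)) (at x)" for x
    by (rule convolution_has_derivative[OF \<xi> Suc.prems a r'])
  have "frechet_derivative ?G (at x) = (\<lambda>v. \<integral>y. \<xi> y * r' (x - y) v \<partial>lborel)" for x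
    using frechet_derivative_at[OF d] by simp
  then show ?case using d Suc.IH[OF r'(2)] by (auto simp: differentiable_def)
qed

section \<open>Mollification and the Gagliardo energy\<close>

lemma nn_integral_reflect:
  fixes f :: "'a::euclidean_space \<Rightarrow> ennreal"
  assumes [measurable]: "f \<in> borel_measurable borel"
  shows "(\<integral>\<^sup>+y. f (x - y) \<partial>lborel) = (\<integral>\<^sup>+y. f y \<partial>lborel)"
proof -
  have "(\<integral>\<^sup>+y. f y \<partial>lborel) = (\<integral>\<^sup>+y. f y \<partial>(density (distr lborel borel (\<lambda>y. x + (- 1) *\<^sub>R y)) (\<lambda>_. 1)))"
    using lborel_affine[of "- 1" x] by simp
  also have "\<dots> = (\<integral>\<^sup>+y. f (x - y) \<partial>lborel)"
    by (simp add: nn_integral_density nn_integral_distr)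
  finally show ?thesis ..
qed

lemma nn_integral_shift:
  fixes f :: "'a::euclidean_space \<Rightarrow> ennreal"
  assumes [measurable]: "f \<in> borel_measurable borel"
  shows "(\<integral>\<^sup>+y. f (y - x) \<partial>lborel) = (\<integral>\<^sup>+y. f y \<partial>lborel)"
  using nn_integral_reflect[of "\<lambda>t. f (- t)" x] nn_integral_reflect[of f 0] by simp

lemma lborel_integral_reflect:
  fixes f :: "'a::euclidean_space \<Rightarrow> real"
  assumes f: "integrable lborel f"
  shows "integrable lborel (\<lambda>y. f (x - y))" "(\<integral>y. f (x - y) \<partial>lborel) = (\<integral>y. f y \<partial>lborel)"
proof -
  have [measurable]: "f \<in> borel_measurable borel" using borel_measurable_integrable[OF f] by simp
  show i: "integrable lborel (\<lambda>y. f (x - y))"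
    using f nn_integral_reflect[of "\<lambda>y. ennreal (norm (f y))" x] by (auto simp: integrable_iff_bounded)
  have 1: "(\<integral>\<^sup>+y. ennreal (f (x - y)) \<partial>lborel) = (\<integral>\<^sup>+y. ennreal (f y) \<partial>lborel)"
    by (rule nn_integral_reflect) measurable
  have 2: "(\<integral>\<^sup>+y. ennreal (- f (x - y)) \<partial>lborel) = (\<integral>\<^sup>+y. ennreal (- f y) \<partial>lborel)"
    by (rule nn_integral_reflect[of "\<lambda>y. ennreal (- f y)"]) measurable
  show "(\<integral>y. f (x - y) \<partial>lborel) = (\<integral>y. f y \<partial>lborel)"
    using i f 1 2 by (simp add: real_lebesgue_integral_def)
qed

text \<open>The point is that B does not depend on \<delta>. Before normalisation the function is
  exp(-1/(1 - |x|^2/\<delta>^2)); on the ball of radius \<delta>/2 the exponent is at least -4/3, so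
  its integral is at least exp(-4/3) times the volume of that ball. Dividing by it yields B.\<close>

lemma mollifier_exists:
  obtains B where "0 < B" "\<And>\<delta>. 0 < \<delta> \<Longrightarrow> \<exists>r :: 'a::euclidean_space \<Rightarrow> real.
    bump (1 / \<delta>\<^sup>2) r \<and> (\<forall>x. 0 \<le> r x) \<and> integrable lborel r \<and> (\<integral>x. r x \<partial>lborel) = 1 \<and>
    (\<forall>x. r x \<le> B * \<delta> powr (- real DIM('a))) \<and> (\<forall>x. \<delta> < norm x \<longrightarrow> r x = 0)"
proof (rule that[of "exp (4 / 3) / unit_ball_vol (real DIM('a)) * 2 ^ DIM('a)"])
  let ?N = "DIM('a)"
  have ubv: "0 < unit_ball_vol (real ?N)" by simp
  then show "0 < exp (4 / 3) / unit_ball_vol (real ?N) * 2 ^ ?N" by simp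
  fix \<delta> :: real assume \<delta>: "0 < \<delta>"
  define w where "w x = flat 0 (1 - 1 / \<delta>\<^sup>2 * (x \<bullet> x))" for x :: 'a
  have zero: "w x = 0" if "\<delta> < norm x" for x
  proof -
    have "\<delta>\<^sup>2 < x \<bullet> x" using that \<delta> power_strict_mono[of \<delta> "norm x" 2] by (simp add: power2_norm_eq_inner)
    then show ?thesis using \<delta> by (simp add: w_def flat_def)
  qed
  have "bumpy (1 / \<delta>\<^sup>2) w" unfolding w_def[abs_def] by (rule bumpy.base)
  then have bw: "bump (1 / \<delta>\<^sup>2) w" by (simp add: bump_def w_def flat_def)
  have [measurable]: "w \<in> borel_measurable borel" by (rule bump_measurable[OF bw])
  have w01: "0 \<le> w x" "w x \<le> 1" for x by (auto simp: w_def flat_def)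
  have wlow: "exp (- (4 / 3)) * indicator (cball 0 (\<delta> / 2)) x \<le> w x" for x
  proof (cases "x \<in> cball 0 (\<delta> / 2)")
    case True
    have "(norm x)\<^sup>2 \<le> (\<delta> / 2)\<^sup>2" using True by (intro power_mono) auto
    then have "1 / \<delta>\<^sup>2 * (x \<bullet> x) \<le> 1 / 4" using \<delta> by (simp add: power2_norm_eq_inner power_divide field_simps)
    moreover define T where "T = 1 - 1 / \<delta>\<^sup>2 * (x \<bullet> x)"
    ultimately have t: "3 / 4 \<le> T" by linarith
    then have "1 / T \<le> 1 / (3 / 4)" by (intro divide_left_mono) auto
    then have "exp (- (4 / 3)) \<le> exp (- (1 / T))" by simp
    then show ?thesis using True t unfolding w_def T_def[symmetric] by (simp add: flat_def)
  qed (use w01 in auto)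
  have iw: "integrable lborel w"
  proof (rule Bochner_Integration.integrable_bound[where f = "indicator (cball 0 \<delta>) :: 'a \<Rightarrow> real"])
    show "integrable lborel (indicator (cball 0 \<delta>) :: 'a \<Rightarrow> real)"
      using emeasure_bounded_finite[OF bounded_cball, of "0::'a" \<delta>] by (simp add: integrable_indicator_iff)
    show "AE x in lborel. norm (w x) \<le> norm (indicator (cball 0 \<delta>) x :: real)"
      using w01 zero by (intro AE_I2) (auto simp: indicator_def)
  qed simp
  define c where "c = (\<integral>x. w x \<partial>lborel)"
  have "exp (- (4 / 3)) * measure lborel (cball (0::'a) (\<delta> / 2)) = (\<integral>x. exp (- (4 / 3)) * indicator (cball 0 (\<delta> / 2)) x \<partial>(lborel::'a measure))"
    by simp
  also have "\<dots> \<le> c" unfolding c_def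
  proof (rule integral_mono)
    show "integrable lborel (\<lambda>x::'a. exp (- (4 / 3)) * indicator (cball 0 (\<delta> / 2)) x :: real)"
      using emeasure_bounded_finite[OF bounded_cball, of "0::'a" "\<delta> / 2"] by (simp add: integrable_indicator_iff)
  qed (use iw wlow in auto)
  also have "measure lborel (cball (0::'a) (\<delta> / 2)) = unit_ball_vol (real ?N) * (\<delta> / 2) ^ ?N"
    using \<delta> by (simp add: content_cball)
  finally have cl: "exp (- (4 / 3)) * (unit_ball_vol (real ?N) * (\<delta> / 2) ^ ?N) \<le> c" .
  have pos: "0 < exp (- (4 / 3)) * (unit_ball_vol (real ?N) * (\<delta> / 2) ^ ?N)" using \<delta> ubv by simp
  then have c: "0 < c" using cl by linarith
  have "w x * (1 / c) \<le> exp (4 / 3) / unit_ball_vol (real ?N) * 2 ^ ?N * \<delta> powr (- real ?N)" for x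
  proof -
    have "w x * (1 / c) \<le> 1 * (1 / (exp (- (4 / 3)) * (unit_ball_vol (real ?N) * (\<delta> / 2) ^ ?N)))"
      using w01 cl pos c by (intro mult_mono divide_left_mono) auto
    also have "\<dots> = exp (4 / 3) / unit_ball_vol (real ?N) * 2 ^ ?N * \<delta> powr (- real ?N)"
      using \<delta> by (simp add: powr_minus powr_realpow exp_minus power_divide field_simps)
    finally show ?thesis .
  qed
  moreover have "bump (1 / \<delta>\<^sup>2) (\<lambda>x. w x * (1 / c))"
    unfolding bump_def
  proof
    show "bumpy (1 / \<delta>\<^sup>2) (\<lambda>x. w x * (1 / c))" using bw by (intro bumpy.mult bumpy.const) (simp add: bump_def)
  qed (use bw in \<open>auto simp: bump_def\<close>)
  moreover have "(\<integral>x. w x * (1 / c) \<partial>lborel) = 1" using c by (simp add: c_def[symmetric])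
  ultimately show "\<exists>r :: 'a \<Rightarrow> real. bump (1 / \<delta>\<^sup>2) r \<and> (\<forall>x. 0 \<le> r x) \<and> integrable lborel r \<and> (\<integral>x. r x \<partial>lborel) = 1 \<and>
    (\<forall>x. r x \<le> exp (4 / 3) / unit_ball_vol (real ?N) * 2 ^ ?N * \<delta> powr (- real ?N)) \<and> (\<forall>x. \<delta> < norm x \<longrightarrow> r x = 0)"
    using w01 c iw zero by (intro exI[of _ "\<lambda>x. w x * (1 / c)"]) auto
qed

text \<open>The tangent inequality at the mean m, integrated against the probability density r: the
  linear term drops out.\<close>

lemma Jensen_weighted:
  fixes X r :: "'a::euclidean_space \<Rightarrow> real"
  assumes p: "1 < p" and r: "integrable lborel r" "\<And>x. 0 \<le> r x" "(\<integral>x. r x \<partial>lborel) = 1"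
    and X [measurable]: "X \<in> borel_measurable borel" and M: "\<And>x. \<bar>X x\<bar> \<le> M"
  shows "ennreal (\<bar>\<integral>z. X z * r z \<partial>lborel\<bar> powr p) \<le> (\<integral>\<^sup>+z. ennreal (\<bar>X z\<bar> powr p * r z) \<partial>lborel)"
proof -
  have [measurable]: "r \<in> borel_measurable borel" using borel_measurable_integrable[OF r(1)] by simp
  have M0: "0 \<le> M" using M[of 0] by linarith
  have i1: "integrable lborel (\<lambda>z. X z * r z)"
  proof (rule Bochner_Integration.integrable_bound[where f = "\<lambda>y. M * r y"])
    show "AE y in lborel. norm (X y * r y) \<le> norm (M * r y)"
      using M M0 by (auto simp: abs_mult intro!: mult_right_mono AE_I2)
  qed (use r in auto)
  have i2: "integrable lborel (\<lambda>z. \<bar>X z\<bar> powr p * r z)"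
  proof (rule Bochner_Integration.integrable_bound[where f = "\<lambda>y. M powr p * r y"])
    have "\<bar>X y\<bar> powr p \<le> M powr p" for y using M p by (intro powr_mono2) auto
    then show "AE y in lborel. norm (\<bar>X y\<bar> powr p * r y) \<le> norm (M powr p * r y)"
      by (auto simp: abs_mult intro!: mult_right_mono AE_I2)
  qed (use r in auto)
  define m where "m = (\<integral>z. X z * r z \<partial>lborel)"
  have "(\<integral>z. (\<bar>m\<bar> powr p - p * phi p m * m) * r z + p * phi p m * (X z * r z) \<partial>lborel) \<le> (\<integral>z. \<bar>X z\<bar> powr p * r z \<partial>lborel)"
  proof (rule integral_mono)
    fix z
    have "(\<bar>m\<bar> powr p + p * phi p m * (X z - m)) * r z \<le> \<bar>X z\<bar> powr p * r z"
      using abs_powr_above_tangent[OF p, of m "X z"] r(2) by (intro mult_right_mono) auto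
    then show "(\<bar>m\<bar> powr p - p * phi p m * m) * r z + p * phi p m * (X z * r z) \<le> \<bar>X z\<bar> powr p * r z"
      by (simp add: algebra_simps)
  qed (use r i1 i2 in auto)
  also have "(\<integral>z. (\<bar>m\<bar> powr p - p * phi p m * m) * r z + p * phi p m * (X z * r z) \<partial>lborel) = \<bar>m\<bar> powr p"
    using r i1 by (simp add: m_def[symmetric])
  finally have "ennreal (\<bar>m\<bar> powr p) \<le> ennreal (\<integral>z. \<bar>X z\<bar> powr p * r z \<partial>lborel)" by (rule ennreal_leI)
  also have "\<dots> = (\<integral>\<^sup>+z. ennreal (\<bar>X z\<bar> powr p * r z) \<partial>lborel)"
    using i2 r by (intro nn_integral_eq_integral[symmetric]) auto
  finally show ?thesis by (simp add: m_def)
qed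

text \<open>The energy with the model kernel. Unlike \<open>k\<close> it is translation invariant,
  which is what keeps mollification from raising it.\<close>

definition gagliardo :: "real \<Rightarrow> real \<Rightarrow> ('a::euclidean_space \<Rightarrow> real) \<Rightarrow> ennreal"
  where "gagliardo p \<gamma> \<xi> = (\<integral>\<^sup>+x. \<integral>\<^sup>+y. ennreal (norm (x - y) powr (- \<gamma> - real DIM('a)) * \<bar>\<xi> x - \<xi> y\<bar> powr p) \<partial>lborel \<partial>lborel)"

text \<open>The mollified function is an average of translates of \<xi>. Jensen moves the p-th power
  inside the average, Fubini puts the average outermost, and each translate has the same energy as
  \<xi>.\<close>

lemma gagliardo_convolution:
  fixes \<xi> r :: "'a::euclidean_space \<Rightarrow> real"
  assumes p: "1 < p" and r: "integrable lborel r" "\<And>x. 0 \<le> r x" "(\<integral>x. r x \<partial>lborel) = 1"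
    and \<xi> [measurable]: "\<xi> \<in> borel_measurable borel" and M: "\<And>x. \<bar>\<xi> x\<bar> \<le> M"
    and \<eta>: "\<And>x. \<eta> x = (\<integral>z. \<xi> (x - z) * r z \<partial>lborel)"
  shows "gagliardo p \<gamma> \<eta> \<le> gagliardo p \<gamma> \<xi>"
proof -
  let ?\<kappa> = "\<lambda>x y::'a. norm (x - y) powr (- \<gamma> - real DIM('a))"
  have [measurable]: "r \<in> borel_measurable borel" using borel_measurable_integrable[OF r(1)] by simp
  have r1: "(\<integral>\<^sup>+z. ennreal (r z) \<partial>lborel) = 1"
    using r by (subst nn_integral_eq_integral) auto
  have i: "integrable lborel (\<lambda>z. \<xi> (x - z) * r z)" for x
  proof (rule Bochner_Integration.integrable_bound[where f = "\<lambda>y. M * r y"])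
    show "AE y in lborel. norm (\<xi> (x - y) * r y) \<le> norm (M * r y)"
      using M order_trans[OF abs_ge_zero M] by (auto simp: abs_mult intro!: mult_right_mono AE_I2)
  qed (use r in auto)
  let ?F = "\<lambda>x y z. ennreal (?\<kappa> x y * \<bar>\<xi> (x - z) - \<xi> (y - z)\<bar> powr p) * ennreal (r z)"
  have J: "ennreal (?\<kappa> x y * \<bar>\<eta> x - \<eta> y\<bar> powr p) \<le> (\<integral>\<^sup>+z. ?F x y z \<partial>lborel)" for x y
  proof -
    have "\<eta> x - \<eta> y = (\<integral>z. (\<xi> (x - z) - \<xi> (y - z)) * r z \<partial>lborel)"
      using i by (simp add: \<eta> left_diff_distrib)
    moreover have "ennreal (\<bar>\<integral>z. (\<xi> (x - z) - \<xi> (y - z)) * r z \<partial>lborel\<bar> powr p) \<le> (\<integral>\<^sup>+z. ennreal (\<bar>\<xi> (x - z) - \<xi> (y - z)\<bar> powr p * r z) \<partial>lborel)"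
    proof (rule Jensen_weighted[OF p r, where M = "2 * M"])
      show "\<bar>\<xi> (x - z) - \<xi> (y - z)\<bar> \<le> 2 * M" for z using M[of "x - z"] M[of "y - z"] by linarith
    qed measurable
    ultimately have "ennreal (?\<kappa> x y) * ennreal (\<bar>\<eta> x - \<eta> y\<bar> powr p) \<le> ennreal (?\<kappa> x y) * (\<integral>\<^sup>+z. ennreal (\<bar>\<xi> (x - z) - \<xi> (y - z)\<bar> powr p * r z) \<partial>lborel)"
      by (intro mult_left_mono) auto
    also have "\<dots> = (\<integral>\<^sup>+z. ennreal (?\<kappa> x y) * ennreal (\<bar>\<xi> (x - z) - \<xi> (y - z)\<bar> powr p * r z) \<partial>lborel)"
      by (rule nn_integral_cmult[symmetric]) measurable
    also have "\<dots> = (\<integral>\<^sup>+z. ?F x y z \<partial>lborel)"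
      using r(2) by (intro nn_integral_cong) (simp add: ennreal_mult[symmetric] mult.assoc)
    finally show ?thesis by (simp add: ennreal_mult)
  qed
  have "gagliardo p \<gamma> \<eta> \<le> (\<integral>\<^sup>+x. \<integral>\<^sup>+y. \<integral>\<^sup>+z. ?F x y z \<partial>lborel \<partial>lborel \<partial>lborel)"
    unfolding gagliardo_def by (intro nn_integral_mono J)
  also have "\<dots> = (\<integral>\<^sup>+x. \<integral>\<^sup>+z. \<integral>\<^sup>+y. ?F x y z \<partial>lborel \<partial>lborel \<partial>lborel)"
    by (intro nn_integral_cong lborel_pair.Fubini') measurable
  also have "\<dots> = (\<integral>\<^sup>+z. \<integral>\<^sup>+x. \<integral>\<^sup>+y. ?F x y z \<partial>lborel \<partial>lborel \<partial>lborel)"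
    by (rule lborel_pair.Fubini') measurable
  also have "\<dots> = (\<integral>\<^sup>+z. ennreal (r z) * gagliardo p \<gamma> \<xi> \<partial>lborel)"
  proof (rule nn_integral_cong)
    fix z
    define H where "H x = (\<integral>\<^sup>+y. ennreal (?\<kappa> x y * \<bar>\<xi> x - \<xi> y\<bar> powr p) \<partial>lborel)" for x
    have [measurable]: "H \<in> borel_measurable borel" unfolding H_def by measurable
    have "(\<integral>\<^sup>+y. ?F x y z \<partial>lborel) = H (x - z) * ennreal (r z)" for x
    proof -
      have "(\<integral>\<^sup>+y. ?F x y z \<partial>lborel) = (\<integral>\<^sup>+y. ennreal (?\<kappa> x y * \<bar>\<xi> (x - z) - \<xi> (y - z)\<bar> powr p) \<partial>lborel) * ennreal (r z)"
        by (rule nn_integral_multc) measurable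
      also have "(\<integral>\<^sup>+y. ennreal (?\<kappa> x y * \<bar>\<xi> (x - z) - \<xi> (y - z)\<bar> powr p) \<partial>lborel) = H (x - z)"
        using nn_integral_shift[of "\<lambda>y. ennreal (?\<kappa> (x - z) y * \<bar>\<xi> (x - z) - \<xi> y\<bar> powr p)" z] by (simp add: H_def)
      finally show ?thesis .
    qed
    then have "(\<integral>\<^sup>+x. \<integral>\<^sup>+y. ?F x y z \<partial>lborel \<partial>lborel) = (\<integral>\<^sup>+x. H (x - z) \<partial>lborel) * ennreal (r z)"
      by (simp add: nn_integral_multc)
    also have "(\<integral>\<^sup>+x. H (x - z) \<partial>lborel) = gagliardo p \<gamma> \<xi>"
      by (subst nn_integral_shift) (simp_all add: H_def[abs_def] gagliardo_def)
    finally show "(\<integral>\<^sup>+x. \<integral>\<^sup>+y. ?F x y z \<partial>lborel \<partial>lborel) = ennreal (r z) * gagliardo p \<gamma> \<xi>"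
      by (simp add: mult.commute)
  qed
  also have "\<dots> = gagliardo p \<gamma> \<xi>"
    by (simp add: nn_integral_multc r1)
  finally show ?thesis .
qed

text \<open>Where r does not vanish, the distance is at most \<delta>, so
  \<open>\<delta> powr (- N)\<close> equals
  \<open>\<delta> powr \<gamma> * \<delta> powr (- \<gamma> - N)\<close> and is dominated by
  \<open>\<delta> powr \<gamma>\<close> times the Gagliardo kernel. Regularity of \<xi> thus becomes
  a rate of approximation.\<close>

lemma gagliardo_convolution_Lp:
  fixes \<xi> r :: "'a::euclidean_space \<Rightarrow> real"
  assumes p: "1 < p" and r: "integrable lborel r" "\<And>x. 0 \<le> r x" "(\<integral>x. r x \<partial>lborel) = 1"
    and \<delta>: "0 < \<delta>" "0 < \<gamma>" "0 \<le> B" and rB: "\<And>x. r x \<le> B * \<delta> powr (- real DIM('a))" "\<And>x. \<delta> < norm x \<Longrightarrow> r x = 0"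
    and \<xi> [measurable]: "\<xi> \<in> borel_measurable borel" and M: "\<And>x. \<bar>\<xi> x\<bar> \<le> M"
    and \<eta>: "\<And>x. \<eta> x = (\<integral>z. \<xi> (x - z) * r z \<partial>lborel)"
  shows "(\<integral>\<^sup>+x. ennreal (\<bar>\<eta> x - \<xi> x\<bar> powr p) \<partial>lborel) \<le> ennreal (B * \<delta> powr \<gamma>) * gagliardo p \<gamma> \<xi>"
proof -
  let ?\<kappa> = "\<lambda>x y::'a. norm (x - y) powr (- \<gamma> - real DIM('a))"
  have [measurable]: "r \<in> borel_measurable borel" using borel_measurable_integrable[OF r(1)] by simp
  have i: "integrable lborel (\<lambda>z. \<xi> (x - z) * r z)" for x
  proof (rule Bochner_Integration.integrable_bound[where f = "\<lambda>y. M * r y"])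
    show "AE y in lborel. norm (\<xi> (x - y) * r y) \<le> norm (M * r y)"
      using M order_trans[OF abs_ge_zero M] by (auto simp: abs_mult intro!: mult_right_mono AE_I2)
  qed (use r in auto)
  have "(\<integral>\<^sup>+x. ennreal (\<bar>\<eta> x - \<xi> x\<bar> powr p) \<partial>lborel) \<le>
    (\<integral>\<^sup>+x. ennreal (B * \<delta> powr \<gamma>) * (\<integral>\<^sup>+y. ennreal (?\<kappa> x y * \<bar>\<xi> x - \<xi> y\<bar> powr p) \<partial>lborel) \<partial>lborel)"
  proof (rule nn_integral_mono)
    fix x
    have "\<eta> x - \<xi> x = (\<integral>z. (\<xi> (x - z) - \<xi> x) * r z \<partial>lborel)"
      using i r by (simp add: \<eta> left_diff_distrib)
    then have "ennreal (\<bar>\<eta> x - \<xi> x\<bar> powr p) \<le> (\<integral>\<^sup>+z. ennreal (\<bar>\<xi> (x - z) - \<xi> x\<bar> powr p * r z) \<partial>lborel)"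
    proof (simp only:, intro Jensen_weighted[OF p r, where M = "2 * M"])
      show "\<bar>\<xi> (x - z) - \<xi> x\<bar> \<le> 2 * M" for z using M[of "x - z"] M[of x] by linarith
    qed measurable
    also have "\<dots> = (\<integral>\<^sup>+y. ennreal (\<bar>\<xi> y - \<xi> x\<bar> powr p * r (x - y)) \<partial>lborel)"
      using nn_integral_reflect[of "\<lambda>y. ennreal (\<bar>\<xi> y - \<xi> x\<bar> powr p * r (x - y))" x] by simp
    also have "\<dots> \<le> (\<integral>\<^sup>+y. ennreal (B * \<delta> powr \<gamma>) * ennreal (?\<kappa> x y * \<bar>\<xi> x - \<xi> y\<bar> powr p) \<partial>lborel)"
    proof (rule nn_integral_mono)
      fix y
      have "\<bar>\<xi> y - \<xi> x\<bar> powr p * r (x - y) \<le> B * \<delta> powr \<gamma> * (?\<kappa> x y * \<bar>\<xi> x - \<xi> y\<bar> powr p)"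
      proof (cases "x = y \<or> \<delta> < norm (x - y)")
        case True then show ?thesis using rB(2)[of "x - y"] \<delta> by auto
      next
        case False
        then have n: "0 < norm (x - y)" "norm (x - y) \<le> \<delta>" by auto
        have "r (x - y) \<le> B * \<delta> powr (- real DIM('a))" by (rule rB)
        also have "\<dots> = B * \<delta> powr \<gamma> * \<delta> powr (- \<gamma> - real DIM('a))" by (simp add: powr_add[symmetric] mult.assoc)
        also have "\<dots> \<le> B * \<delta> powr \<gamma> * ?\<kappa> x y" using n \<delta> by (intro mult_left_mono powr_mono2') auto
        finally have "r (x - y) * \<bar>\<xi> x - \<xi> y\<bar> powr p \<le> B * \<delta> powr \<gamma> * ?\<kappa> x y * \<bar>\<xi> x - \<xi> y\<bar> powr p"
          by (rule mult_right_mono) auto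
        then show ?thesis by (simp add: abs_minus_commute mult_ac)
      qed
      then show "ennreal (\<bar>\<xi> y - \<xi> x\<bar> powr p * r (x - y)) \<le> ennreal (B * \<delta> powr \<gamma>) * ennreal (?\<kappa> x y * \<bar>\<xi> x - \<xi> y\<bar> powr p)"
        using \<delta> by (subst ennreal_mult[symmetric]) (auto intro: ennreal_leI)
    qed
    also have "\<dots> = ennreal (B * \<delta> powr \<gamma>) * (\<integral>\<^sup>+y. ennreal (?\<kappa> x y * \<bar>\<xi> x - \<xi> y\<bar> powr p) \<partial>lborel)"
      by (rule nn_integral_cmult) measurable
    finally show "ennreal (\<bar>\<eta> x - \<xi> x\<bar> powr p) \<le> \<dots>" .
  qed
  also have "\<dots> = ennreal (B * \<delta> powr \<gamma>) * gagliardo p \<gamma> \<xi>"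
    unfolding gagliardo_def by (rule nn_integral_cmult) measurable
  finally show ?thesis .
qed

lemma AE_tendsto_of_summable_Lp:
  fixes f :: "nat \<Rightarrow> 'a \<Rightarrow> real"
  assumes [measurable]: "\<And>i. f i \<in> borel_measurable M" and p: "0 < p"
    and s: "(\<Sum>i. \<integral>\<^sup>+x. ennreal (\<bar>f i x\<bar> powr p) \<partial>M) < \<infinity>"
  shows "AE x in M. (\<lambda>i. f i x) \<longlonglongrightarrow> 0"
proof -
  have "(\<integral>\<^sup>+x. (\<Sum>i. ennreal (\<bar>f i x\<bar> powr p)) \<partial>M) = (\<Sum>i. \<integral>\<^sup>+x. ennreal (\<bar>f i x\<bar> powr p) \<partial>M)"
    by (rule nn_integral_suminf) measurable
  then have "AE x in M. (\<Sum>i. ennreal (\<bar>f i x\<bar> powr p)) \<noteq> \<infinity>"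
    using s by (intro nn_integral_PInf_AE) auto
  then show ?thesis
  proof eventually_elim
    case (elim x)
    then have "summable (\<lambda>i. \<bar>f i x\<bar> powr p)" by (intro summable_suminf_not_top) auto
    then have "(\<lambda>i. \<bar>f i x\<bar> powr p) \<longlonglongrightarrow> 0" by (rule summable_LIMSEQ_zero)
    then have "(\<lambda>i. (\<bar>f i x\<bar> powr p) powr (1 / p)) \<longlonglongrightarrow> 0 powr (1 / p)"
      using p by (intro tendsto_powr') auto
    then show ?case using p by (simp add: powr_powr tendsto_rabs_zero_iff)
  qed
qed

theorem smooth_approximation:
  fixes \<xi> :: "real ^ 'n \<Rightarrow> real"
  assumes p: "1 < p" and \<gamma>: "0 < \<gamma>"
    and \<xi> [measurable]: "\<xi> \<in> borel_measurable borel" and M: "\<And>x. \<bar>\<xi> x\<bar> \<le> M" and nn: "\<And>x. 0 \<le> \<xi> x"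
    and C: "compact C" "C \<subseteq> D" "open D" "\<And>x. x \<notin> C \<Longrightarrow> \<xi> x = 0"
    and E: "gagliardo p \<gamma> \<xi> < \<infinity>"
  obtains \<eta> :: "nat \<Rightarrow> real ^ 'n \<Rightarrow> real" and C'
  where "\<And>i k. Ck k (\<eta> i)" "\<And>i x. 0 \<le> \<eta> i x" "\<And>i x. \<eta> i x \<le> M"
    "compact C'" "C' \<subseteq> D" "\<And>i x. x \<notin> C' \<Longrightarrow> \<eta> i x = 0" "\<And>i. \<eta> i \<in> borel_measurable borel"
    "\<And>i. gagliardo p \<gamma> (\<eta> i) \<le> gagliardo p \<gamma> \<xi>" "AE x in lborel. (\<lambda>i. \<eta> i x) \<longlonglongrightarrow> \<xi> x"
proof -
  obtain B where B: "0 < B" "\<And>\<delta>. 0 < \<delta> \<Longrightarrow> \<exists>r :: real ^ 'n \<Rightarrow> real.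
    bump (1 / \<delta>\<^sup>2) r \<and> (\<forall>x. 0 \<le> r x) \<and> integrable lborel r \<and> (\<integral>x. r x \<partial>lborel) = 1 \<and>
    (\<forall>x. r x \<le> B * \<delta> powr (- real DIM(real ^ 'n))) \<and> (\<forall>x. \<delta> < norm x \<longrightarrow> r x = 0)"
    using mollifier_exists[where 'a = "real ^ 'n"] by blast
  obtain e where e: "0 < e" "(\<Union>x\<in>C. cball x e) \<subseteq> D"
    using compact_subset_open_imp_cball_epsilon_subset[OF C(1,3,2)] by blast
  define C' where "C' = (\<Union>x\<in>C. cball x e)"
  have C': "compact C'" "C' \<subseteq> D"
    unfolding C'_def using compact_minkowski_sum_cball[OF C(1), of e] e by simp_all
  \<comment> \<open>Geometric radii make the errors, of order
    \<open>\<delta> i powr \<gamma>\<close>, summable; hence the whole sequence converges almost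
    everywhere without passing to a subsequence. The bound by e keeps all supports in one compact
    set.\<close>
  define \<delta> where "\<delta> i = e * (1 / 2) ^ i" for i :: nat
  have \<delta>: "0 < \<delta> i" "\<delta> i \<le> e" for i
    using e mult_left_le[of "(1 / 2) ^ i" e] power_le_one[of "1 / 2 :: real" i] by (simp_all add: \<delta>_def)
  obtain r :: "nat \<Rightarrow> real ^ 'n \<Rightarrow> real" where r: "\<And>i. bump (1 / (\<delta> i)\<^sup>2) (r i)" "\<And>i x. 0 \<le> r i x"
    "\<And>i. integrable lborel (r i)" "\<And>i. (\<integral>x. r i x \<partial>lborel) = 1"
    "\<And>i x. r i x \<le> B * \<delta> i powr (- real DIM(real ^ 'n))" "\<And>i x. \<delta> i < norm x \<Longrightarrow> r i x = 0"
    using B(2)[OF \<delta>(1)] by metis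
  have [measurable]: "r i \<in> borel_measurable borel" for i by (rule bump_measurable[OF r(1)])
  have i\<xi>: "integrable lborel \<xi>"
  proof (rule Bochner_Integration.integrable_bound[where f = "\<lambda>x. M * indicator C x :: real"])
    have "integrable lborel (indicator C :: real ^ 'n \<Rightarrow> real)"
      using emeasure_bounded_finite[OF compact_imp_bounded[OF C(1)]] borel_compact[OF C(1)] by (simp add: integrable_indicator_iff)
    then show "integrable lborel (\<lambda>x. M * indicator C x :: real)" by simp
    show "AE x in lborel. norm (\<xi> x) \<le> norm (M * indicator C x :: real)"
    proof (rule AE_I2)
      fix x show "norm (\<xi> x) \<le> norm (M * indicator C x :: real)"
        using M[of x] C(4)[of x] by (cases "x \<in> C") auto
    qed
  qed simp
  have iz: "integrable lborel (\<lambda>z. \<xi> (x - z) * r i z)" for i x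
  proof (rule Bochner_Integration.integrable_bound[where f = "\<lambda>y. M * r i y"])
    show "AE y in lborel. norm (\<xi> (x - y) * r i y) \<le> norm (M * r i y)"
      using M order_trans[OF abs_ge_zero M] r(2) by (auto simp: abs_mult intro!: mult_right_mono AE_I2)
  qed (use r in auto)
  define \<eta> where "\<eta> i x = (\<integral>z. \<xi> (x - z) * r i z \<partial>lborel)" for i x
  have \<eta>2: "\<eta> i = (\<lambda>x. \<integral>y. \<xi> y * r i (x - y) \<partial>lborel)" for i
  proof
    fix x
    show "\<eta> i x = (\<integral>y. \<xi> y * r i (x - y) \<partial>lborel)"
      using lborel_integral_reflect(2)[OF iz[of x i], of x] by (simp add: \<eta>_def)
  qed
  have Ck: "Ck k (\<eta> i)" for k i
    unfolding \<eta>2 using \<delta>(1)[of i] by (intro convolution_Ck[OF i\<xi> _ r(1)]) auto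
  have \<eta>m [measurable]: "\<eta> i \<in> borel_measurable borel" for i
    using Ck[of 0 i] by (intro borel_measurable_continuous_onI) simp
  have nn\<eta>: "0 \<le> \<eta> i x" for i x unfolding \<eta>_def using nn r(2) by (intro integral_nonneg_AE) auto
  have "\<eta> i x \<le> (\<integral>z. M * r i z \<partial>lborel)" for i x
    unfolding \<eta>_def using M abs_le_D1 r(2) iz r(3) by (intro integral_mono) (auto intro!: mult_right_mono)
  then have le: "\<eta> i x \<le> M" for i x using r(4) by simp
  have zero: "\<eta> i x = 0" if "x \<notin> C'" for i x
  proof -
    have "\<xi> (x - z) * r i z = 0" for z
    proof (cases "\<delta> i < norm z")
      case False
      then have "dist (x - z) x \<le> e" using \<delta>(2)[of i] by (simp add: dist_norm)
      then have "x - z \<notin> C" using that by (auto simp: C'_def)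
      then show ?thesis using C(4) by simp
    qed (use r(6) in simp)
    then have "(\<lambda>z. \<xi> (x - z) * r i z) = (\<lambda>z. 0)" by (rule ext)
    then show ?thesis by (simp add: \<eta>_def)
  qed
  have g: "gagliardo p \<gamma> (\<eta> i) \<le> gagliardo p \<gamma> \<xi>" for i
    by (rule gagliardo_convolution[OF p r(3,2,4) \<xi> M \<eta>_def])
  have L: "(\<integral>\<^sup>+x. ennreal (\<bar>\<eta> i x - \<xi> x\<bar> powr p) \<partial>lborel) \<le> ennreal (B * \<delta> i powr \<gamma>) * gagliardo p \<gamma> \<xi>" for i
    by (rule gagliardo_convolution_Lp[OF p r(3,2,4) \<delta>(1) \<gamma> _ r(5,6) \<xi> M \<eta>_def]) (use B in auto)
  have "(\<Sum>i. \<integral>\<^sup>+x. ennreal (\<bar>\<eta> i x - \<xi> x\<bar> powr p) \<partial>lborel) \<le> (\<Sum>i. ennreal (B * \<delta> i powr \<gamma>) * gagliardo p \<gamma> \<xi>)"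
    by (intro suminf_le L summableI)
  also have "\<dots> = (\<Sum>i. ennreal (B * \<delta> i powr \<gamma>)) * gagliardo p \<gamma> \<xi>" by (rule ennreal_suminf_multc)
  also have "(\<Sum>i. ennreal (B * \<delta> i powr \<gamma>)) = (\<Sum>i. ennreal (B * e powr \<gamma> * (2 powr (- \<gamma>)) ^ i))"
  proof (rule suminf_cong)
    fix i
    have "\<delta> i powr \<gamma> = e powr \<gamma> * ((1 / 2) ^ i) powr \<gamma>" using e by (simp add: \<delta>_def powr_mult)
    also have "((1 / 2 :: real) ^ i) powr \<gamma> = (2 powr (- \<gamma>)) ^ i"
      by (simp add: powr_realpow[symmetric] powr_powr powr_minus powr_divide power_divide inverse_eq_divide mult.commute)
    finally show "ennreal (B * \<delta> i powr \<gamma>) = ennreal (B * e powr \<gamma> * (2 powr (- \<gamma>)) ^ i)" by (simp add: mult.assoc)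
  qed
  also have "\<dots> = ennreal (B * e powr \<gamma> / (1 - 2 powr (- \<gamma>)))" using B \<gamma> by (intro geometric_powr_sum) auto
  also have "\<dots> * gagliardo p \<gamma> \<xi> < \<infinity>" using E by (simp add: ennreal_mult_less_top)
  finally have "AE x in lborel. (\<lambda>i. \<eta> i x - \<xi> x) \<longlonglongrightarrow> 0"
    using p by (intro AE_tendsto_of_summable_Lp[of _ _ p]) auto
  then have "AE x in lborel. (\<lambda>i. \<eta> i x) \<longlonglongrightarrow> \<xi> x"
    by eventually_elim (simp add: LIM_zero_iff)
  then show ?thesis by (intro that[of \<eta> C'] Ck nn\<eta> le C' zero \<eta>m g)
qed

section \<open>Comparison and smooth tests\<close>

lemma AE_lborel_fst_snd:
  assumes "AE x in (lborel :: 'a::euclidean_space measure). Q x"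
  shows "AE z in (lborel :: ('a \<times> 'a) measure). Q (fst z) \<and> Q (snd z)"
proof -
  obtain N where N: "{x. \<not> Q x} \<subseteq> N" "N \<in> null_sets (lborel :: 'a measure)"
    using assms by (auto simp: eventually_ae_filter)
  have [measurable]: "N \<in> sets borel" using N(2) by (auto simp: null_sets_def)
  have "AE x in (lborel :: 'a measure). AE y in (lborel :: 'a measure). x \<notin> N \<and> y \<notin> N"
    using AE_not_in[OF N(2)] by (auto elim: eventually_mono)
  moreover have "{z \<in> space (lborel \<Otimes>\<^sub>M lborel). fst z \<notin> N \<and> snd z \<notin> N} \<in> sets (lborel \<Otimes>\<^sub>M (lborel :: 'a measure))"
    by measurable
  ultimately have "AE z in (lborel \<Otimes>\<^sub>M (lborel :: 'a measure)). fst z \<notin> N \<and> snd z \<notin> N"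
    by (intro lborel_pair.AE_pair_measure) auto
  then show ?thesis unfolding lborel_prod by (rule eventually_mono) (use N(1) in blast)
qed

lemma emeasure_Compl_bounded:
  fixes D :: "'a::euclidean_space set"
  assumes "bounded D" "D \<in> sets borel"
  shows "emeasure lborel (- D) = \<infinity>"
proof -
  have "emeasure lborel (UNIV :: 'a set) \<le> emeasure lborel D + emeasure lborel (- D)"
    using emeasure_subadditive[of D lborel "- D"] assms(2) by (auto simp: Compl_partition)
  moreover have "emeasure lborel D < \<infinity>" by (rule emeasure_bounded_finite[OF assms(1)])
  ultimately show ?thesis by (auto simp: top_unique less_top[symmetric] ennreal_add_eq_top)
qed

context frac_kernel
begin

lemma k_measurable_pair [measurable]: "(\<lambda>z. k (fst z) (snd z)) \<in> borel_measurable borel"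
  by (rule k_measurable)

lemma gagliardo_pair:
  fixes \<xi> :: "'a \<Rightarrow> real"
  assumes [measurable]: "\<xi> \<in> borel_measurable borel"
  shows "gagliardo p (s * p) \<xi> = (\<integral>\<^sup>+z. ennreal (norm (fst z - snd z) powr (- (s * p) - real DIM('a)) * \<bar>dif \<xi> z\<bar> powr p) \<partial>lborel)"
proof -
  have "(\<lambda>z. ennreal (norm (fst z - snd z) powr (- (s * p) - real DIM('a)) * \<bar>dif \<xi> z\<bar> powr p)) \<in> borel_measurable (lborel \<Otimes>\<^sub>M lborel)"
    unfolding lborel_prod by measurable
  from lborel.nn_integral_fst[OF this] show ?thesis by (simp add: gagliardo_def lborel_prod)
qed

lemma gagliardo_le_energy:
  fixes \<xi> :: "'a \<Rightarrow> real"
  assumes [measurable]: "\<xi> \<in> borel_measurable borel"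
  shows "gagliardo p (s * p) \<xi> \<le> ennreal \<Lambda> * energy \<xi> UNIV"
proof -
  have "gagliardo p (s * p) \<xi> \<le> (\<integral>\<^sup>+z. ennreal \<Lambda> * (ennreal (k (fst z) (snd z)) * (ennreal (\<bar>dif \<xi> z\<bar> powr p) * indicator UNIV z)) \<partial>lborel)"
    unfolding gagliardo_pair[OF assms]
  proof (rule nn_integral_mono)
    fix z :: "'a \<times> 'a"
    have "norm (fst z - snd z) powr (- (s * p) - real DIM('a)) * \<bar>dif \<xi> z\<bar> powr p \<le> (\<Lambda> * k (fst z) (snd z)) * \<bar>dif \<xi> z\<bar> powr p"
      using k_lower[of "fst z" "snd z"] \<Lambda>_ge by (intro mult_right_mono) (auto simp: pos_divide_le_eq mult.commute)
    then show "ennreal (norm (fst z - snd z) powr (- (s * p) - real DIM('a)) * \<bar>dif \<xi> z\<bar> powr p) \<le>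
      ennreal \<Lambda> * (ennreal (k (fst z) (snd z)) * (ennreal (\<bar>dif \<xi> z\<bar> powr p) * indicator UNIV z))"
      using \<Lambda>_ge k_nonneg by (simp add: ennreal_mult[symmetric] ennreal_leI mult.assoc)
  qed
  also have "\<dots> = ennreal \<Lambda> * energy \<xi> UNIV"
    unfolding energy_def by (subst nn_integral_cmult) (simp_all add: nn_integral_mu_lborel)
  finally show ?thesis .
qed

lemma tests_mono: "D \<subseteq> D' \<Longrightarrow> tests D \<subseteq> tests D'"
  unfolding tests_def by blast

lemma tests_measurable: "\<eta> \<in> tests D \<Longrightarrow> \<eta> \<in> borel_measurable borel"
  by (simp add: tests_def)

lemma wsuper_mono: "wsuper u D' \<Longrightarrow> D \<subseteq> D' \<Longrightarrow> wsuper u D"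
  using tests_mono unfolding wsuper_def by blast

lemma loc_energy_common:
  assumes "loc_energy u D" "loc_energy v D" "compact C" "C \<subseteq> D"
  obtains U where "open U" "C \<subseteq> U" "U \<subseteq> D" "energy u (U \<times> U) < \<infinity>" "energy v (U \<times> U) < \<infinity>"
proof -
  obtain U1 where U1: "open U1" "C \<subseteq> U1" "U1 \<subseteq> D" "energy u (U1 \<times> U1) < \<infinity>"
    using assms(1,3,4) unfolding loc_energy_def by blast
  obtain U2 where U2: "open U2" "C \<subseteq> U2" "U2 \<subseteq> D" "energy v (U2 \<times> U2) < \<infinity>"
    using assms(2,3,4) unfolding loc_energy_def by blast
  show ?thesis
  proof (rule that[of "U1 \<inter> U2"])
    show "energy u ((U1 \<inter> U2) \<times> (U1 \<inter> U2)) < \<infinity>"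
      by (rule le_less_trans[OF energy_mono U1(4)]) auto
    show "energy v ((U1 \<inter> U2) \<times> (U1 \<inter> U2)) < \<infinity>"
      by (rule le_less_trans[OF energy_mono U2(4)]) auto
  qed (use U1 U2 in auto)
qed

text \<open>\<open>mu\<close> does not charge the diagonal, where the kernel is 0, and has positive
  density everywhere else.\<close>

lemma mu_AE_iff:
  assumes "AE z in mu. P z"
  shows "AE z in lborel. fst z \<noteq> snd z \<longrightarrow> P z"
proof -
  have "AE z in lborel. 0 < ennreal (k (fst z) (snd z)) \<longrightarrow> P z"
    using assms unfolding mu_def by (subst (asm) AE_density) auto
  moreover have "0 < k x y" if "x \<noteq> y" for x y
  proof -
    have "0 < norm (x - y) powr (- (s * p) - real DIM('a)) / \<Lambda>" using that \<Lambda>_ge by simp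
    then show ?thesis using k_lower[of x y] by linarith
  qed
  ultimately show ?thesis by (auto elim!: eventually_mono)
qed

lemma mu_AE_I: "AE z in lborel. P z \<Longrightarrow> AE z in mu. P z"
  unfolding mu_def by (subst AE_density) (auto elim: eventually_mono)

text \<open>Testing both inequalities with the excess \<open>(v - h - e)\<close> cut at 0 gives an
  integrand that is nonnegative by monotonicity of \<open>phi\<close> but has integral at most 0. No
  Poincare inequality is needed to conclude: by nonlocality a point with positive excess interacts
  with every point outside D, and there the integrand would be strictly positive.\<close>

theorem weak_comparison:
  assumes D: "bounded D" "D \<in> sets borel"
    and v: "loc_energy v D" "wsuper (\<lambda>x. - v x) D" and h: "loc_energy h D" "wsuper h D"
    and out: "AE x in lborel. x \<notin> D \<longrightarrow> v x \<le> h x"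
    and e: "0 < e" and C: "compact C" "C \<subseteq> D" "\<And>x. x \<in> D \<Longrightarrow> h x + e < v x \<Longrightarrow> x \<in> C"
    and B: "\<And>x. x \<in> C \<Longrightarrow> v x - h x \<le> B"
  shows "AE x in lborel. x \<in> D \<longrightarrow> v x \<le> h x + e"
proof -
  have [measurable]: "v \<in> borel_measurable borel" "h \<in> borel_measurable borel" "C \<in> sets borel" "D \<in> sets borel"
    using v h C D by (auto simp: loc_energy_def borel_compact)
  \<comment> \<open>Cutting off by C gives compact support at every point; outside D the order of v
    and h is known only almost everywhere.\<close>
  define \<xi> where "\<xi> x = (if x \<in> C then max (v x - h x - e) 0 else 0)" for x
  have \<xi>m [measurable]: "\<xi> \<in> borel_measurable borel" unfolding \<xi>_def[abs_def] by measurable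
  have \<xi>0: "0 \<le> \<xi> x" for x by (simp add: \<xi>_def)
  have \<xi>z: "x \<notin> C \<Longrightarrow> \<xi> x = 0" for x by (simp add: \<xi>_def)
  have \<xi>eq: "\<xi> x = max (v x - h x - e) 0" if "x \<in> D \<or> v x \<le> h x" for x
  proof (cases "x \<in> C")
    case False
    then have "v x - h x - e \<le> 0" using that C(3)[of x] e by linarith
    then show ?thesis using False by (simp add: \<xi>_def)
  qed (simp add: \<xi>_def)
  obtain U where U: "open U" "C \<subseteq> U" "U \<subseteq> D" "energy v (U \<times> U) < \<infinity>" "energy h (U \<times> U) < \<infinity>"
    using loc_energy_common[OF v(1) h(1) C(1,2)] by blast
  have [measurable]: "U \<in> sets borel" using U by simp
  have t: "\<xi> \<in> tests D"
  proof -
    have "energy \<xi> (U \<times> U) < \<infinity>"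
    proof (rule energy_finite_add[OF _ _ _ _ U(4,5)])
      fix z assume "z \<in> U \<times> U"
      then have "\<xi> (fst z) = max (v (fst z) - h (fst z) - e) 0" "\<xi> (snd z) = max (v (snd z) - h (snd z) - e) 0"
        using U(3) by (auto intro!: \<xi>eq)
      then show "\<bar>dif \<xi> z\<bar> \<le> \<bar>dif v z\<bar> + \<bar>dif h z\<bar>" by (auto simp: dif_def max_def)
    qed auto
    moreover have b: "\<bar>\<xi> x\<bar> \<le> max (B - e) 0" for x using B[of x] by (auto simp: \<xi>_def)
    ultimately have "energy \<xi> UNIV < \<infinity>"
      by (intro bounded_support_energy[OF \<xi>m b C(1) \<xi>z U(1,2)])
    then show ?thesis unfolding tests_def using b C \<xi>z \<xi>m by blast
  qed
  define g where "g z = wform v \<xi> z - wform h \<xi> z" for z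
  have i: "integrable mu (wform v \<xi>)" "integrable mu (wform h \<xi>)"
    using wform_integrable v(1) h(1) t by auto
  then have gi: "integrable mu g" unfolding g_def[abs_def] by simp
  have gle: "(\<integral>z. g z \<partial>mu) \<le> 0"
    using wsuper_uminusD[OF v(2) t \<xi>0] h(2) t \<xi>0 i unfolding g_def wsuper_def by auto
  have AE2: "AE z in lborel. (fst z \<notin> D \<longrightarrow> v (fst z) \<le> h (fst z)) \<and> (snd z \<notin> D \<longrightarrow> v (snd z) \<le> h (snd z))"
    using AE_lborel_fst_snd[OF out] .
  have geq: "g z = (phi p (dif v z) - phi p (dif h z)) * dif \<xi> z" for z
    by (simp add: g_def wform_def left_diff_distrib)
  have nonneg: "AE z in mu. 0 \<le> g z"
  proof (rule mu_AE_I, use AE2 in eventually_elim)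
    fix z :: "'a \<times> 'a"
    assume z: "(fst z \<notin> D \<longrightarrow> v (fst z) \<le> h (fst z)) \<and> (snd z \<notin> D \<longrightarrow> v (snd z) \<le> h (snd z))"
    have x: "\<xi> (fst z) = max (v (fst z) - h (fst z) - e) 0" "\<xi> (snd z) = max (v (snd z) - h (snd z) - e) 0"
      using z by (auto intro!: \<xi>eq)
    have "0 \<le> (a - b) * (max (a - e) 0 - max (b - e) 0)" for a b :: real
      by (cases "a \<le> b") (auto intro!: mult_nonneg_nonneg mult_nonpos_nonpos simp: max_def)
    from this[of "v (fst z) - h (fst z)" "v (snd z) - h (snd z)"]
    have "0 \<le> (dif v z - dif h z) * dif \<xi> z" unfolding dif_def x by (simp add: algebra_simps)
    then show "0 \<le> g z" unfolding geq by (rule phi_mult_diff_nonneg[OF p_gt])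
  qed
  then have "0 \<le> (\<integral>z. g z \<partial>mu)" by (rule integral_nonneg_AE)
  then have "(\<integral>z. g z \<partial>mu) = 0" using gle by simp
  then have "AE z in mu. g z = 0" using integral_nonneg_eq_0_iff_AE[OF gi nonneg] by simp
  then have "AE z in lborel. fst z \<noteq> snd z \<longrightarrow> g z = 0" by (rule mu_AE_iff)
  \<comment> \<open>For such a pair the first point has \<open>v - h > e\<close> and the second
    \<open>v - h \<le> 0\<close>, so the increments of v and h differ strictly and
    \<open>g z > 0\<close>.\<close>
  then have "AE z in lborel. \<not> (0 < \<xi> (fst z) \<and> snd z \<notin> D)"
    using AE2
  proof eventually_elim
    case (elim z)
    then have a: "fst z \<noteq> snd z \<longrightarrow> g z = 0"
      and z: "(fst z \<notin> D \<longrightarrow> v (fst z) \<le> h (fst z)) \<and> (snd z \<notin> D \<longrightarrow> v (snd z) \<le> h (snd z))" by auto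
    show "\<not> (0 < \<xi> (fst z) \<and> snd z \<notin> D)"
    proof
      assume c: "0 < \<xi> (fst z) \<and> snd z \<notin> D"
      then have "fst z \<in> C" "e < v (fst z) - h (fst z)" by (auto simp: \<xi>_def split: if_splits)
      moreover have "\<xi> (snd z) = 0" using c C(2) by (auto simp: \<xi>_def)
      moreover have "v (snd z) \<le> h (snd z)" using c z by auto
      ultimately have "0 < (dif v z - dif h z) * dif \<xi> z"
        using c e by (intro mult_pos_pos) (auto simp: dif_def)
      then have "0 < g z" unfolding geq by (rule phi_mult_diff_pos[OF p_gt])
      moreover have "fst z \<noteq> snd z" using c C(2) \<open>fst z \<in> C\<close> by auto
      ultimately show False using a by simp
    qed
  qed
  then have "{x. 0 < \<xi> x} \<times> (- D) \<in> null_sets lborel"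
    by (subst AE_iff_null_sets) (auto elim!: eventually_mono)
  \<comment> \<open>The complement of the bounded set D has infinite measure, which forces the other
    factor to be 0.\<close>
  then have "emeasure lborel {x. 0 < \<xi> x} * emeasure lborel (- D) = 0"
    using lborel.emeasure_pair_measure_Times[of "{x. 0 < \<xi> x}" lborel "- D"] by (auto simp: lborel_prod null_sets_def)
  then have "emeasure lborel {x. 0 < \<xi> x} = 0" using emeasure_Compl_bounded[OF D] by simp
  then have "AE x in lborel. \<not> 0 < \<xi> x" by (intro AE_I[of _ _ "{x. 0 < \<xi> x}"]) auto
  then show ?thesis
  proof eventually_elim
    case (elim x)
    then show ?case using \<xi>eq[of x] by (auto simp: max_def split: if_splits)
  qed
qed

lemma tailf_bounded:
  assumes [measurable]: "u \<in> borel_measurable borel" and t: "tailf u" and w: "\<And>x. \<bar>w x\<bar> \<le> \<bar>u x\<bar> + a" and a: "0 \<le> a"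
  shows "tailf w"
proof -
  have "(\<integral>\<^sup>+x. ennreal (\<bar>w x\<bar> powr (p - 1) * tailw x) \<partial>lborel) \<le>
    (\<integral>\<^sup>+x. ennreal (2 powr (p - 1)) * (ennreal (\<bar>u x\<bar> powr (p - 1) * tailw x) + ennreal (a powr (p - 1)) * ennreal (tailw x)) \<partial>lborel)"
  proof (rule nn_integral_mono)
    fix x
    have "\<bar>w x\<bar> powr (p - 1) \<le> (\<bar>u x\<bar> + a) powr (p - 1)" using w[of x] p_gt by (intro powr_mono2) auto
    also have "\<dots> \<le> 2 powr (p - 1) * (\<bar>u x\<bar> powr (p - 1) + a powr (p - 1))" using p_gt a by (intro powr_add2_le) auto
    finally have "\<bar>w x\<bar> powr (p - 1) * tailw x \<le> 2 powr (p - 1) * (\<bar>u x\<bar> powr (p - 1) + a powr (p - 1)) * tailw x"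
      using tailw_pos[of x] by (intro mult_right_mono) auto
    then show "ennreal (\<bar>w x\<bar> powr (p - 1) * tailw x) \<le> ennreal (2 powr (p - 1)) * (ennreal (\<bar>u x\<bar> powr (p - 1) * tailw x) + ennreal (a powr (p - 1)) * ennreal (tailw x))"
      using tailw_pos[of x] by (simp add: ennreal_mult[symmetric] ennreal_plus[symmetric] ennreal_leI algebra_simps del: ennreal_plus)
  qed
  also have "\<dots> = ennreal (2 powr (p - 1)) * ((\<integral>\<^sup>+x. ennreal (\<bar>u x\<bar> powr (p - 1) * tailw x) \<partial>lborel) + ennreal (a powr (p - 1)) * (\<integral>\<^sup>+x. ennreal (tailw x) \<partial>lborel))"
    by (simp add: nn_integral_cmult nn_integral_add)
  also have "\<dots> < \<infinity>" using t tailw_finite by (simp add: tailf_def ennreal_mult_less_top)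
  finally show ?thesis by (simp add: tailf_def)
qed

end

section \<open>From smooth to bounded test functions\<close>

locale frac_kernel_cart = frac_kernel s p \<Lambda> k
  for s p \<Lambda> and k :: "real ^ 'n \<Rightarrow> real ^ 'n \<Rightarrow> real"
begin

text \<open>The bounded tests are reached from smooth ones by Fatou's lemma: mollification does not increase
  the Gagliardo energy, so the dominating functions converge together with their integrals.\<close>

theorem wsuper_of_smooth:
  assumes D: "open D" and u: "loc_energy u D"
    and sm: "\<And>\<eta>. \<eta> \<in> tests D \<Longrightarrow> (\<And>k. Ck k \<eta>) \<Longrightarrow> (\<And>x. 0 \<le> \<eta> x) \<Longrightarrow> 0 \<le> (\<integral>z. wform u \<eta> z \<partial>mu)"
  shows "wsuper u D"
  unfolding wsuper_def
proof (intro ballI impI)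
  fix \<xi> assume \<xi>: "\<xi> \<in> tests D" and \<xi>0: "\<forall>x. 0 \<le> \<xi> x"
  have [measurable]: "u \<in> borel_measurable borel" "\<xi> \<in> borel_measurable borel"
    using u \<xi> by (auto simp: loc_energy_def tests_def)
  obtain M C where M: "\<And>x. \<bar>\<xi> x\<bar> \<le> M" and C: "compact C" "C \<subseteq> D" "\<And>x. x \<notin> C \<Longrightarrow> \<xi> x = 0"
    using \<xi> by (auto simp: tests_def)
  have E: "gagliardo p (s * p) \<xi> < \<infinity>"
    using gagliardo_le_energy[of \<xi>] \<xi> by (auto simp: tests_def ennreal_mult_less_top intro: le_less_trans)
  obtain \<eta> C' where ck: "\<And>i k. Ck k (\<eta> i)" and \<eta>0: "\<And>i x. 0 \<le> \<eta> i x" and \<eta>M: "\<And>i x. \<eta> i x \<le> M"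
    and C': "compact C'" "C' \<subseteq> D" "\<And>i x. x \<notin> C' \<Longrightarrow> \<eta> i x = 0"
    and \<eta>m [measurable]: "\<And>i. \<eta> i \<in> borel_measurable borel"
    and \<eta>g: "\<And>i. gagliardo p (s * p) (\<eta> i) \<le> gagliardo p (s * p) \<xi>"
    and lim: "AE x in lborel. (\<lambda>i. \<eta> i x) \<longlonglongrightarrow> \<xi> x"
    by (rule smooth_approximation[OF p_gt sp_pos _ M _ C(1,2) D C(3) E]) (use \<xi>0 in auto)
  let ?e = "- (s * p) - real DIM(real ^ 'n)"
  let ?\<kappa> = "\<lambda>z::(real ^ 'n) \<times> (real ^ 'n). norm (fst z - snd z) powr ?e"
  have M0: "0 \<le> M" using M[of 0] by linarith
  have \<eta>t: "\<eta> i \<in> tests D" for i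
  proof -
    have "energy (\<eta> i) UNIV = (\<integral>\<^sup>+z. ennreal (k (fst z) (snd z)) * (ennreal (\<bar>dif (\<eta> i) z\<bar> powr p) * indicator UNIV z) \<partial>lborel)"
      unfolding energy_def by (subst nn_integral_mu_lborel) auto
    also have "\<dots> \<le> (\<integral>\<^sup>+z. ennreal \<Lambda> * ennreal (?\<kappa> z * \<bar>dif (\<eta> i) z\<bar> powr p) \<partial>lborel)"
    proof (rule nn_integral_mono)
      fix z :: "(real ^ 'n) \<times> (real ^ 'n)"
      have "k (fst z) (snd z) * \<bar>dif (\<eta> i) z\<bar> powr p \<le> \<Lambda> * ?\<kappa> z * \<bar>dif (\<eta> i) z\<bar> powr p"
        using k_upper by (intro mult_right_mono) auto
      then show "ennreal (k (fst z) (snd z)) * (ennreal (\<bar>dif (\<eta> i) z\<bar> powr p) * indicator UNIV z) \<le> ennreal \<Lambda> * ennreal (?\<kappa> z * \<bar>dif (\<eta> i) z\<bar> powr p)"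
        using \<Lambda>_ge k_nonneg by (simp add: ennreal_mult[symmetric] ennreal_leI mult.assoc)
    qed
    also have "\<dots> = ennreal \<Lambda> * gagliardo p (s * p) (\<eta> i)"
      by (subst nn_integral_cmult) (auto simp: gagliardo_pair)
    also have "\<dots> < \<infinity>" using le_less_trans[OF \<eta>g E] by (simp add: ennreal_mult_less_top)
    finally show ?thesis unfolding tests_def using \<eta>0 \<eta>M C' by (auto intro!: exI[of _ M] exI[of _ C'])
  qed
  have CC: "compact (C \<union> C')" "C \<union> C' \<subseteq> D" using C C' by auto
  obtain U where U: "open U" "C \<union> C' \<subseteq> U" "energy u (U \<times> U) < \<infinity>"
    using u CC unfolding loc_energy_def by blast
  have [measurable]: "C \<in> sets borel" "C' \<in> sets borel" "U \<in> sets borel" using C C' U by (auto simp: borel_compact)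
  \<comment> \<open>The terms of \<open>wform_bound\<close> that do not involve the test function.
    One G serves \<xi> and all approximants, as they share the bound M and are supported in
    \<open>C \<union> C'\<close>.\<close>
  define G where "G z = (\<bar>dif u z\<bar> powr p) * indicator (U \<times> U) z
    + M * ((\<bar>u (fst z)\<bar> + \<bar>u (snd z)\<bar> + 0) powr (p - 1) * indicator (outs (C \<union> C') U) z)" for z
  have Gm [measurable]: "G \<in> borel_measurable borel" unfolding G_def[abs_def] by measurable
  have G0: "0 \<le> G z" for z using M0 by (simp add: G_def)
  have iG: "integrable lborel (\<lambda>z. k (fst z) (snd z) * G z)"
  proof (rule integrableI_nonneg)
    have "(\<integral>\<^sup>+z. ennreal (k (fst z) (snd z) * G z) \<partial>lborel) = (\<integral>\<^sup>+z. ennreal (G z) \<partial>mu)"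
      using k_nonneg G0 by (subst nn_integral_mu_lborel) (auto simp: ennreal_mult)
    also have "\<dots> = (\<integral>\<^sup>+z. ennreal (\<bar>dif u z\<bar> powr p) * indicator (U \<times> U) z + ennreal M * (ennreal ((\<bar>u (fst z)\<bar> + \<bar>u (snd z)\<bar> + 0) powr (p - 1)) * indicator (outs (C \<union> C') U) z) \<partial>mu)"
      using M0 by (intro nn_integral_cong) (auto simp: G_def ennreal_plus[symmetric] ennreal_mult[symmetric] simp del: ennreal_plus split: split_indicator)
    also have "\<dots> = energy u (U \<times> U) + ennreal M * (\<integral>\<^sup>+z. ennreal ((\<bar>u (fst z)\<bar> + \<bar>u (snd z)\<bar> + 0) powr (p - 1)) * indicator (outs (C \<union> C') U) z \<partial>mu)"
      unfolding energy_def by (simp add: nn_integral_add nn_integral_cmult del: add_0_right)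
    also have "\<dots> < \<infinity>"
      using U(3) outs_finite[OF CC(1) U(1,2), where u = u and M = 0] u by (auto simp: loc_energy_def ennreal_mult_less_top)
    finally show "(\<integral>\<^sup>+z. ennreal (k (fst z) (snd z) * G z) \<partial>lborel) < \<infinity>" .
  qed (use k_nonneg G0 in auto)
  define H where "H \<zeta> z = k (fst z) (snd z) * G z + \<Lambda> * (?\<kappa> z * \<bar>dif \<zeta> z\<bar> powr p)" for \<zeta> z
  define f where "f \<zeta> z = k (fst z) (snd z) * wform u \<zeta> z" for \<zeta> z
  have Hm [measurable]: "H \<zeta> \<in> borel_measurable borel" "f \<zeta> \<in> borel_measurable borel" if [measurable]: "\<zeta> \<in> borel_measurable borel" for \<zeta>
    unfolding H_def f_def by measurable
  have ig: "integrable lborel (\<lambda>z. ?\<kappa> z * \<bar>dif \<zeta> z\<bar> powr p)"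
    and igv: "ennreal (\<integral>z. ?\<kappa> z * \<bar>dif \<zeta> z\<bar> powr p \<partial>lborel) = gagliardo p (s * p) \<zeta>"
    if [measurable]: "\<zeta> \<in> borel_measurable borel" and "gagliardo p (s * p) \<zeta> < \<infinity>" for \<zeta>
  proof -
    show i: "integrable lborel (\<lambda>z. ?\<kappa> z * \<bar>dif \<zeta> z\<bar> powr p)"
      by (rule integrableI_nonneg) (use that gagliardo_pair[of \<zeta>] in auto)
    show "ennreal (\<integral>z. ?\<kappa> z * \<bar>dif \<zeta> z\<bar> powr p \<partial>lborel) = gagliardo p (s * p) \<zeta>"
      using nn_integral_eq_integral[OF i] gagliardo_pair[of \<zeta>] that by simp
  qed
  have Eg: "gagliardo p (s * p) (\<eta> i) < \<infinity>" for i using le_less_trans[OF \<eta>g E] .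
  have iH: "integrable lborel (H \<zeta>)" if "\<zeta> \<in> borel_measurable borel" "gagliardo p (s * p) \<zeta> < \<infinity>" for \<zeta>
    unfolding H_def using iG ig[OF that] by auto
  \<comment> \<open>Only this one-sided bound is used; no convergence of the energies of the
    approximants has to be proved.\<close>
  have Hle: "(\<integral>z. H (\<eta> i) z \<partial>lborel) \<le> (\<integral>z. H \<xi> z \<partial>lborel)" for i
  proof -
    have "ennreal (\<integral>z. ?\<kappa> z * \<bar>dif (\<eta> i) z\<bar> powr p \<partial>lborel) \<le> ennreal (\<integral>z. ?\<kappa> z * \<bar>dif \<xi> z\<bar> powr p \<partial>lborel)"
      using igv[OF \<eta>m Eg] igv[of \<xi>] E \<eta>g by simp
    then have "(\<integral>z. ?\<kappa> z * \<bar>dif (\<eta> i) z\<bar> powr p \<partial>lborel) \<le> (\<integral>z. ?\<kappa> z * \<bar>dif \<xi> z\<bar> powr p \<partial>lborel)"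
      by (subst (asm) ennreal_le_iff) auto
    then show ?thesis unfolding H_def using iG ig[OF \<eta>m Eg] ig[of \<xi>] E \<Lambda>_ge by (simp add: mult_left_mono)
  qed
  have if_: "integrable lborel (f \<zeta>)" and intf: "(\<integral>z. f \<zeta> z \<partial>lborel) = (\<integral>z. wform u \<zeta> z \<partial>mu)"
    if "\<zeta> \<in> tests D" for \<zeta>
  proof -
    have [measurable]: "\<zeta> \<in> borel_measurable borel" using that by (simp add: tests_def)
    show "integrable lborel (f \<zeta>)"
      using wform_integrable[OF u that] k_nonneg unfolding mu_def f_def by (subst (asm) integrable_density) auto
    show "(\<integral>z. f \<zeta> z \<partial>lborel) = (\<integral>z. wform u \<zeta> z \<partial>mu)"
      using k_nonneg unfolding mu_def f_def by (subst integral_density) auto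
  qed
  have fH: "\<bar>f \<zeta> z\<bar> \<le> H \<zeta> z" if "\<And>x. \<bar>\<zeta> x\<bar> \<le> M" "\<And>x. x \<notin> C \<union> C' \<Longrightarrow> \<zeta> x = 0" for \<zeta> z
  proof -
    have "\<bar>wform u \<zeta> z\<bar> \<le> G z + \<bar>dif \<zeta> z\<bar> powr p"
      using wform_bound[where \<eta> = \<zeta> and M = M, OF that U(2), where u = u and z = z] by (simp add: G_def)
    then have "\<bar>f \<zeta> z\<bar> \<le> k (fst z) (snd z) * (G z + \<bar>dif \<zeta> z\<bar> powr p)"
      using k_nonneg unfolding f_def by (simp add: abs_mult mult_left_mono)
    also have "\<dots> \<le> H \<zeta> z"
      using mult_right_mono[OF k_upper[of "fst z" "snd z"], of "\<bar>dif \<zeta> z\<bar> powr p"] by (simp add: H_def algebra_simps)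
    finally show ?thesis .
  qed
  have fH\<eta>: "\<bar>f (\<eta> i) z\<bar> \<le> H (\<eta> i) z" for i z
    using \<eta>0 \<eta>M C'(3) by (intro fH) auto
  have nn\<eta>: "0 \<le> H (\<eta> i) z - f (\<eta> i) z" for i z using fH\<eta>[of i z] by linarith
  have fH\<xi>: "\<bar>f \<xi> z\<bar> \<le> H \<xi> z" for z using M C(3) by (intro fH) auto
  have nn\<xi>: "0 \<le> H \<xi> z - f \<xi> z" for z using fH\<xi>[of z] by linarith
  \<comment> \<open>Fatou for the nonnegative functions \<open>H - f\<close>. Since the integrals of
    \<open>f (\<eta> i)\<close> are nonnegative, the liminf is at most the integral of
    \<open>H \<xi>\<close>; cancelling this finite number leaves the claim for
    \<open>f \<xi>\<close>.\<close>
  have "(\<integral>\<^sup>+z. ennreal (H \<xi> z - f \<xi> z) \<partial>lborel) \<le> (\<integral>\<^sup>+z. liminf (\<lambda>i. ennreal (H (\<eta> i) z - f (\<eta> i) z)) \<partial>lborel)"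
  proof (rule nn_integral_mono_AE)
    show "AE z in lborel. ennreal (H \<xi> z - f \<xi> z) \<le> liminf (\<lambda>i. ennreal (H (\<eta> i) z - f (\<eta> i) z))"
      using AE_lborel_fst_snd[OF lim]
    proof eventually_elim
      case (elim z)
      then have d: "(\<lambda>i. dif (\<eta> i) z) \<longlonglongrightarrow> dif \<xi> z" unfolding dif_def by (auto intro: tendsto_diff)
      have "(\<lambda>i. H (\<eta> i) z - f (\<eta> i) z) \<longlonglongrightarrow> H \<xi> z - f \<xi> z"
        unfolding H_def f_def wform_def using p_gt d by (intro tendsto_intros tendsto_powr') auto
      then have "(\<lambda>i. ennreal (H (\<eta> i) z - f (\<eta> i) z)) \<longlonglongrightarrow> ennreal (H \<xi> z - f \<xi> z)" by (rule tendsto_ennrealI)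
      then show ?case by (simp add: lim_imp_Liminf)
    qed
  qed
  also have "\<dots> \<le> liminf (\<lambda>i. \<integral>\<^sup>+z. ennreal (H (\<eta> i) z - f (\<eta> i) z) \<partial>lborel)"
    by (rule nn_integral_liminf) measurable
  also have "\<dots> \<le> liminf (\<lambda>i::nat. ennreal (\<integral>z. H \<xi> z \<partial>lborel))"
  proof (rule Liminf_mono, rule always_eventually, rule allI)
    fix i
    have "(\<integral>\<^sup>+z. ennreal (H (\<eta> i) z - f (\<eta> i) z) \<partial>lborel) = ennreal (\<integral>z. H (\<eta> i) z - f (\<eta> i) z \<partial>lborel)"
      using nn\<eta> iH[OF \<eta>m Eg] if_[OF \<eta>t] by (intro nn_integral_eq_integral) auto
    also have "0 \<le> (\<integral>z. wform u (\<eta> i) z \<partial>mu)" by (rule sm[OF \<eta>t ck \<eta>0])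
    then have "(\<integral>z. H (\<eta> i) z - f (\<eta> i) z \<partial>lborel) \<le> (\<integral>z. H \<xi> z \<partial>lborel)"
      using iH[OF \<eta>m Eg] if_[OF \<eta>t] intf[OF \<eta>t] Hle[of i] by simp
    finally show "(\<integral>\<^sup>+z. ennreal (H (\<eta> i) z - f (\<eta> i) z) \<partial>lborel) \<le> ennreal (\<integral>z. H \<xi> z \<partial>lborel)"
      by (simp add: ennreal_leI)
  qed
  also have "\<dots> = ennreal (\<integral>z. H \<xi> z \<partial>lborel)" by (simp add: Liminf_const)
  finally have "ennreal (\<integral>z. H \<xi> z - f \<xi> z \<partial>lborel) \<le> ennreal (\<integral>z. H \<xi> z \<partial>lborel)"
    using nn_integral_eq_integral[of lborel "\<lambda>z. H \<xi> z - f \<xi> z"] iH[of \<xi>] E if_[OF \<xi>] nn\<xi> by simp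
  moreover have "0 \<le> (\<integral>z. H \<xi> z \<partial>lborel)"
    using fH\<xi> order_trans[OF abs_ge_zero fH\<xi>] by (intro integral_nonneg_AE) auto
  ultimately have "(\<integral>z. H \<xi> z - f \<xi> z \<partial>lborel) \<le> (\<integral>z. H \<xi> z \<partial>lborel)"
    by (subst (asm) ennreal_le_iff) auto
  then show "0 \<le> (\<integral>z. wform u \<xi> z \<partial>mu)"
    using iH[of \<xi>] E if_[OF \<xi>] intf[OF \<xi>] by simp
qed

end

section \<open>Truncated subsolutions\<close>

definition cutdown :: "'a set \<Rightarrow> ('a \<Rightarrow> real) \<Rightarrow> real \<Rightarrow> real \<Rightarrow> 'a \<Rightarrow> real"
  where "cutdown \<Omega> h e K x = (if x \<in> \<Omega> then h x - 2 * e else min (h x) K - e)"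

lemma cutdown_measurable [measurable]:
  assumes [measurable]: "h \<in> borel_measurable borel" "\<Omega> \<in> sets borel"
  shows "cutdown \<Omega> h e K \<in> borel_measurable borel"
  unfolding cutdown_def[abs_def] by measurable

lemma integral_nonpos_of_parts:
  fixes f :: "'a \<Rightarrow> real"
  assumes f: "integrable M f" and le: "(\<integral>\<^sup>+x. ennreal (f x) \<partial>M) \<le> (\<integral>\<^sup>+x. ennreal (- f x) \<partial>M)"
  shows "(\<integral>x. f x \<partial>M) \<le> 0"
proof -
  have "(\<integral>\<^sup>+x. ennreal (- f x) \<partial>M) < \<infinity>"
    using f by (auto simp: real_integrable_def less_top)
  then have "enn2real (\<integral>\<^sup>+x. ennreal (f x) \<partial>M) \<le> enn2real (\<integral>\<^sup>+x. ennreal (- f x) \<partial>M)"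
    using le by (intro enn2real_mono) auto
  then show ?thesis using f by (simp add: real_lebesgue_integral_def)
qed

context frac_kernel
begin

lemma loc_energyD:
  assumes "loc_energy u D" shows "u \<in> borel_measurable borel" "tailf u"
  using assms by (simp_all add: loc_energy_def)

lemma wform_swap: "wform u \<eta> (y, x) = wform u \<eta> (x, y)"
proof -
  have "phi p (u y - u x) = - phi p (u x - u y)" using phi_minus[of p "u x - u y"] by simp
  then show ?thesis by (simp add: wform_def algebra_simps)
qed

lemma cutdown_loc_energy:
  assumes \<Omega>: "open \<Omega>" and h: "loc_energy h \<Omega>" and e: "0 < e" and K: "0 \<le> K"
  shows "loc_energy (cutdown \<Omega> h e K) \<Omega>"
proof -
  have [measurable]: "h \<in> borel_measurable borel" "\<Omega> \<in> sets borel" using loc_energyD h \<Omega> by auto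
  have "tailf (cutdown \<Omega> h e K)"
    by (rule tailf_bounded[of h _ "2 * e"]) (use loc_energyD(2)[OF h] e K in \<open>auto simp: cutdown_def min_def\<close>)
  moreover have "energy (cutdown \<Omega> h e K) (U \<times> U) = energy h (U \<times> U)" if "U \<subseteq> \<Omega>" for U
    unfolding energy_def using that by (intro nn_integral_cong) (auto simp: cutdown_def dif_def indicator_def)
  moreover have "cutdown \<Omega> h e K \<in> borel_measurable borel" by measurable
  ultimately show ?thesis using h unfolding loc_energy_def by metis
qed

text \<open>Inside \<open>\<Omega>\<close> nothing is changed up to a constant. Seen from inside, lowering the inner values
  by an extra \<open>e\<close> costs a fixed amount, which for large \<open>K\<close> outweighs the effect of the truncation.\<close>

theorem cutdown_subsolution:
  assumes \<Omega>: "open \<Omega>" "bounded \<Omega>" and h: "loc_energy h \<Omega>" "wsuper (\<lambda>x. - h x) \<Omega>"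
    and m: "\<And>x. x \<in> \<Omega> \<Longrightarrow> \<bar>h x\<bar> \<le> m" and e: "0 < e" and C0: "compact C0" "C0 \<subseteq> \<Omega>"
  obtains K where "0 \<le> K" "wsuper (\<lambda>x. - cutdown \<Omega> h e K x) C0"
proof -
  have [measurable]: "h \<in> borel_measurable borel" "\<Omega> \<in> sets borel" using loc_energyD h \<Omega> by auto
  obtain c where c: "0 < c" "\<And>x y. x \<in> C0 \<Longrightarrow> y \<notin> \<Omega> \<Longrightarrow> k x y \<le> c * tailw y"
    using sep_kernel_bound[OF C0(1) \<Omega>(1) C0(2)] by blast
  \<comment> \<open>Bounded pieces of the complement on which h is bounded too. They exhaust a set
    of infinite measure, so one of them has positive measure; the gain comes from interactions with
    that piece.\<close>
  define Ys where "Ys j = {y. y \<notin> \<Omega> \<and> \<bar>h y\<bar> \<le> real j \<and> norm y \<le> real j}" for j :: nat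
  have [measurable]: "Ys j \<in> sets borel" for j unfolding Ys_def by measurable
  have "\<exists>j. emeasure lborel (Ys j) \<noteq> 0"
  proof (rule ccontr)
    assume "\<not> ?thesis"
    then have "emeasure lborel (\<Union>j. Ys j) = 0" by (intro emeasure_UN_eq_0) auto
    moreover have "(\<Union>j. Ys j) = - \<Omega>"
    proof safe
      fix y assume "y \<notin> \<Omega>"
      moreover obtain j :: nat where "max \<bar>h y\<bar> (norm y) \<le> real j" using real_arch_simple by blast
      ultimately show "y \<in> (\<Union>j. Ys j)" by (auto simp: Ys_def)
    qed (auto simp: Ys_def)
    ultimately show False using emeasure_Compl_bounded[OF \<Omega>(2)] by simp
  qed
  then obtain j where j: "emeasure lborel (Ys j) \<noteq> 0" by blast
  obtain m0 where m0: "0 < m0" "\<And>x. x \<in> C0 \<Longrightarrow> norm x \<le> m0"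
    using compact_imp_bounded[OF C0(1)] by (auto simp: bounded_pos)
  let ?e = "- (s * p) - real DIM('a)"
  \<comment> \<open>A lower bound for the kernel between \<open>C0\<close> and \<open>Ys j\<close>,
    from the largest distance that can occur.\<close>
  define c' where "c' = (m0 + real j) powr ?e / \<Lambda>"
  have c': "0 < c'" using m0 \<Lambda>_ge by (auto simp: c'_def)
  have klow: "c' \<le> k x y" if "x \<in> C0" "y \<in> Ys j" for x y
  proof -
    have "norm (x - y) \<le> m0 + real j" using that m0(2)[of x] norm_triangle_ineq4[of x y] by (auto simp: Ys_def)
    moreover have "x \<noteq> y" using that C0(2) by (auto simp: Ys_def)
    ultimately have "(m0 + real j) powr ?e \<le> norm (x - y) powr ?e" using sp_pos by (intro powr_mono2') auto
    then have "c' \<le> norm (x - y) powr ?e / \<Lambda>" using \<Lambda>_ge by (simp add: c'_def divide_right_mono)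
    then show ?thesis using k_lower[of x y] by linarith
  qed
  obtain \<kappa> where \<kappa>: "0 < \<kappa>" "\<And>a. \<bar>a\<bar> \<le> m + real j \<Longrightarrow> phi p (a - e) \<le> phi p a - \<kappa>"
    using phi_gap[OF p_gt e] by blast
  define m' where "m' = max m 0"
  have m': "0 \<le> m'" "\<And>x. x \<in> \<Omega> \<Longrightarrow> \<bar>h x\<bar> \<le> m'" using m by (auto simp: m'_def intro: order_trans max.coboundedI1)
  \<comment> \<open>Bounds, up to a constant factor, the effect at points of \<open>C0\<close> of
    truncating h at height i outside \<Omega>. By dominated convergence its integral tends to 0,
    whereas the gain does not depend on i.\<close>
  define Fi where "Fi i y = ennreal ((\<bar>h y\<bar> + m') powr (p - 1) * tailw y) * indicator {y. y \<notin> \<Omega> \<and> real i < h y} y" for i y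
  have [measurable]: "Fi i \<in> borel_measurable borel" for i unfolding Fi_def by measurable
  have "(\<lambda>i. \<integral>\<^sup>+y. Fi i y \<partial>lborel) \<longlonglongrightarrow> (\<integral>\<^sup>+y. 0 \<partial>(lborel :: 'a measure))"
  proof (rule nn_integral_dominated_convergence[where w = "\<lambda>y. ennreal ((\<bar>h y\<bar> + m') powr (p - 1) * tailw y)"])
    have "tailf (\<lambda>y. \<bar>h y\<bar> + m')" by (rule tailf_bounded[of h _ m']) (use loc_energyD(2)[OF h(1)] m' in auto)
    then show "(\<integral>\<^sup>+y. ennreal ((\<bar>h y\<bar> + m') powr (p - 1) * tailw y) \<partial>lborel) < \<infinity>" using m' by (simp add: tailf_def)
    show "AE y in lborel. (\<lambda>i. Fi i y) \<longlonglongrightarrow> 0"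
    proof (rule AE_I2)
      fix y
      obtain i0 :: nat where "h y \<le> real i0" using real_arch_simple by blast
      then have "Fi i y = 0" if "i0 \<le> i" for i using that by (auto simp: Fi_def)
      then have "eventually (\<lambda>i. Fi i y = 0) sequentially" unfolding eventually_sequentially by blast
      then show "(\<lambda>i. Fi i y) \<longlonglongrightarrow> 0" by (rule tendsto_eventually)
    qed
    show "AE y in lborel. Fi i y \<le> ennreal ((\<bar>h y\<bar> + m') powr (p - 1) * tailw y)" for i
      by (auto simp: Fi_def indicator_def)
  qed auto
  then have "(\<lambda>i. ennreal c * (\<integral>\<^sup>+y. Fi i y \<partial>lborel)) \<longlonglongrightarrow> ennreal c * 0"
    by (intro ennreal_tendsto_cmult) auto
  moreover have "ennreal c * 0 < ennreal (\<kappa> * c') * emeasure lborel (Ys j)"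
    using j \<kappa> c' by (simp add: ennreal_zero_less_mult_iff zero_less_iff_neq_zero)
  ultimately have "eventually (\<lambda>i. ennreal c * (\<integral>\<^sup>+y. Fi i y \<partial>lborel) < ennreal (\<kappa> * c') * emeasure lborel (Ys j)) sequentially"
    by (rule order_tendstoD)
  then obtain i0 where i0: "\<And>i. i0 \<le> i \<Longrightarrow> ennreal c * (\<integral>\<^sup>+y. Fi i y \<partial>lborel) < ennreal (\<kappa> * c') * emeasure lborel (Ys j)"
    unfolding eventually_sequentially by blast
  obtain i1 :: nat where i1: "m' \<le> real i1" using real_arch_simple by blast
  \<comment> \<open>Three demands on the height: from \<open>i0\<close> on the truncation costs less
    than the gain; \<open>i1\<close> puts it above all values of h in \<Omega>, which makes
    \<open>phi p (h x - e - real i)\<close> nonpositive; j keeps \<open>Ys j\<close> untouched by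
    the truncation.\<close>
  define i where "i = max (max i0 i1) j"
  have i: "ennreal c * (\<integral>\<^sup>+y. Fi i y \<partial>lborel) \<le> ennreal (\<kappa> * c') * emeasure lborel (Ys j)" "m' \<le> real i" "real j \<le> real i"
    using i0[of i] i1 by (auto simp: i_def less_imp_le)
  let ?w = "cutdown \<Omega> h e (real i)"
  have wl: "loc_energy ?w \<Omega>" by (rule cutdown_loc_energy[OF \<Omega>(1) h(1) e]) simp
  have "(\<integral>z. wform ?w \<eta> z \<partial>mu) \<le> 0" if \<eta>: "\<eta> \<in> tests C0" "\<And>x. 0 \<le> \<eta> x" for \<eta>
  proof -
    have \<eta>\<Omega>: "\<eta> \<in> tests \<Omega>" using \<eta>(1) tests_mono[OF C0(2)] by blast
    have [measurable]: "\<eta> \<in> borel_measurable borel" using \<eta> by (simp add: tests_def)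
    have \<eta>0: "\<eta> x = 0" if "x \<notin> C0" for x using \<eta>(1) that by (auto simp: tests_def)
    define R where "R z = wform ?w \<eta> z - wform h \<eta> z" for z
    have iR: "integrable mu R" unfolding R_def[abs_def]
      using wform_integrable[OF wl \<eta>\<Omega>] wform_integrable[OF h(1) \<eta>\<Omega>] by simp
    \<comment> \<open>For x in \<Omega> and y outside, P bounds the increase of the weak form from
      above and Q its decrease from below. The opposite orientation is obtained by swapping, since
      the form is symmetric.\<close>
    define P where "P z = ennreal (\<eta> (fst z) * (\<bar>h (snd z)\<bar> + m') powr (p - 1)) * indicator {y. y \<notin> \<Omega> \<and> real i < h y} (snd z)" for z
    define Q where "Q z = ennreal (\<kappa> * \<eta> (fst z)) * indicator (Ys j) (snd z)" for z :: "'a \<times> 'a"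
    have [measurable]: "P \<in> borel_measurable borel" "Q \<in> borel_measurable borel" unfolding P_def[abs_def] Q_def[abs_def] by measurable
    have Rsw: "R (y, x) = R (x, y)" for x y by (simp add: R_def wform_swap)
    \<comment> \<open>Inside \<Omega> both points are shifted by the same constant; outside, the
      test function vanishes.\<close>
    have R0: "R (x, y) = 0" if "x \<in> \<Omega> \<longleftrightarrow> y \<in> \<Omega>" for x y
    proof (cases "x \<in> \<Omega>")
      case True then show ?thesis using that by (simp add: R_def wform_def cutdown_def)
    next
      case False
      then have "\<eta> x = 0" "\<eta> y = 0" using that C0(2) \<eta>0 by blast+
      then show ?thesis by (simp add: R_def wform_def)
    qed
    have Rx: "ennreal (R (x, y)) \<le> P (x, y)" "Q (x, y) \<le> ennreal (- R (x, y))"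
      if xy: "x \<in> \<Omega>" "y \<notin> \<Omega>" for x y
    proof -
      have "\<eta> y = 0" using xy C0(2) \<eta>0 by blast
      then have Req: "R (x, y) = (phi p (h x - e - min (h y) (real i)) - phi p (h x - h y)) * \<eta> x"
        using xy by (simp add: R_def wform_def cutdown_def left_diff_distrib algebra_simps)
      show "ennreal (R (x, y)) \<le> P (x, y)"
      proof (cases "real i < h y")
        case True
        have "phi p (h x - e - real i) \<le> phi p 0" using m'(2)[OF xy(1)] i(2) e by (intro phi_mono[OF p_gt]) auto
        then have 1: "phi p (h x - e - real i) \<le> 0" by simp
        have "- phi p (h x - h y) \<le> \<bar>h x - h y\<bar> powr (p - 1)" using abs_phi[of p "h x - h y"] by linarith
        also have "\<dots> \<le> (\<bar>h y\<bar> + m') powr (p - 1)" using m'(2)[OF xy(1)] p_gt by (intro powr_mono2) auto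
        finally have "phi p (h x - e - min (h y) (real i)) - phi p (h x - h y) \<le> (\<bar>h y\<bar> + m') powr (p - 1)"
          using 1 True by (simp add: min_def)
        then have "R (x, y) \<le> (\<bar>h y\<bar> + m') powr (p - 1) * \<eta> x" unfolding Req using \<eta>(2) by (intro mult_right_mono) auto
        then show ?thesis using True xy by (simp add: P_def ennreal_leI mult.commute)
      next
        case False
        have "phi p (h x - e - h y) \<le> phi p (h x - h y)" using e by (intro phi_mono[OF p_gt]) auto
        then have "R (x, y) \<le> 0" unfolding Req using \<eta>(2)[of x] False by (intro mult_nonpos_nonneg) (auto simp: min_def)
        then show ?thesis by (simp add: ennreal_neg)
      qed
      show "Q (x, y) \<le> ennreal (- R (x, y))"
      proof (cases "y \<in> Ys j")
        case True
        then have hy: "\<bar>h y\<bar> \<le> real j" by (simp add: Ys_def)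
        have "phi p (h x - h y - e) \<le> phi p (h x - h y) - \<kappa>" using m[OF xy(1)] hy by (intro \<kappa>(2)) auto
        moreover have "min (h y) (real i) = h y" using hy i(3) by (simp add: min_def)
        moreover have "h x - e - h y = h x - h y - e" by simp
        ultimately have "phi p (h x - e - min (h y) (real i)) - phi p (h x - h y) \<le> - \<kappa>" by (simp only:)
        then have "R (x, y) \<le> (- \<kappa>) * \<eta> x" unfolding Req using \<eta>(2) by (intro mult_right_mono) auto
        then show ?thesis using True by (simp add: Q_def ennreal_leI)
      qed (simp add: Q_def)
    qed
    have Pz: "P (x, y) = 0" "Q (x, y) = 0" if "x \<notin> \<Omega> \<or> y \<in> \<Omega>" for x y
    proof -
      have "\<eta> x = 0 \<or> y \<in> \<Omega>" using that C0(2) \<eta>0 by blast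
      then show "P (x, y) = 0" "Q (x, y) = 0" by (auto simp: P_def Q_def Ys_def)
    qed
    have up: "ennreal (R z) \<le> P z + P (snd z, fst z)" and lo: "Q z + Q (snd z, fst z) \<le> ennreal (- R z)" for z
    proof -
      obtain x y where z: "z = (x, y)" by (cases z)
      have "ennreal (R z) \<le> P z + P (snd z, fst z) \<and> Q z + Q (snd z, fst z) \<le> ennreal (- R z)"
      proof (cases "x \<in> \<Omega>"; cases "y \<in> \<Omega>")
        assume "x \<in> \<Omega>" "y \<notin> \<Omega>" then show ?thesis using Rx[of x y] Pz[of y x] by (simp add: z)
      next
        assume "x \<notin> \<Omega>" "y \<in> \<Omega>" then show ?thesis using Rx[of y x] Pz[of x y] Rsw[of x y] by (simp add: z)
      qed (use R0[of x y] Pz[of x y] Pz[of y x] in \<open>simp_all add: z\<close>)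
      then show "ennreal (R z) \<le> P z + P (snd z, fst z)" "Q z + Q (snd z, fst z) \<le> ennreal (- R z)" by auto
    qed
    \<comment> \<open>Compared separately for each x: both inner integrals carry the factor
      \<open>\<eta> x\<close>, and what remains is the inequality by which i was chosen.\<close>
    have PQ: "(\<integral>\<^sup>+z. P z \<partial>mu) \<le> (\<integral>\<^sup>+z. Q z \<partial>mu)"
    proof (subst (1 2) nn_integral_mu, measurable, rule nn_integral_mono)
      fix x
      show "(\<integral>\<^sup>+y. ennreal (k x y) * P (x, y) \<partial>lborel) \<le> (\<integral>\<^sup>+y. ennreal (k x y) * Q (x, y) \<partial>lborel)"
      proof (cases "x \<in> C0")
        case True
        have "(\<integral>\<^sup>+y. ennreal (k x y) * P (x, y) \<partial>lborel) \<le> (\<integral>\<^sup>+y. ennreal (c * \<eta> x) * Fi i y \<partial>lborel)"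
        proof (rule nn_integral_mono)
          fix y
          show "ennreal (k x y) * P (x, y) \<le> ennreal (c * \<eta> x) * Fi i y"
          proof (cases "y \<notin> \<Omega> \<and> real i < h y")
            case y: True
            have "k x y * (\<eta> x * (\<bar>h y\<bar> + m') powr (p - 1)) \<le> (c * tailw y) * (\<eta> x * (\<bar>h y\<bar> + m') powr (p - 1))"
              using c(2)[OF True] y \<eta>(2) by (intro mult_right_mono) auto
            also have "\<dots> = c * \<eta> x * ((\<bar>h y\<bar> + m') powr (p - 1) * tailw y)" by simp
            finally show ?thesis using y c(1) \<eta>(2) k_nonneg tailw_pos[of y]
              by (simp add: P_def Fi_def ennreal_mult[symmetric] less_imp_le ennreal_leI)
          qed (auto simp: P_def)
        qed
        also have "\<dots> = ennreal (\<eta> x) * (ennreal c * (\<integral>\<^sup>+y. Fi i y \<partial>lborel))"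
          using c(1) \<eta>(2) by (simp add: nn_integral_cmult ennreal_mult mult_ac less_imp_le)
        also have "\<dots> \<le> ennreal (\<eta> x) * (ennreal (\<kappa> * c') * emeasure lborel (Ys j))"
          by (intro mult_left_mono i) auto
        also have "\<dots> = (\<integral>\<^sup>+y. ennreal (\<kappa> * c' * \<eta> x) * indicator (Ys j) y \<partial>lborel)"
          using \<kappa> c' \<eta>(2) by (subst nn_integral_cmult_indicator) (auto simp: ennreal_mult mult_ac)
        also have "\<dots> \<le> (\<integral>\<^sup>+y. ennreal (k x y) * Q (x, y) \<partial>lborel)"
        proof (rule nn_integral_mono)
          fix y
          show "ennreal (\<kappa> * c' * \<eta> x) * indicator (Ys j) y \<le> ennreal (k x y) * Q (x, y)"
          proof (cases "y \<in> Ys j")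
            case y: True
            have "c' * (\<kappa> * \<eta> x) \<le> k x y * (\<kappa> * \<eta> x)" using klow[OF True y] \<kappa> \<eta>(2) by (intro mult_right_mono) auto
            then have "\<kappa> * c' * \<eta> x \<le> k x y * (\<kappa> * \<eta> x)" by (simp add: mult_ac)
            then show ?thesis using y \<kappa> \<eta>(2) k_nonneg by (simp add: Q_def ennreal_mult[symmetric] ennreal_leI)
          qed simp
        qed
        finally show ?thesis .
      next
        case False then show ?thesis using \<eta>0[OF False] by (simp add: P_def Q_def)
      qed
    qed
    have "(\<integral>\<^sup>+z. ennreal (R z) \<partial>mu) \<le> (\<integral>\<^sup>+z. P z + P (snd z, fst z) \<partial>mu)"
      by (intro nn_integral_mono up)
    also have "\<dots> = (\<integral>\<^sup>+z. P z \<partial>mu) + (\<integral>\<^sup>+z. P z \<partial>mu)"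
      by (subst nn_integral_add) (auto simp: nn_integral_mu_swap)
    also have "\<dots> \<le> (\<integral>\<^sup>+z. Q z \<partial>mu) + (\<integral>\<^sup>+z. Q z \<partial>mu)" by (intro add_mono PQ)
    also have "\<dots> = (\<integral>\<^sup>+z. Q z + Q (snd z, fst z) \<partial>mu)"
      by (subst nn_integral_add) (auto simp: nn_integral_mu_swap)
    also have "\<dots> \<le> (\<integral>\<^sup>+z. ennreal (- R z) \<partial>mu)" by (intro nn_integral_mono lo)
    finally have "(\<integral>z. R z \<partial>mu) \<le> 0" by (rule integral_nonpos_of_parts[OF iR])
    moreover have "(\<integral>z. R z \<partial>mu) = (\<integral>z. wform ?w \<eta> z \<partial>mu) - (\<integral>z. wform h \<eta> z \<partial>mu)"
      unfolding R_def using wform_integrable[OF wl \<eta>\<Omega>] wform_integrable[OF h(1) \<eta>\<Omega>] by simp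
    ultimately show ?thesis using wsuper_uminusD[OF h(2) \<eta>\<Omega> \<eta>(2)] by linarith
  qed
  then have "wsuper (\<lambda>x. - ?w x) C0"
    unfolding wsuper_def by (auto simp: wform_uminus[abs_def])
  then show ?thesis using that[of "real i"] by simp
qed

end

section \<open>The obstacle problem\<close>

primrec runmax :: "(nat \<Rightarrow> 'a \<Rightarrow> real) \<Rightarrow> nat \<Rightarrow> nat \<Rightarrow> 'a \<Rightarrow> real"
  where
    "runmax Z m 0 x = Z m x"
  | "runmax Z m (Suc l) x = max (runmax Z m l x) (Z (m + Suc l) x)"

lemma runmax_shift: "runmax Z (Suc m) l x \<le> runmax Z m (Suc l) x"
  by (induction l) (auto intro: max.mono max.coboundedI1)

lemma runmax_measurable [measurable]:
  assumes [measurable]: "\<And>i. Z i \<in> borel_measurable M"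
  shows "runmax Z m l \<in> borel_measurable M"
proof (induction l)
  case (Suc l)
  note Suc [measurable]
  show ?case unfolding runmax.simps by measurable
qed simp

lemma runmax_bounds:
  assumes "\<And>i. a \<le> Z i x \<and> Z i x \<le> b" shows "a \<le> runmax Z m l x \<and> runmax Z m l x \<le> b"
  using assms by (induction l) (auto intro: max.coboundedI1)

context frac_kernel
begin

text \<open>The energy difference is kept finite by subtracting the energy density of \<open>w\<close>, since \<open>w\<close> is only
  locally of finite energy.\<close>

definition ediff :: "('a \<Rightarrow> real) \<Rightarrow> ('a \<Rightarrow> real) \<Rightarrow> 'a \<times> 'a \<Rightarrow> real"
  where "ediff w \<zeta> z = \<bar>dif w z + dif \<zeta> z\<bar> powr p - \<bar>dif w z\<bar> powr p"

lemma ediff_measurable [measurable]: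
  assumes [measurable]: "w \<in> borel_measurable borel" "\<zeta> \<in> borel_measurable borel"
  shows "ediff w \<zeta> \<in> borel_measurable borel"
  unfolding ediff_def[abs_def] by measurable

text \<open>A bound for the negative part of \<open>ediff w \<zeta>\<close> common to all \<zeta>
  supported in C with values of size at most M. Adding it turns the energy difference into a
  nonnegative integrand.\<close>

definition edom :: "('a \<Rightarrow> real) \<Rightarrow> real \<Rightarrow> 'a set \<Rightarrow> 'a set \<Rightarrow> 'a \<times> 'a \<Rightarrow> real"
  where "edom w M C U z = \<bar>dif w z\<bar> powr p * indicator (U \<times> U) z
    + p * M * ((\<bar>w (fst z)\<bar> + \<bar>w (snd z)\<bar> + M) powr (p - 1) * indicator (outs C U) z)"

lemma edom_measurable [measurable]:
  assumes [measurable]: "w \<in> borel_measurable borel" "C \<in> sets borel" "U \<in> sets borel"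
  shows "edom w M C U \<in> borel_measurable borel"
  unfolding edom_def[abs_def] by measurable

lemma edom_nonneg: "0 \<le> M \<Longrightarrow> 0 \<le> edom w M C U z"
  using p_gt by (simp add: edom_def)

lemma edom_integrable:
  assumes C: "compact C" and U: "open U" "C \<subseteq> U" "energy w (U \<times> U) < \<infinity>" and w: "w \<in> borel_measurable borel" "tailf w"
    and M: "0 \<le> M"
  shows "integrable mu (edom w M C U)"
proof (rule integrableI_nonneg)
  have [measurable]: "w \<in> borel_measurable borel" "C \<in> sets borel" "U \<in> sets borel" using C U w by (auto simp: borel_compact)
  show "edom w M C U \<in> borel_measurable mu" by measurable
  have "(\<integral>\<^sup>+z. ennreal (edom w M C U z) \<partial>mu) = (\<integral>\<^sup>+z. ennreal (\<bar>dif w z\<bar> powr p) * indicator (U \<times> U) z + ennreal (p * M) * (ennreal ((\<bar>w (fst z)\<bar> + \<bar>w (snd z)\<bar> + M) powr (p - 1)) * indicator (outs C U) z) \<partial>mu)"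
    using M p_gt by (intro nn_integral_cong) (auto simp: edom_def ennreal_plus[symmetric] ennreal_mult[symmetric] simp del: ennreal_plus split: split_indicator)
  also have "\<dots> = energy w (U \<times> U) + ennreal (p * M) * (\<integral>\<^sup>+z. ennreal ((\<bar>w (fst z)\<bar> + \<bar>w (snd z)\<bar> + M) powr (p - 1)) * indicator (outs C U) z \<partial>mu)"
    unfolding energy_def by (simp add: nn_integral_add nn_integral_cmult)
  also have "\<dots> < \<infinity>"
    using U(3) outs_finite[OF C U(1,2) w M] by (auto simp: ennreal_mult_less_top)
  finally show "(\<integral>\<^sup>+z. ennreal (edom w M C U z) \<partial>mu) < \<infinity>" .
qed (auto intro!: AE_I2 edom_nonneg M)

lemma support_cases:
  assumes "C \<subseteq> U" "\<And>x. x \<notin> C \<Longrightarrow> \<zeta> x = 0" "\<And>x. \<bar>\<zeta> x\<bar> \<le> M"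
  obtains "z \<in> U \<times> U" | "dif \<zeta> z = 0" "z \<notin> U \<times> U" | "z \<in> outs C U" "z \<notin> U \<times> U" "\<bar>dif \<zeta> z\<bar> \<le> M"
proof -
  obtain x y where z: "z = (x, y)" by (cases z)
  consider "x \<in> U" "y \<in> U" | "x \<notin> C" "y \<notin> C" "\<not> (x \<in> U \<and> y \<in> U)" | "(x, y) \<in> outs C U" "\<not> (x \<in> U \<and> y \<in> U)"
    using assms(1) unfolding outs_def by blast
  then show ?thesis
  proof cases
    case 1 then show ?thesis using that(1) by (simp add: z)
  next
    case 2 then show ?thesis using that(2) assms(2) by (auto simp: z)
  next
    case 3
    then have "\<zeta> x = 0 \<or> \<zeta> y = 0" using assms by blast
    then have "\<bar>dif \<zeta> z\<bar> \<le> M" using assms(3)[of x] assms(3)[of y] by (auto simp: z)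
    then show ?thesis using that(3) 3 by (simp add: z)
  qed
qed

lemma ediff_bounds:
  assumes C: "C \<subseteq> U" "\<And>x. x \<notin> C \<Longrightarrow> \<zeta> x = 0" "\<And>x. \<bar>\<zeta> x\<bar> \<le> M"
  shows "- edom w M C U z \<le> ediff w \<zeta> z"
    and "\<bar>ediff w \<zeta> z\<bar> \<le> 2 powr p * \<bar>dif \<zeta> z\<bar> powr p + (2 powr p + 1) * edom w M C U z"
proof -
  have M0: "0 \<le> M" using C(3)[of undefined] by linarith
  have "- edom w M C U z \<le> ediff w \<zeta> z \<and> \<bar>ediff w \<zeta> z\<bar> \<le> 2 powr p * \<bar>dif \<zeta> z\<bar> powr p + (2 powr p + 1) * edom w M C U z"
  proof (rule support_cases[where \<zeta> = \<zeta> and M = M and z = z, OF C])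
    assume z: "z \<in> U \<times> U"
    have e: "\<bar>dif w z\<bar> powr p \<le> edom w M C U z" using z M0 p_gt by (simp add: edom_def)
    have "\<bar>dif w z + dif \<zeta> z\<bar> powr p \<le> (\<bar>dif w z\<bar> + \<bar>dif \<zeta> z\<bar>) powr p" using p_gt by (intro powr_mono2) auto
    also have "\<dots> \<le> 2 powr p * (\<bar>dif w z\<bar> powr p + \<bar>dif \<zeta> z\<bar> powr p)" using p_gt by (intro powr_add2_le) auto
    finally have 1: "\<bar>dif w z + dif \<zeta> z\<bar> powr p \<le> 2 powr p * \<bar>dif w z\<bar> powr p + 2 powr p * \<bar>dif \<zeta> z\<bar> powr p" by (simp add: distrib_left)
    have "2 powr p * \<bar>dif w z\<bar> powr p \<le> 2 powr p * edom w M C U z" using e by (intro mult_left_mono) auto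
    moreover have "0 \<le> \<bar>dif w z\<bar> powr p" "0 \<le> \<bar>dif w z + dif \<zeta> z\<bar> powr p" "0 \<le> 2 powr p * \<bar>dif \<zeta> z\<bar> powr p" "0 \<le> 2 powr p * \<bar>dif w z\<bar> powr p" by simp_all
    ultimately show ?thesis using 1 e unfolding ediff_def abs_le_iff distrib_right by (intro conjI; linarith)
  next
    assume "dif \<zeta> z = 0"
    then show ?thesis using edom_nonneg[OF M0] by (simp add: ediff_def add_nonneg_nonneg)
  next
    assume z: "z \<in> outs C U" "z \<notin> U \<times> U" "\<bar>dif \<zeta> z\<bar> \<le> M"
    have dw: "\<bar>dif w z\<bar> \<le> \<bar>w (fst z)\<bar> + \<bar>w (snd z)\<bar>" by (simp add: dif_def)
    have "\<bar>ediff w \<zeta> z\<bar> \<le> p * \<bar>dif \<zeta> z\<bar> * (\<bar>dif w z\<bar> + \<bar>dif \<zeta> z\<bar>) powr (p - 1)"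
      unfolding ediff_def by (rule abs_powr_diff_bound[OF p_gt])
    also have "\<dots> \<le> p * M * (\<bar>w (fst z)\<bar> + \<bar>w (snd z)\<bar> + M) powr (p - 1)"
      using z dw p_gt M0 by (intro mult_mono powr_mono2) auto
    also have "\<dots> = edom w M C U z" using z by (simp add: edom_def)
    finally have 1: "\<bar>ediff w \<zeta> z\<bar> \<le> edom w M C U z" .
    moreover have "edom w M C U z \<le> (2 powr p + 1) * edom w M C U z"
      using edom_nonneg[OF M0, of w C U z] by (simp add: distrib_right)
    ultimately show ?thesis by (smt (verit) mult_nonneg_nonneg powr_ge_zero)
  qed
  then show "- edom w M C U z \<le> ediff w \<zeta> z"
    "\<bar>ediff w \<zeta> z\<bar> \<le> 2 powr p * \<bar>dif \<zeta> z\<bar> powr p + (2 powr p + 1) * edom w M C U z" by auto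
qed

lemma integrable_energy:
  assumes [measurable]: "\<zeta> \<in> borel_measurable borel" and E: "energy \<zeta> UNIV < \<infinity>"
  shows "integrable mu (\<lambda>z. \<bar>dif \<zeta> z\<bar> powr p)"
  by (rule integrableI_nonneg) (use E in \<open>auto simp: energy_def\<close>)

lemma ediff_integrable:
  assumes C: "compact C" and U: "open U" "C \<subseteq> U" "energy w (U \<times> U) < \<infinity>" and w: "w \<in> borel_measurable borel" "tailf w"
    and \<zeta>: "\<zeta> \<in> borel_measurable borel" "\<And>x. x \<notin> C \<Longrightarrow> \<zeta> x = 0" "\<And>x. \<bar>\<zeta> x\<bar> \<le> M" "energy \<zeta> UNIV < \<infinity>"
  shows "integrable mu (ediff w \<zeta>)"
proof (rule Bochner_Integration.integrable_bound)
  have M0: "0 \<le> M" using \<zeta>(3)[of undefined] by linarith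
  show "integrable mu (\<lambda>z. 2 powr p * \<bar>dif \<zeta> z\<bar> powr p + (2 powr p + 1) * edom w M C U z)"
    using integrable_energy[OF \<zeta>(1,4)] edom_integrable[OF C U w M0] by auto
  show "ediff w \<zeta> \<in> borel_measurable mu" using w \<zeta> by measurable
  show "AE z in mu. norm (ediff w \<zeta> z) \<le> norm (2 powr p * \<bar>dif \<zeta> z\<bar> powr p + (2 powr p + 1) * edom w M C U z)"
    using ediff_bounds(2)[where \<zeta> = \<zeta> and M = M and w = w, OF U(2) \<zeta>(2,3)] by (intro AE_I2) (auto intro: order_trans[OF _ abs_ge_self])
qed

definition obst :: "real \<Rightarrow> 'a set \<Rightarrow> ('a \<Rightarrow> real) set"
  where "obst e D = {\<zeta>. \<zeta> \<in> borel_measurable borel \<and> (\<forall>x. 0 \<le> \<zeta> x \<and> \<zeta> x \<le> e) \<and> (\<forall>x. x \<notin> D \<longrightarrow> \<zeta> x = 0)}"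

text \<open>Submodularity turns a minimising sequence into one that is monotone, so no compactness is needed.\<close>

lemma obstacle_minimiser:
  assumes C: "compact C" "D \<subseteq> C" "D \<in> sets borel" and U: "open U" "C \<subseteq> U" "energy w (U \<times> U) < \<infinity>"
    and w: "w \<in> borel_measurable borel" "tailf w" and e: "0 \<le> e"
  obtains \<zeta> where "\<zeta> \<in> obst e D" "energy \<zeta> UNIV < \<infinity>"
    "\<And>\<xi>. \<xi> \<in> obst e D \<Longrightarrow> energy \<xi> UNIV < \<infinity> \<Longrightarrow> (\<integral>z. ediff w \<zeta> z \<partial>mu) \<le> (\<integral>z. ediff w \<xi> z \<partial>mu)"
proof -
  have [measurable]: "w \<in> borel_measurable borel" "C \<in> sets borel" "U \<in> sets borel" using C U w by (auto simp: borel_compact)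
  let ?g = "edom w e C U"
  \<comment> \<open>The shift by the integrable \<open>edom\<close> does not affect minimisers and
    makes Fatou's lemma available.\<close>
  define F where "F \<zeta> = (\<integral>\<^sup>+z. ennreal (ediff w \<zeta> z + ?g z) \<partial>mu)" for \<zeta>
  have om: "\<zeta> \<in> borel_measurable borel" if "\<zeta> \<in> obst e D" for \<zeta> using that by (simp add: obst_def)
  have oC: "x \<notin> C \<Longrightarrow> \<zeta> x = 0" "\<bar>\<zeta> x\<bar> \<le> e" if "\<zeta> \<in> obst e D" for \<zeta> x using that C(2) by (auto simp: obst_def)
  have nn: "0 \<le> ediff w \<zeta> z + ?g z" if "\<zeta> \<in> obst e D" for \<zeta> z
    using ediff_bounds(1)[where \<zeta> = \<zeta> and M = e and w = w and z = z, OF U(2) oC[OF that]] by linarith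
  have ig: "integrable mu ?g" by (rule edom_integrable[OF C(1) U w e])
  have z0: "(\<lambda>x. 0) \<in> obst e D" using e by (simp add: obst_def)
  define \<alpha> where "\<alpha> = (INF \<zeta>\<in>obst e D. F \<zeta>)"
  have \<alpha>le: "\<alpha> \<le> F \<zeta>" if "\<zeta> \<in> obst e D" for \<zeta> unfolding \<alpha>_def using that by (rule INF_lower)
  have "F (\<lambda>x. 0) = (\<integral>\<^sup>+z. ennreal (?g z) \<partial>mu)" unfolding F_def by (intro nn_integral_cong) (simp add: ediff_def dif_def)
  also have "\<dots> = ennreal (\<integral>z. ?g z \<partial>mu)" using ig edom_nonneg[OF e] by (intro nn_integral_eq_integral) auto
  finally have "F (\<lambda>x. 0) < \<infinity>" by simp
  then have \<alpha>fin: "\<alpha> < \<infinity>" using \<alpha>le[OF z0] by (rule le_less_trans[rotated])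
  have "\<exists>\<zeta>\<in>obst e D. F \<zeta> < \<alpha> + ennreal ((1 / 2) ^ i)" for i :: nat
  proof (rule ccontr)
    assume "\<not> ?thesis"
    then have "\<alpha> + ennreal ((1 / 2) ^ i) \<le> \<alpha>" unfolding \<alpha>_def by (intro INF_greatest) (auto simp: not_less)
    moreover define d where "d = (1 / 2 :: real) ^ i"
    moreover have "0 < d" by (simp add: d_def)
    ultimately show False using \<alpha>fin by (cases \<alpha>) (auto simp: ennreal_plus[symmetric] simp del: ennreal_plus)
  qed
  then obtain Z where Z: "\<And>i. Z i \<in> obst e D" "\<And>i. F (Z i) \<le> \<alpha> + ennreal ((1 / 2) ^ i)"
    by (metis less_imp_le)
  have omax: "(\<lambda>x. max (\<zeta> x) (\<xi> x)) \<in> obst e D" and omin: "(\<lambda>x. min (\<zeta> x) (\<xi> x)) \<in> obst e D"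
    if "\<zeta> \<in> obst e D" "\<xi> \<in> obst e D" for \<zeta> \<xi>
    using that unfolding obst_def by (auto simp: min_def max_def)
  have submod: "F (\<lambda>x. max (\<zeta> x) (\<xi> x)) + F (\<lambda>x. min (\<zeta> x) (\<xi> x)) \<le> F \<zeta> + F \<xi>"
    if a: "\<zeta> \<in> obst e D" "\<xi> \<in> obst e D" for \<zeta> \<xi>
  proof -
    note [measurable] = om[OF a(1)] om[OF a(2)]
    have "F (\<lambda>x. max (\<zeta> x) (\<xi> x)) + F (\<lambda>x. min (\<zeta> x) (\<xi> x)) =
      (\<integral>\<^sup>+z. ennreal (ediff w (\<lambda>x. max (\<zeta> x) (\<xi> x)) z + ?g z) + ennreal (ediff w (\<lambda>x. min (\<zeta> x) (\<xi> x)) z + ?g z) \<partial>mu)"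
      unfolding F_def by (rule nn_integral_add[symmetric]) measurable
    also have "\<dots> \<le> (\<integral>\<^sup>+z. ennreal (ediff w \<zeta> z + ?g z) + ennreal (ediff w \<xi> z + ?g z) \<partial>mu)"
    proof (rule nn_integral_mono)
      fix z
      let ?f = "\<lambda>x. w x + \<zeta> x" and ?h = "\<lambda>x. w x + \<xi> x"
      have "ediff w (\<lambda>x. max (\<zeta> x) (\<xi> x)) z + ediff w (\<lambda>x. min (\<zeta> x) (\<xi> x)) z \<le> ediff w \<zeta> z + ediff w \<xi> z"
      proof -
        have "dif w z + dif (\<lambda>x. max (\<zeta> x) (\<xi> x)) z = max (?f (fst z)) (?h (fst z)) - max (?f (snd z)) (?h (snd z))"
          "dif w z + dif (\<lambda>x. min (\<zeta> x) (\<xi> x)) z = min (?f (fst z)) (?h (fst z)) - min (?f (snd z)) (?h (snd z))"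
          "dif w z + dif \<zeta> z = ?f (fst z) - ?f (snd z)" "dif w z + dif \<xi> z = ?h (fst z) - ?h (snd z)"
          by (auto simp: dif_def max_def min_def)
        then show ?thesis
          using abs_powr_submodular[OF p_gt, of "?f (fst z)" "?h (fst z)" "?f (snd z)" "?h (snd z)"] by (simp only: ediff_def)
      qed
      then show "ennreal (ediff w (\<lambda>x. max (\<zeta> x) (\<xi> x)) z + ?g z) + ennreal (ediff w (\<lambda>x. min (\<zeta> x) (\<xi> x)) z + ?g z)
        \<le> ennreal (ediff w \<zeta> z + ?g z) + ennreal (ediff w \<xi> z + ?g z)"
        using nn[OF a(1), of z] nn[OF a(2), of z] nn[OF omax[OF a], of z] nn[OF omin[OF a], of z]
        by (simp add: ennreal_plus[symmetric] ennreal_leI del: ennreal_plus)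
    qed
    also have "\<dots> = F \<zeta> + F \<xi>" unfolding F_def by (rule nn_integral_add) measurable
    finally show ?thesis .
  qed
  have lsc: "F \<zeta> \<le> b" if Y: "\<And>i. Y i \<in> obst e D" "\<And>x. (\<lambda>i. Y i x) \<longlonglongrightarrow> \<zeta> x" "\<And>i. F (Y i) \<le> B i" "B \<longlonglongrightarrow> b" for Y \<zeta> B b
  proof -
    note [measurable] = om[OF Y(1)]
    have "F \<zeta> = (\<integral>\<^sup>+z. liminf (\<lambda>i. ennreal (ediff w (Y i) z + ?g z)) \<partial>mu)"
      unfolding F_def
    proof (rule nn_integral_cong)
      fix z
      have d: "(\<lambda>i. dif (Y i) z) \<longlonglongrightarrow> dif \<zeta> z" unfolding dif_def by (intro tendsto_diff Y)
      have "(\<lambda>i. ediff w (Y i) z + ?g z) \<longlonglongrightarrow> ediff w \<zeta> z + ?g z"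
        unfolding ediff_def using p_gt d by (intro tendsto_intros tendsto_powr') auto
      then have "(\<lambda>i. ennreal (ediff w (Y i) z + ?g z)) \<longlonglongrightarrow> ennreal (ediff w \<zeta> z + ?g z)" by (rule tendsto_ennrealI)
      then show "ennreal (ediff w \<zeta> z + ?g z) = liminf (\<lambda>i. ennreal (ediff w (Y i) z + ?g z))" by (simp add: lim_imp_Liminf)
    qed
    also have "\<dots> \<le> liminf (\<lambda>i. F (Y i))" unfolding F_def by (rule nn_integral_liminf) measurable
    also have "\<dots> \<le> liminf B" by (intro Liminf_mono always_eventually allI Y)
    also have "\<dots> = b" using Y(4) by (simp add: lim_imp_Liminf)
    finally show ?thesis .
  qed
  define q where "q m = ennreal (2 * (1 / 2) ^ m)" for m :: nat
  have oR: "runmax Z m l \<in> obst e D" for m l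
  proof -
    note [measurable] = om[OF Z(1)]
    have "runmax Z m l \<in> borel_measurable borel" by measurable
    moreover have "0 \<le> runmax Z m l x \<and> runmax Z m l x \<le> e" for x using Z(1) by (intro runmax_bounds) (auto simp: obst_def)
    moreover have "0 \<le> runmax Z m l x \<and> runmax Z m l x \<le> 0" if "x \<notin> D" for x
      using Z(1) that by (intro runmax_bounds) (auto simp: obst_def)
    ultimately show ?thesis unfolding obst_def by (auto intro: antisym)
  qed
  \<comment> \<open>The excess over \<alpha> is at most the sum of \<open>(1 / 2) ^ i\<close> for i
    from m to m + l. By submodularity the excess of a maximum is at most the sum of the two
    excesses, because the corresponding minimum is again a competitor and has energy at least
    \<alpha>.\<close>
  have FR: "F (runmax Z m l) \<le> \<alpha> + ennreal (2 * (1 / 2) ^ m - (1 / 2) ^ (m + l))" for m l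
  proof (induction l)
    case 0
    have "runmax Z m 0 = Z m" by auto
    then show ?case using Z(2)[of m] by simp
  next
    case (Suc l)
    let ?A = "runmax Z m l" and ?B = "Z (m + Suc l)"
    have "F (runmax Z m (Suc l)) + \<alpha> \<le> F (\<lambda>x. max (?A x) (?B x)) + F (\<lambda>x. min (?A x) (?B x))"
    proof -
      have "runmax Z m (Suc l) = (\<lambda>x. max (?A x) (?B x))" by (rule ext) simp
      then show ?thesis using \<alpha>le[OF omin[OF oR Z(1)]] by (simp only: add_left_mono)
    qed
    also have "\<dots> \<le> F ?A + F ?B" by (rule submod[OF oR Z(1)])
    also have "\<dots> \<le> (\<alpha> + ennreal (2 * (1 / 2) ^ m - (1 / 2) ^ (m + l))) + (\<alpha> + ennreal ((1 / 2) ^ (m + Suc l)))"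
      by (intro add_mono Suc.IH Z)
    finally have "\<alpha> + F (runmax Z m (Suc l)) \<le> \<alpha> + (\<alpha> + (ennreal (2 * (1 / 2) ^ m - (1 / 2) ^ (m + l)) + ennreal ((1 / 2) ^ (m + Suc l))))"
      by (simp add: add_ac)
    then have "F (runmax Z m (Suc l)) \<le> \<alpha> + (ennreal (2 * (1 / 2) ^ m - (1 / 2) ^ (m + l)) + ennreal ((1 / 2) ^ (m + Suc l)))"
      using \<alpha>fin by (subst (asm) ennreal_add_left_cancel_le) auto
    also have "ennreal (2 * (1 / 2) ^ m - (1 / 2) ^ (m + l)) + ennreal ((1 / 2) ^ (m + Suc l)) = ennreal (2 * (1 / 2) ^ m - (1 / 2) ^ (m + Suc l))"
    proof -
      have "(1 / 2 :: real) ^ (m + l) \<le> (1 / 2) ^ m" by (intro power_decreasing) auto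
      then have nn2: "0 \<le> 2 * (1 / 2 :: real) ^ m - (1 / 2) ^ (m + l)"
        using zero_le_power[of "1 / 2 :: real" m] by linarith
      show ?thesis by (subst ennreal_plus[symmetric]) (use nn2 in \<open>auto simp: field_simps\<close>)
    qed
    finally show ?case .
  qed
  \<comment> \<open>The supremum of the sequence from index m on, reached as an increasing limit;
    its excess over \<alpha> is at most the full geometric tail \<open>q m\<close>.\<close>
  define S where "S m x = lim (\<lambda>l. runmax Z m l x)" for m x
  have RS: "(\<lambda>l. runmax Z m l x) \<longlonglongrightarrow> S m x" for m x
  proof -
    have "convergent (\<lambda>l. runmax Z m l x)"
    proof (rule Bseq_mono_convergent)
      show "Bseq (\<lambda>l. runmax Z m l x)" using oR oC(2) by (intro BseqI'[of _ e]) auto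
      show "\<forall>i j. i \<le> j \<longrightarrow> runmax Z m i x \<le> runmax Z m j x"
        using lift_Suc_mono_le[of "\<lambda>l. runmax Z m l x"] by auto
    qed
    then show ?thesis by (simp add: S_def convergent_LIMSEQ_iff)
  qed
  have oS: "S m \<in> obst e D" for m
  proof -
    note [measurable] = om[OF oR]
    have "S m \<in> borel_measurable borel" by (rule borel_measurable_LIMSEQ_real[OF RS]) measurable
    moreover have "0 \<le> S m x \<and> S m x \<le> e" for x
      using LIMSEQ_le_const[OF RS[of m x], of 0] LIMSEQ_le_const2[OF RS[of m x], of e] oR by (auto simp: obst_def)
    moreover have "S m x = 0" if "x \<notin> D" for x
    proof -
      have "(\<lambda>l. runmax Z m l x) = (\<lambda>l. 0)" using oR that by (auto simp: obst_def)
      then show ?thesis using RS[of m x] by (simp add: LIMSEQ_const_iff)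
    qed
    ultimately show ?thesis by (simp add: obst_def)
  qed
  have FS: "F (S m) \<le> \<alpha> + q m" for m
  proof (rule lsc[OF oR RS])
    show "F (runmax Z m l) \<le> \<alpha> + q m" for l
      using FR[of m l] by (rule order_trans) (auto simp: q_def intro!: add_left_mono ennreal_leI)
  qed simp
  have Smono: "S (Suc m) x \<le> S m x" for m x
    by (rule LIMSEQ_le[OF RS LIMSEQ_Suc[OF RS]]) (blast intro: runmax_shift)
  \<comment> \<open>The upper limit of the minimising sequence. It is a decreasing limit of the
    \<open>S m\<close>, so lower semicontinuity along pointwise limits is all that existence
    requires.\<close>
  define L where "L x = lim (\<lambda>m. S m x)" for x
  have SL: "(\<lambda>m. S m x) \<longlonglongrightarrow> L x" for x
  proof -
    have "convergent (\<lambda>m. - S m x)"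
    proof (rule Bseq_mono_convergent)
      show "Bseq (\<lambda>m. - S m x)" using oS oC(2) by (intro BseqI'[of _ e]) auto
      show "\<forall>i j. i \<le> j \<longrightarrow> - S i x \<le> - S j x"
        using lift_Suc_mono_le[of "\<lambda>m. - S m x"] Smono by auto
    qed
    then have "convergent (\<lambda>m. S m x)" by (subst convergent_minus_iff)
    then show ?thesis by (simp add: L_def convergent_LIMSEQ_iff)
  qed
  have oL: "L \<in> obst e D"
  proof -
    note [measurable] = om[OF oS]
    have "L \<in> borel_measurable borel" by (rule borel_measurable_LIMSEQ_real[OF SL]) measurable
    moreover have "0 \<le> L x \<and> L x \<le> e" for x
      using LIMSEQ_le_const[OF SL[of x], of 0] LIMSEQ_le_const2[OF SL[of x], of e] oS by (auto simp: obst_def)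
    moreover have "L x = 0" if "x \<notin> D" for x
    proof -
      have "(\<lambda>m. S m x) = (\<lambda>m. 0)" using oS that by (auto simp: obst_def)
      then show ?thesis using SL[of x] by (simp add: LIMSEQ_const_iff)
    qed
    ultimately show ?thesis by (simp add: obst_def)
  qed
  have FL: "F L \<le> \<alpha>"
  proof (rule lsc[OF oS SL FS])
    have "(\<lambda>m. 2 * (1 / 2 :: real) ^ m) \<longlonglongrightarrow> 2 * 0" by (intro tendsto_mult_left LIMSEQ_power_zero) auto
    then have "q \<longlonglongrightarrow> ennreal 0" unfolding q_def by (intro tendsto_ennrealI) simp
    then have "(\<lambda>m. \<alpha> + q m) \<longlonglongrightarrow> \<alpha> + ennreal 0" by (intro tendsto_add) auto
    then show "(\<lambda>m. \<alpha> + q m) \<longlonglongrightarrow> \<alpha>" by simp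
  qed
  note [measurable] = om[OF oL]
  \<comment> \<open>Finiteness of \<open>F L\<close> controls the increments of
    \<open>w + L\<close>; on \<open>U \<times> U\<close> those of w are controlled as well, and
    \<open>bounded_support_energy\<close> covers the rest.\<close>
  have EL: "energy L UNIV < \<infinity>"
  proof (rule bounded_support_energy[OF om[OF oL] oC(2)[OF oL] C(1) oC(1)[OF oL] U(1,2)])
    have "energy L (U \<times> U) \<le> (\<integral>\<^sup>+z. ennreal (2 powr p) * (ennreal (ediff w L z + ?g z) + (ennreal (\<bar>dif w z\<bar> powr p) * indicator (U \<times> U) z + ennreal (\<bar>dif w z\<bar> powr p) * indicator (U \<times> U) z)) \<partial>mu)"
      unfolding energy_def
    proof (rule nn_integral_mono)
      fix z
      show "ennreal (\<bar>dif L z\<bar> powr p) * indicator (U \<times> U) z \<le> ennreal (2 powr p) * (ennreal (ediff w L z + ?g z) + (ennreal (\<bar>dif w z\<bar> powr p) * indicator (U \<times> U) z + ennreal (\<bar>dif w z\<bar> powr p) * indicator (U \<times> U) z))"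
      proof (cases "z \<in> U \<times> U")
        case True
        have "\<bar>dif L z\<bar> powr p \<le> (\<bar>dif w z + dif L z\<bar> + \<bar>dif w z\<bar>) powr p" using p_gt by (intro powr_mono2) auto
        also have "\<dots> \<le> 2 powr p * (\<bar>dif w z + dif L z\<bar> powr p + \<bar>dif w z\<bar> powr p)" using p_gt by (intro powr_add2_le) auto
        also have "\<dots> \<le> 2 powr p * ((ediff w L z + ?g z) + (\<bar>dif w z\<bar> powr p + \<bar>dif w z\<bar> powr p))"
          using edom_nonneg[OF e, of w C U z] by (intro mult_left_mono) (auto simp: ediff_def)
        finally show ?thesis using True nn[OF oL, of z]
          by (simp add: ennreal_plus[symmetric] ennreal_mult[symmetric] ennreal_leI del: ennreal_plus)
      qed simp
    qed
    also have "\<dots> = ennreal (2 powr p) * (F L + (energy w (U \<times> U) + energy w (U \<times> U)))"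
      unfolding F_def energy_def by (simp add: nn_integral_cmult nn_integral_add)
    also have "\<dots> < \<infinity>" using le_less_trans[OF FL \<alpha>fin] U(3) by (simp add: ennreal_mult_less_top)
    finally show "energy L (U \<times> U) < \<infinity>" .
  qed
  have Fint: "F \<xi> = ennreal ((\<integral>z. ediff w \<xi> z \<partial>mu) + (\<integral>z. ?g z \<partial>mu)) \<and> 0 \<le> (\<integral>z. ediff w \<xi> z \<partial>mu) + (\<integral>z. ?g z \<partial>mu)"
    if "\<xi> \<in> obst e D" "energy \<xi> UNIV < \<infinity>" for \<xi>
  proof -
    have i: "integrable mu (ediff w \<xi>)" by (rule ediff_integrable[OF C(1) U w om[OF that(1)] oC[OF that(1)] that(2)])
    have "F \<xi> = ennreal (\<integral>z. ediff w \<xi> z + ?g z \<partial>mu)"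
      unfolding F_def using i ig nn[OF that(1)] by (intro nn_integral_eq_integral) auto
    moreover have "0 \<le> (\<integral>z. ediff w \<xi> z + ?g z \<partial>mu)" using nn[OF that(1)] by simp
    ultimately show ?thesis using i ig by simp
  qed
  show ?thesis
  proof (rule that[OF oL EL])
    fix \<xi> assume \<xi>: "\<xi> \<in> obst e D" "energy \<xi> UNIV < \<infinity>"
    have "F L \<le> F \<xi>" using FL \<alpha>le[OF \<xi>(1)] by (rule order_trans)
    then show "(\<integral>z. ediff w L z \<partial>mu) \<le> (\<integral>z. ediff w \<xi> z \<partial>mu)"
      using Fint[OF oL EL] Fint[OF \<xi>] by (auto simp: ennreal_le_iff)
  qed
qed

end

section \<open>The Euler-Lagrange equation\<close>

context frac_kernel
begin

lemma tests_energy: "\<eta> \<in> tests D \<Longrightarrow> energy \<eta> UNIV < \<infinity>"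
  by (simp add: tests_def)

lemma energy_scale_finite:
  assumes [measurable]: "u \<in> borel_measurable borel" and E: "energy u UNIV < \<infinity>"
  shows "energy (\<lambda>x. t * u x) UNIV < \<infinity>"
proof -
  have "energy (\<lambda>x. t * u x) UNIV = (\<integral>\<^sup>+z. ennreal (\<bar>t\<bar> powr p) * (ennreal (\<bar>dif u z\<bar> powr p) * indicator UNIV z) \<partial>mu)"
    unfolding energy_def
  proof (rule nn_integral_cong)
    fix z
    have "dif (\<lambda>x. t * u x) z = t * dif u z" by (simp add: dif_def algebra_simps)
    then show "ennreal (\<bar>dif (\<lambda>x. t * u x) z\<bar> powr p) * indicator UNIV z = ennreal (\<bar>t\<bar> powr p) * (ennreal (\<bar>dif u z\<bar> powr p) * indicator UNIV z)"
      by (simp add: abs_mult powr_mult ennreal_mult)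
  qed
  also have "\<dots> = ennreal (\<bar>t\<bar> powr p) * energy u UNIV" unfolding energy_def by (rule nn_integral_cmult) measurable
  also have "\<dots> < \<infinity>" using E by (simp add: ennreal_mult_less_top)
  finally show ?thesis .
qed

lemma energy_finite_mono:
  assumes "\<And>z. \<bar>dif w z\<bar> \<le> \<bar>dif u z\<bar>" "energy u UNIV < \<infinity>"
  shows "energy w UNIV < \<infinity>"
proof -
  have "energy w UNIV \<le> energy u UNIV"
    unfolding energy_def using assms(1) p_gt by (intro nn_integral_mono mult_right_mono ennreal_leI powr_mono2) auto
  then show ?thesis using assms(2) by (rule le_less_trans)
qed

text \<open>Removes the constraint. The competitor \<open>\<zeta> + \<eta>\<close> is cut at the
  upper obstacle e, then at the lower obstacle 0. The first cut changes the energy by at most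
  \<open>- p\<close> times the weak form of H tested with the part cut off, the second by at most p
  times that of w; both are nonpositive. The result lies in the strip, where \<zeta> is
  minimal.\<close>

lemma obstacle_variation_nonneg:
  assumes \<Omega>: "open \<Omega>" and C: "compact C" "C \<subseteq> \<Omega>" and D: "open D" "D \<subseteq> C"
    and w: "loc_energy w \<Omega>" "wsuper (\<lambda>x. - w x) C" and H: "loc_energy H \<Omega>" "wsuper H C" and e: "0 \<le> e"
    and Hw: "\<And>x. x \<in> \<Omega> \<Longrightarrow> H x = w x + e" "\<And>x. x \<notin> \<Omega> \<Longrightarrow> w x \<le> H x"
    and U: "open U" "C \<subseteq> U" "energy w (U \<times> U) < \<infinity>"
    and \<zeta>: "\<zeta> \<in> obst e D" "energy \<zeta> UNIV < \<infinity>"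
      "\<And>\<xi>. \<xi> \<in> obst e D \<Longrightarrow> energy \<xi> UNIV < \<infinity> \<Longrightarrow> (\<integral>z. ediff w \<zeta> z \<partial>mu) \<le> (\<integral>z. ediff w \<xi> z \<partial>mu)"
    and \<eta>: "\<eta> \<in> tests D"
  shows "integrable mu (ediff w (\<lambda>x. \<zeta> x + \<eta> x))"
    "(\<integral>z. ediff w \<zeta> z \<partial>mu) \<le> (\<integral>z. ediff w (\<lambda>x. \<zeta> x + \<eta> x) z \<partial>mu)"
proof -
  have [measurable]: "w \<in> borel_measurable borel" "H \<in> borel_measurable borel" "\<zeta> \<in> borel_measurable borel" "\<eta> \<in> borel_measurable borel" "D \<in> sets borel"
    using loc_energyD w(1) H(1) \<zeta>(1) \<eta> D by (auto simp: obst_def tests_def)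
  have wt: "tailf w" using loc_energyD w(1) by blast
  have \<zeta>b: "0 \<le> \<zeta> x" "\<zeta> x \<le> e" "x \<notin> D \<Longrightarrow> \<zeta> x = 0" for x using \<zeta>(1) by (auto simp: obst_def)
  obtain M C1 where M: "\<And>x. \<bar>\<eta> x\<bar> \<le> M" and C1: "compact C1" "C1 \<subseteq> D" "\<And>x. x \<notin> C1 \<Longrightarrow> \<eta> x = 0"
    using \<eta> by (auto simp: tests_def)
  define F where "F x = \<zeta> x + \<eta> x" for x
  define G where "G x = min (F x) e" for x
  define B where "B x = max (G x) 0" for x
  have [measurable]: "F \<in> borel_measurable borel" "G \<in> borel_measurable borel" "B \<in> borel_measurable borel"
    unfolding F_def[abs_def] G_def[abs_def] B_def[abs_def] by measurable
  have EF: "energy F UNIV < \<infinity>"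
    by (rule energy_finite_add[OF _ _ _ _ \<zeta>(2) tests_energy[OF \<eta>]]) (auto simp: F_def dif_def)
  have EG: "energy G UNIV < \<infinity>" by (rule energy_finite_mono[OF _ EF]) (auto simp: G_def dif_def min_def)
  have EB: "energy B UNIV < \<infinity>" by (rule energy_finite_mono[OF _ EG]) (auto simp: B_def dif_def max_def)
  have Fb: "\<bar>F x\<bar> \<le> e + M" "x \<notin> C \<Longrightarrow> F x = 0" for x
  proof -
    show "\<bar>F x\<bar> \<le> e + M" using M[of x] \<zeta>b[of x] by (simp add: F_def)
    assume "x \<notin> C"
    then have "x \<notin> D" "x \<notin> C1" using D C1 by auto
    then show "F x = 0" using \<zeta>b C1 by (simp add: F_def)
  qed
  have Gb: "\<bar>G x\<bar> \<le> e + M" "x \<notin> C \<Longrightarrow> G x = 0" and Bb: "\<bar>B x\<bar> \<le> e + M" "x \<notin> C \<Longrightarrow> B x = 0" for x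
    using Fb[of x] e M[of x] by (auto simp: G_def B_def min_def max_def)
  have iF: "integrable mu (ediff w F)" by (rule ediff_integrable[OF C(1) U _ wt _ Fb(2,1) EF]) auto
  have iG: "integrable mu (ediff w G)" by (rule ediff_integrable[OF C(1) U _ wt _ Gb(2,1) EG]) auto
  have iB: "integrable mu (ediff w B)" by (rule ediff_integrable[OF C(1) U _ wt _ Bb(2,1) EB]) auto
  show "integrable mu (ediff w (\<lambda>x. \<zeta> x + \<eta> x))" using iF by (simp add: F_def[abs_def])
  have Bo: "B \<in> obst e D"
  proof -
    have "B x = 0" if "x \<notin> D" for x
    proof -
      have "x \<notin> C1" using that C1 by auto
      then show ?thesis using that \<zeta>b(3) C1(3) e by (simp add: B_def G_def F_def)
    qed
    then show ?thesis using e by (auto simp: obst_def B_def G_def)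
  qed
  have C1C: "C1 \<subseteq> C" using C1 D by auto
  \<comment> \<open>The parts cut off above and below. Since \<zeta> stays between 0 and e, both
    vanish where \<eta> does, so they have compact support and are admissible tests.\<close>
  define \<xi> where "\<xi> x = max (F x - e) 0" for x
  define \<rho> where "\<rho> x = max (- F x) 0" for x
  have \<xi>t: "\<xi> \<in> tests C"
  proof -
    have "energy \<xi> UNIV < \<infinity>" by (rule energy_finite_mono[OF _ EF]) (auto simp: \<xi>_def dif_def max_def)
    moreover have "\<bar>\<xi> x\<bar> \<le> e + M" for x using Fb(1)[of x] e M[of x] by (auto simp: \<xi>_def)
    moreover have "\<xi> x = 0" if "x \<notin> C1" for x using C1(3)[OF that] \<zeta>b(2)[of x] by (simp add: \<xi>_def F_def)
    moreover have "\<xi> \<in> borel_measurable borel" unfolding \<xi>_def[abs_def] by measurable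
    ultimately show ?thesis unfolding tests_def using C1(1) C1C by blast
  qed
  have \<rho>t: "\<rho> \<in> tests C"
  proof -
    have "energy \<rho> UNIV < \<infinity>" by (rule energy_finite_mono[OF _ EF]) (auto simp: \<rho>_def dif_def max_def)
    moreover have "\<bar>\<rho> x\<bar> \<le> e + M" for x using Fb(1)[of x] e M[of x] by (auto simp: \<rho>_def)
    moreover have "\<rho> x = 0" if "x \<notin> C1" for x using C1(3)[OF that] \<zeta>b(1)[of x] by (simp add: \<rho>_def F_def)
    moreover have "\<rho> \<in> borel_measurable borel" unfolding \<rho>_def[abs_def] by measurable
    ultimately show ?thesis unfolding tests_def using C1(1) C1C by blast
  qed
  have \<xi>\<Omega>: "\<xi> \<in> tests \<Omega>" and \<rho>\<Omega>: "\<rho> \<in> tests \<Omega>" using \<xi>t \<rho>t tests_mono[OF C(2)] by auto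
  have i\<xi>: "integrable mu (wform H \<xi>)" by (rule wform_integrable[OF H(1) \<xi>\<Omega>])
  have i\<rho>: "integrable mu (wform w \<rho>)" by (rule wform_integrable[OF w(1) \<rho>\<Omega>])
  have F0: "F x = 0" if "x \<notin> \<Omega>" for x using Fb(2) that C(2) by blast
  have 1: "(\<integral>z. ediff w G z \<partial>mu) \<le> (\<integral>z. ediff w F z - p * wform H \<xi> z \<partial>mu)"
  proof (rule integral_mono[OF iG])
    show "integrable mu (\<lambda>z. ediff w F z - p * wform H \<xi> z)" using iF i\<xi> by auto
    fix z
    \<comment> \<open>Inside \<Omega> this is \<open>H = w + e\<close>. Outside, F vanishes and
      \<open>w \<le> H\<close>, so the minimum is attained by w.\<close>
    have mn: "min (w x + F x) (H x) = w x + G x" and mx: "max (w x + F x - H x) 0 = \<xi> x" for x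
      using Hw(1)[of x] Hw(2)[of x] F0[of x] e by (cases "x \<in> \<Omega>"; simp add: G_def \<xi>_def)+
    show "ediff w G z \<le> ediff w F z - p * wform H \<xi> z"
      using abs_powr_min_obstacle[OF p_gt, of "w (fst z) + F (fst z)" "H (fst z)" "w (snd z) + F (snd z)" "H (snd z)"]
      unfolding mn mx by (simp add: ediff_def wform_def dif_def algebra_simps)
  qed
  have "0 \<le> (\<integral>z. wform H \<xi> z \<partial>mu)" using H(2) \<xi>t unfolding wsuper_def by (auto simp: \<xi>_def)
  then have "0 \<le> p * (\<integral>z. wform H \<xi> z \<partial>mu)" using p_gt by simp
  then have GF: "(\<integral>z. ediff w G z \<partial>mu) \<le> (\<integral>z. ediff w F z \<partial>mu)" using 1 iF i\<xi> by simp
  have 2: "(\<integral>z. ediff w B z \<partial>mu) \<le> (\<integral>z. ediff w G z + p * wform w \<rho> z \<partial>mu)"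
  proof (rule integral_mono[OF iB])
    show "integrable mu (\<lambda>z. ediff w G z + p * wform w \<rho> z)" using iG i\<rho> by auto
    fix z
    have mn: "max (w x + G x) (w x) = w x + B x" and mx: "max (w x - (w x + G x)) 0 = \<rho> x" for x
      using e by (auto simp: B_def G_def \<rho>_def max_def min_def)
    show "ediff w B z \<le> ediff w G z + p * wform w \<rho> z"
      using abs_powr_max_obstacle[OF p_gt, of "w (fst z) + G (fst z)" "w (fst z)" "w (snd z) + G (snd z)" "w (snd z)"]
      unfolding mn mx by (simp add: ediff_def wform_def dif_def algebra_simps)
  qed
  have "(\<integral>z. wform w \<rho> z \<partial>mu) \<le> 0" by (rule wsuper_uminusD[OF w(2) \<rho>t]) (simp add: \<rho>_def)
  then have "p * (\<integral>z. wform w \<rho> z \<partial>mu) \<le> 0" using p_gt by (simp add: mult_nonneg_nonpos)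
  then have "(\<integral>z. ediff w B z \<partial>mu) \<le> (\<integral>z. ediff w G z \<partial>mu)" using 2 iG i\<rho> by simp
  then show "(\<integral>z. ediff w \<zeta> z \<partial>mu) \<le> (\<integral>z. ediff w (\<lambda>x. \<zeta> x + \<eta> x) z \<partial>mu)"
    using GF \<zeta>(3)[OF Bo EB] by (simp add: F_def[abs_def])
qed

text \<open>The energy is never differentiated under the integral. Convexity with the tangent at the
  perturbed function \<open>u t\<close> bounds the energy increment by \<open>p * t\<close> times
  the weak form of \<open>u t\<close>, which is therefore nonnegative; letting t tend to 0 gives the
  inequality for v, and \<eta> together with its negative gives equality.\<close>

theorem obstacle_solution:
  assumes \<Omega>: "open \<Omega>" and C: "compact C" "C \<subseteq> \<Omega>" and D: "open D" "D \<subseteq> C"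
    and w: "loc_energy w \<Omega>" "wsuper (\<lambda>x. - w x) C" and H: "loc_energy H \<Omega>" "wsuper H C" and e: "0 \<le> e"
    and Hw: "\<And>x. x \<in> \<Omega> \<Longrightarrow> H x = w x + e" "\<And>x. x \<notin> \<Omega> \<Longrightarrow> w x \<le> H x"
  obtains v where "v \<in> borel_measurable borel" "\<And>x. w x \<le> v x" "\<And>x. v x \<le> w x + e" "\<And>x. x \<notin> D \<Longrightarrow> v x = w x"
    "loc_energy v D" "energy v (D \<times> D) < \<infinity>" "\<And>\<eta>. \<eta> \<in> tests D \<Longrightarrow> (\<integral>z. wform v \<eta> z \<partial>mu) = 0"
proof -
  have [measurable]: "w \<in> borel_measurable borel" "D \<in> sets borel"
    using loc_energyD w(1) D by auto
  have wt: "tailf w" using loc_energyD w(1) by blast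
  obtain U where U: "open U" "C \<subseteq> U" "energy w (U \<times> U) < \<infinity>"
    using w(1) C unfolding loc_energy_def by blast
  have [measurable]: "U \<in> sets borel" using U by simp
  obtain \<zeta> where \<zeta>: "\<zeta> \<in> obst e D" "energy \<zeta> UNIV < \<infinity>"
    "\<And>\<xi>. \<xi> \<in> obst e D \<Longrightarrow> energy \<xi> UNIV < \<infinity> \<Longrightarrow> (\<integral>z. ediff w \<zeta> z \<partial>mu) \<le> (\<integral>z. ediff w \<xi> z \<partial>mu)"
    by (rule obstacle_minimiser[OF C(1) D(2) _ U _ wt e]) auto
  have [measurable]: "\<zeta> \<in> borel_measurable borel" using \<zeta>(1) by (simp add: obst_def)
  have \<zeta>b: "0 \<le> \<zeta> x" "\<zeta> x \<le> e" "x \<notin> D \<Longrightarrow> \<zeta> x = 0" for x using \<zeta>(1) by (auto simp: obst_def)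
  define v where "v x = w x + \<zeta> x" for x
  have vm [measurable]: "v \<in> borel_measurable borel" unfolding v_def[abs_def] by measurable
  have dv: "dif v z = dif w z + dif \<zeta> z" for z by (simp add: v_def dif_def)
  have "energy v (U \<times> U) < \<infinity>"
    by (rule energy_finite_add[OF _ _ _ _ U(3) le_less_trans[OF energy_mono \<zeta>(2)]]) (auto simp: dv)
  then have vU: "energy v (U \<times> U) < \<infinity>" .
  have vD: "energy v (D \<times> D) < \<infinity>"
    by (rule le_less_trans[OF energy_mono vU]) (use D U in auto)
  have vt: "tailf v"
    by (rule tailf_bounded[OF _ wt _ e]) (use \<zeta>b in \<open>auto simp: v_def intro!: order_trans[OF abs_triangle_ineq] add_left_mono\<close>)
  have vl: "loc_energy v D"
    unfolding loc_energy_def using vm vt D(1) vD by blast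
  have var: "0 \<le> (\<integral>z. wform v \<eta> z \<partial>mu)" if \<eta>: "\<eta> \<in> tests D" for \<eta>
  proof -
    have [measurable]: "\<eta> \<in> borel_measurable borel" using \<eta> by (simp add: tests_def)
    obtain M C1 where M: "\<And>x. \<bar>\<eta> x\<bar> \<le> M" and C1: "compact C1" "C1 \<subseteq> D" "\<And>x. x \<notin> C1 \<Longrightarrow> \<eta> x = 0"
      using \<eta> by (auto simp: tests_def)
    have M0: "0 \<le> M" using M[of undefined] by linarith
    have C1U: "C1 \<subseteq> U" using C1 D U by auto
    have [measurable]: "C1 \<in> sets borel" using C1(1) by (rule borel_compact)
    define u where "u t x = v x + t * \<eta> x" for t x
    have [measurable]: "u t \<in> borel_measurable borel" for t unfolding u_def[abs_def] by measurable
    have du: "dif (u t) z = dif v z + t * dif \<eta> z" for t z by (simp add: u_def dif_def algebra_simps)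
    \<comment> \<open>One integrable majorant for the weak forms of all \<open>u t\<close> with t in
      [0,1], prepared for dominated convergence.\<close>
    define b where "b z = 2 powr p * (\<bar>dif v z\<bar> powr p * indicator (U \<times> U) z + \<bar>dif \<eta> z\<bar> powr p)
      + M * ((\<bar>v (fst z)\<bar> + \<bar>v (snd z)\<bar> + M) powr (p - 1) * indicator (outs C1 U) z)" for z
    have [measurable]: "b \<in> borel_measurable borel" unfolding b_def[abs_def] by measurable
    have b0: "0 \<le> b z" for z using M0 by (simp add: b_def)
    have ib: "integrable mu b"
    proof (rule integrableI_nonneg)
      have "(\<integral>\<^sup>+z. ennreal (b z) \<partial>mu) = (\<integral>\<^sup>+z. ennreal (2 powr p) * (ennreal (\<bar>dif v z\<bar> powr p) * indicator (U \<times> U) z + ennreal (\<bar>dif \<eta> z\<bar> powr p) * indicator UNIV z)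
        + ennreal M * (ennreal ((\<bar>v (fst z)\<bar> + \<bar>v (snd z)\<bar> + M) powr (p - 1)) * indicator (outs C1 U) z) \<partial>mu)"
        using M0 by (intro nn_integral_cong) (auto simp: b_def ennreal_plus[symmetric] ennreal_mult[symmetric] simp del: ennreal_plus split: split_indicator)
      also have "\<dots> = ennreal (2 powr p) * (energy v (U \<times> U) + energy \<eta> UNIV)
        + ennreal M * (\<integral>\<^sup>+z. ennreal ((\<bar>v (fst z)\<bar> + \<bar>v (snd z)\<bar> + M) powr (p - 1)) * indicator (outs C1 U) z \<partial>mu)"
        unfolding energy_def by (simp add: nn_integral_add nn_integral_cmult)
      also have "\<dots> < \<infinity>"
        using vU tests_energy[OF \<eta>] outs_finite[OF C1(1) U(1) C1U vm vt M0] by (simp add: ennreal_mult_less_top)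
      finally show "(\<integral>\<^sup>+z. ennreal (b z) \<partial>mu) < \<infinity>" .
    qed (use b0 in auto)
    have wb: "\<bar>wform (u t) \<eta> z\<bar> \<le> b z" if t: "0 \<le> t" "t \<le> 1" for t z
    proof -
      have tb: "\<bar>t * dif \<eta> z\<bar> \<le> \<bar>dif \<eta> z\<bar>" using t by (simp add: abs_mult mult_left_le_one_le)
      have le: "\<bar>dif v z + t * dif \<eta> z\<bar> \<le> \<bar>dif v z\<bar> + \<bar>dif \<eta> z\<bar>" using tb by linarith
      have eq: "\<bar>wform (u t) \<eta> z\<bar> = \<bar>dif v z + t * dif \<eta> z\<bar> powr (p - 1) * \<bar>dif \<eta> z\<bar>" by (simp add: wform_def du abs_mult abs_phi)
      show ?thesis
      proof (rule support_cases[where \<zeta> = \<eta> and M = M and z = z, OF C1U C1(3) M])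
        assume z: "z \<in> U \<times> U"
        have "\<bar>wform (u t) \<eta> z\<bar> \<le> (\<bar>dif v z\<bar> + \<bar>dif \<eta> z\<bar>) powr (p - 1) * (\<bar>dif v z\<bar> + \<bar>dif \<eta> z\<bar>)"
          unfolding eq using le p_gt by (intro mult_mono powr_mono2) auto
        also have "\<dots> = (\<bar>dif v z\<bar> + \<bar>dif \<eta> z\<bar>) powr p" by (rule powr_minus_one_mult) simp
        also have "\<dots> \<le> 2 powr p * (\<bar>dif v z\<bar> powr p + \<bar>dif \<eta> z\<bar> powr p)" using p_gt by (intro powr_add2_le) auto
        finally show ?thesis using z M0 by (simp add: b_def add_increasing2)
      next
        assume "dif \<eta> z = 0" then show ?thesis using b0 by (simp add: wform_def)
      next
        assume z: "z \<in> outs C1 U" "\<bar>dif \<eta> z\<bar> \<le> M"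
        have "\<bar>dif v z + t * dif \<eta> z\<bar> \<le> \<bar>v (fst z)\<bar> + \<bar>v (snd z)\<bar> + M"
          using le z(2) by (simp add: dif_def)
        then have "\<bar>wform (u t) \<eta> z\<bar> \<le> (\<bar>v (fst z)\<bar> + \<bar>v (snd z)\<bar> + M) powr (p - 1) * M"
          unfolding eq using z p_gt by (intro mult_mono powr_mono2) auto
        then show ?thesis using z by (simp add: b_def add_increasing mult.commute)
      qed
    qed
    define t where "t n = 1 / real (Suc n)" for n
    have t: "0 < t n" "t n \<le> 1" for n by (simp_all add: t_def)
    have pos: "0 \<le> (\<integral>z. wform (u (t n)) \<eta> z \<partial>mu)" for n
    proof -
      define \<theta> where "\<theta> x = t n * \<eta> x" for x
      have \<theta>t: "\<theta> \<in> tests D"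
      proof -
        have "energy \<theta> UNIV < \<infinity>" unfolding \<theta>_def by (rule energy_scale_finite[OF _ tests_energy[OF \<eta>]]) measurable
        moreover have "\<bar>\<theta> x\<bar> \<le> t n * M" for x using t[of n] M[of x] by (simp add: \<theta>_def abs_mult mult_left_mono)
        moreover have "\<theta> \<in> borel_measurable borel" unfolding \<theta>_def[abs_def] by measurable
        moreover have "\<theta> x = 0" if "x \<notin> C1" for x using C1(3)[OF that] by (simp add: \<theta>_def)
        ultimately show ?thesis unfolding tests_def using C1 by blast
      qed
      note var1 = obstacle_variation_nonneg[OF \<Omega> C D w H e Hw U \<zeta> \<theta>t]
      have iz: "integrable mu (ediff w \<zeta>)"
        by (rule ediff_integrable[where M = e, OF C(1) U _ wt _ _ _ \<zeta>(2)]) (use \<zeta>b D in auto)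
      have iw: "integrable mu (wform (u (t n)) \<eta>)"
        by (rule Bochner_Integration.integrable_bound[OF ib]) (use wb[of "t n"] t[of n] b0 in \<open>auto simp: less_imp_le\<close>)
      have "0 \<le> (\<integral>z. ediff w (\<lambda>x. \<zeta> x + \<theta> x) z - ediff w \<zeta> z \<partial>mu)" using var1 iz by simp
      also have "\<dots> \<le> (\<integral>z. p * t n * wform (u (t n)) \<eta> z \<partial>mu)"
      proof (rule integral_mono)
        show "integrable mu (\<lambda>z. ediff w (\<lambda>x. \<zeta> x + \<theta> x) z - ediff w \<zeta> z)" using var1 iz by simp
        show "integrable mu (\<lambda>z. p * t n * wform (u (t n)) \<eta> z)" using iw by simp
        fix z
        have d: "dif w z + dif (\<lambda>x. \<zeta> x + \<theta> x) z = dif v z + t n * dif \<eta> z" by (simp add: v_def \<theta>_def dif_def algebra_simps)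
        \<comment> \<open>The tangent at the perturbed increment, evaluated at the unperturbed one;
          hence the weak form that appears is that of \<open>u (t n)\<close>.\<close>
        have "p * phi p (dif v z + t n * dif \<eta> z) * (dif v z - (dif v z + t n * dif \<eta> z)) \<le> \<bar>dif v z\<bar> powr p - \<bar>dif v z + t n * dif \<eta> z\<bar> powr p"
          by (rule abs_powr_above_tangent[OF p_gt])
        then show "ediff w (\<lambda>x. \<zeta> x + \<theta> x) z - ediff w \<zeta> z \<le> p * t n * wform (u (t n)) \<eta> z"
          unfolding ediff_def d dv[symmetric] by (simp add: wform_def du algebra_simps)
      qed
      also have "\<dots> = p * t n * (\<integral>z. wform (u (t n)) \<eta> z \<partial>mu)" by simp
      finally have "0 \<le> p * t n * (\<integral>z. wform (u (t n)) \<eta> z \<partial>mu)" .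
      moreover have "0 < p * t n" using p_gt t(1)[of n] by simp
      ultimately show ?thesis by (simp only: zero_le_mult_iff) linarith
    qed
    have "(\<lambda>n. \<integral>z. wform (u (t n)) \<eta> z \<partial>mu) \<longlonglongrightarrow> (\<integral>z. wform v \<eta> z \<partial>mu)"
    proof (rule integral_dominated_convergence[OF _ _ ib])
      have t0: "t \<longlonglongrightarrow> 0" unfolding t_def using LIMSEQ_inverse_real_of_nat by (simp add: inverse_eq_divide)
      show "AE z in mu. (\<lambda>n. wform (u (t n)) \<eta> z) \<longlonglongrightarrow> wform v \<eta> z"
      proof (rule AE_I2)
        fix z
        have "(\<lambda>n. dif (u (t n)) z) \<longlonglongrightarrow> dif v z + 0 * dif \<eta> z" unfolding du by (intro tendsto_intros t0)
        then have "(\<lambda>n. phi p (dif (u (t n)) z)) \<longlonglongrightarrow> phi p (dif v z)"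
          using continuous_on_tendsto_compose[OF continuous_on_phi[OF p_gt, of UNIV]] by simp
        then show "(\<lambda>n. wform (u (t n)) \<eta> z) \<longlonglongrightarrow> wform v \<eta> z" unfolding wform_def by (intro tendsto_intros)
      qed
      show "AE z in mu. norm (wform (u (t n)) \<eta> z) \<le> b z" for n
        using wb[of "t n"] t[of n] by (auto simp: less_imp_le)
    qed auto
    then show ?thesis by (rule LIMSEQ_le_const) (use pos in auto)
  qed
  have "(\<integral>z. wform v \<eta> z \<partial>mu) = 0" if \<eta>: "\<eta> \<in> tests D" for \<eta>
  proof -
    have "(\<lambda>x. - \<eta> x) \<in> tests D"
    proof -
      have "energy (\<lambda>x. - \<eta> x) UNIV < \<infinity>" by (rule energy_finite_mono[OF _ tests_energy[OF \<eta>]]) (auto simp: dif_def)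
      then show ?thesis using \<eta> unfolding tests_def by auto
    qed
    from var[OF this] have "(\<integral>z. wform v \<eta> z \<partial>mu) \<le> 0" by (simp add: wform_uminus_right[abs_def])
    then show ?thesis using var[OF \<eta>] by simp
  qed
  then show ?thesis using that[of v] \<zeta>b vm vl vD by (simp add: v_def)
qed

end

section \<open>De Giorgi's continuity theorem\<close>

text \<open>Induction on \<open>Y n \<le> \<nu> * q ^ n\<close>. The ratio
  \<open>q = B powr (- 1 / \<gamma>)\<close> makes \<open>(q powr \<gamma>) ^ n\<close> cancel
  \<open>B ^ n\<close>, and \<nu> is the number with
  \<open>C * \<nu> powr \<gamma> = q\<close>.\<close>

lemma De_Giorgi_sequence:
  fixes Y :: "nat \<Rightarrow> real"
  assumes C: "0 < C" and B: "1 < B" and \<gamma>: "0 < \<gamma>" and Y0: "\<And>n. 0 \<le> Y n"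
    and step: "\<And>n. Y (Suc n) \<le> C * B ^ n * Y n powr (1 + \<gamma>)"
    and init: "Y 0 \<le> C powr (- 1 / \<gamma>) * B powr (- 1 / \<gamma>\<^sup>2)"
  shows "Y \<longlonglongrightarrow> 0"
proof -
  define \<nu> where "\<nu> = C powr (- 1 / \<gamma>) * B powr (- 1 / \<gamma>\<^sup>2)"
  define q where "q = B powr (- 1 / \<gamma>)"
  have \<nu>: "0 < \<nu>" and q: "0 < q" "q < 1" using C B \<gamma> powr_less_one[of B "- 1 / \<gamma>"] by (auto simp: \<nu>_def q_def)
  have q\<gamma>: "q powr \<gamma> = 1 / B"
  proof -
    have "q powr \<gamma> = B powr (- 1 / \<gamma> * \<gamma>)" by (simp only: q_def powr_powr)
    also have "- 1 / \<gamma> * \<gamma> = - 1" using \<gamma> by simp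
    finally show ?thesis using B by (simp add: powr_minus_divide)
  qed
  have \<nu>\<gamma>: "C * \<nu> powr \<gamma> = q"
  proof -
    have "\<nu> powr \<gamma> = (C powr (- 1 / \<gamma>)) powr \<gamma> * (B powr (- 1 / \<gamma>\<^sup>2)) powr \<gamma>" using C B by (simp add: \<nu>_def powr_mult)
    also have "\<dots> = C powr (- 1 / \<gamma> * \<gamma>) * B powr (- 1 / \<gamma>\<^sup>2 * \<gamma>)" by (simp only: powr_powr)
    also have "- 1 / \<gamma> * \<gamma> = - 1" using \<gamma> by simp
    also have "- 1 / \<gamma>\<^sup>2 * \<gamma> = - 1 / \<gamma>" using \<gamma> by (simp add: power2_eq_square)
    finally show ?thesis using C by (simp add: powr_minus_divide q_def)
  qed
  have le: "Y n \<le> \<nu> * q ^ n" for n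
  proof (induction n)
    case 0 then show ?case using init by (simp add: \<nu>_def)
  next
    case (Suc n)
    have "Y (Suc n) \<le> C * B ^ n * Y n powr (1 + \<gamma>)" by (rule step)
    also have "\<dots> \<le> C * B ^ n * (\<nu> * q ^ n) powr (1 + \<gamma>)"
      using Suc Y0 C B \<gamma> by (intro mult_left_mono powr_mono2) auto
    also have "(\<nu> * q ^ n) powr (1 + \<gamma>) = (\<nu> * q ^ n) * (\<nu> powr \<gamma> * (q powr \<gamma>) ^ n)"
      using \<nu> q by (simp add: powr_add powr_mult powr_realpow[symmetric] powr_powr mult.commute)
    also have "C * B ^ n * ((\<nu> * q ^ n) * (\<nu> powr \<gamma> * (q powr \<gamma>) ^ n)) = \<nu> * q ^ n * (C * \<nu> powr \<gamma>)"
      using B by (simp add: q\<gamma> power_divide)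
    also have "\<dots> = \<nu> * q ^ Suc n" by (simp add: \<nu>\<gamma>)
    finally show ?case .
  qed
  have "(\<lambda>n. \<nu> * q ^ n) \<longlonglongrightarrow> \<nu> * 0" using q by (intro tendsto_mult_left LIMSEQ_power_zero) auto
  then have "(\<lambda>n. \<nu> * q ^ n) \<longlonglongrightarrow> 0" by simp
  then show ?thesis by (rule tendsto_sandwich[OF _ _ tendsto_const, rotated 2]) (use Y0 le in auto)
qed

context frac_kernel
begin

section \<open>Cone barriers and the Caccioppoli inequality\<close>

definition cone :: "'a \<Rightarrow> real \<Rightarrow> 'a \<Rightarrow> real"
  where "cone x0 r y = min 1 (norm (y - x0) / r)"

lemma cone_measurable [measurable]: "cone x0 r \<in> borel_measurable borel"
  unfolding cone_def[abs_def] by measurable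

lemma cone_bounds: "0 < r \<Longrightarrow> 0 \<le> cone x0 r y" "cone x0 r y \<le> 1"
  by (auto simp: cone_def)

lemma cone_lipschitz:
  assumes "0 < r" shows "\<bar>cone x0 r x - cone x0 r y\<bar> \<le> min 1 (norm (x - y) / r)"
proof -
  have "\<bar>norm (x - x0) - norm (y - x0)\<bar> \<le> norm (x - y)" using norm_triangle_ineq3[of "x - x0" "y - x0"] by simp
  then have "\<bar>norm (x - x0) / r - norm (y - x0) / r\<bar> \<le> norm (x - y) / r"
    using assms by (simp add: diff_divide_distrib[symmetric] divide_right_mono)
  then have "\<bar>cone x0 r x - cone x0 r y\<bar> \<le> norm (x - y) / r" by (auto simp: cone_def min_def)
  moreover have "\<bar>cone x0 r x - cone x0 r y\<bar> \<le> 1" using cone_bounds(1)[OF assms, of x0 x] cone_bounds(1)[OF assms, of x0 y] cone_bounds(2)[of x0 r x] cone_bounds(2)[of x0 r y] by linarith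
  ultimately show ?thesis by simp
qed

text \<open>The first summand comes from distances below r, where the cone is Lipschitz with
  constant 1/r and the exponent is p - sp; the second from distances above r, where increments are
  at most 1. After scaling both carry the factor \<open>r powr (- (s * p))\<close>.\<close>

definition C2 :: real
  where "C2 = unit_ball_vol (real DIM('a)) * 2 ^ DIM('a) * (1 / (1 - 2 powr (- (p - s * p)))) + unit_ball_vol (real DIM('a)) * 2 ^ DIM('a) * (1 / (1 - 2 powr (- (s * p))))"

lemma psp: "0 < p - s * p"
  using s_less p_gt by simp

lemma C2_nonneg: "0 \<le> C2"
proof -
  have "2 powr (- (p - s * p)) < (1::real)" "2 powr (- (s * p)) < (1::real)"
    using psp sp_pos powr_less_one[of 2 "- (p - s * p)"] powr_less_one[of 2 "- (s * p)"] by auto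
  then show ?thesis unfolding C2_def by (intro add_nonneg_nonneg mult_nonneg_nonneg) auto
qed

lemma cone_energy_density:
  assumes r: "0 < r"
  shows "(\<integral>\<^sup>+y. ennreal (\<bar>cone x0 r x - cone x0 r y\<bar> powr p * k x y) \<partial>lborel) \<le> ennreal (\<Lambda> * C2 * r powr (- (s * p)))"
proof -
  let ?N = "real DIM('a)"
  let ?u = "unit_ball_vol ?N * 2 ^ DIM('a)"
  let ?in = "\<lambda>y. ennreal (norm (x - y) powr (p - s * p - ?N)) * indicator {y. norm (x - y) \<le> r} y"
  let ?out = "\<lambda>y. ennreal (norm (x - y) powr (- (s * p) - ?N)) * indicator {y. r \<le> norm (x - y)} y"
  have l1: "2 powr (- (p - s * p)) < (1::real)" "2 powr (- (s * p)) < (1::real)"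
    using psp sp_pos powr_less_one[of 2 "- (p - s * p)"] powr_less_one[of 2 "- (s * p)"] by auto
  have "(\<integral>\<^sup>+y. ennreal (\<bar>cone x0 r x - cone x0 r y\<bar> powr p * k x y) \<partial>lborel)
    \<le> (\<integral>\<^sup>+y. ennreal (\<Lambda> * r powr (- p)) * ?in y + ennreal \<Lambda> * ?out y \<partial>lborel)"
  proof (rule nn_integral_mono)
    fix y
    let ?c = "\<bar>cone x0 r x - cone x0 r y\<bar>"
    show "ennreal (?c powr p * k x y) \<le> ennreal (\<Lambda> * r powr (- p)) * ?in y + ennreal \<Lambda> * ?out y"
    proof (cases "norm (x - y) \<le> r")
      case True
      have "?c powr p \<le> (norm (x - y) / r) powr p" using cone_lipschitz[OF r, of x0 x y] p_gt by (intro powr_mono2) auto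
      then have "?c powr p * k x y \<le> (norm (x - y) / r) powr p * (\<Lambda> * norm (x - y) powr (- (s * p) - ?N))"
        using k_upper k_nonneg by (intro mult_mono) auto
      also have "\<dots> = \<Lambda> * r powr (- p) * (norm (x - y) powr p * norm (x - y) powr (- (s * p) - ?N))"
        using r by (simp add: powr_divide powr_minus_divide)
      also have "norm (x - y) powr p * norm (x - y) powr (- (s * p) - ?N) = norm (x - y) powr (p - s * p - ?N)"
        unfolding powr_add[symmetric] by (simp add: algebra_simps)
      finally have "ennreal (?c powr p * k x y) \<le> ennreal (\<Lambda> * r powr (- p)) * ?in y"
        using True \<Lambda>_ge by (simp add: ennreal_mult[symmetric] ennreal_leI)
      then show ?thesis by (rule order_trans) simp
    next
      case False
      have "?c powr p \<le> 1 powr p" using cone_lipschitz[OF r, of x0 x y] p_gt by (intro powr_mono2) auto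
      then have "?c powr p * k x y \<le> 1 * (\<Lambda> * norm (x - y) powr (- (s * p) - ?N))"
        using k_upper k_nonneg by (intro mult_mono) auto
      then have "ennreal (?c powr p * k x y) \<le> ennreal \<Lambda> * ?out y"
        using False \<Lambda>_ge by (simp add: ennreal_mult[symmetric] ennreal_leI)
      then show ?thesis by (rule order_trans) simp
    qed
  qed
  also have "\<dots> = ennreal (\<Lambda> * r powr (- p)) * (\<integral>\<^sup>+y. ?in y \<partial>lborel) + ennreal \<Lambda> * (\<integral>\<^sup>+y. ?out y \<partial>lborel)"
    by (simp add: nn_integral_add nn_integral_cmult)
  also have "\<dots> \<le> ennreal (\<Lambda> * r powr (- p)) * ennreal (?u * (r powr (p - s * p) / (1 - 2 powr (- (p - s * p)))))
    + ennreal \<Lambda> * ennreal (?u * (r powr (- (s * p)) / (1 - 2 powr (- (s * p)))))"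
    by (intro add_mono mult_left_mono nn_integral_powr_inside[OF psp r] nn_integral_powr_outside[OF sp_pos r]) auto
  also have "\<dots> = ennreal (\<Lambda> * r powr (- p) * (?u * (r powr (p - s * p) / (1 - 2 powr (- (p - s * p)))))
    + \<Lambda> * (?u * (r powr (- (s * p)) / (1 - 2 powr (- (s * p))))))"
    using \<Lambda>_ge l1 by (simp add: ennreal_mult[symmetric] ennreal_plus[symmetric] del: ennreal_plus)
  also have "\<Lambda> * r powr (- p) * (?u * (r powr (p - s * p) / (1 - 2 powr (- (p - s * p)))))
    + \<Lambda> * (?u * (r powr (- (s * p)) / (1 - 2 powr (- (s * p))))) = \<Lambda> * C2 * r powr (- (s * p))"
  proof -
    have "r powr (- p) * r powr (p - s * p) = r powr (- (s * p))" unfolding powr_add[symmetric] by simp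
    then show ?thesis unfolding C2_def by (simp add: algebra_simps)
  qed
  finally show ?thesis .
qed

text \<open>\<open>C1\<close> is the price of the barrier in \<open>phi_add_mult_lower\<close>.
  \<open>C3\<close> collects the cone error \<open>C1 * \<Lambda> * C2\<close> and 1 for the tail,
  doubled because each pair occurs in both orders.\<close>

definition C1 :: real where "C1 = 2 * 3 powr (p - 1) + 2"
definition C3 :: real where "C3 = 2 * (C1 * \<Lambda> * C2 + 1)"

lemma C1_pos: "0 < C1" by (simp add: C1_def add_nonneg_pos)
lemma C3_pos: "0 < C3" using C1_pos C2_nonneg \<Lambda>_ge by (simp add: C3_def add_nonneg_pos)

text \<open>Caccioppoli inequality in De Giorgi's iteration. Instead of multiplying by a cutoff, the test function \<open>(v - b)\<^sub>+\<close>
  uses a cone \<open>b\<close> that exceeds \<open>v\<close> outside a small ball.\<close>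

lemma Caccioppoli_barrier:
  assumes v: "loc_energy v D" and sub: "\<And>\<eta>. \<eta> \<in> tests D \<Longrightarrow> (\<And>x. 0 \<le> \<eta> x) \<Longrightarrow> (\<integral>z. wform v \<eta> z \<partial>mu) \<le> 0"
    and R: "ball x0 R \<subseteq> D" "0 < r" "4 * r \<le> R" and m0: "\<And>x. x \<in> D \<Longrightarrow> \<bar>v x\<bar> \<le> m0"
    and M: "AE y in lborel. y \<in> ball x0 R \<longrightarrow> v y \<le> M" and a: "0 < a" and c: "M \<le> c + a"
    and T: "\<And>x. x \<in> ball x0 r \<Longrightarrow> (\<integral>\<^sup>+y. ennreal ((\<bar>v y\<bar> + m0) powr (p - 1) * k x y) * indicator (- ball x0 R) y \<partial>lborel) \<le> ennreal (a powr (p - 1) * r powr (- (s * p)))"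
    and b: "\<And>y. b y = c + a * cone x0 r y" and A: "A = {y \<in> ball x0 r. b y < v y}"
    and L: "L \<in> sets borel" "L \<subseteq> ball x0 R" "L \<inter> A = {}"
    and q: "q \<in> borel_measurable borel" "\<And>x y. x \<in> A \<Longrightarrow> y \<in> L \<Longrightarrow> q x - C1 * \<bar>b x - b y\<bar> powr p \<le> phi p (v x - v y) * (v x - b x)"
  shows "(\<integral>\<^sup>+x. \<integral>\<^sup>+y. ennreal (k x y) * (ennreal (q x) * indicator A x * indicator L y) \<partial>lborel \<partial>lborel) \<le> ennreal (C3 * a powr p * r powr (- (s * p))) * emeasure lborel A"
proof -
  have [measurable]: "v \<in> borel_measurable borel" "L \<in> sets borel" "q \<in> borel_measurable borel" using loc_energyD v L q by auto
  have [measurable]: "b \<in> borel_measurable borel" unfolding b[abs_def] by measurable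
  have [measurable]: "A \<in> sets borel" unfolding A by measurable
  have AR: "A \<subseteq> ball x0 r" "ball x0 r \<subseteq> ball x0 R" "A \<subseteq> D" using R A by auto
  have "x0 \<in> D" using R by auto
  then have m00: "0 \<le> m0" using m0[of x0] by linarith
  have cbD: "cball x0 r \<subseteq> D" using R by (auto intro!: subsetD[OF R(1)])
  \<comment> \<open>Outside the ball of radius r the barrier has height
    \<open>c + a \<ge> M\<close>, so inside the ball of radius R this is almost everywhere the
    positive part of \<open>v - b\<close>. Restriction to A makes the support compact
    everywhere.\<close>
  define \<xi> where "\<xi> x = (if x \<in> A then v x - b x else 0)" for x
  have \<xi>m [measurable]: "\<xi> \<in> borel_measurable borel" unfolding \<xi>_def[abs_def] by measurable
  have \<xi>0: "0 \<le> \<xi> x" for x by (auto simp: \<xi>_def A)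
  have bc: "c \<le> b x" for x unfolding b using a cone_bounds(1)[OF R(2), of x0 x] by simp
  have bout: "b y = c + a" if "y \<notin> ball x0 r" for y
  proof -
    have "1 \<le> norm (y - x0) / r" using that R(2) by (simp add: dist_norm norm_minus_commute)
    then show ?thesis unfolding b cone_def by simp
  qed
  have \<xi>b: "\<bar>\<xi> x\<bar> \<le> m0 + \<bar>c\<bar>" for x
  proof (cases "x \<in> A")
    case True
    then have "\<bar>v x\<bar> \<le> m0" using m0 AR by blast
    then show ?thesis using True \<xi>0[of x] bc[of x] by (auto simp: \<xi>_def)
  qed (use m00 in \<open>simp add: \<xi>_def\<close>)
  have \<xi>z: "x \<notin> cball x0 r \<Longrightarrow> \<xi> x = 0" for x using AR(1) by (auto simp: \<xi>_def)
  have db: "\<bar>b x - b y\<bar> powr p = a powr p * \<bar>cone x0 r x - cone x0 r y\<bar> powr p" for x y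
  proof -
    have "b x - b y = a * (cone x0 r x - cone x0 r y)" by (simp add: b algebra_simps)
    then show ?thesis using a by (simp add: abs_mult powr_mult)
  qed
  have bint: "(\<integral>\<^sup>+y. ennreal (\<bar>b x - b y\<bar> powr p * k x y) \<partial>lborel) \<le> ennreal (\<Lambda> * C2 * a powr p * r powr (- (s * p)))" for x
  proof -
    have "(\<integral>\<^sup>+y. ennreal (\<bar>b x - b y\<bar> powr p * k x y) \<partial>lborel) = (\<integral>\<^sup>+y. ennreal (a powr p) * ennreal (\<bar>cone x0 r x - cone x0 r y\<bar> powr p * k x y) \<partial>lborel)"
      using k_nonneg by (intro nn_integral_cong) (simp add: db ennreal_mult[symmetric] mult.assoc)
    also have "\<dots> = ennreal (a powr p) * (\<integral>\<^sup>+y. ennreal (\<bar>cone x0 r x - cone x0 r y\<bar> powr p * k x y) \<partial>lborel)"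
      by (rule nn_integral_cmult) measurable
    also have "\<dots> \<le> ennreal (a powr p) * ennreal (\<Lambda> * C2 * r powr (- (s * p)))"
      by (intro mult_left_mono cone_energy_density R) auto
    also have "\<dots> = ennreal (\<Lambda> * C2 * a powr p * r powr (- (s * p)))"
      using \<Lambda>_ge C2_nonneg by (simp add: ennreal_mult[symmetric] mult_ac)
    finally show ?thesis .
  qed
  have cR: "compact (cball x0 r)" by simp
  obtain U0 where U0: "open U0" "cball x0 r \<subseteq> U0" "U0 \<subseteq> D" "energy v (U0 \<times> U0) < \<infinity>"
    using v cbD cR unfolding loc_energy_def by blast
  have \<xi>t: "\<xi> \<in> tests D"
  proof -
    define U where "U = U0 \<inter> ball x0 R"
    have U: "open U" "cball x0 r \<subseteq> U" using U0 R by (auto simp: U_def)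
    have [measurable]: "U \<in> sets borel" using U by simp
    have bU: "bounded U" by (rule bounded_subset[OF bounded_ball[of x0 R]]) (simp add: U_def)
    \<comment> \<open>The increments of the positive part are controlled by those of v and b, while
      those of \<xi> need not be on the null set where \<open>v > M\<close>. Both functions agree
      almost everywhere on U.\<close>
    define \<xi>' where "\<xi>' x = max (v x - b x) 0" for x
    have [measurable]: "\<xi>' \<in> borel_measurable borel" unfolding \<xi>'_def[abs_def] by measurable
    have Ev: "energy v (U \<times> U) < \<infinity>" by (rule le_less_trans[OF energy_mono U0(4)]) (auto simp: U_def)
    have Eb: "energy b (U \<times> U) < \<infinity>"
    proof -
      have "energy b (U \<times> U) = (\<integral>\<^sup>+x. \<integral>\<^sup>+y. ennreal (k x y) * (ennreal (\<bar>dif b (x, y)\<bar> powr p) * indicator (U \<times> U) (x, y)) \<partial>lborel \<partial>lborel)"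
        unfolding energy_def by (rule nn_integral_mu) measurable
      also have "\<dots> \<le> (\<integral>\<^sup>+x. ennreal (\<Lambda> * C2 * a powr p * r powr (- (s * p))) * indicator U x \<partial>lborel)"
      proof (rule nn_integral_mono)
        fix x
        show "(\<integral>\<^sup>+y. ennreal (k x y) * (ennreal (\<bar>dif b (x, y)\<bar> powr p) * indicator (U \<times> U) (x, y)) \<partial>lborel) \<le> ennreal (\<Lambda> * C2 * a powr p * r powr (- (s * p))) * indicator U x"
        proof (cases "x \<in> U")
          case True
          have "(\<integral>\<^sup>+y. ennreal (k x y) * (ennreal (\<bar>dif b (x, y)\<bar> powr p) * indicator (U \<times> U) (x, y)) \<partial>lborel) \<le> (\<integral>\<^sup>+y. ennreal (\<bar>b x - b y\<bar> powr p * k x y) \<partial>lborel)"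
            using k_nonneg by (intro nn_integral_mono) (auto simp: ennreal_mult[symmetric] mult.commute indicator_def)
          then show ?thesis using bint[of x] True by simp
        qed simp
      qed
      also have "\<dots> = ennreal (\<Lambda> * C2 * a powr p * r powr (- (s * p))) * emeasure lborel U" by (rule nn_integral_cmult_indicator) simp
      also have "\<dots> < \<infinity>" using emeasure_bounded_finite[OF bU] by (simp add: ennreal_mult_less_top)
      finally show ?thesis .
    qed
    have E': "energy \<xi>' (U \<times> U) < \<infinity>"
      by (rule energy_finite_add[OF _ _ _ _ Ev Eb]) (auto simp: \<xi>'_def dif_def max_def)
    have "AE z in mu. z \<in> U \<times> U \<longrightarrow> dif \<xi> z = dif \<xi>' z"
    proof (rule mu_AE_I, use AE_lborel_fst_snd[OF M] in eventually_elim, intro impI)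
      fix z assume z: "(fst z \<in> ball x0 R \<longrightarrow> v (fst z) \<le> M) \<and> (snd z \<in> ball x0 R \<longrightarrow> v (snd z) \<le> M)" "z \<in> U \<times> U"
      have "\<xi> x = \<xi>' x" if "x \<in> U" "x \<in> ball x0 R \<longrightarrow> v x \<le> M" for x
        using that bout[of x] c by (cases "x \<in> ball x0 r") (auto simp: \<xi>_def \<xi>'_def A U_def)
      then show "dif \<xi> z = dif \<xi>' z" using z by (auto simp: dif_def)
    qed
    then have "energy \<xi> (U \<times> U) = energy \<xi>' (U \<times> U)"
      unfolding energy_def by (intro nn_integral_cong_AE) (auto elim!: eventually_mono simp: indicator_def)
    then have "energy \<xi> UNIV < \<infinity>"
      using E' by (intro bounded_support_energy[OF \<xi>m \<xi>b cR \<xi>z U]) auto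
    then show ?thesis unfolding tests_def using \<xi>m \<xi>b \<xi>z cbD cR by blast
  qed
  \<comment> \<open>The amount by which the weak form may be negative at a pair starting in A:
    inside the large ball the error of the barrier, outside the interaction with the tail.\<close>
  define n where "n z = (if fst z \<in> A then C1 * \<bar>b (fst z) - b (snd z)\<bar> powr p * indicator (ball x0 R) (snd z)
    + (\<bar>v (snd z)\<bar> + m0) powr (p - 1) * \<xi> (fst z) * indicator (- ball x0 R) (snd z) else 0)" for z
  have [measurable]: "n \<in> borel_measurable borel" unfolding n_def[abs_def] by measurable
  have n0: "0 \<le> n z" for z using C1_pos \<xi>0 by (auto simp: n_def indicator_def)
  have nint: "(\<integral>\<^sup>+z. ennreal (n z) \<partial>mu) \<le> ennreal (C3 / 2 * a powr p * r powr (- (s * p))) * emeasure lborel A"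
  proof -
    have "(\<integral>\<^sup>+z. ennreal (n z) \<partial>mu) = (\<integral>\<^sup>+x. \<integral>\<^sup>+y. ennreal (k x y) * ennreal (n (x, y)) \<partial>lborel \<partial>lborel)"
      by (rule nn_integral_mu) measurable
    also have "\<dots> \<le> (\<integral>\<^sup>+x. ennreal (C3 / 2 * a powr p * r powr (- (s * p))) * indicator A x \<partial>lborel)"
    proof (rule nn_integral_mono_AE, use M in eventually_elim)
      fix x assume xM: "x \<in> ball x0 R \<longrightarrow> v x \<le> M"
      show "(\<integral>\<^sup>+y. ennreal (k x y) * ennreal (n (x, y)) \<partial>lborel) \<le> ennreal (C3 / 2 * a powr p * r powr (- (s * p))) * indicator A x"
      proof (cases "x \<in> A")
        case True
        have xb: "x \<in> ball x0 r" "x \<in> ball x0 R" using True AR by auto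
        have \<xi>a: "\<xi> x \<le> a" using True xM xb bc[of x] c by (simp add: \<xi>_def)
        have "(\<integral>\<^sup>+y. ennreal (k x y) * ennreal (n (x, y)) \<partial>lborel) \<le>
          (\<integral>\<^sup>+y. ennreal C1 * ennreal (\<bar>b x - b y\<bar> powr p * k x y) + ennreal a * (ennreal ((\<bar>v y\<bar> + m0) powr (p - 1) * k x y) * indicator (- ball x0 R) y) \<partial>lborel)"
        proof (rule nn_integral_mono)
          fix y
          show "ennreal (k x y) * ennreal (n (x, y)) \<le> ennreal C1 * ennreal (\<bar>b x - b y\<bar> powr p * k x y) + ennreal a * (ennreal ((\<bar>v y\<bar> + m0) powr (p - 1) * k x y) * indicator (- ball x0 R) y)"
          proof (cases "y \<in> ball x0 R")
            case y: True
            then have "ennreal (k x y) * ennreal (n (x, y)) = ennreal C1 * ennreal (\<bar>b x - b y\<bar> powr p * k x y)"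
              using True k_nonneg C1_pos by (simp add: n_def ennreal_mult[symmetric] mult_ac)
            then show ?thesis by simp
          next
            case y: False
            have "k x y * ((\<bar>v y\<bar> + m0) powr (p - 1) * \<xi> x) \<le> k x y * ((\<bar>v y\<bar> + m0) powr (p - 1) * a)"
              using \<xi>a k_nonneg by (intro mult_left_mono) auto
            also have "\<dots> = a * ((\<bar>v y\<bar> + m0) powr (p - 1) * k x y)" by simp
            finally have "ennreal (k x y) * ennreal (n (x, y)) \<le> ennreal a * (ennreal ((\<bar>v y\<bar> + m0) powr (p - 1) * k x y) * indicator (- ball x0 R) y)"
              using True y k_nonneg a \<xi>0[of x] by (simp add: n_def ennreal_mult[symmetric] ennreal_leI)
            then show ?thesis by (rule order_trans) simp
          qed
        qed
        also have "\<dots> = ennreal C1 * (\<integral>\<^sup>+y. ennreal (\<bar>b x - b y\<bar> powr p * k x y) \<partial>lborel) + ennreal a * (\<integral>\<^sup>+y. ennreal ((\<bar>v y\<bar> + m0) powr (p - 1) * k x y) * indicator (- ball x0 R) y \<partial>lborel)"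
          by (simp add: nn_integral_add nn_integral_cmult)
        also have "\<dots> \<le> ennreal C1 * ennreal (\<Lambda> * C2 * a powr p * r powr (- (s * p))) + ennreal a * ennreal (a powr (p - 1) * r powr (- (s * p)))"
          by (intro add_mono mult_left_mono bint T xb) auto
        also have "\<dots> = ennreal (C1 * (\<Lambda> * C2 * a powr p * r powr (- (s * p))) + a * (a powr (p - 1) * r powr (- (s * p))))"
          using C1_pos a \<Lambda>_ge C2_nonneg by (simp add: ennreal_mult[symmetric] ennreal_plus[symmetric] del: ennreal_plus)
        also have "C1 * (\<Lambda> * C2 * a powr p * r powr (- (s * p))) + a * (a powr (p - 1) * r powr (- (s * p))) = C3 / 2 * a powr p * r powr (- (s * p))"
        proof -
          have "a * a powr (p - 1) = a powr p" using powr_minus_one_mult[of a p] a by (simp add: mult.commute)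
          then have "a * (a powr (p - 1) * r powr (- (s * p))) = a powr p * r powr (- (s * p))" by (simp add: mult.assoc[symmetric])
          then show ?thesis by (simp add: C3_def algebra_simps)
        qed
        finally show ?thesis using True by simp
      qed (simp add: n_def)
    qed
    also have "\<dots> = ennreal (C3 / 2 * a powr p * r powr (- (s * p))) * emeasure lborel A" by (rule nn_integral_cmult_indicator) simp
    finally show ?thesis .
  qed
  define n2 where "n2 z = n z + n (snd z, fst z)" for z
  have [measurable]: "n2 \<in> borel_measurable borel" unfolding n2_def[abs_def] by measurable
  have n20: "0 \<le> n2 z" for z using n0 by (simp add: n2_def)
  have Afin: "emeasure lborel A < \<infinity>" by (rule emeasure_bounded_finite[OF bounded_subset[OF bounded_ball AR(1)]])
  have n2int: "(\<integral>\<^sup>+z. ennreal (n2 z) \<partial>mu) \<le> ennreal (C3 * a powr p * r powr (- (s * p))) * emeasure lborel A"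
  proof -
    have "(\<integral>\<^sup>+z. ennreal (n2 z) \<partial>mu) = (\<integral>\<^sup>+z. ennreal (n z) + ennreal (n (snd z, fst z)) \<partial>mu)"
      using n0 by (intro nn_integral_cong) (simp add: n2_def)
    also have "\<dots> = (\<integral>\<^sup>+z. ennreal (n z) \<partial>mu) + (\<integral>\<^sup>+z. ennreal (n z) \<partial>mu)"
      using nn_integral_mu_swap[of "\<lambda>z. ennreal (n z)"] by (subst nn_integral_add) auto
    also have "\<dots> \<le> ennreal (C3 / 2 * a powr p * r powr (- (s * p))) * emeasure lborel A + ennreal (C3 / 2 * a powr p * r powr (- (s * p))) * emeasure lborel A"
      by (intro add_mono nint)
    also have "\<dots> = (ennreal (C3 / 2 * a powr p * r powr (- (s * p))) + ennreal (C3 / 2 * a powr p * r powr (- (s * p)))) * emeasure lborel A"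
      by (rule distrib_right[symmetric])
    also have "ennreal (C3 / 2 * a powr p * r powr (- (s * p))) + ennreal (C3 / 2 * a powr p * r powr (- (s * p))) = ennreal (C3 * a powr p * r powr (- (s * p)))"
      using C3_pos by (subst ennreal_plus[symmetric]) (auto intro!: mult_nonneg_nonneg)
    finally show ?thesis .
  qed
  have in2: "integrable mu n2"
  proof (rule integrableI_nonneg)
    show "(\<integral>\<^sup>+z. ennreal (n2 z) \<partial>mu) < \<infinity>"
      by (rule le_less_trans[OF n2int]) (use Afin in \<open>simp add: ennreal_mult_less_top\<close>)
  qed (use n20 in auto)
  define P where "P z = ennreal (q (fst z)) * indicator A (fst z) * indicator L (snd z)" for z
  have [measurable]: "P \<in> borel_measurable borel" unfolding P_def[abs_def] by measurable
  have pw: "AE z in mu. P z \<le> ennreal (wform v \<xi> z + n2 z) \<and> 0 \<le> wform v \<xi> z + n2 z"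
  proof (rule mu_AE_I, use AE_lborel_fst_snd[OF M] in eventually_elim)
    fix z :: "'a \<times> 'a"
    assume zM: "(fst z \<in> ball x0 R \<longrightarrow> v (fst z) \<le> M) \<and> (snd z \<in> ball x0 R \<longrightarrow> v (snd z) \<le> M)"
    have main: "P (x, y) \<le> ennreal (wform v \<xi> (x, y) + n (x, y)) \<and> 0 \<le> wform v \<xi> (x, y) + n (x, y)"
      if xA: "x \<in> A" and yM: "y \<in> ball x0 R \<longrightarrow> v y \<le> M" for x y
    proof -
      have \<xi>x: "\<xi> x = v x - b x" "0 < \<xi> x" using xA by (auto simp: \<xi>_def A)
      have young: "- (C1 * \<bar>\<beta>\<bar> powr p) \<le> phi p (\<alpha> + \<beta>) * \<alpha>" for \<alpha> \<beta> :: real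
      proof -
        have "0 \<le> 2 powr (1 - p) * \<bar>\<alpha>\<bar> powr p" by simp
        then show ?thesis using phi_add_mult_lower[OF p_gt, of \<alpha> \<beta>] unfolding C1_def by linarith
      qed
      \<comment> \<open>With both points in A only nonnegativity up to the barrier error is claimed.
        If y leaves A within the large ball, then \<open>v y \<le> b y\<close>, and for y in L the
        term \<open>q x\<close> is collected. Beyond the large ball the tail bound applies.\<close>
      consider "y \<in> A" | "y \<notin> A" "y \<in> ball x0 R" | "y \<notin> ball x0 R" by blast
      then show ?thesis
      proof cases
        case 1
        have yR: "y \<in> ball x0 R" using 1 AR by blast
        have "phi p ((\<xi> x - \<xi> y) + (b x - b y)) * (\<xi> x - \<xi> y) = wform v \<xi> (x, y)"
          using xA 1 by (simp add: wform_def \<xi>_def)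
        then have "0 \<le> wform v \<xi> (x, y) + n (x, y)" using young[of "b x - b y" "\<xi> x - \<xi> y"] xA yR by (simp add: n_def)
        moreover have "P (x, y) = 0" using 1 L(3) by (auto simp: P_def indicator_def)
        ultimately show ?thesis by simp
      next
        case 2
        have \<xi>y: "\<xi> y = 0" using 2 by (simp add: \<xi>_def)
        have vy: "v y \<le> b y" using 2 yM bout[of y] c by (cases "y \<in> ball x0 r") (auto simp: A)
        have wfe: "wform v \<xi> (x, y) = phi p (v x - v y) * \<xi> x" using \<xi>y by (simp add: wform_def)
        have "phi p (\<xi> x + (b x - b y)) * \<xi> x \<le> phi p (v x - v y) * \<xi> x"
          using \<xi>x vy by (intro mult_right_mono phi_mono[OF p_gt]) auto
        then have nn: "0 \<le> wform v \<xi> (x, y) + n (x, y)"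
          using young[of "b x - b y" "\<xi> x"] xA 2 unfolding wfe by (simp add: n_def)
        show ?thesis
        proof (cases "y \<in> L")
          case True
          have "q x \<le> wform v \<xi> (x, y) + n (x, y)" using q(2)[OF xA True] xA 2 \<xi>x(1) unfolding wfe by (simp add: n_def)
          then show ?thesis using nn True xA by (simp add: P_def ennreal_leI)
        next
          case False then show ?thesis using nn by (simp add: P_def)
        qed
      next
        case 3
        have \<xi>y: "\<xi> y = 0" using 3 AR by (auto simp: \<xi>_def)
        have "\<bar>v x\<bar> \<le> m0" using m0 xA AR by blast
        then have le: "\<bar>v x - v y\<bar> powr (p - 1) \<le> (\<bar>v y\<bar> + m0) powr (p - 1)" using p_gt by (intro powr_mono2) auto
        have "- ((\<bar>v y\<bar> + m0) powr (p - 1)) \<le> phi p (v x - v y)" using le abs_phi[of p "v x - v y"] by linarith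
        then have "- ((\<bar>v y\<bar> + m0) powr (p - 1)) * \<xi> x \<le> phi p (v x - v y) * \<xi> x" using \<xi>x by (intro mult_right_mono) auto
        then have "0 \<le> wform v \<xi> (x, y) + n (x, y)" using \<xi>y xA 3 by (simp add: wform_def n_def)
        moreover have "P (x, y) = 0" using 3 L(2) by (auto simp: P_def indicator_def)
        ultimately show ?thesis by simp
      qed
    qed
    obtain x y where z: "z = (x, y)" by (cases z)
    show "P z \<le> ennreal (wform v \<xi> z + n2 z) \<and> 0 \<le> wform v \<xi> z + n2 z"
    proof (cases "x \<in> A")
      case True
      have m: "P (x, y) \<le> ennreal (wform v \<xi> (x, y) + n (x, y))" "0 \<le> wform v \<xi> (x, y) + n (x, y)"
        using main[OF True, of y] zM by (auto simp: z)
      have le: "wform v \<xi> (x, y) + n (x, y) \<le> wform v \<xi> z + n2 z" using n0 by (simp add: z n2_def)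
      show ?thesis using m le order_trans[OF m(1) ennreal_leI[OF le]] by (simp add: z)
    next
      case False
      then have P0: "P z = 0" by (simp add: P_def z)
      show ?thesis
      proof (cases "y \<in> A")
        case True
        have "0 \<le> wform v \<xi> (y, x) + n (y, x)" using main[OF True, of x] zM by (auto simp: z)
        then show ?thesis using P0 n0[of "(x, y)"] wform_swap[of v \<xi> x y] by (simp add: z n2_def)
      next
        case yA: False
        then have "wform v \<xi> z = 0" using False by (simp add: z wform_def \<xi>_def)
        then show ?thesis using P0 n20 by simp
      qed
    qed
  qed
  have iw: "integrable mu (wform v \<xi>)" by (rule wform_integrable[OF v \<xi>t])
  have "(\<integral>\<^sup>+x. \<integral>\<^sup>+y. ennreal (k x y) * (ennreal (q x) * indicator A x * indicator L y) \<partial>lborel \<partial>lborel) = (\<integral>\<^sup>+z. P z \<partial>mu)"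
    by (subst nn_integral_mu) (auto simp: P_def)
  also have "\<dots> \<le> (\<integral>\<^sup>+z. ennreal (wform v \<xi> z + n2 z) \<partial>mu)"
    using pw by (intro nn_integral_mono_AE) (auto elim: eventually_mono)
  also have "\<dots> = ennreal (\<integral>z. wform v \<xi> z + n2 z \<partial>mu)"
    using pw iw in2 by (intro nn_integral_eq_integral) (auto elim: eventually_mono)
  \<comment> \<open>The subsolution property: the integral of the weak form against \<xi> is at most
    0 and is dropped.\<close>
  also have "\<dots> \<le> ennreal (\<integral>z. n2 z \<partial>mu)"
    using sub[OF \<xi>t \<xi>0] iw in2 by (intro ennreal_leI) simp
  also have "\<dots> = (\<integral>\<^sup>+z. ennreal (n2 z) \<partial>mu)"
    using in2 n20 by (intro nn_integral_eq_integral[symmetric]) auto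
  also note n2int
  finally show ?thesis .
qed

end

section \<open>From integral estimates to a pointwise gain\<close>

lemma emeasure_eq_measure_subset_ball:
  assumes "S \<subseteq> ball x r"
  shows "emeasure lborel S = ennreal (measure lborel S)"
  using emeasure_bounded_finite[OF bounded_subset[OF bounded_ball assms]]
  by (simp add: emeasure_eq_ennreal_measure less_top[symmetric])

context frac_kernel
begin

text \<open>If a ball of radius \<rho> has measure 2\<alpha>, then
  \<open>\<rho> powr (- (s * p) - N) * \<alpha>\<close> equals
  \<open>CF * \<alpha> powr (- (s * p / N))\<close>, where N is the dimension.\<close>

definition CF :: real
  where "CF = (2 / unit_ball_vol (real DIM('a))) powr (- ((s * p + real DIM('a)) / real DIM('a)))"

lemma CF_pos: "0 < CF"
proof -
  have "0 < unit_ball_vol (real DIM('a))" by simp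
  from less_imp_neq[OF this] show ?thesis by (simp add: CF_def)
qed

text \<open>A fractional Faber-Krahn inequality: a set of measure \<open>\<alpha>\<close> leaves half of a ball of measure \<open>2\<alpha>\<close> uncovered.\<close>

lemma complement_kernel_lower:
  assumes A: "A \<in> sets borel" "A \<subseteq> ball x0 r" "0 < measure lborel A" and r: "0 < r" "4 * r \<le> R" and x: "x \<in> ball x0 r"
    and L: "L \<in> sets borel" "AE y in lborel. y \<in> ball x0 R \<longrightarrow> y \<in> A \<or> y \<in> L"
  shows "ennreal (CF * measure lborel A powr (- (s * p / real DIM('a))) / \<Lambda>) \<le> (\<integral>\<^sup>+y. ennreal (k x y) * indicator L y \<partial>lborel)"
proof -
  note [measurable] = A(1) L(1)
  let ?N = "real DIM('a)" and ?w = "unit_ball_vol (real DIM('a))"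
  define \<alpha> where "\<alpha> = measure lborel A"
  have \<alpha>: "0 < \<alpha>" using A(3) by (simp add: \<alpha>_def)
  have Afin: "emeasure lborel A < \<infinity>" by (rule emeasure_bounded_finite[OF bounded_subset[OF bounded_ball A(2)]])
  have eA: "emeasure lborel A = ennreal \<alpha>" using emeasure_eq_measure_subset_ball[OF A(2)] by (simp add: \<alpha>_def)
  \<comment> \<open>The radius at which a ball has twice the measure of A. As A lies in a ball of
    radius r, \<rho> is at most 2r, and the ball around x stays within 3r of \<open>x0\<close>,
    hence inside the ball of radius R.\<close>
  define \<rho> where "\<rho> = (2 * \<alpha> / ?w) powr (1 / ?N)"
  have w: "0 < ?w" by simp
  have \<rho>: "0 < \<rho>" using \<alpha> less_imp_neq[OF w] by (simp add: \<rho>_def)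
  have \<rho>N: "\<rho> ^ DIM('a) = 2 * \<alpha> / ?w"
  proof -
    have "\<rho> ^ DIM('a) = \<rho> powr ?N" using \<rho> by (simp add: powr_realpow)
    also have "\<dots> = (2 * \<alpha> / ?w) powr (1 / ?N * ?N)" by (simp only: \<rho>_def powr_powr)
    also have "1 / ?N * ?N = 1" by simp
    finally show ?thesis using \<alpha> by simp
  qed
  have "emeasure lborel A \<le> emeasure lborel (ball x0 r)" by (rule emeasure_mono[OF A(2)]) simp
  also have "\<dots> = ennreal (?w * r ^ DIM('a))" using r by (simp add: emeasure_ball)
  finally have "\<alpha> \<le> ?w * r ^ DIM('a)" unfolding eA using r by (simp add: ennreal_le_iff)
  then have "\<rho> ^ DIM('a) \<le> 2 * r ^ DIM('a)" unfolding \<rho>N by (simp add: divide_le_eq mult.commute)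
  also have "\<dots> \<le> 2 ^ DIM('a) * r ^ DIM('a)" using r self_le_power[of "2 :: real" "DIM('a)"] by (intro mult_right_mono) auto
  finally have "\<rho> ^ DIM('a) \<le> (2 * r) ^ DIM('a)" by (simp add: power_mult_distrib)
  then have \<rho>r: "\<rho> \<le> 2 * r" using power_strict_mono[of "2 * r" \<rho> "DIM('a)"] r by (simp only: not_le[symmetric]) force
  have sub: "ball x \<rho> \<subseteq> ball x0 R"
  proof
    fix y assume "y \<in> ball x \<rho>"
    then have "dist x0 y < r + \<rho>" using x dist_triangle[of x0 y x] by auto
    then show "y \<in> ball x0 R" using \<rho>r r by auto
  qed
  \<comment> \<open>The point x is removed because the kernel vanishes on the diagonal.\<close>
  define L' where "L' = (L \<inter> ball x \<rho>) - {x}"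
  have [measurable]: "L' \<in> sets borel" unfolding L'_def by measurable
  have "ennreal (2 * \<alpha>) = emeasure lborel (ball x \<rho>)" using \<rho> less_imp_neq[OF w] by (simp add: emeasure_ball \<rho>N)
  also have "\<dots> \<le> emeasure lborel (A \<union> L')"
  proof (rule emeasure_mono_AE)
    have "AE y in lborel. y \<notin> {x}" by (rule AE_not_in) (auto simp: null_sets_def)
    then show "AE y in lborel. y \<in> ball x \<rho> \<longrightarrow> y \<in> A \<union> L'"
      using L(2) by eventually_elim (use sub in \<open>auto simp: L'_def\<close>)
  qed measurable
  also have "\<dots> \<le> emeasure lborel A + emeasure lborel L'" by (rule emeasure_subadditive) auto
  finally have "ennreal \<alpha> + ennreal \<alpha> \<le> ennreal \<alpha> + emeasure lborel L'" unfolding eA using \<alpha> by (simp add: ennreal_plus[symmetric] del: ennreal_plus)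
  then have L'\<alpha>: "ennreal \<alpha> \<le> emeasure lborel L'" by (subst (asm) ennreal_add_left_cancel_le) auto
  let ?e = "- (s * p) - ?N"
  have "CF * \<alpha> powr (- (s * p / ?N)) / \<Lambda> = \<rho> powr ?e / \<Lambda> * \<alpha>"
  proof -
    have "\<rho> powr ?e = (2 * \<alpha> / ?w) powr (1 / ?N * ?e)" by (simp only: \<rho>_def powr_powr)
    also have "1 / ?N * ?e = - ((s * p + ?N) / ?N)" by (simp add: field_simps)
    also have "(2 * \<alpha> / ?w) powr (- ((s * p + ?N) / ?N)) = CF * \<alpha> powr (- ((s * p + ?N) / ?N))"
      using \<alpha> by (simp add: CF_def powr_mult[symmetric])
    also have "- ((s * p + ?N) / ?N) = - (s * p / ?N) + - 1" by (simp add: field_simps)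
    also have "\<alpha> powr (- (s * p / ?N) + - 1) = \<alpha> powr (- (s * p / ?N)) * \<alpha> powr (- 1)" by (rule powr_add)
    finally show ?thesis using \<alpha> by (simp add: powr_minus_divide)
  qed
  then have "ennreal (CF * \<alpha> powr (- (s * p / ?N)) / \<Lambda>) = ennreal (\<rho> powr ?e / \<Lambda>) * ennreal \<alpha>"
    using \<Lambda>_ge \<alpha> by (simp add: ennreal_mult[symmetric])
  also have "\<dots> \<le> ennreal (\<rho> powr ?e / \<Lambda>) * emeasure lborel L'" by (intro mult_left_mono L'\<alpha>) auto
  also have "\<dots> = (\<integral>\<^sup>+y. ennreal (\<rho> powr ?e / \<Lambda>) * indicator L' y \<partial>lborel)" by (rule nn_integral_cmult_indicator[symmetric]) simp
  also have "\<dots> \<le> (\<integral>\<^sup>+y. ennreal (k x y) * indicator L y \<partial>lborel)"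
  proof (rule nn_integral_mono)
    fix y
    show "ennreal (\<rho> powr ?e / \<Lambda>) * indicator L' y \<le> ennreal (k x y) * indicator L y"
    proof (cases "y \<in> L'")
      case True
      then have y: "y \<in> L" "y \<noteq> x" "norm (x - y) \<le> \<rho>" by (auto simp: L'_def dist_norm)
      have "\<rho> powr ?e \<le> norm (x - y) powr ?e" using y sp_pos by (intro powr_mono2') auto
      then have "\<rho> powr ?e / \<Lambda> \<le> k x y" using k_lower[of x y] \<Lambda>_ge divide_right_mono[of "\<rho> powr ?e" _ \<Lambda>] by (meson order_trans zero_le_one)
      then show ?thesis using True y by (simp add: ennreal_leI)
    qed simp
  qed
  finally show ?thesis by (simp add: \<alpha>_def)
qed

lemma product_integral_lower:
  assumes [measurable]: "q \<in> borel_measurable borel" "A \<in> sets borel" "L \<in> sets borel"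
    and low: "\<And>x. x \<in> A \<Longrightarrow> ennreal d \<le> (\<integral>\<^sup>+y. ennreal (k x y) * indicator L y \<partial>lborel)"
  shows "ennreal d * (\<integral>\<^sup>+x. ennreal (q x) * indicator A x \<partial>lborel) \<le> (\<integral>\<^sup>+x. \<integral>\<^sup>+y. ennreal (k x y) * (ennreal (q x) * indicator A x * indicator L y) \<partial>lborel \<partial>lborel)"
proof -
  have "ennreal d * (\<integral>\<^sup>+x. ennreal (q x) * indicator A x \<partial>lborel) = (\<integral>\<^sup>+x. ennreal d * (ennreal (q x) * indicator A x) \<partial>lborel)"
    by (rule nn_integral_cmult[symmetric]) measurable
  also have "\<dots> \<le> (\<integral>\<^sup>+x. \<integral>\<^sup>+y. ennreal (k x y) * (ennreal (q x) * indicator A x * indicator L y) \<partial>lborel \<partial>lborel)"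
  proof (rule nn_integral_mono)
    fix x
    have "ennreal d * (ennreal (q x) * indicator A x) \<le> (\<integral>\<^sup>+y. ennreal (k x y) * indicator L y \<partial>lborel) * (ennreal (q x) * indicator A x)"
      using low[of x] by (cases "x \<in> A") (auto intro: mult_right_mono)
    also have "\<dots> = (\<integral>\<^sup>+y. ennreal (k x y) * indicator L y * (ennreal (q x) * indicator A x) \<partial>lborel)"
      by (rule nn_integral_multc[symmetric]) measurable
    finally show "ennreal d * (ennreal (q x) * indicator A x) \<le> (\<integral>\<^sup>+y. ennreal (k x y) * (ennreal (q x) * indicator A x * indicator L y) \<partial>lborel)"
      by (simp add: mult_ac)
  qed
  finally show ?thesis .
qed

lemma measure_superlevel_le:
  assumes [measurable]: "q \<in> borel_measurable borel" "A \<in> sets borel" "B \<in> sets borel" and BA: "B \<subseteq> A" and g: "\<And>x. x \<in> B \<Longrightarrow> g \<le> q x"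
  shows "ennreal g * emeasure lborel B \<le> (\<integral>\<^sup>+x. ennreal (q x) * indicator A x \<partial>lborel)"
proof -
  have "ennreal g * emeasure lborel B = (\<integral>\<^sup>+x. ennreal g * indicator B x \<partial>lborel)" by (rule nn_integral_cmult_indicator[symmetric]) simp
  also have "\<dots> \<le> (\<integral>\<^sup>+x. ennreal (q x) * indicator A x \<partial>lborel)"
    using g BA by (intro nn_integral_mono) (auto simp: indicator_def intro: ennreal_leI)
  finally show ?thesis .
qed

text \<open>The half-measure set enters only through the nonlocal cross term, which at once makes the
  first superlevel set small; De Giorgi's iteration does the rest.\<close>

theorem growth_lemma:
  obtains \<delta> where "0 < \<delta>" "\<delta> \<le> 1 / 4"
    "\<And>v D x0 R r m0 M \<omega>. loc_energy v D \<Longrightarrow> (\<And>\<eta>. \<eta> \<in> tests D \<Longrightarrow> (\<And>x. 0 \<le> \<eta> x) \<Longrightarrow> (\<integral>z. wform v \<eta> z \<partial>mu) \<le> 0) \<Longrightarrow>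
      ball x0 R \<subseteq> D \<Longrightarrow> 0 < r \<Longrightarrow> 4 * r \<le> R \<Longrightarrow> (\<And>x. x \<in> D \<Longrightarrow> \<bar>v x\<bar> \<le> m0) \<Longrightarrow> 0 < \<omega> \<Longrightarrow>
      (AE y in lborel. y \<in> ball x0 R \<longrightarrow> v y \<le> M) \<Longrightarrow>
      (\<And>x. x \<in> ball x0 r \<Longrightarrow> (\<integral>\<^sup>+y. ennreal ((\<bar>v y\<bar> + m0) powr (p - 1) * k x y) * indicator (- ball x0 R) y \<partial>lborel) \<le> ennreal ((\<delta> * \<omega>) powr (p - 1) * r powr (- (s * p)))) \<Longrightarrow>
      measure lborel (ball x0 r) / 2 \<le> measure lborel {y \<in> ball x0 r. v y \<le> M - \<omega> / 2} \<Longrightarrow>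
      (AE y in lborel. y \<in> ball x0 (r / 4) \<longrightarrow> v y \<le> M - \<delta> / 4 * \<omega>)"
proof -
  let ?N = "real DIM('a)" and ?w = "unit_ball_vol (real DIM('a))"
  let ?e = "- (s * p) - ?N"
  have N: "0 < ?N" by simp
  have w: "0 < ?w" by simp
  define \<gamma> where "\<gamma> = s * p / ?N"
  have \<gamma>: "0 < \<gamma>" using sp_pos by (simp add: \<gamma>_def)
  define c0 where "c0 = 2 powr (1 - p)"
  have c0: "0 < c0" by (simp add: c0_def)
  \<comment> \<open>\<open>C4\<close> is the quotient of the Caccioppoli constant by the Faber-Krahn
    and coercivity constants. The gap between consecutive levels contributes the factor
    \<open>2 powr (p * (j + 2))\<close>; with j = n + 1 this splits into \<open>B ^ n\<close> and
    the \<open>2 powr (3 * p)\<close> in \<open>C5\<close>.\<close>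
  define C4 where "C4 = C3 * \<Lambda> / (c0 * CF)"
  have C4: "0 < C4" using C3_pos \<Lambda>_ge c0 CF_pos by (simp add: C4_def)
  define C5 where "C5 = C4 * 2 powr (3 * p)"
  have C5: "0 < C5" using C4 by (simp add: C5_def)
  define B where "B = 2 powr p"
  have B: "1 < B" using p_gt by (simp add: B_def)
  define \<nu> where "\<nu> = C5 powr (- 1 / \<gamma>) * B powr (- 1 / \<gamma>\<^sup>2)"
  have \<nu>: "0 < \<nu>" using C5 B by (simp add: \<nu>_def)
  \<comment> \<open>Factors of the first estimate: 8 is 2 for half of the ball times 4 for the level
    gap a/4, \<open>4 powr (p - 1)\<close> comes from the height \<omega>/4, and the last power from
    the distance 2r. Then \<delta> is taken so small that \<open>C6 * \<delta> powr (p - 1)\<close>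
    meets the threshold \<nu> of \<open>De_Giorgi_sequence\<close>.\<close>
  define C6 where "C6 = 8 * C3 * \<Lambda> * 4 powr (p - 1) * 2 powr (s * p + ?N)"
  have C6: "0 < C6" using C3_pos \<Lambda>_ge by (simp add: C6_def)
  define \<delta> where "\<delta> = min (1 / 4) ((\<nu> / C6) powr (1 / (p - 1)))"
  have \<delta>: "0 < \<delta>" "\<delta> \<le> 1 / 4" using \<nu> C6 by (auto simp: \<delta>_def)
  have \<delta>\<nu>: "C6 * \<delta> powr (p - 1) \<le> \<nu>"
  proof -
    have "\<delta> powr (p - 1) \<le> ((\<nu> / C6) powr (1 / (p - 1))) powr (p - 1)" using \<delta> p_gt by (intro powr_mono2) (auto simp: \<delta>_def)
    also have "\<dots> = (\<nu> / C6) powr (1 / (p - 1) * (p - 1))" by (simp only: powr_powr)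
    also have "1 / (p - 1) * (p - 1) = 1" using p_gt by simp
    finally have "\<delta> powr (p - 1) \<le> \<nu> / C6" using \<nu> C6 by simp
    then show ?thesis using C6 by (simp add: pos_le_divide_eq mult.commute)
  qed
  show ?thesis
  proof (rule that[OF \<delta>])
    fix v D x0 R r m0 M \<omega>
    assume v: "loc_energy v D" and sub: "\<And>\<eta>. \<eta> \<in> tests D \<Longrightarrow> (\<And>x. 0 \<le> \<eta> x) \<Longrightarrow> (\<integral>z. wform v \<eta> z \<partial>mu) \<le> 0"
      and R: "ball x0 R \<subseteq> D" "0 < r" "4 * r \<le> R" and m0: "\<And>x. x \<in> D \<Longrightarrow> \<bar>v x\<bar> \<le> m0" and \<omega>: "0 < \<omega>"
      and M: "AE y in lborel. y \<in> ball x0 R \<longrightarrow> v y \<le> M"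
      and T: "\<And>x. x \<in> ball x0 r \<Longrightarrow> (\<integral>\<^sup>+y. ennreal ((\<bar>v y\<bar> + m0) powr (p - 1) * k x y) * indicator (- ball x0 R) y \<partial>lborel) \<le> ennreal ((\<delta> * \<omega>) powr (p - 1) * r powr (- (s * p)))"
      and half: "measure lborel (ball x0 r) / 2 \<le> measure lborel {y \<in> ball x0 r. v y \<le> M - \<omega> / 2}"
    have [measurable]: "v \<in> borel_measurable borel" using loc_energyD v by auto
    define a where "a = \<delta> * \<omega>"
    have a: "0 < a" "a \<le> \<omega> / 4" using \<delta> \<omega> mult_right_mono[of \<delta> "1 / 4" \<omega>] by (auto simp: a_def)
    \<comment> \<open>The levels rise from \<open>M - a\<close> at j = 0 towards
      \<open>M - a / 2\<close>. The barriers of all j have the same slope, so the iteration uses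
      neither shrinking balls nor varying cutoffs.\<close>
    define c where "c j = M - a * (1 / 2 + (1 / 2) ^ Suc j)" for j :: nat
    define b where "b j y = c j + a * cone x0 r y" for j y
    define A where "A j = {y \<in> ball x0 r. b j y < v y}" for j
    have [measurable]: "b j \<in> borel_measurable borel" for j unfolding b_def[abs_def] by measurable
    have [measurable]: "A j \<in> sets borel" for j unfolding A_def by measurable
    have pj: "0 < (1 / 2 :: real) ^ Suc j" "(1 / 2 :: real) ^ Suc j \<le> 1 / 2" for j
      using power_le_one[of "1 / 2 :: real" j] by auto
    have ca: "M \<le> c j + a" for j using a pj[of j] by (simp add: c_def algebra_simps)
    have cM: "M - a \<le> c j" for j
    proof -
      have "a * (1 / 2 + (1 / 2) ^ Suc j) \<le> a * 1" using a pj[of j] by (intro mult_left_mono) linarith+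
      then show ?thesis by (simp add: c_def)
    qed
    have AR: "A j \<subseteq> ball x0 r" for j by (auto simp: A_def)
    have Afin: "emeasure lborel (A j) < \<infinity>" for j by (rule emeasure_bounded_finite[OF bounded_subset[OF bounded_ball AR]])
    have eA: "emeasure lborel (A j) = ennreal (measure lborel (A j))" for j
      by (rule emeasure_eq_measure_subset_ball[OF AR])
    have gap: "a * (1 / 2) ^ Suc (Suc j) \<le> v x - b j x" if "x \<in> A (Suc j)" for j x
    proof -
      have "c (Suc j) - c j = a * (1 / 2) ^ Suc (Suc j)" by (simp add: c_def algebra_simps)
      then show ?thesis using that by (auto simp: A_def b_def)
    qed
    have gap0: "0 < a * (1 / 2) ^ Suc (Suc j)" for j using a by simp
    have Asub: "A (Suc j) \<subseteq> A j" for j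
      using gap[of _ j] gap0[of j] by (fastforce simp: A_def)
    define \<beta> where "\<beta> = C3 * a powr p * r powr (- (s * p))"
    have \<beta>: "0 < \<beta>" using C3_pos a R by (simp add: \<beta>_def)
    have Cacc: "(\<integral>\<^sup>+x. \<integral>\<^sup>+y. ennreal (k x y) * (ennreal (q x) * indicator (A j) x * indicator L y) \<partial>lborel \<partial>lborel) \<le> ennreal \<beta> * emeasure lborel (A j)"
      if L: "L \<in> sets borel" "L \<subseteq> ball x0 R" "L \<inter> A j = {}"
        and q: "q \<in> borel_measurable borel" "\<And>x y. x \<in> A j \<Longrightarrow> y \<in> L \<Longrightarrow> q x - C1 * \<bar>b j x - b j y\<bar> powr p \<le> phi p (v x - v y) * (v x - b j x)"
      for j q L
      unfolding \<beta>_def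
      by (rule Caccioppoli_barrier[OF v sub R m0 M a(1) ca[of j] T[folded a_def] b_def[of j] A_def[of j] L q])
    \<comment> \<open>On \<open>A (Suc j)\<close> the excess over the lower barrier is at least the
      gap, so the Caccioppoli inequality bounds its measure, weighted by the interaction with the
      complement of \<open>A j\<close>. That interaction is at least of order
      \<open>\<alpha> powr (- \<gamma>)\<close>, and this produces the superlinear power
      \<open>1 + \<gamma>\<close>.\<close>
    have step: "measure lborel (A (Suc j)) \<le> C4 * 2 powr (p * real (Suc (Suc j))) * r powr (- (s * p)) * measure lborel (A j) powr (1 + \<gamma>)" for j
    proof (cases "measure lborel (A j) = 0")
      case True
      have "emeasure lborel (A (Suc j)) \<le> emeasure lborel (A j)" by (rule emeasure_mono[OF Asub]) simp
      then have "measure lborel (A (Suc j)) = 0" unfolding eA True by (simp add: ennreal_eq_0_iff measure_le_0_iff)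
      then show ?thesis using True by simp
    next
      case False
      define \<alpha> where "\<alpha> = measure lborel (A j)"
      have \<alpha>: "0 < \<alpha>" using False by (simp add: \<alpha>_def less_le)
      define L where "L = {y \<in> ball x0 R. v y \<le> b j y}"
      have [measurable]: "L \<in> sets borel" unfolding L_def by measurable
      define q where "q x = c0 * \<bar>v x - b j x\<bar> powr p" for x
      have [measurable]: "q \<in> borel_measurable borel" unfolding q_def[abs_def] by measurable
      have ca1: "(\<integral>\<^sup>+x. \<integral>\<^sup>+y. ennreal (k x y) * (ennreal (q x) * indicator (A j) x * indicator L y) \<partial>lborel \<partial>lborel) \<le> ennreal \<beta> * emeasure lborel (A j)"
      proof (rule Cacc)
        fix x y assume x: "x \<in> A j" and y: "y \<in> L"
        have "q x - C1 * \<bar>b j x - b j y\<bar> powr p \<le> phi p ((v x - b j x) + (b j x - b j y)) * (v x - b j x)"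
          using phi_add_mult_lower[OF p_gt, of "v x - b j x" "b j x - b j y"] by (simp add: q_def c0_def C1_def)
        also have "\<dots> \<le> phi p (v x - v y) * (v x - b j x)"
          using x y by (intro mult_right_mono phi_mono[OF p_gt]) (auto simp: A_def L_def)
        finally show "q x - C1 * \<bar>b j x - b j y\<bar> powr p \<le> phi p (v x - v y) * (v x - b j x)" .
      qed (auto simp: L_def A_def)
      \<comment> \<open>Outside the small ball the barrier is at least M, so almost every point of
        the large ball not in \<open>A j\<close> belongs to L.\<close>
      have LA: "AE y in lborel. y \<in> ball x0 R \<longrightarrow> y \<in> A j \<or> y \<in> L"
        using M
      proof eventually_elim
        case (elim y)
        show ?case
        proof
          assume y: "y \<in> ball x0 R"
          show "y \<in> A j \<or> y \<in> L"
          proof (cases "y \<in> ball x0 r")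
            case False
            have "1 \<le> norm (y - x0) / r" using False R(2) by (simp add: dist_norm norm_minus_commute)
            then have "b j y = c j + a" by (simp add: b_def cone_def)
            then show ?thesis using elim y ca[of j] by (simp add: L_def)
          qed (use y in \<open>auto simp: A_def L_def\<close>)
        qed
      qed
      define d where "d = CF * \<alpha> powr (- \<gamma>) / \<Lambda>"
      have d: "0 < d" using CF_pos \<Lambda>_ge \<alpha> by (simp add: d_def)
      have low: "ennreal d \<le> (\<integral>\<^sup>+y. ennreal (k x y) * indicator L y \<partial>lborel)" if "x \<in> A j" for x
        unfolding d_def \<alpha>_def \<gamma>_def
        by (rule complement_kernel_lower[OF _ AR _ R(2,3) subsetD[OF AR that] _ LA]) (use \<alpha> in \<open>auto simp: \<alpha>_def\<close>)
      define g where "g = c0 * (a * (1 / 2) ^ Suc (Suc j)) powr p"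
      have "0 < (a * (1 / 2) ^ Suc (Suc j)) powr p" using gap0[of j] by (metis powr_gt_zero order_less_irrefl)
      then have g: "0 < g" using c0 unfolding g_def by (rule mult_pos_pos[rotated])
      have "ennreal d * (ennreal g * emeasure lborel (A (Suc j))) \<le> ennreal d * (\<integral>\<^sup>+x. ennreal (q x) * indicator (A j) x \<partial>lborel)"
      proof (intro mult_left_mono measure_superlevel_le Asub)
        fix x assume "x \<in> A (Suc j)"
        from gap[OF this] gap0[of j] show "g \<le> q x" unfolding g_def q_def using c0 p_gt by (intro mult_left_mono powr_mono2) auto
      qed auto
      also have "\<dots> \<le> ennreal \<beta> * emeasure lborel (A j)"
        by (rule order_trans[OF product_integral_lower[OF _ _ _ low] ca1]) auto
      finally have "ennreal (d * (g * measure lborel (A (Suc j)))) \<le> ennreal (\<beta> * \<alpha>)"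
        unfolding eA \<alpha>_def using d g \<beta> by (simp add: ennreal_mult)
      then have "d * (g * measure lborel (A (Suc j))) \<le> \<beta> * \<alpha>" using \<beta> \<alpha> by (subst (asm) ennreal_le_iff) auto
      then have "measure lborel (A (Suc j)) \<le> \<beta> * \<alpha> / (d * g)" using d g by (simp add: pos_le_divide_eq mult_ac)
      also have "\<dots> = C4 * 2 powr (p * real (Suc (Suc j))) * r powr (- (s * p)) * \<alpha> powr (1 + \<gamma>)"
      proof -
        have h: "((1 / 2 :: real) ^ Suc (Suc j)) powr p = 1 / 2 powr (p * real (Suc (Suc j)))"
          by (simp add: powr_realpow[symmetric] powr_powr powr_divide power_divide mult.commute del: power_Suc)
        have "g = c0 * a powr p / 2 powr (p * real (Suc (Suc j)))"
          unfolding g_def using a by (subst powr_mult) (auto simp: h simp del: power_Suc)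
        moreover have "\<alpha> powr (1 + \<gamma>) = \<alpha> / \<alpha> powr (- \<gamma>)" using \<alpha> by (simp add: powr_add powr_minus_divide)
        ultimately show ?thesis using c0 a CF_pos \<Lambda>_ge \<alpha> by (simp add: \<beta>_def d_def C4_def mult_ac)
      qed
      finally show ?thesis by (simp add: \<alpha>_def)
    qed
    have first: "measure lborel (A 1) \<le> C6 * \<delta> powr (p - 1) * r ^ DIM('a)"
    proof -
      define L where "L = {y \<in> ball x0 r. v y \<le> M - \<omega> / 2}"
      have [measurable]: "L \<in> sets borel" unfolding L_def by measurable
      \<comment> \<open>For x in \<open>A 0\<close> the value of v exceeds
        \<open>M - a \<ge> M - \<omega> / 4\<close>, for y in L it is at most
        \<open>M - \<omega> / 2\<close>. The increment is thus at least \<omega>/4, far above the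
        barrier scale a when \<delta> is small.\<close>
      define q where "q x = (\<omega> / 4) powr (p - 1) * (v x - b 0 x)" for x
      have [measurable]: "q \<in> borel_measurable borel" unfolding q_def[abs_def] by measurable
      have bM: "M - a \<le> b 0 x" for x unfolding b_def using cM[of 0] a cone_bounds(1)[OF R(2), of x0 x] by (simp add: add_increasing2)
      have rR: "ball x0 r \<subseteq> ball x0 R" using R by auto
      have LA: "L \<inter> A 0 = {}"
      proof -
        have "\<not> (b 0 y < v y \<and> v y \<le> M - \<omega> / 2)" for y using bM[of y] a \<omega> by linarith
        then show ?thesis by (auto simp: L_def A_def)
      qed
      have ca1: "(\<integral>\<^sup>+x. \<integral>\<^sup>+y. ennreal (k x y) * (ennreal (q x) * indicator (A 0) x * indicator L y) \<partial>lborel \<partial>lborel) \<le> ennreal \<beta> * emeasure lborel (A 0)"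
      proof (rule Cacc)
        show "L \<subseteq> ball x0 R" using rR by (auto simp: L_def)
        fix x y assume x: "x \<in> A 0" and y: "y \<in> L"
        have xb: "b 0 x < v x" using x by (simp add: A_def)
        have "\<omega> / 4 \<le> v x - v y" using xb y bM[of x] a by (simp add: L_def)
        then have "phi p (\<omega> / 4) \<le> phi p (v x - v y)" by (rule phi_mono[OF p_gt])
        then have "(\<omega> / 4) powr (p - 1) \<le> phi p (v x - v y)" using \<omega> by (simp add: phi_def)
        then have "q x \<le> phi p (v x - v y) * (v x - b 0 x)" unfolding q_def using xb by (intro mult_right_mono) auto
        moreover have "0 \<le> C1 * \<bar>b 0 x - b 0 y\<bar> powr p" using C1_pos by simp
        ultimately show "q x - C1 * \<bar>b 0 x - b 0 y\<bar> powr p \<le> phi p (v x - v y) * (v x - b 0 x)" by linarith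
      qed (use LA in auto)
      have mb: "measure lborel (ball x0 r) = ?w * r ^ DIM('a)" using R by (simp add: content_ball)
      have Lfin: "emeasure lborel L = ennreal (measure lborel L)"
        by (rule emeasure_eq_measure_subset_ball[of _ x0 r]) (auto simp: L_def)
      \<comment> \<open>Points of \<open>A 0\<close> and L are at distance below 2r, and L fills at
        least half of the ball.\<close>
      define d where "d = (2 * r) powr ?e / \<Lambda> * (?w * r ^ DIM('a) / 2)"
      have d: "0 < d" using R \<Lambda>_ge w by (simp add: d_def)
      have low: "ennreal d \<le> (\<integral>\<^sup>+y. ennreal (k x y) * indicator L y \<partial>lborel)" if x: "x \<in> A 0" for x
      proof -
        have "ennreal d = ennreal ((2 * r) powr ?e / \<Lambda>) * ennreal (?w * r ^ DIM('a) / 2)"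
          unfolding d_def using \<Lambda>_ge w R by (intro ennreal_mult) auto
        also have "\<dots> \<le> ennreal ((2 * r) powr ?e / \<Lambda>) * emeasure lborel L"
          unfolding Lfin using half by (intro mult_left_mono ennreal_leI) (auto simp: mb L_def)
        also have "\<dots> = (\<integral>\<^sup>+y. ennreal ((2 * r) powr ?e / \<Lambda>) * indicator L y \<partial>lborel)" by (rule nn_integral_cmult_indicator[symmetric]) simp
        also have "\<dots> \<le> (\<integral>\<^sup>+y. ennreal (k x y) * indicator L y \<partial>lborel)"
        proof (rule nn_integral_mono)
          fix y
          show "ennreal ((2 * r) powr ?e / \<Lambda>) * indicator L y \<le> ennreal (k x y) * indicator L y"
          proof (cases "y \<in> L")
            case True
            have xy: "x \<noteq> y" using x True LA by auto
            have "dist x y < 2 * r" using x True dist_triangle[of x y x0] by (auto simp: L_def A_def dist_commute)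
            then have "(2 * r) powr ?e \<le> norm (x - y) powr ?e" using xy sp_pos by (intro powr_mono2') (auto simp: dist_norm)
            then have "(2 * r) powr ?e / \<Lambda> \<le> k x y" using k_lower[of x y] \<Lambda>_ge divide_right_mono[of "(2 * r) powr ?e" _ \<Lambda>] by (meson order_trans zero_le_one)
            then show ?thesis using True by (simp add: ennreal_leI)
          qed simp
        qed
        finally show ?thesis .
      qed
      define g where "g = (\<omega> / 4) powr (p - 1) * (a / 4)"
      have g: "0 < g" using \<omega> a by (simp add: g_def)
      have "ennreal d * (ennreal g * emeasure lborel (A 1)) \<le> ennreal d * (\<integral>\<^sup>+x. ennreal (q x) * indicator (A 0) x \<partial>lborel)"
      proof (intro mult_left_mono measure_superlevel_le)
        show "A 1 \<subseteq> A 0" using Asub[of 0] by simp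
        fix x assume "x \<in> A 1"
        then have "a / 4 \<le> v x - b 0 x" using gap[of x 0] by simp
        then show "g \<le> q x" unfolding g_def q_def by (intro mult_left_mono) auto
      qed auto
      also have "\<dots> \<le> ennreal \<beta> * emeasure lborel (A 0)"
        by (rule order_trans[OF product_integral_lower[OF _ _ _ low] ca1]) auto
      also have "\<dots> \<le> ennreal \<beta> * ennreal (?w * r ^ DIM('a))"
      proof (rule mult_left_mono)
        have "emeasure lborel (A 0) \<le> emeasure lborel (ball x0 r)" by (rule emeasure_mono[OF AR]) simp
        then show "emeasure lborel (A 0) \<le> ennreal (?w * r ^ DIM('a))" using R by (simp add: emeasure_ball)
      qed simp
      finally have "ennreal (d * (g * measure lborel (A 1))) \<le> ennreal (\<beta> * (?w * r ^ DIM('a)))"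
        unfolding eA using d g \<beta> w R by (simp add: ennreal_mult)
      then have "d * (g * measure lborel (A 1)) \<le> \<beta> * (?w * r ^ DIM('a))" using \<beta> w R by (subst (asm) ennreal_le_iff) auto
      then have "measure lborel (A 1) \<le> \<beta> * (?w * r ^ DIM('a)) / (d * g)" using d g by (simp add: pos_le_divide_eq mult_ac)
      also have "\<dots> = C6 * \<delta> powr (p - 1) * r ^ DIM('a)"
      proof -
        have e1: "(2 * r) powr ?e = r powr (- (s * p)) / (r ^ DIM('a) * 2 powr (s * p + ?N))"
        proof -
          have "(2 * r) powr ?e = 2 powr (- (s * p + ?N)) * (r powr (- (s * p)) * r powr (- ?N))"
            using R by (simp add: powr_mult powr_add[symmetric])
          moreover have "2 powr ?e = 1 / 2 powr (s * p + ?N)" using powr_minus_divide[of 2 "s * p + ?N"] by simp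
          ultimately show ?thesis using R by (simp add: powr_minus_divide powr_realpow)
        qed
        have e2: "a powr p = a * (\<delta> powr (p - 1) * \<omega> powr (p - 1))"
          using powr_minus_one_mult[of a p] a \<delta> \<omega> by (simp add: a_def powr_mult mult_ac)
        have e3: "(\<omega> / 4) powr (p - 1) = \<omega> powr (p - 1) / 4 powr (p - 1)" using \<omega> by (simp add: powr_divide)
        show ?thesis unfolding \<beta>_def d_def g_def e1 e2 e3 C6_def
          using a R less_imp_neq[OF w] \<omega> \<delta> \<Lambda>_ge by (simp add: field_simps)
      qed
      finally show ?thesis .
    qed
    \<comment> \<open>The index starts at 1, since it is \<open>A 1\<close>, not \<open>A 0\<close>,
      that the half-measure condition makes small. Dividing by \<open>r ^ DIM('a)\<close> removes
      the scale.\<close>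
    define Y where "Y n = measure lborel (A (Suc n)) / r ^ DIM('a)" for n
    have rN: "0 < r ^ DIM('a)" using R by simp
    have "Y \<longlonglongrightarrow> 0"
    proof (rule De_Giorgi_sequence[OF C5 B \<gamma>])
      show "0 \<le> Y n" for n using R by (simp add: Y_def)
      show "Y 0 \<le> C5 powr (- 1 / \<gamma>) * B powr (- 1 / \<gamma>\<^sup>2)"
        using first \<delta>\<nu> rN order_trans[OF first mult_right_mono[OF \<delta>\<nu>]] by (simp add: Y_def \<nu>_def pos_divide_le_eq)
      show "Y (Suc n) \<le> C5 * B ^ n * Y n powr (1 + \<gamma>)" for n
      proof -
        let ?m = "measure lborel (A (Suc n))"
        have "Y (Suc n) \<le> C4 * 2 powr (p * real (Suc (Suc (Suc n)))) * r powr (- (s * p)) * ?m powr (1 + \<gamma>) / r ^ DIM('a)"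
          unfolding Y_def using step[of "Suc n"] rN by (intro divide_right_mono) auto
        also have "?m = Y n * r ^ DIM('a)" using rN R by (simp add: Y_def)
        also have "(Y n * r ^ DIM('a)) powr (1 + \<gamma>) = Y n powr (1 + \<gamma>) * (r ^ DIM('a) * r powr (s * p))"
        proof -
          have "(r ^ DIM('a)) powr (1 + \<gamma>) = r powr (?N * (1 + \<gamma>))" using R by (simp add: powr_realpow[symmetric] powr_powr)
          also have "?N * (1 + \<gamma>) = ?N + s * p" by (simp add: \<gamma>_def distrib_left)
          also have "r powr (?N + s * p) = r ^ DIM('a) * r powr (s * p)" using R by (simp add: powr_add powr_realpow)
          finally show ?thesis by (simp add: powr_mult)
        qed
        also have "C4 * 2 powr (p * real (Suc (Suc (Suc n)))) * r powr (- (s * p)) * (Y n powr (1 + \<gamma>) * (r ^ DIM('a) * r powr (s * p))) / r ^ DIM('a)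
          = C4 * 2 powr (p * real (Suc (Suc (Suc n)))) * Y n powr (1 + \<gamma>)"
          using R by (simp add: powr_minus_divide)
        also have "2 powr (p * real (Suc (Suc (Suc n)))) = 2 powr (3 * p) * B ^ n"
        proof -
          have "p * real (Suc (Suc (Suc n))) = 3 * p + p * real n" by (simp add: algebra_simps)
          then show ?thesis by (simp add: B_def powr_add powr_realpow[symmetric] powr_powr)
        qed
        finally show ?thesis by (simp add: C5_def mult_ac)
      qed
    qed
    then have "(\<lambda>n. Y n * r ^ DIM('a)) \<longlonglongrightarrow> 0 * r ^ DIM('a)" by (intro tendsto_mult_right)
    then have lim: "(\<lambda>n. measure lborel (A (Suc n))) \<longlonglongrightarrow> 0" using R by (simp add: Y_def)
    \<comment> \<open>The superlevel set at the limit level, contained in every \<open>A n\<close>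
      and hence null. On the quarter ball the cone is at most 1/4, which leaves
      \<open>v \<le> M - a / 2 + a / 4\<close>.\<close>
    define E where "E = {y \<in> ball x0 r. M - a / 2 + a * cone x0 r y < v y}"
    have [measurable]: "E \<in> sets borel" unfolding E_def by measurable
    have EA: "E \<subseteq> A n" for n
    proof -
      have "c n \<le> M - a / 2"
        using a mult_nonneg_nonneg[of a "(1 / 2) ^ Suc n"] pj(1)[of n] unfolding c_def distrib_left by linarith
      then show ?thesis by (auto simp: E_def A_def b_def)
    qed
    have "measure lborel E \<le> measure lborel (A (Suc n))" for n
      by (rule measure_mono_fmeasurable[OF EA]) (use Afin in \<open>auto intro!: fmeasurableI\<close>)
    then have "measure lborel E \<le> 0" by (intro LIMSEQ_le_const[OF lim]) auto
    moreover have "emeasure lborel E = ennreal (measure lborel E)"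
      by (rule emeasure_eq_measure_subset_ball[of _ x0 r]) (auto simp: E_def)
    ultimately have "emeasure lborel E = 0" by (simp add: measure_le_0_iff)
    then have "AE y in lborel. y \<notin> E" by (intro AE_not_in) (auto simp: null_sets_def)
    then show "AE y in lborel. y \<in> ball x0 (r / 4) \<longrightarrow> v y \<le> M - \<delta> / 4 * \<omega>"
    proof eventually_elim
      case (elim y)
      show ?case
      proof
        assume y: "y \<in> ball x0 (r / 4)"
        then have "norm (y - x0) / r \<le> 1 / 4" using R by (simp add: dist_norm norm_minus_commute field_simps)
        then have "cone x0 r y \<le> 1 / 4" unfolding cone_def by (rule min.coboundedI2)
        then have "a * cone x0 r y \<le> a * (1 / 4)" using a by (intro mult_left_mono) auto
        moreover have "y \<in> ball x0 r" using y R by auto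
        ultimately have "v y \<le> M - a / 4" using elim by (simp add: E_def)
        then show "v y \<le> M - \<delta> / 4 * \<omega>" by (simp add: a_def)
      qed
    qed
  qed
qed

end

text \<open>The representative is the limit of essential suprema over shrinking balls, written as
  the infimum of all local essential upper bounds. Essential bounds on a ball then become pointwise
  bounds for V, and small essential oscillation becomes continuity.\<close>

lemma continuous_representative:
  fixes v :: "'a::euclidean_space \<Rightarrow> real"
  assumes v [measurable]: "v \<in> borel_measurable borel" and D: "open D"
    and osc: "\<And>x e. x \<in> D \<Longrightarrow> 0 < e \<Longrightarrow> \<exists>R>0. \<exists>m. ball x R \<subseteq> D \<and> (AE y in lborel. y \<in> ball x R \<longrightarrow> m \<le> v y \<and> v y \<le> m + e)"
  obtains V where "V \<in> borel_measurable borel" "continuous_on D V" "AE x in lborel. V x = v x" "\<And>x. x \<notin> D \<Longrightarrow> V x = v x"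
proof -
  define S where "S x = {t. \<exists>R>0. AE y in lborel. y \<in> ball x R \<longrightarrow> v y \<le> t}" for x
  define V where "V x = (if x \<in> D then Inf (S x) else v x)" for x
  have bnd: "m \<le> V z \<and> V z \<le> M"
    if z: "z \<in> ball x R" "z \<in> D" and ae: "AE y in lborel. y \<in> ball x R \<longrightarrow> m \<le> v y \<and> v y \<le> M" for x z R m M
  proof -
    define d where "d = R - dist x z"
    have d: "0 < d" using z by (simp add: d_def)
    have dsub: "ball z d \<subseteq> ball x R"
    proof
      fix y assume "y \<in> ball z d"
      then show "y \<in> ball x R" using dist_triangle[of x y z] by (simp add: d_def)
    qed
    have MS: "M \<in> S z"
    proof -
      have "AE y in lborel. y \<in> ball z d \<longrightarrow> v y \<le> M" using ae by eventually_elim (use dsub in blast)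
      then show ?thesis using d unfolding S_def by blast
    qed
    have low: "m \<le> t" if t: "t \<in> S z" for t
    proof (rule ccontr)
      assume n: "\<not> m \<le> t"
      obtain R' where R': "0 < R'" "AE y in lborel. y \<in> ball z R' \<longrightarrow> v y \<le> t" using t by (auto simp: S_def)
      have "AE y in lborel. y \<notin> ball z (min d R')"
        using ae R'(2) by eventually_elim (use n dsub in force)
      then have "emeasure lborel (ball z (min d R')) = 0"
        by (subst (asm) AE_iff_null_sets[symmetric]) (auto simp: null_sets_def)
      moreover have "0 < emeasure lborel (ball z (min d R'))"
        using d R' by (simp add: emeasure_ball)
      ultimately show False by simp
    qed
    have bb: "bdd_below (S z)" by (rule bdd_belowI[of _ m]) (rule low)
    have "Inf (S z) \<le> M" using MS bb by (rule cInf_lower)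
    moreover have "m \<le> Inf (S z)" using MS low by (intro cInf_greatest) auto
    ultimately show ?thesis using z by (simp add: V_def)
  qed
  have cont: "continuous_on D V"
    unfolding continuous_on_iff
  proof (intro ballI allI impI)
    fix x e assume x: "x \<in> D" and e: "0 < (e :: real)"
    obtain R m where R: "0 < R" "AE y in lborel. y \<in> ball x R \<longrightarrow> m \<le> v y \<and> v y \<le> m + e / 2"
      using osc[OF x, of "e / 2"] e by auto
    have xx: "m \<le> V x \<and> V x \<le> m + e / 2" using bnd[OF _ x R(2)] R(1) by simp
    show "\<exists>d>0. \<forall>y\<in>D. dist y x < d \<longrightarrow> dist (V y) (V x) < e"
    proof (intro exI[of _ R] conjI R ballI impI)
      fix y assume y: "y \<in> D" "dist y x < R"
      then have "m \<le> V y \<and> V y \<le> m + e / 2" using bnd[OF _ y(1) R(2)] by (simp add: dist_commute)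
      then show "dist (V y) (V x) < e" using xx e by (simp add: dist_real_def abs_less_iff)
    qed
  qed
  have ae1: "AE y in lborel. y \<in> D \<longrightarrow> \<bar>V y - v y\<bar> \<le> e" if e: "0 < e" for e
  proof -
    define P where "P x R m \<longleftrightarrow> 0 < R \<and> ball x R \<subseteq> D \<and> (AE y in lborel. y \<in> ball x R \<longrightarrow> m \<le> v y \<and> v y \<le> m + e)" for x R m
    have "\<forall>x\<in>D. \<exists>R m. P x R m" unfolding P_def using osc e by blast
    then obtain R m where Rm: "\<And>x. x \<in> D \<Longrightarrow> P x (R x) (m x)" by metis
    have R: "0 < R x" "ball x (R x) \<subseteq> D" "AE y in lborel. y \<in> ball x (R x) \<longrightarrow> m x \<le> v y \<and> v y \<le> m x + e" if "x \<in> D" for x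
      using Rm[OF that] by (simp_all add: P_def)
    \<comment> \<open>A countable subcover is needed to combine the null sets of the individual
      balls.\<close>
    obtain F where F: "F \<subseteq> (\<lambda>x. ball x (R x)) ` D" "countable F" "\<Union>F = \<Union>((\<lambda>x. ball x (R x)) ` D)"
      using Lindelof[of "(\<lambda>x. ball x (R x)) ` D"] by auto
    have cov: "D \<subseteq> \<Union>F" unfolding F(3) using R(1) by force
    have "AE y in lborel. \<forall>B\<in>F. y \<in> B \<longrightarrow> \<bar>V y - v y\<bar> \<le> e"
    proof (subst AE_ball_countable[OF F(2)], rule ballI)
      fix B assume "B \<in> F"
      then obtain x where x: "x \<in> D" "B = ball x (R x)" using F(1) by auto
      have ae: "AE y in lborel. y \<in> ball x (R x) \<longrightarrow> m x \<le> v y \<and> v y \<le> m x + e" by (rule R(3)[OF x(1)])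
      from ae show "AE y in lborel. y \<in> B \<longrightarrow> \<bar>V y - v y\<bar> \<le> e"
      proof eventually_elim
        case (elim y)
        show ?case
        proof
          assume y: "y \<in> B"
          then have yD: "y \<in> D" using R(2)[OF x(1)] x(2) by blast
          have "m x \<le> V y \<and> V y \<le> m x + e" using bnd[OF _ yD ae] y x(2) by simp
          then show "\<bar>V y - v y\<bar> \<le> e" using elim y x(2) by auto
        qed
      qed
    qed
    then show ?thesis by eventually_elim (use cov in blast)
  qed
  have "AE y in lborel. \<forall>n::nat. y \<in> D \<longrightarrow> \<bar>V y - v y\<bar> \<le> 1 / real (Suc n)"
    unfolding AE_all_countable using ae1 by simp
  then have ae: "AE y in lborel. V y = v y"
  proof eventually_elim
    case (elim y)
    show ?case
    proof (cases "y \<in> D")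
      case True
      have "(\<lambda>n. 1 / real (Suc n)) \<longlonglongrightarrow> 0" using LIMSEQ_inverse_real_of_nat by (simp add: inverse_eq_divide)
      then have "\<bar>V y - v y\<bar> \<le> 0" by (rule LIMSEQ_le_const) (use elim True in auto)
      then show ?thesis by simp
    qed (simp add: V_def)
  qed
  have [measurable]: "D \<in> sets borel" using D by simp
  have "(\<lambda>x. if x \<in> D then V x else v x) \<in> borel_measurable borel"
  proof (rule measurable_If_restrict_space_iff[THEN iffD2])
    show "V \<in> restrict_space borel {x. x \<in> D} \<rightarrow>\<^sub>M borel \<and> v \<in> restrict_space borel {x. x \<notin> D} \<rightarrow>\<^sub>M borel"
      using borel_measurable_continuous_on_restrict[OF cont] measurable_restrict_space1[OF v] by simp
  qed simp
  moreover have "(\<lambda>x. if x \<in> D then V x else v x) = V" by (auto simp: V_def)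
  ultimately show ?thesis using that[of V] cont ae by (simp add: V_def)
qed

context frac_kernel
begin

lemma dif_uminus: "dif (\<lambda>x. - v x) z = - dif v z"
  by (simp add: dif_def)

lemma loc_energy_uminus: "loc_energy v D \<Longrightarrow> loc_energy (\<lambda>x. - v x) D"
  unfolding loc_energy_def tailf_def energy_def dif_uminus by simp

text \<open>On every ball v is in the lower half of its range on at least half of the ball, or -v
  is; the growth lemma cuts the oscillation from above or from below by a fixed factor. Only
  convergence to 0 is required, so the radii may shrink without control and no Hoelder rate is
  tracked.\<close>

theorem solution_continuous_representative:
  assumes D: "open D" and v: "loc_energy v D" and sol: "\<And>\<eta>. \<eta> \<in> tests D \<Longrightarrow> (\<integral>z. wform v \<eta> z \<partial>mu) = 0"
    and m0: "\<And>x. x \<in> D \<Longrightarrow> \<bar>v x\<bar> \<le> m0"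
  obtains V where "V \<in> borel_measurable borel" "continuous_on D V" "AE x in lborel. V x = v x" "\<And>x. x \<notin> D \<Longrightarrow> V x = v x"
proof (rule continuous_representative[OF _ D])
  show vm [measurable]: "v \<in> borel_measurable borel" using loc_energyD v by auto
  obtain \<delta> where \<delta>: "0 < \<delta>" "\<delta> \<le> 1 / 4" and G:
    "\<And>v D x0 R r m0 M \<omega>. loc_energy v D \<Longrightarrow> (\<And>\<eta>. \<eta> \<in> tests D \<Longrightarrow> (\<And>x. 0 \<le> \<eta> x) \<Longrightarrow> (\<integral>z. wform v \<eta> z \<partial>mu) \<le> 0) \<Longrightarrow>
      ball x0 R \<subseteq> D \<Longrightarrow> 0 < r \<Longrightarrow> 4 * r \<le> R \<Longrightarrow> (\<And>x. x \<in> D \<Longrightarrow> \<bar>v x\<bar> \<le> m0) \<Longrightarrow> 0 < \<omega> \<Longrightarrow>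
      (AE y in lborel. y \<in> ball x0 R \<longrightarrow> v y \<le> M) \<Longrightarrow>
      (\<And>x. x \<in> ball x0 r \<Longrightarrow> (\<integral>\<^sup>+y. ennreal ((\<bar>v y\<bar> + m0) powr (p - 1) * k x y) * indicator (- ball x0 R) y \<partial>lborel) \<le> ennreal ((\<delta> * \<omega>) powr (p - 1) * r powr (- (s * p)))) \<Longrightarrow>
      measure lborel (ball x0 r) / 2 \<le> measure lborel {y \<in> ball x0 r. v y \<le> M - \<omega> / 2} \<Longrightarrow>
      (AE y in lborel. y \<in> ball x0 (r / 4) \<longrightarrow> v y \<le> M - \<delta> / 4 * \<omega>)"
    by (rule growth_lemma) blast
  fix x0 and e :: real assume x0: "x0 \<in> D" and e: "0 < e"
  have m00: "0 \<le> m0" using m0[OF x0] by linarith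
  define good where "good \<omega> \<longleftrightarrow> (\<exists>R>0. \<exists>m. ball x0 R \<subseteq> D \<and> (AE y in lborel. y \<in> ball x0 R \<longrightarrow> m \<le> v y \<and> v y \<le> m + \<omega>))" for \<omega>
  have shrink: "good ((1 - \<delta> / 4) * \<omega>)" if g: "good \<omega>" and \<omega>: "0 < \<omega>" for \<omega>
  proof -
    obtain R m where R: "0 < R" "ball x0 R \<subseteq> D" and ae: "AE y in lborel. y \<in> ball x0 R \<longrightarrow> m \<le> v y \<and> v y \<le> m + \<omega>"
      using g unfolding good_def by blast
    let ?C = "cball x0 (R / 4)"
    have CR: "?C \<subseteq> ball x0 R" using R by auto
    obtain c where c: "0 < c" "\<And>x y. x \<in> ?C \<Longrightarrow> y \<notin> ball x0 R \<Longrightarrow> k x y \<le> c * tailw y"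
      using sep_kernel_bound[OF compact_cball open_ball CR] by blast
    define TT where "TT = (\<integral>\<^sup>+y. ennreal ((\<bar>v y\<bar> + m0) powr (p - 1) * tailw y) \<partial>lborel)"
    have "tailf (\<lambda>y. \<bar>v y\<bar> + m0)"
      by (rule tailf_bounded[of v _ m0]) (use loc_energyD[OF v] m00 in auto)
    then have TTf: "TT < \<infinity>" using m00 by (simp add: tailf_def TT_def)
    define T where "T = c * enn2real TT"
    have T0: "0 \<le> T" using c by (simp add: T_def)
    have Tb: "(\<integral>\<^sup>+y. ennreal ((\<bar>v y\<bar> + m0) powr (p - 1) * k x y) * indicator (- ball x0 R) y \<partial>lborel) \<le> ennreal T" if x: "x \<in> ?C" for x
    proof -
      have "(\<integral>\<^sup>+y. ennreal ((\<bar>v y\<bar> + m0) powr (p - 1) * k x y) * indicator (- ball x0 R) y \<partial>lborel)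
        \<le> (\<integral>\<^sup>+y. ennreal c * ennreal ((\<bar>v y\<bar> + m0) powr (p - 1) * tailw y) \<partial>lborel)"
      proof (rule nn_integral_mono)
        fix y
        show "ennreal ((\<bar>v y\<bar> + m0) powr (p - 1) * k x y) * indicator (- ball x0 R) y \<le> ennreal c * ennreal ((\<bar>v y\<bar> + m0) powr (p - 1) * tailw y)"
        proof (cases "y \<in> ball x0 R")
          case False
          have "(\<bar>v y\<bar> + m0) powr (p - 1) * k x y \<le> (\<bar>v y\<bar> + m0) powr (p - 1) * (c * tailw y)"
            using c(2)[OF x False] by (intro mult_left_mono) auto
          also have "\<dots> = c * ((\<bar>v y\<bar> + m0) powr (p - 1) * tailw y)" by simp
          finally show ?thesis using False c(1) tailw_pos[of y] by (simp add: ennreal_mult[symmetric] less_imp_le ennreal_leI)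
        qed simp
      qed
      also have "\<dots> = ennreal c * TT" unfolding TT_def by (rule nn_integral_cmult) measurable
      also have "\<dots> = ennreal T" using TTf c(1) by (simp add: T_def ennreal_mult less_imp_le)
      finally show ?thesis .
    qed
    define K where "K = (\<delta> * \<omega>) powr (p - 1)"
    have K: "0 < K" using \<delta> \<omega> by (simp add: K_def)
    \<comment> \<open>The tail bound T belongs to the fixed ball of radius R, whereas the admissible
      size \<open>K * r powr (- (s * p))\<close> grows as r decreases, so a small r meets the tail
      condition of the growth lemma.\<close>
    define r where "r = min (R / 4) ((K / (T + 1)) powr (1 / (s * p)))"
    have r: "0 < r" "4 * r \<le> R" using R K T0 by (auto simp: r_def)
    have Tr: "T \<le> K * r powr (- (s * p))"
    proof -
      have "r powr (s * p) \<le> ((K / (T + 1)) powr (1 / (s * p))) powr (s * p)" using r sp_pos by (intro powr_mono2) (auto simp: r_def)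
      also have "\<dots> = (K / (T + 1)) powr (1 / (s * p) * (s * p))" by (simp only: powr_powr)
      also have "1 / (s * p) * (s * p) = 1" using s_pos p_gt by simp
      also have "(K / (T + 1)) powr 1 = K / (T + 1)" using K T0 by simp
      finally have "r powr (s * p) * (T + 1) \<le> K" using T0 by (simp add: pos_le_divide_eq)
      moreover have "0 \<le> r powr (s * p)" by simp
      ultimately have "r powr (s * p) * T \<le> K" unfolding distrib_left by linarith
      moreover have "0 < r powr (s * p)" using r by simp
      ultimately show ?thesis by (simp add: powr_minus_divide pos_le_divide_eq mult.commute)
    qed
    have Tc: "(\<integral>\<^sup>+y. ennreal ((\<bar>v y\<bar> + m0) powr (p - 1) * k x y) * indicator (- ball x0 R) y \<partial>lborel) \<le> ennreal ((\<delta> * \<omega>) powr (p - 1) * r powr (- (s * p)))"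
      if x: "x \<in> ball x0 r" for x
    proof -
      have "x \<in> ?C" using x r by auto
      then show ?thesis using order_trans[OF Tb ennreal_leI[OF Tr]] by (simp add: K_def)
    qed
    let ?B = "ball x0 r"
    let ?lo = "{y \<in> ?B. v y \<le> (m + \<omega>) - \<omega> / 2}" and ?hi = "{y \<in> ?B. - v y \<le> - m - \<omega> / 2}"
    have fin: "emeasure lborel S = ennreal (measure lborel S)" if "S \<subseteq> ?B" for S
      by (rule emeasure_eq_measure_subset_ball[OF that])
    have "emeasure lborel ?B \<le> emeasure lborel (?lo \<union> ?hi)"
      by (rule emeasure_mono) auto
    also have "\<dots> \<le> emeasure lborel ?lo + emeasure lborel ?hi" by (rule emeasure_subadditive) auto
    finally have "ennreal (measure lborel ?B) \<le> ennreal (measure lborel ?lo + measure lborel ?hi)"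
      using fin[of ?B] fin[of ?lo] fin[of ?hi] by (simp add: subset_iff)
    then have "measure lborel ?B \<le> measure lborel ?lo + measure lborel ?hi"
      by (subst (asm) ennreal_le_iff) auto
    then consider "measure lborel ?B / 2 \<le> measure lborel ?lo" | "measure lborel ?B / 2 \<le> measure lborel ?hi" by linarith
    then show ?thesis
    proof cases
      case 1
      have "AE y in lborel. y \<in> ball x0 (r / 4) \<longrightarrow> v y \<le> (m + \<omega>) - \<delta> / 4 * \<omega>"
      proof (rule G[OF v _ R(2) r m0 \<omega> _ Tc 1])
        show "AE y in lborel. y \<in> ball x0 R \<longrightarrow> v y \<le> m + \<omega>" using ae by eventually_elim auto
      qed (simp_all add: sol)
      with ae have "AE y in lborel. y \<in> ball x0 (r / 4) \<longrightarrow> m \<le> v y \<and> v y \<le> m + (1 - \<delta> / 4) * \<omega>"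
        by eventually_elim (use r in \<open>auto simp: algebra_simps\<close>)
      moreover have "ball x0 (r / 4) \<subseteq> D" using R r by (intro order_trans[OF subset_ball R(2)]) auto
      ultimately show ?thesis unfolding good_def using r by (intro exI[of _ "r / 4"] conjI exI[of _ m]) auto
    next
      case 2
      have m0': "\<bar>- v x\<bar> \<le> m0" if "x \<in> D" for x using m0[OF that] by simp
      have "AE y in lborel. y \<in> ball x0 (r / 4) \<longrightarrow> - v y \<le> - m - \<delta> / 4 * \<omega>"
      proof (rule G[OF loc_energy_uminus[OF v] _ R(2) r m0' \<omega> _ _ 2])
        show "AE y in lborel. y \<in> ball x0 R \<longrightarrow> - v y \<le> - m" using ae by eventually_elim auto
      qed (simp_all add: sol wform_uminus[abs_def] Tc[simplified])
      with ae have "AE y in lborel. y \<in> ball x0 (r / 4) \<longrightarrow> (m + \<delta> / 4 * \<omega>) \<le> v y \<and> v y \<le> (m + \<delta> / 4 * \<omega>) + (1 - \<delta> / 4) * \<omega>"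
        by eventually_elim (use r in \<open>auto simp: algebra_simps\<close>)
      moreover have "ball x0 (r / 4) \<subseteq> D" using R r by (intro order_trans[OF subset_ball R(2)]) auto
      ultimately show ?thesis unfolding good_def using r by (intro exI[of _ "r / 4"] conjI exI[of _ "m + \<delta> / 4 * \<omega>"]) auto
    qed
  qed
  obtain R0 where R0: "0 < R0" "ball x0 R0 \<subseteq> D" using D x0 open_contains_ball by blast
  define \<omega>0 where "\<omega>0 = 2 * m0 + 1"
  have \<omega>0: "0 < \<omega>0" using m00 by (simp add: \<omega>0_def)
  have "AE y in lborel. y \<in> ball x0 R0 \<longrightarrow> - m0 \<le> v y \<and> v y \<le> - m0 + \<omega>0"
  proof (rule AE_I2, rule impI)
    fix y assume "y \<in> ball x0 R0"
    then have "\<bar>v y\<bar> \<le> m0" using m0 R0 by blast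
    then show "- m0 \<le> v y \<and> v y \<le> - m0 + \<omega>0" using m00 by (auto simp: \<omega>0_def)
  qed
  then have "good \<omega>0" unfolding good_def using R0 by blast
  have q: "0 < 1 - \<delta> / 4" "1 - \<delta> / 4 < 1" using \<delta> by auto
  have gn: "good ((1 - \<delta> / 4) ^ n * \<omega>0)" for n
  proof (induction n)
    case (Suc n)
    have "good ((1 - \<delta> / 4) * ((1 - \<delta> / 4) ^ n * \<omega>0))" by (rule shrink[OF Suc]) (use q \<omega>0 in simp)
    then show ?case by (simp add: mult.assoc)
  qed (use \<open>good \<omega>0\<close> in simp)
  have "(\<lambda>n. (1 - \<delta> / 4) ^ n * \<omega>0) \<longlonglongrightarrow> 0 * \<omega>0" using q by (intro tendsto_mult_right LIMSEQ_power_zero) auto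
  then have "eventually (\<lambda>n. (1 - \<delta> / 4) ^ n * \<omega>0 < e) sequentially" using e by (intro order_tendstoD(2)[of _ 0]) auto
  then obtain n where n: "(1 - \<delta> / 4) ^ n * \<omega>0 < e" unfolding eventually_sequentially by blast
  obtain R m where "0 < R" "ball x0 R \<subseteq> D" "AE y in lborel. y \<in> ball x0 R \<longrightarrow> m \<le> v y \<and> v y \<le> m + (1 - \<delta> / 4) ^ n * \<omega>0"
    using gn[of n] unfolding good_def by blast
  moreover from this(3) have "AE y in lborel. y \<in> ball x0 R \<longrightarrow> m \<le> v y \<and> v y \<le> m + e"
    by eventually_elim (use n in auto)
  ultimately show "\<exists>R>0. \<exists>m. ball x0 R \<subseteq> D \<and> (AE y in lborel. y \<in> ball x0 R \<longrightarrow> m \<le> v y \<and> v y \<le> m + e)" by blast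
qed (rule that)

text \<open>Inside \<Omega> the obstacles \<open>cutdown\<close> and \<open>h - e\<close> differ by
  exactly e. The solution equals the lower obstacle outside D, hence is bounded above by K outside
  \<Omega>, and the strip bounds it within \<Omega>. Passing to the continuous representative
  changes null sets only, which \<open>mu\<close> does not see.\<close>

theorem bounded_solution_below:
  assumes \<Omega>: "open \<Omega>" "bounded \<Omega>" and h: "loc_energy h \<Omega>" "wsuper h \<Omega>" "wsuper (\<lambda>x. - h x) \<Omega>"
    and m: "\<And>x. x \<in> \<Omega> \<Longrightarrow> \<bar>h x\<bar> \<le> m" and e: "0 < e" and D: "open D" "compact (closure D)" "closure D \<subseteq> \<Omega>"
  obtains V b where "V \<in> borel_measurable borel" "continuous_on D V" "tailf V" "\<And>x. x \<in> D \<Longrightarrow> \<bar>V x\<bar> \<le> b" "AE x in lborel. V x \<le> b"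
    "AE x in lborel. V x \<le> h x - e" "AE x in lborel. x \<in> \<Omega> \<longrightarrow> h x - 2 * e \<le> V x"
    "energy V (D \<times> D) < \<infinity>" "\<And>\<eta>. \<eta> \<in> tests D \<Longrightarrow> integrable mu (wform V \<eta>) \<and> (\<integral>z. wform V \<eta> z \<partial>mu) = 0"
proof -
  let ?C = "closure D"
  obtain K where K: "0 \<le> K" "wsuper (\<lambda>x. - cutdown \<Omega> h e K x) ?C"
    by (rule cutdown_subsolution[OF \<Omega> h(1,3) m e D(2,3)]) auto
  let ?w = "cutdown \<Omega> h e K" and ?H = "\<lambda>x. h x - e"
  have w: "loc_energy ?w \<Omega>" by (rule cutdown_loc_energy[OF \<Omega>(1) h(1) e K(1)])
  have dH: "dif ?H z = dif h z" for z by (simp add: dif_def)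
  have Ht: "tailf ?H" by (rule tailf_bounded[of h _ e]) (use loc_energyD[OF h(1)] e in auto)
  have Hl: "loc_energy ?H \<Omega>"
    using h(1) Ht unfolding loc_energy_def energy_def dH by auto
  have HC: "wsuper ?H ?C" using wsuper_mono[OF h(2) D(3)] unfolding wsuper_def wform_def dH .
  obtain v where vm: "v \<in> borel_measurable borel" and v: "\<And>x. ?w x \<le> v x" "\<And>x. v x \<le> ?w x + e" "\<And>x. x \<notin> D \<Longrightarrow> v x = ?w x"
    and vl: "loc_energy v D" "energy v (D \<times> D) < \<infinity>" and sol: "\<And>\<eta>. \<eta> \<in> tests D \<Longrightarrow> (\<integral>z. wform v \<eta> z \<partial>mu) = 0"
  proof (rule obstacle_solution[OF \<Omega>(1) D(2,3) D(1) closure_subset w K(2) Hl HC])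
    show "x \<in> \<Omega> \<Longrightarrow> ?H x = ?w x + e" for x by (simp add: cutdown_def)
    show "x \<notin> \<Omega> \<Longrightarrow> ?w x \<le> ?H x" for x by (simp add: cutdown_def)
  qed (use e in auto)
  have D\<Omega>: "D \<subseteq> \<Omega>" using closure_subset D(3) by blast
  define b where "b = max (m + 2 * e) K"
  have vb: "\<bar>v x\<bar> \<le> b" if "x \<in> D" for x
    using v(1,2)[of x] m[of x] that D\<Omega> e by (auto simp: cutdown_def b_def)
  have vle: "v x \<le> h x - e" for x
  proof (cases "x \<in> \<Omega>")
    case True then show ?thesis using v(2)[of x] by (simp add: cutdown_def)
  next
    case False
    then have "x \<notin> D" using D\<Omega> by blast
    then show ?thesis using v(3)[of x] False by (simp add: cutdown_def)
  qed
  have vge: "x \<in> \<Omega> \<Longrightarrow> h x - 2 * e \<le> v x" for x using v(1)[of x] by (simp add: cutdown_def)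
  have vlb: "v x \<le> b" for x
  proof (cases "x \<in> \<Omega>")
    case True then show ?thesis using vle[of x] m[OF True] e by (auto simp: b_def)
  next
    case False
    then have "x \<notin> D" using D\<Omega> by blast
    then show ?thesis using v(3)[of x] False e by (auto simp: cutdown_def b_def)
  qed
  obtain V where V [measurable]: "V \<in> borel_measurable borel" and cont: "continuous_on D V" and ae: "AE x in lborel. V x = v x" and Vout: "\<And>x. x \<notin> D \<Longrightarrow> V x = v x"
    by (rule solution_continuous_representative[OF D(1) vl(1) sol vb]) auto
  note vm [measurable]
  have [measurable]: "D \<in> sets borel" using D(1) by simp
  have aed: "AE z in mu. dif V z = dif v z"
    by (rule mu_AE_I, use AE_lborel_fst_snd[OF ae] in eventually_elim) (simp add: dif_def)
  have "energy V (D \<times> D) = energy v (D \<times> D)"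
    unfolding energy_def by (rule nn_integral_cong_AE) (use aed in eventually_elim, simp)
  then have E: "energy V (D \<times> D) < \<infinity>" using vl(2) by simp
  have "(\<integral>\<^sup>+x. ennreal (\<bar>V x\<bar> powr (p - 1) * tailw x) \<partial>lborel) = (\<integral>\<^sup>+x. ennreal (\<bar>v x\<bar> powr (p - 1) * tailw x) \<partial>lborel)"
    by (rule nn_integral_cong_AE) (use ae in eventually_elim, simp)
  then have Vt: "tailf V" using loc_energyD[OF vl(1)] by (simp add: tailf_def)
  \<comment> \<open>The bound holds for v everywhere but for V only almost everywhere; by continuity
    a violation at one point of the open set D would persist on a ball.\<close>
  have Vb: "\<bar>V x\<bar> \<le> b" if x: "x \<in> D" for x
  proof (rule ccontr)
    assume n: "\<not> \<bar>V x\<bar> \<le> b"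
    have "open {y \<in> D. b < \<bar>V y\<bar>}"
    proof -
      have "open ((\<lambda>y. \<bar>V y\<bar>) -` {b<..} \<inter> D)"
        using cont D(1) continuous_on_open_vimage[OF D(1), of "\<lambda>y. \<bar>V y\<bar>"] by (auto intro: continuous_on_rabs)
      moreover have "(\<lambda>y. \<bar>V y\<bar>) -` {b<..} \<inter> D = {y \<in> D. b < \<bar>V y\<bar>}" by auto
      ultimately show ?thesis by simp
    qed
    moreover have "x \<in> {y \<in> D. b < \<bar>V y\<bar>}" using n x by auto
    ultimately obtain r where r: "0 < r" "ball x r \<subseteq> {y \<in> D. b < \<bar>V y\<bar>}" using open_contains_ball by blast
    have "AE y in lborel. y \<notin> ball x r" using ae by eventually_elim (use r(2) vb in force)
    then have "emeasure lborel (ball x r) = 0" by (subst (asm) AE_iff_null_sets[symmetric]) (auto simp: null_sets_def)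
    moreover have "0 < unit_ball_vol (real DIM('a))" by simp
    ultimately show False using r(1) by (simp add: emeasure_ball order_less_imp_not_eq2)
  qed
  have wfV: "integrable mu (wform V \<eta>) \<and> (\<integral>z. wform V \<eta> z \<partial>mu) = 0" if \<eta>: "\<eta> \<in> tests D" for \<eta>
  proof -
    have [measurable]: "\<eta> \<in> borel_measurable borel" using \<eta> by (simp add: tests_def)
    have eq: "AE z in mu. wform V \<eta> z = wform v \<eta> z" using aed by eventually_elim (simp add: wform_def)
    have "integrable mu (wform V \<eta>) = integrable mu (wform v \<eta>)" by (rule integrable_cong_AE[OF _ _ eq]) auto
    moreover have "(\<integral>z. wform V \<eta> z \<partial>mu) = (\<integral>z. wform v \<eta> z \<partial>mu)" by (rule integral_cong_AE[OF _ _ eq]) auto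
    ultimately show ?thesis using wform_integrable[OF vl(1) \<eta>] sol[OF \<eta>] by simp
  qed
  show ?thesis
  proof (rule that[OF V cont Vt Vb _ _ _ E wfV])
    show "AE x in lborel. V x \<le> b" using ae by eventually_elim (use vlb in simp)
    show "AE x in lborel. V x \<le> h x - e" using ae by eventually_elim (use vle in simp)
    show "AE x in lborel. x \<in> \<Omega> \<longrightarrow> h x - 2 * e \<le> V x" using ae by eventually_elim (use vge in simp)
  qed
qed

end

section \<open>Comparison with Perron classes\<close>

lemma AE_lborel_swap:
  assumes "AE z in (lborel :: ('a::euclidean_space \<times> 'a) measure). Q z"
  shows "AE z in (lborel :: ('a \<times> 'a) measure). Q (snd z, fst z)"
proof -
  obtain N where N: "{z. \<not> Q z} \<subseteq> N" "N \<in> null_sets (lborel :: ('a \<times> 'a) measure)"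
    using assms by (auto simp: eventually_ae_filter)
  have [measurable]: "N \<in> sets (borel :: ('a \<times> 'a) measure)" using N(2) by (auto simp: null_sets_def)
  have m: "(\<lambda>z. indicator N z :: ennreal) \<in> borel_measurable (lborel \<Otimes>\<^sub>M (lborel :: 'a measure))"
    unfolding lborel_prod by measurable
  have m': "(\<lambda>z. indicator N (snd z, fst z) :: ennreal) \<in> borel_measurable (lborel \<Otimes>\<^sub>M (lborel :: 'a measure))"
    unfolding lborel_prod by measurable
  have "(\<integral>\<^sup>+z. indicator N (snd z, fst z) \<partial>(lborel \<Otimes>\<^sub>M (lborel :: 'a measure))) = (\<integral>\<^sup>+x. \<integral>\<^sup>+y. indicator N (y, x) \<partial>lborel \<partial>(lborel :: 'a measure))"
    using lborel.nn_integral_fst[OF m'] by simp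
  also have "\<dots> = (\<integral>\<^sup>+z. indicator N z \<partial>(lborel \<Otimes>\<^sub>M (lborel :: 'a measure)))"
    using lborel_pair.nn_integral_snd[OF m] by simp
  also have "\<dots> = 0" using N(2) by (simp add: lborel_prod null_sets_def)
  finally have "(\<integral>\<^sup>+z. indicator N (snd z, fst z) \<partial>(lborel :: ('a \<times> 'a) measure)) = 0" by (simp add: lborel_prod)
  then have "AE z in (lborel :: ('a \<times> 'a) measure). (indicator N (snd z, fst z) :: ennreal) = 0"
    by (subst (asm) nn_integral_0_iff_AE) auto
  then show ?thesis by eventually_elim (use N(1) in \<open>auto simp: indicator_def split: if_splits\<close>)
qed

lemma lebesgue_borel_representative:
  fixes f :: "'a::euclidean_space \<Rightarrow> real"
  assumes "f \<in> borel_measurable lebesgue"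
  obtains g where "g \<in> borel_measurable borel" "AE x in lborel. f x = g x"
  using completion_ex_borel_measurable_real[OF assms] by auto

lemma borel_imp_lebesgue_measurable:
  assumes "f \<in> borel_measurable borel" shows "f \<in> borel_measurable lebesgue"
proof -
  have "f \<in> borel_measurable lborel" using assms by simp
  then show ?thesis by (rule measurable_completion)
qed

text \<open>A Borel representative is clamped between the two bounds and then symmetrised. Clamping
  alters it only where the original bounds fail, and symmetrising only on the null set, or its
  reflection, where it differs from the symmetric K.\<close>

lemma admissible_kernel_borel:
  fixes K :: "real ^ 'n \<Rightarrow> real ^ 'n \<Rightarrow> real"
  assumes s: "0 < s" "s < 1" and p: "1 < p" and \<Lambda>: "1 \<le> \<Lambda>" and K: "admissible_kernel s p \<Lambda> K"
  obtains k where "frac_kernel_cart s p \<Lambda> k" "AE z in lborel. K (fst z) (snd z) = k (fst z) (snd z)"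
proof -
  have Km: "(\<lambda>z. K (fst z) (snd z)) \<in> borel_measurable lebesgue" and Ksym: "K x y = K y x"
    and Kb: "AE z in lborel. inverse \<Lambda> \<le> K (fst z) (snd z) * norm (fst z - snd z) powr (real CARD('n) + s * p) \<and>
       K (fst z) (snd z) * norm (fst z - snd z) powr (real CARD('n) + s * p) \<le> \<Lambda>" for x y
    using K by (auto simp: admissible_kernel_def case_prod_unfold AE_completion_iff)
  obtain g where g [measurable]: "g \<in> borel_measurable borel" and Kg: "AE z in lborel. K (fst z) (snd z) = g z"
    using lebesgue_borel_representative[OF Km] by blast
  let ?e = "- (s * p) - real CARD('n)"
  define \<kappa> where "\<kappa> z = norm (fst z - snd z) powr ?e" for z :: "(real ^ 'n) \<times> (real ^ 'n)"
  have \<kappa>0: "0 \<le> \<kappa> z" for z by (simp add: \<kappa>_def)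
  have \<kappa>s: "\<kappa> (y, x) = \<kappa> (x, y)" for x y by (simp add: \<kappa>_def norm_minus_commute)
  have [measurable]: "\<kappa> \<in> borel_measurable borel" unfolding \<kappa>_def[abs_def] by measurable
  define f where "f z = max (\<kappa> z / \<Lambda>) (min (\<Lambda> * \<kappa> z) (g z))" for z
  have [measurable]: "f \<in> borel_measurable borel" unfolding f_def[abs_def] by measurable
  define k where "k x y = (f (x, y) + f (y, x)) / 2" for x y
  have \<kappa>\<Lambda>: "\<kappa> z / \<Lambda> \<le> \<Lambda> * \<kappa> z" for z
  proof -
    have "\<kappa> z / \<Lambda> \<le> \<kappa> z" using \<kappa>0[of z] \<Lambda> by (simp add: divide_le_eq mult_le_cancel_left1)
    also have "\<dots> \<le> \<Lambda> * \<kappa> z" using \<kappa>0[of z] \<Lambda> by (simp add: mult_le_cancel_right1)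
    finally show ?thesis .
  qed
  have fb: "\<kappa> z / \<Lambda> \<le> f z" "f z \<le> \<Lambda> * \<kappa> z" for z using \<kappa>\<Lambda>[of z] by (auto simp: f_def)
  have "frac_kernel_cart s p \<Lambda> k"
  proof (unfold frac_kernel_cart_def, unfold_locales)
    show "(\<lambda>z. k (fst z) (snd z)) \<in> borel_measurable borel" unfolding k_def by measurable
    fix x y :: "real ^ 'n"
    show "k x y = k y x" by (simp add: k_def)
    show "k x y \<le> \<Lambda> * norm (x - y) powr (- (s * p) - real DIM(real ^ 'n))"
      using fb(2)[of "(x, y)"] fb(2)[of "(y, x)"] \<kappa>s[of x y] by (simp add: k_def \<kappa>_def)
    show "norm (x - y) powr (- (s * p) - real DIM(real ^ 'n)) / \<Lambda> \<le> k x y"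
    proof -
      define c where "c = \<kappa> (x, y) / \<Lambda>"
      have "c \<le> f (x, y)" "c \<le> f (y, x)"
        using fb(1)[of "(x, y)"] fb(1)[of "(y, x)"] \<kappa>s[of x y] by (simp_all add: c_def)
      from add_mono[OF this] have "c \<le> k x y" unfolding k_def by (simp add: le_divide_eq mult_2_right)
      then have "\<kappa> (x, y) / \<Lambda> \<le> k x y" by (simp add: c_def)
      then show ?thesis by (simp add: \<kappa>_def)
    qed
  qed (use s p \<Lambda> in auto)
  moreover have Kf: "AE z in lborel. K (fst z) (snd z) = f z"
    using Kb Kg
  proof eventually_elim
    case (elim z)
    let ?n = "norm (fst z - snd z)" and ?d = "real CARD('n) + s * p"
    \<comment> \<open>On the diagonal the product with the power of the norm is 0, below
      \<open>inverse \<Lambda>\<close>; the assumed bounds therefore exclude it.\<close>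
    have n0: "0 < ?n" using elim(1) \<Lambda> by (cases "?n = 0") auto
    have inv: "?n powr ?d * \<kappa> z = 1" using n0 by (simp add: \<kappa>_def powr_add[symmetric])
    have K: "K (fst z) (snd z) = K (fst z) (snd z) * ?n powr ?d * \<kappa> z" using inv by (simp add: mult.assoc)
    have "inverse \<Lambda> * \<kappa> z \<le> K (fst z) (snd z) * ?n powr ?d * \<kappa> z" "K (fst z) (snd z) * ?n powr ?d * \<kappa> z \<le> \<Lambda> * \<kappa> z"
      using elim(1) \<kappa>0[of z] by (auto intro: mult_right_mono)
    then have "\<kappa> z / \<Lambda> \<le> K (fst z) (snd z)" "K (fst z) (snd z) \<le> \<Lambda> * \<kappa> z"
      unfolding K[symmetric] by (simp_all add: inverse_eq_divide)
    then show ?case using elim(2) by (simp add: f_def)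
  qed
  moreover have "AE z in lborel. K (fst z) (snd z) = k (fst z) (snd z)"
    using Kf AE_lborel_swap[OF Kf] by eventually_elim (simp add: k_def Ksym)
  ultimately show ?thesis using that by blast
qed

lemma test_function_lipschitz:
  assumes "test_function D \<eta>"
  obtains B where "\<And>x y. \<bar>\<eta> x - \<eta> y\<bar> \<le> B * norm (x - y)"
proof -
  define C where "C = closure {x. \<eta> x \<noteq> 0}"
  have C: "compact C" and ck: "\<And>k. Ck k \<eta>" using assms by (auto simp: test_function_def compactly_contained_def C_def)
  define d where "d x = frechet_derivative \<eta> (at x)" for x
  have d: "(\<eta> has_derivative d x) (at x)" for x using ck[of 1] by (simp add: d_def frechet_derivative_works[symmetric])
  have dc: "continuous_on UNIV (\<lambda>x. d x v)" for v using ck[of "Suc 0"] by (simp add: d_def)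
  have d0: "d x v = 0" if "x \<notin> C" for x v
  proof -
    have "((\<lambda>x. 0) has_derivative d x) (at x)"
    proof (rule has_derivative_transform_within_open[OF d])
      show "open (- C)" using C by (simp add: compact_imp_closed open_Compl)
      show "\<eta> y = 0" if "y \<in> - C" for y using that closure_subset[of "{x. \<eta> x \<noteq> 0}"] by (auto simp: C_def)
    qed (use that in simp)
    then have "d x = (\<lambda>v. 0)" by (rule has_derivative_unique) (auto intro!: derivative_eq_intros)
    then show ?thesis by simp
  qed
  have "\<exists>b. \<forall>x. \<bar>d x i\<bar> \<le> b" for i
  proof -
    have "bounded ((\<lambda>x. d x i) ` C)"
      by (rule compact_imp_bounded[OF compact_continuous_image[OF continuous_on_subset[OF dc] C]]) simp
    then obtain b where b: "\<And>x. x \<in> C \<Longrightarrow> \<bar>d x i\<bar> \<le> b" unfolding bounded_iff by (metis imageI real_norm_def)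
    have "\<bar>d x i\<bar> \<le> max b 0" for x using b[of x] d0[of x i] by (cases "x \<in> C") auto
    then show ?thesis by blast
  qed
  then obtain b where b: "\<And>i x. \<bar>d x i\<bar> \<le> b i" by metis
  define B where "B = (\<Sum>i\<in>Basis. b i)"
  have dB: "\<bar>d x v\<bar> \<le> B * norm v" for x v
  proof -
    have lin: "bounded_linear (d x)" by (rule has_derivative_bounded_linear[OF d])
    have "d x v = d x (\<Sum>i\<in>Basis. (v \<bullet> i) *\<^sub>R i)" by (simp add: euclidean_representation)
    also have "\<dots> = (\<Sum>i\<in>Basis. (v \<bullet> i) * d x i)"
      using lin by (simp add: linear_sum linear_scale bounded_linear.linear)
    also have "\<bar>\<dots>\<bar> \<le> (\<Sum>i\<in>Basis. norm v * b i)"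
      using b by (intro order_trans[OF sum_abs] sum_mono) (auto simp: abs_mult intro!: mult_mono Basis_le_norm)
    finally show ?thesis by (simp add: B_def sum_distrib_left mult.commute)
  qed
  have "\<bar>\<eta> x - \<eta> y\<bar> \<le> B * norm (x - y)" for x y
    using differentiable_bound[of UNIV \<eta> d B x y] d onorm_le[of "d _" B] dB by (simp add: has_derivative_at_withinI)
  then show ?thesis by (rule that)
qed

lemma between_open_compact:
  fixes \<Omega> :: "'a::euclidean_space set"
  assumes "compact C" "open \<Omega>" "C \<subseteq> \<Omega>"
  obtains U where "open U" "C \<subseteq> U" "compact (closure U)" "closure U \<subseteq> \<Omega>"
proof -
  obtain e where e: "0 < e" "(\<Union>x\<in>C. cball x e) \<subseteq> \<Omega>"
    using compact_subset_open_imp_cball_epsilon_subset[OF assms] by blast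
  have c: "compact (\<Union>x\<in>C. cball x e)" by (rule compact_minkowski_sum_cball[OF assms(1)])
  have "closure (\<Union>x\<in>C. ball x e) \<subseteq> (\<Union>x\<in>C. cball x e)"
    by (rule closure_minimal) (auto intro: compact_imp_closed[OF c])
  moreover have "compact (closure (\<Union>x\<in>C. ball x e))"
    using calculation c by (meson bounded_subset closed_closure compact_eq_bounded_closed)
  ultimately show ?thesis using e by (intro that[of "\<Union>x\<in>C. ball x e"]) force+
qed

context frac_kernel_cart
begin

text \<open>The Lipschitz bound turns the energy density into a multiple of
  \<open>norm (x - y) powr (p - s * p - N)\<close>, integrable near the diagonal because s < 1;
  compact support does the rest.\<close>

lemma test_function_tests:
  assumes \<eta>: "test_function D \<eta>" and DD: "D \<subseteq> D'"
  shows "\<eta> \<in> tests D'"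
proof -
  define C where "C = closure {x. \<eta> x \<noteq> 0}"
  have C: "compact C" "C \<subseteq> D'" and ck: "\<And>k. Ck k \<eta>" using \<eta> DD by (auto simp: test_function_def compactly_contained_def C_def)
  have z: "\<eta> x = 0" if "x \<notin> C" for x using that closure_subset[of "{x. \<eta> x \<noteq> 0}"] by (auto simp: C_def)
  have cont: "continuous_on UNIV \<eta>" using ck[of 0] by simp
  have m [measurable]: "\<eta> \<in> borel_measurable borel" by (rule borel_measurable_continuous_onI[OF cont])
  have "bounded (\<eta> ` C)" by (rule compact_imp_bounded[OF compact_continuous_image[OF continuous_on_subset[OF cont] C(1)]]) simp
  then obtain M0 where "\<And>x. x \<in> C \<Longrightarrow> \<bar>\<eta> x\<bar> \<le> M0" unfolding bounded_iff by (metis imageI real_norm_def)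
  then have M: "\<bar>\<eta> x\<bar> \<le> max M0 0" for x using z[of x] by (cases "x \<in> C") (auto simp: max.coboundedI1)
  obtain B where B: "\<And>x y. \<bar>\<eta> x - \<eta> y\<bar> \<le> B * norm (x - y)" using test_function_lipschitz[OF \<eta>] by blast
  obtain r where r: "0 < r" "C \<subseteq> ball 0 r" using bounded_subset_ballD[OF compact_imp_bounded[OF C(1)], of 0] by blast
  let ?U = "ball 0 r :: (real ^ 'n) set"
  let ?N = "real DIM(real ^ 'n)"
  let ?J = "ennreal (unit_ball_vol ?N * 2 ^ DIM(real ^ 'n) * ((2 * r) powr (p - s * p) / (1 - 2 powr (- (p - s * p)))))"
  have "energy \<eta> (?U \<times> ?U) = (\<integral>\<^sup>+x. \<integral>\<^sup>+y. ennreal (k x y) * (ennreal (\<bar>dif \<eta> (x, y)\<bar> powr p) * indicator (?U \<times> ?U) (x, y)) \<partial>lborel \<partial>lborel)"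
    unfolding energy_def by (rule nn_integral_mu) measurable
  also have "\<dots> \<le> (\<integral>\<^sup>+x. (ennreal (\<Lambda> * \<bar>B\<bar> powr p) * ?J) * indicator ?U x \<partial>lborel)"
  proof (rule nn_integral_mono)
    fix x
    show "(\<integral>\<^sup>+y. ennreal (k x y) * (ennreal (\<bar>dif \<eta> (x, y)\<bar> powr p) * indicator (?U \<times> ?U) (x, y)) \<partial>lborel) \<le> (ennreal (\<Lambda> * \<bar>B\<bar> powr p) * ?J) * indicator ?U x"
    proof (cases "x \<in> ?U")
      case True
      have "(\<integral>\<^sup>+y. ennreal (k x y) * (ennreal (\<bar>dif \<eta> (x, y)\<bar> powr p) * indicator (?U \<times> ?U) (x, y)) \<partial>lborel)
        \<le> (\<integral>\<^sup>+y. ennreal (\<Lambda> * \<bar>B\<bar> powr p) * (ennreal (norm (x - y) powr (p - s * p - ?N)) * indicator {y. norm (x - y) \<le> 2 * r} y) \<partial>lborel)"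
      proof (rule nn_integral_mono)
        fix y
        show "ennreal (k x y) * (ennreal (\<bar>dif \<eta> (x, y)\<bar> powr p) * indicator (?U \<times> ?U) (x, y))
          \<le> ennreal (\<Lambda> * \<bar>B\<bar> powr p) * (ennreal (norm (x - y) powr (p - s * p - ?N)) * indicator {y. norm (x - y) \<le> 2 * r} y)"
        proof (cases "y \<in> ?U")
          case y: True
          have n: "norm (x - y) \<le> 2 * r" using True y norm_triangle_ineq4[of x y] by simp
          have "\<bar>\<eta> x - \<eta> y\<bar> \<le> \<bar>B\<bar> * norm (x - y)"
            using B[of x y] mult_right_mono[OF abs_ge_self[of B], of "norm (x - y)"] by simp
          then have "\<bar>\<eta> x - \<eta> y\<bar> powr p \<le> (\<bar>B\<bar> * norm (x - y)) powr p" using p_gt by (intro powr_mono2) auto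
          then have "k x y * \<bar>\<eta> x - \<eta> y\<bar> powr p \<le> (\<Lambda> * norm (x - y) powr (- (s * p) - ?N)) * (\<bar>B\<bar> * norm (x - y)) powr p"
            using k_upper k_nonneg \<Lambda>_ge by (intro mult_mono) auto
          also have "\<dots> = \<Lambda> * \<bar>B\<bar> powr p * (norm (x - y) powr (- (s * p) - ?N) * norm (x - y) powr p)" by (simp add: powr_mult)
          also have "norm (x - y) powr (- (s * p) - ?N) * norm (x - y) powr p = norm (x - y) powr (p - s * p - ?N)"
            unfolding powr_add[symmetric] by (simp add: algebra_simps)
          finally show ?thesis using True y n k_nonneg \<Lambda>_ge by (simp add: ennreal_mult[symmetric] ennreal_leI)
        qed simp
      qed
      also have "\<dots> = ennreal (\<Lambda> * \<bar>B\<bar> powr p) * (\<integral>\<^sup>+y. ennreal (norm (x - y) powr (p - s * p - ?N)) * indicator {y. norm (x - y) \<le> 2 * r} y \<partial>lborel)"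
        by (rule nn_integral_cmult) measurable
      also have "\<dots> \<le> ennreal (\<Lambda> * \<bar>B\<bar> powr p) * ?J"
        using r by (intro mult_left_mono nn_integral_powr_inside[OF psp]) auto
      finally show ?thesis using True by simp
    qed simp
  qed
  also have "\<dots> = (ennreal (\<Lambda> * \<bar>B\<bar> powr p) * ?J) * emeasure lborel ?U" by (rule nn_integral_cmult_indicator) simp
  also have "\<dots> < \<infinity>" using emeasure_bounded_finite[OF bounded_ball, of "0 :: real ^ 'n" r] by (simp add: ennreal_mult_less_top)
  finally have "energy \<eta> (?U \<times> ?U) < \<infinity>" .
  then have "energy \<eta> UNIV < \<infinity>" by (intro bounded_support_energy[OF m M C(1) z open_ball r(2)])
  then show ?thesis unfolding tests_def using M C z m by blast
qed

lemma weak_integrand_AE: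
  assumes K: "AE z in lborel. K (fst z) (snd z) = k (fst z) (snd z)" and u: "AE x in lborel. u x = ereal (ub x)"
  shows "AE z in lborel. weak_integrand p K u \<eta> z = k (fst z) (snd z) * wform ub \<eta> z"
  using K AE_lborel_fst_snd[OF u]
proof eventually_elim
  case (elim z)
  then show ?case
    by (simp add: weak_integrand_def wform_def dif_def case_prod_unfold abs_powr_minus_two mult.commute[of "k (fst z) (snd z)"])
qed

lemma weak_integrand_integral:
  assumes K: "AE z in lborel. K (fst z) (snd z) = k (fst z) (snd z)" and u: "AE x in lborel. u x = ereal (ub x)"
    and m [measurable]: "ub \<in> borel_measurable borel" "\<eta> \<in> borel_measurable borel"
    and w: "weak_integrand p K u \<eta> \<in> borel_measurable lebesgue"
  shows "integrable lebesgue (weak_integrand p K u \<eta>) \<longleftrightarrow> integrable mu (wform ub \<eta>)"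
    "(LINT z|lebesgue. weak_integrand p K u \<eta> z) = (\<integral>z. wform ub \<eta> z \<partial>mu)"
proof -
  let ?g = "\<lambda>z. k (fst z) (snd z) * wform ub \<eta> z"
  have gm [measurable]: "?g \<in> borel_measurable borel" by measurable
  have ae: "AE z in lebesgue. weak_integrand p K u \<eta> z = ?g z"
    by (rule AE_completion[OF weak_integrand_AE[OF K u]])
  have gl: "?g \<in> borel_measurable lebesgue" by (rule borel_imp_lebesgue_measurable[OF gm])
  have "integrable lebesgue (weak_integrand p K u \<eta>) \<longleftrightarrow> integrable lebesgue ?g"
    by (rule integrable_cong_AE[OF w gl ae])
  also have "\<dots> \<longleftrightarrow> integrable lborel ?g" by (rule integrable_completion) simp
  also have "\<dots> \<longleftrightarrow> integrable mu (wform ub \<eta>)"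
    unfolding mu_def using k_nonneg by (subst integrable_density) auto
  finally show "integrable lebesgue (weak_integrand p K u \<eta>) \<longleftrightarrow> integrable mu (wform ub \<eta>)" .
  have "(LINT z|lebesgue. weak_integrand p K u \<eta> z) = (LINT z|lebesgue. ?g z)"
    by (rule integral_cong_AE[OF w gl ae])
  also have "\<dots> = (\<integral>z. ?g z \<partial>lborel)" by (rule integral_completion) simp
  also have "\<dots> = (\<integral>z. wform ub \<eta> z \<partial>mu)"
    unfolding mu_def using k_nonneg by (subst integral_density) auto
  finally show "(LINT z|lebesgue. weak_integrand p K u \<eta> z) = (\<integral>z. wform ub \<eta> z \<partial>mu)" .
qed

lemma tail_space_nn:
  assumes "tail_space s p f" and "AE x in lborel. real_of_ereal (f x) = g x" and [measurable]: "g \<in> borel_measurable borel"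
  shows "tailf g"
proof -
  have i: "integrable lebesgue (\<lambda>x. \<bar>real_of_ereal (f x)\<bar> powr (p - 1) * (1 + norm x) powr (- real CARD('n) - s * p))"
    using assms(1) by (simp add: tail_space_def)
  have "(\<integral>\<^sup>+x. ennreal (\<bar>g x\<bar> powr (p - 1) * tailw x) \<partial>lborel) = (\<integral>\<^sup>+x. ennreal (\<bar>g x\<bar> powr (p - 1) * tailw x) \<partial>lebesgue)"
    by (simp add: nn_integral_completion)
  also have "\<dots> = (\<integral>\<^sup>+x. ennreal (norm (\<bar>real_of_ereal (f x)\<bar> powr (p - 1) * (1 + norm x) powr (- real CARD('n) - s * p))) \<partial>lebesgue)"
  proof (rule nn_integral_cong_AE)
    show "AE x in lebesgue. ennreal (\<bar>g x\<bar> powr (p - 1) * tailw x) = ennreal (norm (\<bar>real_of_ereal (f x)\<bar> powr (p - 1) * (1 + norm x) powr (- real CARD('n) - s * p)))"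
      using AE_completion[OF assms(2)]
    proof eventually_elim
      case (elim x)
      have "- real CARD('n) - s * p = - (s * p) - real CARD('n)" by simp
      then show ?case using elim by (simp only: tailw_def) simp
    qed
  qed
  also have "\<dots> < \<infinity>" using i by (simp add: integrable_iff_bounded)
  finally show ?thesis by (simp add: tailf_def)
qed

lemma nn_tail_space:
  assumes g [measurable]: "g \<in> borel_measurable borel" and t: "tailf g"
  shows "tail_space s p (\<lambda>x. ereal (g x))"
proof -
  have gm: "(\<lambda>x. ereal (g x)) \<in> borel_measurable lebesgue"
    using borel_imp_lebesgue_measurable[of "\<lambda>x. ereal (g x)"] by simp
  have "in_Lq (p - 1) C (\<lambda>x. ereal (g x))" if C: "compact C" for C
  proof -
    have Cl: "C \<in> sets lebesgue" using borel_compact[OF C] by (simp add: sets_completionI_sets)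
    have "integrable lborel (\<lambda>x. indicator C x *\<^sub>R \<bar>g x\<bar> powr (p - 1))"
    proof (rule integrableI_nonneg)
      have [measurable]: "C \<in> sets borel" using C by (rule borel_compact)
      show "(\<lambda>x. indicator C x *\<^sub>R \<bar>g x\<bar> powr (p - 1)) \<in> borel_measurable lborel" by measurable
      have "(\<integral>\<^sup>+x. ennreal (indicator C x *\<^sub>R \<bar>g x\<bar> powr (p - 1)) \<partial>lborel) = (\<integral>\<^sup>+x. ennreal (\<bar>g x\<bar> powr (p - 1)) * indicator C x \<partial>lborel)"
        by (intro nn_integral_cong) (auto simp: indicator_def)
      then show "(\<integral>\<^sup>+x. ennreal (indicator C x *\<^sub>R \<bar>g x\<bar> powr (p - 1)) \<partial>lborel) < \<infinity>" using tail_local[OF C g t] by simp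
    qed auto
    then have "integrable lebesgue (\<lambda>x. indicator C x *\<^sub>R \<bar>g x\<bar> powr (p - 1))"
      by (subst integrable_completion) (auto dest: borel_measurable_integrable)
    then have "integrable (lebesgue_on C) (\<lambda>x. \<bar>g x\<bar> powr (p - 1))"
      using Cl by (subst integrable_restrict_space) auto
    then show ?thesis unfolding in_Lq_def using gm by (auto intro: measurable_restrict_space1)
  qed
  moreover have "integrable lebesgue (\<lambda>x. \<bar>g x\<bar> powr (p - 1) * (1 + norm x) powr (- real CARD('n) - s * p))"
  proof -
    have "integrable lborel (\<lambda>x. \<bar>g x\<bar> powr (p - 1) * tailw x)"
      by (rule integrableI_nonneg) (use t tailw_pos in \<open>auto simp: tailf_def less_imp_le\<close>)
    then have "integrable lebesgue (\<lambda>x. \<bar>g x\<bar> powr (p - 1) * tailw x)"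
      by (subst integrable_completion) (auto dest: borel_measurable_integrable)
    moreover have "- real CARD('n) - s * p = - (s * p) - real CARD('n)" by simp
    ultimately show ?thesis by (simp only: tailw_def) simp
  qed
  ultimately show ?thesis using gm by (simp add: tail_space_def)
qed

lemma weak_solution_borel:
  assumes K: "AE z in lborel. K (fst z) (snd z) = k (fst z) (snd z)" and D: "open D"
    and u: "weak_solution s p K D u" and ub [measurable]: "ub \<in> borel_measurable borel" and ueq: "AE x in lborel. u x = ereal (ub x)"
  shows "loc_energy ub D" "wsuper ub D" "wsuper (\<lambda>x. - ub x) D"
proof -
  have sup: "weak_supersolution s p K D u" and sub: "weak_supersolution s p K D (\<lambda>x. - u x)"
    using u by (auto simp: weak_solution_def weak_subsolution_def)
  \<comment> \<open>The supersolution property controls the tail of the negative part, the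
    subsolution property that of the positive part.\<close>
  have tail: "tailf ub"
  proof -
    have n: "tailf (\<lambda>x. max (- ub x) 0)"
    proof (rule tail_space_nn)
      show "tail_space s p (neg_part u)" using sup by (simp add: weak_supersolution_def)
      show "AE x in lborel. real_of_ereal (neg_part u x) = max (- ub x) 0"
        using ueq by eventually_elim (simp add: neg_part_def zero_ereal_def max_def)
    qed measurable
    have q: "tailf (\<lambda>x. max (ub x) 0)"
    proof (rule tail_space_nn)
      show "tail_space s p (neg_part (\<lambda>x. - u x))" using sub by (simp add: weak_supersolution_def)
      show "AE x in lborel. real_of_ereal (neg_part (\<lambda>x. - u x) x) = max (ub x) 0"
        using ueq by eventually_elim (simp add: neg_part_def zero_ereal_def max_def)
    qed measurable
    have "(\<integral>\<^sup>+x. ennreal (\<bar>ub x\<bar> powr (p - 1) * tailw x) \<partial>lborel)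
      \<le> (\<integral>\<^sup>+x. ennreal (\<bar>max (- ub x) 0\<bar> powr (p - 1) * tailw x) + ennreal (\<bar>max (ub x) 0\<bar> powr (p - 1) * tailw x) \<partial>lborel)"
    proof (rule nn_integral_mono)
      fix x
      show "ennreal (\<bar>ub x\<bar> powr (p - 1) * tailw x) \<le> ennreal (\<bar>max (- ub x) 0\<bar> powr (p - 1) * tailw x) + ennreal (\<bar>max (ub x) 0\<bar> powr (p - 1) * tailw x)"
        by (cases "0 \<le> ub x") (auto simp: max_def)
    qed
    also have "\<dots> = (\<integral>\<^sup>+x. ennreal (\<bar>max (- ub x) 0\<bar> powr (p - 1) * tailw x) \<partial>lborel) + (\<integral>\<^sup>+x. ennreal (\<bar>max (ub x) 0\<bar> powr (p - 1) * tailw x) \<partial>lborel)"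
      by (rule nn_integral_add) measurable
    also have "\<dots> < \<infinity>" using n q by (simp add: tailf_def)
    finally show ?thesis by (simp add: tailf_def)
  qed
  show le: "loc_energy ub D"
    unfolding loc_energy_def
  proof (intro conjI allI impI ub tail)
    fix C assume C: "compact C \<and> C \<subseteq> D"
    obtain U where U: "open U" "C \<subseteq> U" "compact (closure U)" "closure U \<subseteq> D" using between_open_compact[of C D] C D by blast
    have W: "in_Wsp s p U u" using sup U unfolding weak_supersolution_def in_Wsp_loc_def compactly_contained_def by blast
    let ?f = "\<lambda>z. \<bar>real_of_ereal (u (fst z)) - real_of_ereal (u (snd z))\<bar> powr p / norm (fst z - snd z) powr (real CARD('n) + s * p)"
    have [measurable]: "U \<in> sets borel" using U by simp
    have UU: "U \<times> U \<in> sets lebesgue" using U by (intro sets_completionI_sets) simp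
    have "integrable (lebesgue_on (U \<times> U)) ?f" using W by (simp add: in_Wsp_def case_prod_unfold)
    then have i: "integrable lebesgue (\<lambda>z. indicator (U \<times> U) z *\<^sub>R ?f z)" using UU by (subst (asm) integrable_restrict_space) auto
    have "energy ub (U \<times> U) = (\<integral>\<^sup>+z. ennreal (k (fst z) (snd z)) * (ennreal (\<bar>dif ub z\<bar> powr p) * indicator (U \<times> U) z) \<partial>lborel)"
      unfolding energy_def by (rule nn_integral_mu_lborel) measurable
    also have "\<dots> = (\<integral>\<^sup>+z. ennreal (k (fst z) (snd z)) * (ennreal (\<bar>dif ub z\<bar> powr p) * indicator (U \<times> U) z) \<partial>lebesgue)"
      by (simp add: nn_integral_completion)
    also have "\<dots> \<le> (\<integral>\<^sup>+z. ennreal \<Lambda> * ennreal (norm (indicator (U \<times> U) z *\<^sub>R ?f z)) \<partial>lebesgue)"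
    proof (rule nn_integral_mono_AE)
      show "AE z in lebesgue. ennreal (k (fst z) (snd z)) * (ennreal (\<bar>dif ub z\<bar> powr p) * indicator (U \<times> U) z) \<le> ennreal \<Lambda> * ennreal (norm (indicator (U \<times> U) z *\<^sub>R ?f z))"
        using AE_completion[OF AE_lborel_fst_snd[OF ueq]]
      proof eventually_elim
        case (elim z)
        let ?n = "norm (fst z - snd z)"
        show ?case
        proof (cases "z \<in> U \<times> U")
          case True
          have "k (fst z) (snd z) * \<bar>dif ub z\<bar> powr p \<le> (\<Lambda> * ?n powr (- (s * p) - real DIM(real ^ 'n))) * \<bar>dif ub z\<bar> powr p"
            by (intro mult_right_mono k_upper) auto
          also have "\<dots> = \<Lambda> * (\<bar>dif ub z\<bar> powr p / ?n powr (real CARD('n) + s * p))"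
            using powr_minus_divide[of ?n "real CARD('n) + s * p"] by (simp add: algebra_simps)
          finally show ?thesis using True elim k_nonneg \<Lambda>_ge by (simp add: dif_def ennreal_mult[symmetric] ennreal_leI)
        qed simp
      qed
    qed
    also have "\<dots> = ennreal \<Lambda> * (\<integral>\<^sup>+z. ennreal (norm (indicator (U \<times> U) z *\<^sub>R ?f z)) \<partial>lebesgue)"
      using borel_measurable_integrable[OF i] by (intro nn_integral_cmult) simp
    also have "\<dots> < \<infinity>" using i by (simp add: integrable_iff_bounded ennreal_mult_less_top)
    finally have "energy ub (U \<times> U) < \<infinity>" .
    then show "\<exists>U. open U \<and> C \<subseteq> U \<and> U \<subseteq> D \<and> energy ub (U \<times> U) < \<infinity>"
      using U closure_subset[of U] by blast
  qed
  have tf: "test_function D \<eta>" if t: "\<eta> \<in> tests D" and ck: "\<And>k. Ck k \<eta>" for \<eta>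
  proof -
    obtain C where C: "compact C" "C \<subseteq> D" "\<And>x. x \<notin> C \<Longrightarrow> \<eta> x = 0" using t by (auto simp: tests_def)
    have "closure {x. \<eta> x \<noteq> 0} \<subseteq> C" using C by (intro closure_minimal) (auto intro: compact_imp_closed)
    moreover from this have "compact (closure {x. \<eta> x \<noteq> 0})" using C(1)
      by (meson bounded_subset closed_closure compact_eq_bounded_closed)
    ultimately show ?thesis using C ck unfolding test_function_def compactly_contained_def by blast
  qed
  have gen: "0 \<le> (\<integral>z. wform w \<eta> z \<partial>mu)"
    if wsp: "weak_supersolution s p K D W" and W: "AE x in lborel. W x = ereal (w x)" and wm: "w \<in> borel_measurable borel"
      and \<eta>: "\<eta> \<in> tests D" "\<And>k. Ck k \<eta>" "\<And>x. 0 \<le> \<eta> x" for W w \<eta>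
  proof -
    have i: "integrable lebesgue (weak_integrand p K W \<eta>)" "0 \<le> (LINT z|lebesgue. weak_integrand p K W \<eta> z)"
      using wsp tf[OF \<eta>(1,2)] \<eta>(3) by (auto simp: weak_supersolution_def)
    show ?thesis
      using weak_integrand_integral(2)[OF K W wm tests_measurable[OF \<eta>(1)] borel_measurable_integrable[OF i(1)]] i(2) by simp
  qed
  show "wsuper ub D"
    by (rule wsuper_of_smooth[OF D le]) (rule gen[OF sup ueq ub])
  show "wsuper (\<lambda>x. - ub x) D"
  proof (rule wsuper_of_smooth[OF D loc_energy_uminus[OF le]])
    have "AE x in lborel. - u x = ereal (- ub x)" using ueq by eventually_elim simp
    then show "0 \<le> (\<integral>z. wform (\<lambda>x. - ub x) \<eta> z \<partial>mu)" if "\<eta> \<in> tests D" "\<And>k. Ck k \<eta>" "\<And>x. 0 \<le> \<eta> x" for \<eta>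
      using that by (intro gen[OF sub]) auto
  qed
qed

text \<open>The bounds on all of D supply the local Sobolev condition on \<open>D'\<close>: an open
  U compactly contained in \<open>D'\<close> is bounded and lies in D, where V is bounded and has
  finite energy.\<close>

lemma weak_solutionI_borel:
  assumes K: "AE z in lborel. K (fst z) (snd z) = k (fst z) (snd z)" and Km: "(\<lambda>(x, y). K x y) \<in> borel_measurable lebesgue"
    and D: "D' \<subseteq> D" "open D" and V [measurable]: "V \<in> borel_measurable borel" and t: "tailf V"
    and b: "\<And>x. x \<in> D \<Longrightarrow> \<bar>V x\<bar> \<le> b" and E: "energy V (D \<times> D) < \<infinity>"
    and sol: "\<And>\<eta>. \<eta> \<in> tests D \<Longrightarrow> integrable mu (wform V \<eta>) \<and> (\<integral>z. wform V \<eta> z \<partial>mu) = 0"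
  shows "weak_solution s p K D' (\<lambda>x. ereal (V x))"
proof -
  have gen: "weak_supersolution s p K D' (\<lambda>x. ereal (W x))"
    if W [measurable]: "W \<in> borel_measurable borel" and tW: "tailf W" and bW: "\<And>x. x \<in> D \<Longrightarrow> \<bar>W x\<bar> \<le> b"
      and EW: "energy W (D \<times> D) < \<infinity>" and sW: "\<And>\<eta>. \<eta> \<in> tests D \<Longrightarrow> integrable mu (wform W \<eta>) \<and> (\<integral>z. wform W \<eta> z \<partial>mu) = 0" for W
  proof -
    have Wm: "(\<lambda>x. ereal (W x)) \<in> borel_measurable lebesgue"
      using borel_imp_lebesgue_measurable[of "\<lambda>x. ereal (W x)"] by simp
    have "in_Wsp s p U (\<lambda>x. ereal (W x))" if U: "open U" "U \<Subset> D'" for U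
    proof -
      have UD: "U \<subseteq> D" using U(2) D closure_subset[of U] by (auto simp: compactly_contained_def)
      have Ub: "bounded U" using U(2) compact_imp_bounded bounded_subset closure_subset unfolding compactly_contained_def by blast
      have [measurable]: "U \<in> sets borel" using U by simp
      have Ul: "U \<in> sets lebesgue" and UU: "U \<times> U \<in> sets lebesgue" using U by (auto intro!: sets_completionI_sets)
      have "integrable lborel (\<lambda>x. indicator U x *\<^sub>R \<bar>W x\<bar> powr p)"
      proof (rule Bochner_Integration.integrable_bound[where f = "\<lambda>x. b powr p * indicator U x :: real"])
        have "integrable lborel (indicator U :: real ^ 'n \<Rightarrow> real)"
          using emeasure_bounded_finite[OF Ub] by (simp add: integrable_indicator_iff)
        then show "integrable lborel (\<lambda>x. b powr p * indicator U x :: real)" by simp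
        have "\<bar>W x\<bar> powr p \<le> b powr p" if "x \<in> U" for x using bW[of x] that UD p_gt by (intro powr_mono2) auto
        then show "AE x in lborel. norm (indicator U x *\<^sub>R \<bar>W x\<bar> powr p) \<le> norm (b powr p * indicator U x :: real)"
          by (intro AE_I2) (auto simp: indicator_def)
      qed measurable
      then have "integrable lebesgue (\<lambda>x. indicator U x *\<^sub>R \<bar>W x\<bar> powr p)"
        by (subst integrable_completion) (auto dest: borel_measurable_integrable)
      then have i1: "integrable (lebesgue_on U) (\<lambda>x. \<bar>W x\<bar> powr p)" using Ul by (subst integrable_restrict_space) auto
      let ?f = "\<lambda>z. \<bar>W (fst z) - W (snd z)\<bar> powr p / norm (fst z - snd z) powr (real CARD('n) + s * p)"
      have "integrable lborel (\<lambda>z. indicator (U \<times> U) z *\<^sub>R ?f z)"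
      proof (rule integrableI_nonneg)
        show "(\<lambda>z. indicator (U \<times> U) z *\<^sub>R ?f z) \<in> borel_measurable lborel" by measurable
        have "(\<integral>\<^sup>+z. ennreal (indicator (U \<times> U) z *\<^sub>R ?f z) \<partial>lborel) \<le> (\<integral>\<^sup>+z. ennreal \<Lambda> * (ennreal (k (fst z) (snd z)) * (ennreal (\<bar>dif W z\<bar> powr p) * indicator (D \<times> D) z)) \<partial>lborel)"
        proof (rule nn_integral_mono)
          fix z :: "(real ^ 'n) \<times> (real ^ 'n)"
          let ?n = "norm (fst z - snd z)"
          show "ennreal (indicator (U \<times> U) z *\<^sub>R ?f z) \<le> ennreal \<Lambda> * (ennreal (k (fst z) (snd z)) * (ennreal (\<bar>dif W z\<bar> powr p) * indicator (D \<times> D) z))"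
          proof (cases "z \<in> U \<times> U")
            case True
            then have zD: "z \<in> D \<times> D" using UD by auto
            have "?f z = ?n powr (- (s * p) - real DIM(real ^ 'n)) * \<bar>dif W z\<bar> powr p"
              using powr_minus_divide[of ?n "real CARD('n) + s * p"] by (simp add: dif_def algebra_simps)
            also have "\<dots> \<le> (\<Lambda> * k (fst z) (snd z)) * \<bar>dif W z\<bar> powr p"
              using k_lower[of "fst z" "snd z"] \<Lambda>_ge by (intro mult_right_mono) (auto simp: pos_divide_le_eq mult.commute)
            finally have "?f z \<le> \<Lambda> * (k (fst z) (snd z) * \<bar>dif W z\<bar> powr p)" by simp
            then have "ennreal (?f z) \<le> ennreal (\<Lambda> * (k (fst z) (snd z) * \<bar>dif W z\<bar> powr p))" by (rule ennreal_leI)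
            then show ?thesis using True zD \<Lambda>_ge k_nonneg by (simp add: ennreal_mult)
          qed simp
        qed
        also have "\<dots> = ennreal \<Lambda> * energy W (D \<times> D)"
        proof -
          have [measurable]: "D \<in> sets borel" using D by simp
          show ?thesis unfolding energy_def by (subst nn_integral_cmult) (simp_all add: nn_integral_mu_lborel)
        qed
        also have "\<dots> < \<infinity>" using EW by (simp add: ennreal_mult_less_top)
        finally show "(\<integral>\<^sup>+z. ennreal (indicator (U \<times> U) z *\<^sub>R ?f z) \<partial>lborel) < \<infinity>" .
      qed (auto simp: indicator_def)
      then have "integrable lebesgue (\<lambda>z. indicator (U \<times> U) z *\<^sub>R ?f z)"
        by (subst integrable_completion) (auto dest: borel_measurable_integrable)
      then have "integrable (lebesgue_on (U \<times> U)) ?f" using UU by (subst integrable_restrict_space) auto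
      then show ?thesis
        unfolding in_Wsp_def in_Lq_def using i1 Wm by (auto simp: case_prod_unfold intro: measurable_restrict_space1)
    qed
    then have 1: "in_Wsp_loc s p D' (\<lambda>x. ereal (W x))" by (simp add: in_Wsp_loc_def)
    have "neg_part (\<lambda>x. ereal (W x)) = (\<lambda>x. ereal (max (- W x) 0))"
      by (auto simp: neg_part_def fun_eq_iff zero_ereal_def max_def)
    moreover have "tailf (\<lambda>x. max (- W x) 0)" by (rule tailf_bounded[OF W tW, of _ 0]) auto
    ultimately have 2: "tail_space s p (neg_part (\<lambda>x. ereal (W x)))" using nn_tail_space[of "\<lambda>x. max (- W x) 0"] by simp
    have 3: "integrable lebesgue (weak_integrand p K (\<lambda>x. ereal (W x)) \<eta>) \<and> 0 \<le> (LINT z|lebesgue. weak_integrand p K (\<lambda>x. ereal (W x)) \<eta> z)"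
      if \<eta>: "test_function D' \<eta>" for \<eta>
    proof -
      have \<eta>t: "\<eta> \<in> tests D" by (rule test_function_tests[OF \<eta> D(1)])
      note [measurable] = tests_measurable[OF \<eta>t]
      have "(\<lambda>z. wform W \<eta> z) \<in> borel_measurable lebesgue" by (rule borel_imp_lebesgue_measurable) measurable
      then have "(\<lambda>z. wform W \<eta> z * K (fst z) (snd z)) \<in> borel_measurable lebesgue"
        using Km by (simp add: case_prod_unfold)
      moreover have "(\<lambda>z. wform W \<eta> z * K (fst z) (snd z)) = weak_integrand p K (\<lambda>x. ereal (W x)) \<eta>"
        by (simp add: fun_eq_iff weak_integrand_def wform_def dif_def case_prod_unfold abs_powr_minus_two)
      ultimately have m: "weak_integrand p K (\<lambda>x. ereal (W x)) \<eta> \<in> borel_measurable lebesgue" by simp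
      show ?thesis
        using weak_integrand_integral[OF K _ W tests_measurable[OF \<eta>t] m] sW[OF \<eta>t] by simp
    qed
    show ?thesis unfolding weak_supersolution_def using Wm 1 2 3 by auto
  qed
  have "weak_supersolution s p K D' (\<lambda>x. ereal (V x))" by (rule gen[OF V t b E sol])
  moreover have "weak_supersolution s p K D' (\<lambda>x. ereal (- V x))"
  proof (rule gen)
    show "tailf (\<lambda>x. - V x)" using t by (simp add: tailf_def)
    show "energy (\<lambda>x. - V x) (D \<times> D) < \<infinity>" using E unfolding energy_def dif_uminus by simp
  qed (use b sol in \<open>auto simp: wform_uminus[abs_def]\<close>)
  ultimately show ?thesis by (simp add: weak_solution_def weak_subsolution_def)
qed

end

section \<open>Perron classes\<close>

lemma AE_le_imp_le_on_open:
  fixes f g :: "'a::euclidean_space \<Rightarrow> real"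
  assumes D: "open D" and cont: "continuous_on D f" "continuous_on D g"
    and ae: "AE x in lborel. x \<in> D \<longrightarrow> f x \<le> g x" and x: "x \<in> D"
  shows "f x \<le> g x"
proof (rule ccontr)
  assume n: "\<not> f x \<le> g x"
  have "continuous_on D (\<lambda>y. f y - g y)" using cont by (intro continuous_intros)
  then have "open ((\<lambda>y. f y - g y) -` {0<..} \<inter> D)"
    using continuous_on_open_vimage[OF D, of "\<lambda>y. f y - g y"] by simp
  moreover have "x \<in> (\<lambda>y. f y - g y) -` {0<..} \<inter> D" using n x by simp
  ultimately obtain r where r: "0 < r" "ball x r \<subseteq> (\<lambda>y. f y - g y) -` {0<..} \<inter> D" using open_contains_ball by blast
  have "AE y in lborel. y \<notin> ball x r" using ae by eventually_elim (use r(2) in force)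
  then have "emeasure lborel (ball x r) = 0" by (subst (asm) AE_iff_null_sets[symmetric]) (auto simp: null_sets_def)
  moreover have "0 < unit_ball_vol (real DIM('a))" by simp
  ultimately show False using r(1) by (simp add: emeasure_ball order_less_imp_not_eq2)
qed

lemma finite_continuous_borel:
  fixes u :: "'a::euclidean_space \<Rightarrow> ereal"
  assumes D: "open D" and u: "finite_continuous_on (closure D) u" and m: "u \<in> borel_measurable lebesgue"
    and fin: "AE x in lebesgue. \<bar>u x\<bar> \<noteq> \<infinity>"
  obtains ub where "ub \<in> borel_measurable borel" "AE x in lborel. u x = ereal (ub x)" "\<And>x. x \<in> D \<Longrightarrow> u x = ereal (ub x)"
    "continuous_on (closure D) (\<lambda>x. real_of_ereal (u x))" "continuous_on D ub"
proof -
  have cl: "continuous_on (closure D) (\<lambda>x. real_of_ereal (u x))"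
    using u continuous_on_iff_real[of "closure D" u] by (simp add: finite_continuous_on_def o_def)
  have "(\<lambda>x. real_of_ereal (u x)) \<in> borel_measurable lebesgue" using m by measurable
  then obtain g where g [measurable]: "g \<in> borel_measurable borel" and ug: "AE x in lborel. real_of_ereal (u x) = g x"
    using lebesgue_borel_representative by blast
  \<comment> \<open>Real values on D, a Borel representative elsewhere. This way equality holds at
    every point of D and continuity there is preserved.\<close>
  define ub where "ub x = (if x \<in> D then real_of_ereal (u x) else g x)" for x
  have ubD: "u x = ereal (ub x)" if "x \<in> D" for x
    using u that closure_subset[of D] by (auto simp: ub_def finite_continuous_on_def ereal_real')
  have cont: "continuous_on D (\<lambda>x. real_of_ereal (u x))" using cl continuous_on_subset closure_subset by blast
  have [measurable]: "D \<in> sets borel" using D by simp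
  have "ub \<in> borel_measurable borel" unfolding ub_def[abs_def]
  proof (rule measurable_If_restrict_space_iff[THEN iffD2])
    show "(\<lambda>x. real_of_ereal (u x)) \<in> restrict_space borel {x. x \<in> D} \<rightarrow>\<^sub>M borel \<and> g \<in> restrict_space borel {x. x \<notin> D} \<rightarrow>\<^sub>M borel"
      using borel_measurable_continuous_on_restrict[OF cont] measurable_restrict_space1[OF g] by simp
  qed simp
  moreover have "AE x in lborel. u x = ereal (ub x)"
    using fin[unfolded AE_completion_iff] ug
  proof eventually_elim
    case (elim x)
    show ?case
    proof (cases "x \<in> D")
      case False
      have "u x = ereal (real_of_ereal (u x))" using elim(1) by (simp add: ereal_real')
      then show ?thesis using elim(2) False by (simp add: ub_def)
    qed (rule ubD)
  qed
  moreover have "continuous_on D ub"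
    using cont by (rule continuous_on_eq) (simp add: ub_def)
  ultimately show ?thesis using that ubD cl by blast
qed

lemma at_within_closure_nontrivial:
  fixes x :: "real ^ 'n"
  assumes "open \<Omega>" "x \<in> closure \<Omega>"
  shows "at x within \<Omega> \<noteq> bot"
proof (cases "x \<in> \<Omega>")
  case True then show ?thesis by (simp add: at_within_open[OF _ assms(1)])
next
  case False
  then have "x islimpt \<Omega>" using assms(2) unfolding closure_def by blast
  then show ?thesis using trivial_limit_within[of x \<Omega>] by simp
qed

context frac_kernel_cart
begin

lemma loc_energy_mono:
  assumes D: "open D" "D \<subseteq> D'" and u: "loc_energy u D'"
  shows "loc_energy u D"
  unfolding loc_energy_def
proof (intro conjI allI impI loc_energyD[OF u])
  fix C assume C: "compact C \<and> C \<subseteq> D"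
  then have "compact C \<and> C \<subseteq> D'" using D by blast
  then obtain U where U: "open U" "C \<subseteq> U" "energy u (U \<times> U) < \<infinity>"
    using u unfolding loc_energy_def by blast
  have "energy u ((U \<inter> D) \<times> (U \<inter> D)) < \<infinity>" by (rule le_less_trans[OF energy_mono U(3)]) auto
  then show "\<exists>U. open U \<and> C \<subseteq> U \<and> U \<subseteq> D \<and> energy u (U \<times> U) < \<infinity>"
    using U C D by (intro exI[of _ "U \<inter> D"]) auto
qed

text \<open>The work lies in property (c). For each e > 0 the set where v exceeds h by e is compact
  in D thanks to the order on the boundary, so \<open>weak_comparison\<close> applies; continuity
  upgrades its conclusion to every point, and e tends to 0.\<close>

theorem solution_superharmonic:
  assumes K: "AE z in lborel. K (fst z) (snd z) = k (fst z) (snd z)"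
    and \<Omega>: "open \<Omega>" "compact (closure \<Omega>)" and hc: "finite_continuous_on (closure \<Omega>) h" and hs: "weak_solution s p K \<Omega> h"
  shows "superharmonic s p K \<Omega> h"
proof -
  have hm: "h \<in> borel_measurable lebesgue" and hf: "AE x in lebesgue. \<bar>h x\<bar> \<noteq> \<infinity>" and ht: "tail_space s p (neg_part h)"
    using hs by (auto simp: weak_solution_def weak_supersolution_def)
  obtain hb where hb: "hb \<in> borel_measurable borel" and heq: "AE x in lborel. h x = ereal (hb x)" and h\<Omega>: "\<And>x. x \<in> \<Omega> \<Longrightarrow> h x = ereal (hb x)"
    and hcl: "continuous_on (closure \<Omega>) (\<lambda>x. real_of_ereal (h x))" and hcont: "continuous_on \<Omega> hb"
    by (rule finite_continuous_borel[OF \<Omega>(1) hc hm hf]) blast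
  note hsol = weak_solution_borel[OF K \<Omega>(1) hs hb heq]
  have lsc: "h x \<le> Liminf (at x within \<Omega>) h" if x: "x \<in> \<Omega>" for x
  proof -
    have "x \<in> closure \<Omega>" using x closure_subset by blast
    moreover have "(h \<longlongrightarrow> h x) (at x within \<Omega>)"
    proof -
      have "continuous_on \<Omega> h" using hc continuous_on_subset[OF _ closure_subset] by (auto simp: finite_continuous_on_def)
      then show ?thesis using x by (simp add: continuous_on_def)
    qed
    ultimately show ?thesis using lim_imp_Liminf[OF at_within_closure_nontrivial[OF \<Omega>(1)], of x h "h x"] by simp
  qed
  have comp: "v x \<le> h x"
    if D: "open D" "D \<Subset> \<Omega>" and vc: "finite_continuous_on (closure D) v" and vs: "weak_solution s p K D v"
      and fr: "\<forall>x\<in>frontier D. v x \<le> h x" and out: "AE x in lebesgue. x \<notin> D \<longrightarrow> v x \<le> h x" and x: "x \<in> D" for D v x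
  proof -
    have Dc: "compact (closure D)" "closure D \<subseteq> \<Omega>" using D(2) by (auto simp: compactly_contained_def)
    have D\<Omega>: "D \<subseteq> \<Omega>" using Dc closure_subset by blast
    have vm: "v \<in> borel_measurable lebesgue" and vf: "AE x in lebesgue. \<bar>v x\<bar> \<noteq> \<infinity>"
      using vs by (auto simp: weak_solution_def weak_supersolution_def)
    obtain vb where vb: "vb \<in> borel_measurable borel" and veq: "AE x in lborel. v x = ereal (vb x)" and vD: "\<And>x. x \<in> D \<Longrightarrow> v x = ereal (vb x)"
      and vcl: "continuous_on (closure D) (\<lambda>x. real_of_ereal (v x))" and vcont: "continuous_on D vb"
      by (rule finite_continuous_borel[OF D(1) vc vm vf]) blast
    note vsol = weak_solution_borel[OF K D(1) vs vb veq]
    define f where "f x = real_of_ereal (v x) - real_of_ereal (h x)" for x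
    have fc: "continuous_on (closure D) f"
      unfolding f_def using vcl continuous_on_subset[OF hcl] Dc(2) closure_subset[of \<Omega>] by (intro continuous_intros) auto
    have fD: "f x = vb x - hb x" if "x \<in> D" for x using vD[OF that] h\<Omega>[of x] that D\<Omega> by (auto simp: f_def)
    obtain B where B: "\<And>x. x \<in> closure D \<Longrightarrow> f x \<le> B"
    proof -
      have "bounded (f ` closure D)" by (rule compact_imp_bounded[OF compact_continuous_image[OF fc Dc(1)]])
      then obtain b where "\<And>x. x \<in> closure D \<Longrightarrow> \<bar>f x\<bar> \<le> b" unfolding bounded_iff by (metis imageI real_norm_def)
      then show ?thesis using that abs_le_D1 by blast
    qed
    have outb: "AE x in lborel. x \<notin> D \<longrightarrow> vb x \<le> hb x"
      using out[unfolded AE_completion_iff] veq heq by eventually_elim auto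
    have main: "AE x in lborel. x \<in> D \<longrightarrow> vb x \<le> hb x + e" if e: "0 < e" for e
    proof (rule weak_comparison[OF _ _ vsol(1,3) _ _ outb e])
      show "bounded D" using compact_imp_bounded[OF Dc(1)] bounded_subset closure_subset by blast
      show "D \<in> sets borel" using D(1) by simp
      show "loc_energy hb D" by (rule loc_energy_mono[OF D(1) D\<Omega> hsol(1)])
      show "wsuper hb D" by (rule wsuper_mono[OF hsol(2) D\<Omega>])
      \<comment> \<open>Closed within the compact closure, and disjoint from the frontier since f is
        at most 0 there.\<close>
      let ?C = "closure D \<inter> f -` {e..}"
      have cl: "closed ?C" by (rule continuous_closed_preimage[OF fc]) auto
      have "compact (closure D \<inter> ?C)" by (rule compact_Int_closed[OF Dc(1) cl])
      then show "compact ?C" by (simp add: Int_assoc[symmetric])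
      show "?C \<subseteq> D"
      proof
        fix y assume y: "y \<in> ?C"
        show "y \<in> D"
        proof (rule ccontr)
          assume "y \<notin> D"
          then have "y \<in> frontier D" using y D(1) by (simp add: frontier_def interior_open)
          then have le: "v y \<le> h y" using fr by blast
          have "\<bar>v y\<bar> \<noteq> \<infinity>" using y vc by (auto simp: finite_continuous_on_def)
          moreover have "y \<in> closure \<Omega>" using y Dc(2) closure_subset by blast
          then have "\<bar>h y\<bar> \<noteq> \<infinity>" using hc by (auto simp: finite_continuous_on_def)
          ultimately have "f y \<le> 0" using le by (cases "v y"; cases "h y") (auto simp: f_def)
          then show False using y e by simp
        qed
      qed
      show "y \<in> ?C" if "y \<in> D" "hb y + e < vb y" for y
        using that fD[of y] closure_subset[of D] by auto
      show "vb y - hb y \<le> B" if "y \<in> ?C" for y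
        using that \<open>?C \<subseteq> D\<close> fD[of y] B[of y] by auto
    qed
    have hD: "continuous_on D hb" using hcont D\<Omega> continuous_on_subset by blast
    have "vb x \<le> hb x + e" if e: "0 < e" for e
      using AE_le_imp_le_on_open[OF D(1) vcont _ main[OF e] x] hD by (simp add: continuous_intros)
    then have "vb x \<le> hb x" by (rule field_le_epsilon)
    then show ?thesis using vD[OF x] h\<Omega>[of x] x D\<Omega> by auto
  qed
  have fin\<Omega>: "- \<infinity> < h x" "h x < \<infinity>" if "x \<in> \<Omega>" for x using h\<Omega>[OF that] by auto
  show ?thesis
    unfolding superharmonic_def
    using hm ht lsc fin\<Omega> by (auto intro: comp)
qed

theorem upper_class_ge:
  assumes K: "AE z in lborel. K (fst z) (snd z) = k (fst z) (snd z)" and Km: "(\<lambda>(x, y). K x y) \<in> borel_measurable lebesgue"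
    and \<Omega>: "open \<Omega>" "compact (closure \<Omega>)" and hc: "finite_continuous_on (closure \<Omega>) h" and hs: "weak_solution s p K \<Omega> h"
    and hg: "\<And>x. x \<in> frontier \<Omega> \<Longrightarrow> (h \<longlongrightarrow> g x) (at x within \<Omega>)" and out: "AE x in lebesgue. x \<notin> \<Omega> \<longrightarrow> h x = g x"
    and u: "u \<in> upper_class s p K \<Omega> g" and x: "x \<in> \<Omega>"
  shows "h x \<le> u x"
proof -
  have hm: "h \<in> borel_measurable lebesgue" and hf: "AE x in lebesgue. \<bar>h x\<bar> \<noteq> \<infinity>"
    using hs by (auto simp: weak_solution_def weak_supersolution_def)
  obtain hb where hb: "hb \<in> borel_measurable borel" and heq: "AE x in lborel. h x = ereal (hb x)" and h\<Omega>: "\<And>x. x \<in> \<Omega> \<Longrightarrow> h x = ereal (hb x)"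
    and hcl: "continuous_on (closure \<Omega>) (\<lambda>x. real_of_ereal (h x))" and hcont: "continuous_on \<Omega> hb"
    by (rule finite_continuous_borel[OF \<Omega>(1) hc hm hf]) blast
  note hsol = weak_solution_borel[OF K \<Omega>(1) hs hb heq]
  have b\<Omega>: "bounded \<Omega>" using compact_imp_bounded[OF \<Omega>(2)] bounded_subset closure_subset by blast
  obtain m where m: "\<And>y. y \<in> \<Omega> \<Longrightarrow> \<bar>hb y\<bar> \<le> m"
  proof -
    have "bounded ((\<lambda>x. real_of_ereal (h x)) ` closure \<Omega>)" by (rule compact_imp_bounded[OF compact_continuous_image[OF hcl \<Omega>(2)]])
    then obtain b where b: "\<And>y. y \<in> closure \<Omega> \<Longrightarrow> \<bar>real_of_ereal (h y)\<bar> \<le> b" unfolding bounded_iff by (metis imageI real_norm_def)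
    have "\<bar>hb y\<bar> \<le> b" if "y \<in> \<Omega>" for y using b[of y] h\<Omega>[OF that] that closure_subset[of \<Omega>] by auto
    then show ?thesis using that by blast
  qed
  have ush: "superharmonic s p K \<Omega> u" and ubd: "\<And>y. y \<in> frontier \<Omega> \<Longrightarrow> g y \<le> Liminf (at y within \<Omega>) u"
    and uout: "AE y in lebesgue. y \<notin> \<Omega> \<longrightarrow> u y = g y"
    using u by (auto simp: upper_class_def)
  have main: "ereal (hb x - 2 * e) \<le> u x" if e: "0 < e" for e
  proof -
    \<comment> \<open>The points where u falls below \<open>h - e\<close>. The boundary condition on
      u forces the closure of S into \<Omega>, which leaves room for D and
      \<open>D'\<close>.\<close>
    define S where "S = {y \<in> \<Omega>. u y < ereal (hb y - e)}"
    have S\<Omega>: "S \<subseteq> \<Omega>" by (auto simp: S_def)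
    have cS: "compact (closure S)" using bounded_subset[OF b\<Omega> S\<Omega>] by (simp add: compact_closure)
    have "closure S \<subseteq> \<Omega>"
    proof
      fix y assume y: "y \<in> closure S"
      show "y \<in> \<Omega>"
      proof (rule ccontr)
        assume n: "y \<notin> \<Omega>"
        have yc: "y \<in> closure \<Omega>" using y closure_mono[OF S\<Omega>] by blast
        then have yf: "y \<in> frontier \<Omega>" using n \<Omega>(1) by (simp add: frontier_def interior_open)
        have "(h \<longlongrightarrow> h y) (at y within closure \<Omega>)" using hc yc by (simp add: finite_continuous_on_def continuous_on_def)
        then have "(h \<longlongrightarrow> h y) (at y within \<Omega>)" using tendsto_within_subset closure_subset by blast
        \<comment> \<open>Both are limits of h from within \<Omega>, so g is finite at y. The margin
          e is then shared: e/2 for the lower limit of u, e/2 for the limit of h.\<close>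
        then have "h y = g y" using hg[OF yf] at_within_closure_nontrivial[OF \<Omega>(1) yc] tendsto_unique by blast
        moreover have "\<bar>h y\<bar> \<noteq> \<infinity>" using hc yc by (simp add: finite_continuous_on_def)
        ultimately have "\<bar>g y\<bar> \<noteq> \<infinity>" by simp
        then obtain c where c: "g y = ereal c" by (cases "g y") auto
        have "ereal (c - e / 2) < ereal c" using e by simp
        also have "ereal c \<le> Liminf (at y within \<Omega>) u" using ubd[OF yf] by (simp only: c)
        finally have "ereal (c - e / 2) < Liminf (at y within \<Omega>) u" .
        then have e1: "eventually (\<lambda>z. ereal (c - e / 2) < u z) (at y within \<Omega>)" by (rule less_LiminfD)
        have e2: "eventually (\<lambda>z. h z < ereal (c + e / 2)) (at y within \<Omega>)"
          using hg[OF yf] unfolding c by (rule order_tendstoD) (use e in simp)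
        have "eventually (\<lambda>z. z \<in> \<Omega>) (at y within \<Omega>)" by (simp add: eventually_at_filter)
        with e1 e2 have "eventually (\<lambda>z. z \<notin> S) (at y within \<Omega>)"
        proof eventually_elim
          case (elim z)
          then have "hb z - e < c - e / 2" using h\<Omega>[of z] by simp
          then have "ereal (hb z - e) < u z" using elim(1) by (intro less_trans[OF _ elim(1)]) simp
          then show ?case using less_asym by (auto simp: S_def)
        qed
        \<comment> \<open>The filter at y within S would be trivial, so y is no limit point of S;
          not lying in S either, y cannot be in the closure.\<close>
        then have "eventually (\<lambda>z. z \<notin> S) (at y within S)" using S\<Omega> at_le filter_leD by blast
        moreover have "eventually (\<lambda>z. z \<in> S) (at y within S)" by (simp add: eventually_at_filter)
        ultimately have "eventually (\<lambda>z. False) (at y within S)" by eventually_elim simp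
        then have "\<not> y islimpt S" by (simp add: trivial_limit_within[symmetric] trivial_limit_def)
        moreover have "y \<notin> S" using n S\<Omega> by blast
        ultimately show False using y by (simp add: closure_def)
      qed
    qed
    then obtain D where D: "open D" "closure S \<subseteq> D" "compact (closure D)" "closure D \<subseteq> \<Omega>"
      using between_open_compact[OF cS \<Omega>(1)] by blast
    \<comment> \<open>V is continuous only inside D, whereas property (c) needs continuity on a
      closure.\<close>
    obtain D' where D': "open D'" "closure S \<subseteq> D'" "compact (closure D')" "closure D' \<subseteq> D"
      using between_open_compact[OF cS D(1,2)] by blast
    have D\<Omega>: "D \<subseteq> \<Omega>" "D' \<subseteq> D" "S \<subseteq> D'" using D D' closure_subset by blast+
    obtain V b where V [measurable]: "V \<in> borel_measurable borel" and Vc: "continuous_on D V" and Vt: "tailf V"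
      and Vb: "\<And>x. x \<in> D \<Longrightarrow> \<bar>V x\<bar> \<le> b" "AE x in lborel. V x \<le> b" and Vle: "AE x in lborel. V x \<le> hb x - e"
      and Vge: "AE x in lborel. x \<in> \<Omega> \<longrightarrow> hb x - 2 * e \<le> V x" and VE: "energy V (D \<times> D) < \<infinity>"
      and Vs: "\<And>\<eta>. \<eta> \<in> tests D \<Longrightarrow> integrable mu (wform V \<eta>) \<and> (\<integral>z. wform V \<eta> z \<partial>mu) = 0"
      by (rule bounded_solution_below[OF \<Omega>(1) b\<Omega> hsol m e D(1,3,4)]) auto
    have hD: "continuous_on D hb" using hcont D\<Omega> continuous_on_subset by blast
    have VleD: "V y \<le> hb y - e" if "y \<in> D" for y
      by (rule AE_le_imp_le_on_open[OF D(1) Vc _ _ that]) (use hD Vle in \<open>auto intro!: continuous_intros elim: eventually_mono\<close>)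
    have VgeD: "hb y - 2 * e \<le> V y" if "y \<in> D" for y
      by (rule AE_le_imp_le_on_open[OF D(1) _ Vc _ that]) (use hD Vge D\<Omega> in \<open>auto intro!: continuous_intros elim: eventually_mono\<close>)
    let ?V = "\<lambda>x. ereal (V x)"
    have sol: "weak_solution s p K D' ?V"
      by (rule weak_solutionI_borel[OF K Km D\<Omega>(2) D(1) V Vt Vb(1) VE Vs])
    have fc: "finite_continuous_on (closure D') ?V"
      unfolding finite_continuous_on_def using continuous_on_ereal[OF continuous_on_subset[OF Vc D'(4)]] by simp
    have Li: "in_Linf (pos_part ?V)"
    proof -
      have pp: "pos_part ?V = (\<lambda>x. ereal (max (V x) 0))" by (auto simp: pos_part_def fun_eq_iff zero_ereal_def max_def)
      have "(\<lambda>x. ereal (max (V x) 0)) \<in> borel_measurable lebesgue" by (rule borel_imp_lebesgue_measurable) measurable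
      moreover have "AE x in lebesgue. \<bar>ereal (max (V x) 0)\<bar> \<le> ereal (max b 0)"
        using AE_completion[OF Vb(2)]
      proof eventually_elim
        case (elim x)
        then have "\<bar>max (V x) 0\<bar> \<le> max b 0" by auto
        then show ?case by (simp only: abs_ereal.simps ereal_less_eq)
      qed
      ultimately show ?thesis unfolding in_Linf_def pp by blast
    qed
    have nS: "ereal (hb y - e) \<le> u y" if "y \<in> \<Omega>" "y \<notin> S" for y using that by (auto simp: S_def)
    have fr: "?V y \<le> u y" if y: "y \<in> frontier D'" for y
    proof -
      have "y \<in> D" "y \<notin> D'" using y D' by (auto simp: frontier_def interior_open)
      then have "ereal (hb y - e) \<le> u y" using D\<Omega> by (intro nS) auto
      moreover have "?V y \<le> ereal (hb y - e)" using VleD[OF \<open>y \<in> D\<close>] by simp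
      ultimately show ?thesis by (rule order_trans[rotated])
    qed
    \<comment> \<open>Within \<Omega> a point outside \<open>D'\<close> is not in S; outside
      \<Omega> both u and h agree with g almost everywhere. In either case \<open>h - e\<close>
      separates V from u.\<close>
    have outV: "AE y in lebesgue. y \<notin> D' \<longrightarrow> ?V y \<le> u y"
      using AE_completion[OF Vle] AE_completion[OF heq] out uout
    proof eventually_elim
      case (elim y)
      show ?case
      proof
        assume y: "y \<notin> D'"
        have "ereal (hb y - e) \<le> u y"
        proof (cases "y \<in> \<Omega>")
          case True
          then show ?thesis using y D\<Omega>(3) by (intro nS) auto
        next
          case False
          then have "u y = ereal (hb y)" using elim by simp
          then show ?thesis using e by simp
        qed
        moreover have "?V y \<le> ereal (hb y - e)" using elim(1) by simp
        ultimately show "?V y \<le> u y" by (rule order_trans[rotated])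
      qed
    qed
    have D'\<Omega>: "D' \<Subset> \<Omega>" using D' D\<Omega> unfolding compactly_contained_def by blast
    have ge: "?V y \<le> u y" if "y \<in> D'" for y
      using ush D'(1) D'\<Omega> fc sol Li fr outV that unfolding superharmonic_def by blast
    show ?thesis
    proof (cases "x \<in> S")
      case True
      then have "x \<in> D'" "x \<in> D" using D\<Omega> by auto
      then show ?thesis using ge[of x] VgeD[of x] by (meson ereal_less_eq(3) order_trans)
    next
      case False
      have "ereal (hb x - 2 * e) \<le> ereal (hb x - e)" using e by simp
      also have "\<dots> \<le> u x" by (rule nS[OF x False])
      finally show ?thesis .
    qed
  qed
  show ?thesis
  proof (rule ccontr)
    assume n: "\<not> h x \<le> u x"
    have "- \<infinity> < u x" using ush x by (auto simp: superharmonic_def)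
    then obtain c where c: "u x = ereal c" "c < hb x" using n h\<Omega>[OF x] by (cases "u x") auto
    \<comment> \<open>This e makes \<open>hb x - 2 * e\<close> the midpoint of c and
      \<open>hb x\<close>, which exceeds c.\<close>
    then have "hb x - 2 * ((hb x - c) / 4) \<le> c" using main[of "(hb x - c) / 4"] by simp
    then show False using c(2) by (simp add: field_simps)
  qed
qed

lemma solution_in_upper_class:
  assumes K: "AE z in lborel. K (fst z) (snd z) = k (fst z) (snd z)"
    and \<Omega>: "open \<Omega>" "compact (closure \<Omega>)" and hc: "finite_continuous_on (closure \<Omega>) h" and hs: "weak_solution s p K \<Omega> h"
    and hg: "\<And>x. x \<in> frontier \<Omega> \<Longrightarrow> (h \<longlongrightarrow> g x) (at x within \<Omega>)" and out: "AE x in lebesgue. x \<notin> \<Omega> \<longrightarrow> h x = g x"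
  shows "h \<in> upper_class s p K \<Omega> g"
proof -
  have "\<exists>m::real. \<forall>x\<in>\<Omega>. ereal m \<le> h x"
  proof -
    have hcl: "continuous_on (closure \<Omega>) (\<lambda>x. real_of_ereal (h x))"
      using hc continuous_on_iff_real[of "closure \<Omega>" h] by (simp add: finite_continuous_on_def o_def)
    have "bounded ((\<lambda>x. real_of_ereal (h x)) ` closure \<Omega>)" by (rule compact_imp_bounded[OF compact_continuous_image[OF hcl \<Omega>(2)]])
    then obtain b where b: "\<And>y. y \<in> closure \<Omega> \<Longrightarrow> \<bar>real_of_ereal (h y)\<bar> \<le> b" unfolding bounded_iff by (metis imageI real_norm_def)
    have "ereal (- b) \<le> h y" if y: "y \<in> \<Omega>" for y
    proof -
      have yc: "y \<in> closure \<Omega>" using y closure_subset by blast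
      then have "\<bar>h y\<bar> \<noteq> \<infinity>" using hc by (auto simp: finite_continuous_on_def)
      then show ?thesis using b[OF yc] by (cases "h y") auto
    qed
    then show ?thesis by blast
  qed
  moreover have "g x \<le> Liminf (at x within \<Omega>) h" if x: "x \<in> frontier \<Omega>" for x
  proof -
    have "x \<in> closure \<Omega>" using x by (simp add: frontier_def)
    then show ?thesis using lim_imp_Liminf[OF at_within_closure_nontrivial[OF \<Omega>(1)] hg[OF x]] by simp
  qed
  ultimately show ?thesis
    unfolding upper_class_def using solution_superharmonic[OF K \<Omega> hc hs] out by blast
qed

end

lemma weak_solution_uminus: "weak_solution s p K D h \<Longrightarrow> weak_solution s p K D (\<lambda>x. - h x)"
  by (simp add: weak_solution_def weak_subsolution_def)

theorem lemma19:
  fixes K :: "real ^ 'n \<Rightarrow> real ^ 'n \<Rightarrow> real"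
    and s p \<Lambda> :: real
    and \<Omega> \<Omega>' :: "(real ^ 'n) set"
    and g h :: "real ^ 'n \<Rightarrow> ereal"
  assumes "0 < s" "s < 1" "1 < p" "1 \<le> \<Lambda>"
    and "admissible_kernel s p \<Lambda> K"
    and "open \<Omega>" "open \<Omega>'" "\<Omega> \<Subset> \<Omega>'"
    and "finite_continuous_on \<Omega>' g" "tail_space s p g"
    and "finite_continuous_on (closure \<Omega>) h" "weak_solution s p K \<Omega> h"
    and "\<And>x. x \<in> frontier \<Omega> \<Longrightarrow> (h \<longlongrightarrow> g x) (at x within \<Omega>)"
    and "AE x in lebesgue. x \<notin> \<Omega> \<longrightarrow> h x = g x"
  shows "\<forall>x\<in>\<Omega>. upper_Perron s p K \<Omega> g x = h x \<and> lower_Perron s p K \<Omega> g x = h x"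
proof
  fix x assume x: "x \<in> \<Omega>"
  obtain k where k: "frac_kernel_cart s p \<Lambda> k" and Kk: "AE z in lborel. K (fst z) (snd z) = k (fst z) (snd z)"
    using admissible_kernel_borel[OF assms(1-5)] by blast
  interpret frac_kernel_cart s p \<Lambda> k by (rule k)
  have Km: "(\<lambda>(x, y). K x y) \<in> borel_measurable lebesgue" using assms(5) by (simp add: admissible_kernel_def)
  have \<Omega>c: "compact (closure \<Omega>)" using assms(8) by (simp add: compactly_contained_def)
  let ?g = "\<lambda>x. - g x" and ?h = "\<lambda>x. - h x"
  have mc: "finite_continuous_on (closure \<Omega>) ?h"
    using assms(11) by (simp add: finite_continuous_on_def continuous_on_def ereal_Lim_uminus[symmetric])
  have ml: "(?h \<longlongrightarrow> ?g y) (at y within \<Omega>)" if "y \<in> frontier \<Omega>" for y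
    using assms(13)[OF that] by (simp add: ereal_Lim_uminus[symmetric])
  have mo: "AE x in lebesgue. x \<notin> \<Omega> \<longrightarrow> ?h x = ?g x" using assms(14) by eventually_elim simp
  note ms = weak_solution_uminus[OF assms(12)]
  note up = Kk assms(6) \<Omega>c assms(11,12,13,14)
  \<comment> \<open>The lower class for g consists of the negatives of the upper class for -g, and
    -h is again a solution; the same two results for -h and -g settle the lower Perron
    solution.\<close>
  note lo = Kk assms(6) \<Omega>c mc ms ml mo
  have "upper_Perron s p K \<Omega> g x = h x" unfolding upper_Perron_def
  proof (rule antisym)
    show "(INF u\<in>upper_class s p K \<Omega> g. u x) \<le> h x"
      by (rule INF_lower[OF solution_in_upper_class[OF up]])
    show "h x \<le> (INF u\<in>upper_class s p K \<Omega> g. u x)"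
      by (rule INF_greatest) (rule upper_class_ge[OF Kk Km up(2-7) _ x])
  qed
  moreover have "lower_Perron s p K \<Omega> g x = h x" unfolding lower_Perron_def
  proof (rule antisym)
    have "h \<in> lower_class s p K \<Omega> g" using solution_in_upper_class[OF lo] by (simp add: lower_class_def)
    then show "h x \<le> (SUP u\<in>lower_class s p K \<Omega> g. u x)" by (rule SUP_upper)
    show "(SUP u\<in>lower_class s p K \<Omega> g. u x) \<le> h x"
    proof (rule SUP_least)
      fix u assume "u \<in> lower_class s p K \<Omega> g"
      then have "(\<lambda>x. - u x) \<in> upper_class s p K \<Omega> ?g" by (simp add: lower_class_def)
      from upper_class_ge[OF Kk Km lo(2-7) this x] show "u x \<le> h x" by simp
    qed
  qed
  ultimately show "upper_Perron s p K \<Omega> g x = h x \<and> lower_Perron s p K \<Omega> g x = h x" by blast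
qed

end
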